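(* Assume: A1) the initial states $x_i(0)=x_{i0}$, $i=1,\dots,N$, are mutually independent with common mean $\mathbb{E}x_i(0)=\bar x_0$ and $\max_{1\le i\le N}\mathbb{E}\|x_i(0)\|^2<C_0$ with $C_0$ independent of $N$; A2) $(A-\frac\rho2I,B)$ and $(A+G-\frac\rho2I,B)$ are stabilizable, and $\bar A+G-\frac\rho2I$ is Hurwitz, where $\bar A=A-BR^{-1}B^TP$; A3) $Q\ge0$, $(A-\frac\rho2I,\sqrt Q)$ is observable, and $(A+G-\frac\rho2I,\sqrt Q(I-\Gamma))$ is observable. Then for Problem (P), the set of decentralized control laws $$\hat u_i(t)=-R^{-1}B^T[P\hat x_i(t)+(\Pi-P)\bar x(t)+s(t)],\quad t\ge0,\ i=1,\dots,N,$$ has asymptotic social optimality, i.e. $$\Big|\frac1NJ_{\rm soc}(\hat u)-\frac1N\inf_{u\in\mathcal U_c}J_{\rm soc}(u)\Big|=O(1/\sqrt N).$$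
   Context: $\rho>0$; there are $N$ agents, and the data $A,B,G,\Gamma,Q,R,f,\sigma,\eta,\bar x_0$ do not depend on $N$ ($O(\cdot)$ is as $N\to\infty$). $A,G,\Gamma,Q\in\mathbb{R}^{n\times n}$, $B\in\mathbb{R}^{n\times r}$, $R\in\mathbb{R}^{r\times r}$ are constant matrices, $Q,R$ symmetric, $R>0$. $\|z\|_S^2=z^TSz$. $C_{\rho/2}([0,\infty),\mathbb{R}^n)$ is the space of continuous $h:[0,\infty)\to\mathbb{R}^n$ with $\int_0^\infty e^{-\rho t}\|h(t)\|^2dt<\infty$; $f,\sigma,\eta$ belong to it. $W_1,\dots,W_N$ are independent one-dimensional Brownian motions on a complete filtered probability space; $\mathcal F_t^i=\sigma(x_i(0),W_i(s),0\le s\le t)$. Notation: $\Xi=\Gamma^TQ+Q\Gamma-\Gamma^TQ\Gamma$, $\bar\eta=Q\eta-\Gamma^TQ\eta$. Problem (P): agent $i$ evolves by $dx_i=[Ax_i+Bu_i+Gx^{(N)}+f]dt+\sigma dW_i$, $x^{(N)}=\frac1N\sum_jx_j$, with cost $$J_i(u)=\mathbb{E}\int_0^\infty e^{-\rho t}\{\|x_i-\Gamma x^{(N)}-\eta\|_Q^2+\|u_i\|_R^2\}dt,\qquad J_{\rm soc}(u)=\sum_{i=1}^NJ_i(u),$$ and decentralized controls are sought to minimize $J_{\rm soc}$. The centralized control set $\mathcal U_c$ consists of all $u=(u_1,\dots,u_N)$ such that each $u_i(t)$ is adapted to $\sigma\{\bigcup_{j=1}^N\mathcal F_t^j\}$ and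 $\mathbb{E}\int_0^\infty e^{-\rho t}\|u_i(t)\|^2dt<\infty$. $P,\Pi$ are the maximal solutions (a solution $P$ is maximal if $P-P'\ge0$ for every solution $P'$) of $$\rho P=A^TP+PA-PBR^{-1}B^TP+Q,$$ $$\rho\Pi=(A+G)^T\Pi+\Pi(A+G)-\Pi BR^{-1}B^T\Pi+Q-\Xi,$$ and $s,\bar x\in C_{\rho/2}([0,\infty),\mathbb{R}^n)$ are determined by $$\rho s=\dot s+(A+G-BR^{-1}B^T\Pi)^Ts+\Pi f-\bar\eta,$$ $$\dot{\bar x}=(A+G)\bar x-BR^{-1}B^T(\Pi\bar x+s)+f,\quad \bar x(0)=\bar x_0$$ ($s(0)$ is determined by $s\in C_{\rho/2}$). $\hat x_i$ is the state of agent $i$ when all agents use $\hat u=(\hat u_1,\dots,\hat u_N)$. A matrix is Hurwitz if all its eigenvalues have negative real part; stabilizability and observability are in the usual sense. *)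

theory Defs
  imports "HOL-Probability.Probability" "HOL-Library.Landau_Symbols"
begin

section \<open>Matrices and linear systems\<close>

definition psd :: "real^'n^'n \<Rightarrow> bool" where
  "psd S \<longleftrightarrow> transpose S = S \<and> (\<forall>z. 0 \<le> z \<bullet> (S *v z))"

definition posdef :: "real^'n^'n \<Rightarrow> bool" where
  "posdef S \<longleftrightarrow> transpose S = S \<and> (\<forall>z. z \<noteq> 0 \<longrightarrow> 0 < z \<bullet> (S *v z))"

definition psd_sqrt :: "real^'n^'n \<Rightarrow> real^'n^'n \<Rightarrow> bool" where
  "psd_sqrt S Q \<longleftrightarrow> psd S \<and> S ** S = Q"

definition wnorm2 :: "real^'n^'n \<Rightarrow> real^'n \<Rightarrow> real" where
  "wnorm2 S z = z \<bullet> (S *v z)"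

definition hurwitz :: "real^'n^'n \<Rightarrow> bool" where
  "hurwitz A \<longleftrightarrow>
     (\<forall>l v. v \<noteq> 0 \<and> map_matrix complex_of_real A *v v = l *s v \<longrightarrow> Re l < 0)"

definition stabilizable :: "real^'n^'n \<Rightarrow> real^'r^'n \<Rightarrow> bool" where
  "stabilizable A B \<longleftrightarrow> (\<exists>K :: real^'n^'r. hurwitz (A + B ** K))"

definition solves_linear :: "real^'n^'n \<Rightarrow> (real \<Rightarrow> real^'n) \<Rightarrow> bool" where
  "solves_linear A x \<longleftrightarrow>
     (\<forall>t\<ge>0. (x has_vector_derivative A *v x t) (at t within {0..}))"

text \<open>The pair \<open>(A, C)\<close> is observable if the output \<open>C x\<close> of \<open>x' = A x\<close> on \<open>[0,\<infinity>)\<close>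
  determines the initial state.\<close>

definition observable :: "real^'n^'n \<Rightarrow> real^'n^'m \<Rightarrow> bool" where
  "observable A C \<longleftrightarrow>
     (\<forall>x y. solves_linear A x \<and> solves_linear A y \<and> (\<forall>t\<ge>0. C *v x t = C *v y t)
        \<longrightarrow> x 0 = y 0)"

section \<open>Riccati equations and the mean-field equations\<close>

definition Xi :: "real^'n^'n \<Rightarrow> real^'n^'n \<Rightarrow> real^'n^'n" where
  "Xi \<Gamma> Q = transpose \<Gamma> ** Q + Q ** \<Gamma> - transpose \<Gamma> ** Q ** \<Gamma>"

definition eta_bar :: "real^'n^'n \<Rightarrow> real^'n^'n \<Rightarrow> (real \<Rightarrow> real^'n) \<Rightarrow> real \<Rightarrow> real^'n" where
  "eta_bar \<Gamma> Q \<eta> t = Q *v \<eta> t - (transpose \<Gamma> ** Q) *v \<eta> t"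

text \<open>Solutions of the algebraic Riccati equations are symmetric, as usual; the order in
  the definition of maximality is the Loewner order.\<close>

definition riccati_solution ::
  "real \<Rightarrow> real^'n^'n \<Rightarrow> real^'r^'n \<Rightarrow> real^'n^'n \<Rightarrow> real^'r^'r \<Rightarrow> real^'n^'n \<Rightarrow> bool" where
  "riccati_solution \<rho> A B Q R P \<longleftrightarrow> transpose P = P \<and>
     \<rho> *\<^sub>R P = transpose A ** P + P ** A
               - P ** B ** matrix_inv R ** transpose B ** P + Q"

definition maximal_riccati_solution ::
  "real \<Rightarrow> real^'n^'n \<Rightarrow> real^'r^'n \<Rightarrow> real^'n^'n \<Rightarrow> real^'r^'r \<Rightarrow> real^'n^'n \<Rightarrow> bool" where
  "maximal_riccati_solution \<rho> A B Q R P \<longleftrightarrow> riccati_solution \<rho> A B Q R P \<and>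
     (\<forall>P'. riccati_solution \<rho> A B Q R P' \<longrightarrow> psd (P - P'))"

definition C_half :: "real \<Rightarrow> (real \<Rightarrow> real^'n) set" where
  "C_half \<rho> = {h. continuous_on {0..} h \<and>
     set_integrable lborel {0..} (\<lambda>t. exp (- \<rho> * t) * (norm (h t))\<^sup>2)}"

text \<open>Free of an initial condition: \<open>s(0)\<close> is fixed by \<open>s \<in> C_half \<rho>\<close>.\<close>

definition solves_s_equation where
  "solves_s_equation \<rho> A B G \<Gamma> Q R (f :: real \<Rightarrow> real^'n) \<eta> \<Pi>\<^sub>m s \<longleftrightarrow>
     (\<forall>t\<ge>0. (s has_vector_derivative
        (\<rho> *\<^sub>R s t - transpose (A + G - B ** matrix_inv R ** transpose B ** \<Pi>\<^sub>m) *v s t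
          - \<Pi>\<^sub>m *v f t + eta_bar \<Gamma> Q \<eta> t)) (at t within {0..}))"

definition solves_xbar_equation where
  "solves_xbar_equation A B G R (f :: real \<Rightarrow> real^'n) \<Pi>\<^sub>m s xbar0 xbar \<longleftrightarrow>
     xbar 0 = xbar0 \<and>
     (\<forall>t\<ge>0. (xbar has_vector_derivative
        ((A + G) *v xbar t
          - (B ** matrix_inv R ** transpose B) *v (\<Pi>\<^sub>m *v xbar t + s t) + f t))
        (at t within {0..}))"

section \<open>Brownian motion and stochastic integrals\<close>

definition complete_filtered_prob_space :: "'w measure \<Rightarrow> (real \<Rightarrow> 'w measure) \<Rightarrow> bool" where
  "complete_filtered_prob_space M F \<longleftrightarrow>
     prob_space M \<and> complete_measure M \<and> filtration (space M) F \<and>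
     (\<forall>t. sets (F t) \<subseteq> sets M) \<and> null_sets M \<subseteq> sets (F 0)"

definition brownian_motion ::
  "'w measure \<Rightarrow> (real \<Rightarrow> 'w measure) \<Rightarrow> (real \<Rightarrow> 'w \<Rightarrow> real) \<Rightarrow> bool" where
  "brownian_motion M F W \<longleftrightarrow>
     (\<forall>t\<ge>0. W t \<in> borel_measurable (F t)) \<and>
     (AE \<omega> in M. W 0 \<omega> = 0) \<and>
     (AE \<omega> in M. continuous_on {0..} (\<lambda>t. W t \<omega>)) \<and>
     (\<forall>a b. 0 \<le> a \<and> a < b \<longrightarrow>
        distributed M lborel (\<lambda>\<omega>. W b \<omega> - W a \<omega>)
          (\<lambda>y. ennreal (normal_density 0 (sqrt (b - a)) y)) \<and>
        prob_space.indep_set M (sets (F a))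
          {(\<lambda>\<omega>. W b \<omega> - W a \<omega>) -` S \<inter> space M | S. S \<in> sets borel})"

text \<open>A list of triples \<open>(a, b, c)\<close> represents the deterministic step function
  \<open>\<Sum> 1_{(a,b]} c\<close>.\<close>

definition step_fun :: "(real \<times> real \<times> (real^'n)) list \<Rightarrow> real \<Rightarrow> real^'n" where
  "step_fun S r = (\<Sum>(a, b, c)\<leftarrow>S. indicator {a<..b} r *\<^sub>R c)"

definition step_integral ::
  "(real \<Rightarrow> 'w \<Rightarrow> real) \<Rightarrow> (real \<times> real \<times> (real^'n)) list \<Rightarrow> 'w \<Rightarrow> real^'n" where
  "step_integral W S \<omega> = (\<Sum>(a, b, c)\<leftarrow>S. (W b \<omega> - W a \<omega>) *\<^sub>R c)"

text \<open>\<open>is_ito_integral M W g t I\<close>: almost surely, \<open>I\<close> is the Ito integral of \<open>g\<close> with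
  respect to \<open>W\<close> over \<open>[0,t]\<close>. The integrand is deterministic, so deterministic step
  functions suffice in the usual definition as an \<open>L\<^sup>2\<close>-limit of elementary integrals; by the
  Ito isometry the limit does not depend on the approximating sequence.\<close>

definition is_ito_integral ::
  "'w measure \<Rightarrow> (real \<Rightarrow> 'w \<Rightarrow> real) \<Rightarrow> (real \<Rightarrow> real^'n) \<Rightarrow> real \<Rightarrow> ('w \<Rightarrow> real^'n) \<Rightarrow> bool" where
  "is_ito_integral M W g t I \<longleftrightarrow> I \<in> borel_measurable M \<and>
     (\<exists>S :: nat \<Rightarrow> (real \<times> real \<times> (real^'n)) list.
        (\<forall>k. \<forall>(a, b, c)\<in>set (S k). 0 \<le> a \<and> a \<le> b \<and> b \<le> t) \<and>
        (\<lambda>k. \<integral>\<^sup>+r\<in>{0..t}. ennreal ((norm (step_fun (S k) r - g r))\<^sup>2) \<partial>lborel)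
          \<longlonglongrightarrow> 0 \<and>
        (\<lambda>k. \<integral>\<^sup>+\<omega>. ennreal ((norm (step_integral W (S k) \<omega> - I \<omega>))\<^sup>2) \<partial>M)
          \<longlonglongrightarrow> 0)"

section \<open>The social control problem\<close>

text \<open>Agents are numbered \<open>1, \<dots>, N\<close>; a family of processes has type
  \<open>nat \<Rightarrow> real \<Rightarrow> 'w \<Rightarrow> _\<close> (agent, time, sample point), and only times \<open>t \<ge> 0\<close> matter.\<close>

definition average :: "nat \<Rightarrow> (nat \<Rightarrow> real \<Rightarrow> 'w \<Rightarrow> real^'n) \<Rightarrow> real \<Rightarrow> 'w \<Rightarrow> real^'n" where
  "average N x t \<omega> = (1 / real N) *\<^sub>R (\<Sum>j\<in>{1..N}. x j t \<omega>)"

definition drift where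
  "drift A B G (f :: real \<Rightarrow> real^'n) N x u i t \<omega> =
     A *v x i t \<omega> + B *v u i t \<omega> + G *v average N x t \<omega> + f t"

text \<open>\<open>x\<close> is a strong solution (continuous, adapted) of the \<open>N\<close> state equations under the
  controls \<open>u\<close>, in integral form.\<close>

definition is_state where
  "is_state A B G (f :: real \<Rightarrow> real^'n) \<sigma> N M F W x0 u x \<longleftrightarrow>
     (\<forall>i\<in>{1..N}.
        (\<forall>t\<ge>0. x i t \<in> borel_measurable (F t)) \<and>
        (AE \<omega> in M. continuous_on {0..} (\<lambda>t. x i t \<omega>)) \<and>
        (\<forall>t\<ge>0. \<exists>I. is_ito_integral M (W i) \<sigma> t I \<and>
           (AE \<omega> in M.
              set_integrable lborel {0..t} (\<lambda>r. drift A B G f N x u i r \<omega>) \<and>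
              x i t \<omega> = x0 i \<omega> + (LINT r:{0..t}|lborel. drift A B G f N x u i r \<omega>) + I \<omega>)))"

text \<open>Costs are extended nonnegative: an admissible control may have infinite cost, since the
  state need not be square integrable with weight \<open>exp (- \<rho> t)\<close>. The truncation at \<open>0\<close> by
  \<open>ennreal\<close> has no effect when \<open>Q\<close> and \<open>R\<close> are positive semidefinite.\<close>

definition agent_cost where
  "agent_cost \<rho> \<Gamma> Q R (\<eta> :: real \<Rightarrow> real^'n) N M u x i =
     (\<integral>\<^sup>+\<omega>. (\<integral>\<^sup>+t\<in>{0..}.
        ennreal (exp (- \<rho> * t) *
          (wnorm2 Q (x i t \<omega> - \<Gamma> *v average N x t \<omega> - \<eta> t) + wnorm2 R (u i t \<omega>)))
        \<partial>lborel) \<partial>M)"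

definition social_cost where
  "social_cost \<rho> \<Gamma> Q R (\<eta> :: real \<Rightarrow> real^'n) N M u x =
     (\<Sum>i\<in>{1..N}. agent_cost \<rho> \<Gamma> Q R \<eta> N M u x i)"

text \<open>\<open>F_t^i\<close>, not augmented by null sets.\<close>

definition agent_filtration ::
  "'w measure \<Rightarrow> ('w \<Rightarrow> real^'n) \<Rightarrow> (real \<Rightarrow> 'w \<Rightarrow> real) \<Rightarrow> real \<Rightarrow> 'w measure" where
  "agent_filtration M x0 W t = sigma (space M)
     ({x0 -` S \<inter> space M | S. S \<in> sets borel} \<union>
      {W r -` S \<inter> space M | r S. 0 \<le> r \<and> r \<le> t \<and> S \<in> sets borel})"

definition central_filtration ::
  "nat \<Rightarrow> 'w measure \<Rightarrow> (nat \<Rightarrow> 'w \<Rightarrow> real^'n) \<Rightarrow> (nat \<Rightarrow> real \<Rightarrow> 'w \<Rightarrow> real) \<Rightarrow> real \<Rightarrow> 'w measure"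
  where
  "central_filtration N M x0 W t =
     sigma (space M) (\<Union>j\<in>{1..N}. sets (agent_filtration M (x0 j) (W j) t))"

definition central_controls ::
  "real \<Rightarrow> nat \<Rightarrow> 'w measure \<Rightarrow> (nat \<Rightarrow> 'w \<Rightarrow> real^'n) \<Rightarrow> (nat \<Rightarrow> real \<Rightarrow> 'w \<Rightarrow> real)
     \<Rightarrow> (nat \<Rightarrow> real \<Rightarrow> 'w \<Rightarrow> real^'r) set" where
  "central_controls \<rho> N M x0 W = {u. \<forall>i\<in>{1..N}.
     (\<lambda>(t, \<omega>). u i t \<omega>) \<in> borel_measurable (restrict_space borel {0..} \<Otimes>\<^sub>M M) \<and>
     (\<forall>t\<ge>0. u i t \<in> borel_measurable (central_filtration N M x0 W t)) \<and>
     (\<integral>\<^sup>+\<omega>. (\<integral>\<^sup>+t\<in>{0..}. ennreal (exp (- \<rho> * t) * (norm (u i t \<omega>))\<^sup>2) \<partial>lborel) \<partial>M) < \<infinity>}"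

text \<open>The infimum of the social cost over the centralized controls. The state is unique up to
  indistinguishability given \<open>u\<close>, so the cost of a pair \<open>(u, x)\<close> depends on \<open>u\<close> only.\<close>

definition optimal_social_cost where
  "optimal_social_cost \<rho> A B G \<Gamma> Q R (f :: real \<Rightarrow> real^'n) \<sigma> \<eta> N M F W x0 =
     Inf {social_cost \<rho> \<Gamma> Q R \<eta> N M u x | u x.
       u \<in> central_controls \<rho> N M x0 W \<and> is_state A B G f \<sigma> N M F W x0 u x}"

definition decentralized_control where
  "decentralized_control B R P \<Pi>\<^sub>m xbar s x i t \<omega> =
     - ((matrix_inv R ** transpose B) *v (P *v x i t \<omega> + (\<Pi>\<^sub>m - P) *v xbar t + s t))"

end

(* Averaging over the agents splits dynamics and cost into those of the mean m of the states and those of the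
   deviations y_i = x_i - m.  Under the feedback, y_i and e = m - xbar solve linear equations with additive noise
   whose drift matrices Abar = A - B R^-1 B^T P and Abar + G admit quadratic Lyapunov functions for the discounted
   cost; since e is driven by averages over the agents, E int exp(-rho t) |e|^2 dt is O(1/N).

   The difference between a control of finite cost and the feedback solves a noise-free linear equation, and
   observability makes it square integrable with the discount.  Integrating by parts against the costates P y_i
   and Pi xbar + s therefore removes all cross terms of the cost difference except those containing e.  Completing
   squares leaves J(u) >= J(uhat) - const N E int exp(-rho t) |e|^2 dt >= J(uhat) - const, so that the gap per
   agent is even O(1/N).

   The stochastic integrands are deterministic, so covariances and the martingale property of the noise replace
   the Ito formula.  Lyapunov functions and detectability come from one linear matrix inequality, obtained by
   separating convex cones, and the Riccati solution from maximizing the trace over subsolutions. *)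

theory Submission
  imports Defs "HOL-Computational_Algebra.Fundamental_Theorem_Algebra"
begin

text \<open>A finite cost bounds the controls and \<open>sqrtQ\<close> times the tracking errors,
  but not the states, so the boundary terms of the integration by parts are not known to vanish.
  Averaging the outputs isolates \<open>sqrtQ (I - \<Gamma>)\<close> applied to the mean of the
  state difference, and subtracting this isolates \<open>sqrtQ\<close> applied to the deviations;
  the two observability conditions are made for exactly these outputs. The boundary terms then tend
  to 0 because they converge and are dominated by an integrable function. The feedback acts on e
  through P, whereas e is absent from the costates. The mismatch is linear in e and in the mean of
  the difference. It carries a factor N, and so do the mean parts of the quadratic terms, which can
  therefore absorb it. Competitors must be adapted to the raw filtration of the initial states and
  Brownian motions, while states are adapted to F and continuous only almost surely; hence the
  versions obtained by dyadic rounding.\<close>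

declare transpose_matrix_vector [simp del]

section \<open>Quadratic forms of real matrices\<close>

lemma inner_matrix_vector_transpose:
  fixes A :: "real^'n^'m"
  shows "x \<bullet> (A *v y) = (transpose A *v x) \<bullet> y"
  by (simp add: dot_lmul_matrix transpose_matrix_vector)

lemma inner_symmetric_matrix:
  fixes S :: "real^'n^'n"
  assumes "transpose S = S"
  shows "(S *v x) \<bullet> y = x \<bullet> (S *v y)"
  by (simp add: inner_matrix_vector_transpose assms)

lemma uminus_matrix_vector_mult:
  fixes A :: "real^'n^'m"
  shows "(- A) *v x = - (A *v x)"
  by (simp add: vec_eq_iff matrix_vector_mult_def sum_negf)

lemma transpose_add_matrix: "transpose (A + B) = transpose A + transpose B"
  by (simp add: vec_eq_iff transpose_def)

text \<open>A zero of a nonnegative form is a minimum, so the gradient \<open>2 S z\<close>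
  vanishes. Concretely, a step from z against \<open>S z\<close> would make the form
  negative.\<close>

lemma psd_form_zero_imp_kernel:
  fixes S :: "real^'n^'n"
  assumes sym: "transpose S = S" and pos: "\<And>x. 0 \<le> x \<bullet> (S *v x)" and z: "z \<bullet> (S *v z) = 0"
  shows "S *v z = 0"
proof (rule ccontr)
  assume ne: "S *v z \<noteq> 0"
  define y where "y = S *v z"
  define b where "b = y \<bullet> (S *v y)"
  \<comment> \<open>The \<open>+ 1\<close> covers \<open>b = 0\<close>; this size keeps the
    quadratic term at most half of the linear one.\<close>
  define t where "t = - (y \<bullet> y) / (b + 1)"
  have y: "y \<bullet> y > 0" using ne by (simp add: y_def)
  have b: "b \<ge> 0" using pos by (simp add: b_def)
  have t: "t < 0" using y b by (simp add: t_def divide_neg_pos)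
  have s: "z \<bullet> (S *v y) = y \<bullet> y"
    by (simp add: inner_matrix_vector_transpose sym y_def)
  have "(z + t *\<^sub>R y) \<bullet> (S *v (z + t *\<^sub>R y)) = t * (2 * (y \<bullet> y) + t * b)"
    using s z by (simp add: algebra_simps inner_add_left inner_add_right matrix_vector_right_distrib
          matrix_vector_mult_scaleR y_def[symmetric] b_def)
  with pos[of "z + t *\<^sub>R y"] have "0 \<le> t * (2 * (y \<bullet> y) + t * b)" by simp
  with t have "2 * (y \<bullet> y) + t * b \<le> 0" by (simp add: zero_le_mult_iff)
  moreover have "t * b \<ge> - (y \<bullet> y)"
    using y b by (simp add: t_def field_simps)
  ultimately show False using y by simp
qed

lemma quadratic_form_lower_bound:
  fixes S :: "real^'n^'n"
  assumes "\<And>x. x \<noteq> 0 \<Longrightarrow> 0 < x \<bullet> (S *v x)"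
  obtains c where "c > 0" "\<And>x. c * (norm x)\<^sup>2 \<le> x \<bullet> (S *v x)"
proof -
  have "compact (sphere (0::real^'n) 1)" by simp
  moreover have "sphere (0::real^'n) 1 \<noteq> {}" by simp
  moreover have "continuous_on (sphere (0::real^'n) 1) (\<lambda>x. x \<bullet> (S *v x))"
    by (intro continuous_intros matrix_vector_mult_linear_continuous_on[THEN continuous_on_subset]) auto
  ultimately obtain z where z: "z \<in> sphere 0 1" and min: "\<And>x. x \<in> sphere 0 1 \<Longrightarrow> z \<bullet> (S *v z) \<le> x \<bullet> (S *v x)"
    using continuous_attains_inf[of "sphere (0::real^'n) 1" "\<lambda>x. x \<bullet> (S *v x)"] by auto
  define c where "c = z \<bullet> (S *v z)"
  have "z \<noteq> 0" using z by auto
  hence "c > 0" using assms[of z] by (simp add: c_def)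
  moreover have "c * (norm x)\<^sup>2 \<le> x \<bullet> (S *v x)" for x
  proof (cases "x = 0")
    case False
    have "c \<le> (x /\<^sub>R norm x) \<bullet> (S *v (x /\<^sub>R norm x))"
      unfolding c_def by (rule min) (use False in simp)
    also have "\<dots> = x \<bullet> (S *v x) / (norm x)\<^sup>2"
      by (simp add: matrix_vector_mult_scaleR power2_eq_square field_simps)
    finally show ?thesis using False by (simp add: field_simps)
  qed simp
  ultimately show ?thesis using that by blast
qed

lemma norm_matrix_vector_le:
  fixes A :: "real^'n^'m"
  obtains c where "c > 0" "\<And>x. norm (A *v x) \<le> c * norm x"
proof -
  have "bounded_linear (\<lambda>x. A *v x)" by (simp add: matrix_vector_mul_bounded_linear)
  from bounded_linear.pos_bounded[OF this] show ?thesis using that by (auto simp: mult.commute)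
qed

lemma quadratic_form_upper_bound:
  fixes S :: "real^'n^'n"
  obtains c where "c > 0" "\<And>x. x \<bullet> (S *v x) \<le> c * (norm x)\<^sup>2"
proof -
  obtain c where c: "c > 0" "\<And>x. norm (S *v x) \<le> c * norm x" using norm_matrix_vector_le by blast
  have "x \<bullet> (S *v x) \<le> c * (norm x)\<^sup>2" for x
  proof -
    have "x \<bullet> (S *v x) \<le> norm x * norm (S *v x)" by (rule norm_cauchy_schwarz)
    also have "\<dots> \<le> norm x * (c * norm x)" using c by (intro mult_left_mono) auto
    finally show ?thesis by (simp add: power2_eq_square mult_ac)
  qed
  with c show ?thesis using that by blast
qed

section \<open>Eigenvectors in invariant subspaces\<close>

text \<open>The vectors p(f) v, with p a polynomial, stay in S. A nonzero p of least degree that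
  annihilates v has a root l, and the cofactor of X - l, applied to v, is an eigenvector. The
  closure conditions are spelled out because \<open>subspace\<close> would ask for real scalars
  only.\<close>

lemma eigenvector_in_invariant_set:
  fixes f :: "complex^'n \<Rightarrow> complex^'n" and S :: "(complex^'n) set"
  assumes fadd: "\<And>x y. f (x + y) = f x + f y" and fsc: "\<And>c x. f (c *s x) = c *s f x"
    and S0: "0 \<in> S" and Sadd: "\<And>x y. x \<in> S \<Longrightarrow> y \<in> S \<Longrightarrow> x + y \<in> S"
    and Ssc: "\<And>c x. x \<in> S \<Longrightarrow> c *s x \<in> S" and Sf: "\<And>x. x \<in> S \<Longrightarrow> f x \<in> S"
    and v: "v \<in> S" "v \<noteq> 0"
  obtains l u where "u \<in> S" "u \<noteq> 0" "f u = l *s u"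
proof -
  define T where "T p = (\<Sum>i\<le>degree p. coeff p i *s (f ^^ i) v)" for p :: "complex poly"
  have T_ge: "T p = (\<Sum>i\<le>n. coeff p i *s (f ^^ i) v)" if "degree p \<le> n" for p n
    unfolding T_def by (rule sum.mono_neutral_left) (use that in \<open>auto simp: coeff_eq_0\<close>)
  have f0: "f 0 = 0" using fsc[of 0 0] by simp
  have fsum: "f (\<Sum>i\<in>I. g i) = (\<Sum>i\<in>I. f (g i))" if "finite I" for I :: "nat set" and g
    using that by (induction I rule: finite_induct) (auto simp: f0 fadd)
  have fp: "(f ^^ i) v \<in> S" for i by (induction i) (auto simp: v Sf)
  have TS: "T p \<in> S" for p
  proof -
    have "(\<Sum>i\<in>I. coeff p i *s (f ^^ i) v) \<in> S" if "finite I" for I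
      using that by (induction I rule: finite_induct) (auto simp: S0 intro!: Sadd Ssc fp)
    thus ?thesis by (simp add: T_def)
  qed
  \<comment> \<open>One more Krylov vector than the real dimension: either two coincide or they
    satisfy a real linear relation. Both give an annihilating polynomial.\<close>
  have "\<exists>p. p \<noteq> 0 \<and> T p = 0"
  proof (cases "inj_on (\<lambda>i. (f ^^ i) v) {..DIM(complex^'n)}")
    case False
    then obtain i j where ij: "i \<noteq> j" "(f ^^ i) v = (f ^^ j) v" by (auto simp: inj_on_def)
    define p :: "complex poly" where "p = monom 1 i - monom 1 j"
    have "coeff p i = 1" using ij by (simp add: p_def)
    hence "p \<noteq> 0" by auto
    moreover have "T p = (\<Sum>k\<le>max i j. coeff p k *s (f ^^ k) v)"
      unfolding p_def by (intro T_ge degree_diff_le) (auto intro: order.trans[OF degree_monom_le])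
    moreover have "\<dots> = (\<Sum>k\<le>max i j. (if k = i then (f ^^ k) v else 0) - (if k = j then (f ^^ k) v else 0))"
      by (intro sum.cong) (auto simp: p_def ij)
    moreover have "\<dots> = 0" by (simp add: sum_subtractf ij)
    ultimately show ?thesis by auto
  next
    case True
    let ?B = "(\<lambda>i. (f ^^ i) v) ` {..DIM(complex^'n)}"
    have "card ?B = DIM(complex^'n) + 1" using card_image[OF True] by simp
    hence "dependent ?B" using dependent_biggerset[of ?B] by simp
    then obtain u where u: "(\<Sum>w\<in>?B. u w *\<^sub>R w) = 0" "\<exists>w\<in>?B. u w \<noteq> 0"
      using dependent_finite[of ?B] by auto
    define p where "p = (\<Sum>i\<le>DIM(complex^'n). monom (complex_of_real (u ((f ^^ i) v))) i)"
    have cp: "coeff p k = (if k \<le> DIM(complex^'n) then complex_of_real (u ((f ^^ k) v)) else 0)" for k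
      by (simp add: p_def coeff_sum)
    from u(2) obtain k where "k \<le> DIM(complex^'n)" "u ((f ^^ k) v) \<noteq> 0" by auto
    hence "coeff p k \<noteq> 0" by (simp add: cp)
    hence "p \<noteq> 0" by auto
    moreover have "T p = (\<Sum>i\<le>DIM(complex^'n). coeff p i *s (f ^^ i) v)"
      by (rule T_ge) (auto intro!: degree_le simp: cp)
    moreover have "\<dots> = (\<Sum>i\<le>DIM(complex^'n). u ((f ^^ i) v) *\<^sub>R (f ^^ i) v)"
      by (intro sum.cong refl) (simp add: cp vec_eq_iff scaleR_conv_of_real[where 'a = complex] del: scaleR_conv_of_real)
    moreover have "\<dots> = 0" using u(1) sum.reindex[OF True, of "\<lambda>w. u w *\<^sub>R w"] by simp
    ultimately show ?thesis by auto
  qed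
  hence "\<exists>p. (p \<noteq> 0 \<and> T p = 0) \<and> (\<forall>q. q \<noteq> 0 \<and> T q = 0 \<longrightarrow> degree p \<le> degree q)"
    using ex_has_least_nat[of "\<lambda>p. p \<noteq> 0 \<and> T p = 0" _ degree] by metis
  then obtain p where p: "p \<noteq> 0" "T p = 0" and min: "\<And>q. q \<noteq> 0 \<Longrightarrow> T q = 0 \<Longrightarrow> degree p \<le> degree q"
    by auto
  \<comment> \<open>A nonzero constant does not annihilate v, so p has a root.\<close>
  have "degree p \<noteq> 0"
  proof
    assume d: "degree p = 0"
    then obtain c where "p = [:c:]" by (auto elim: degree_eq_zeroE)
    with p v show False by (auto simp: T_def vec_eq_iff)
  qed
  hence "\<not> constant (poly p)" by (simp add: constant_degree)
  then obtain l where l: "poly p l = 0" using fundamental_theorem_of_algebra by blast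
  then obtain q where q: "p = [:-l, 1:] * q" by (auto simp: poly_eq_0_iff_dvd dvd_def)
  have q0: "q \<noteq> 0" using p q by auto
  have "degree p = degree [:-l, 1:] + degree q" unfolding q by (rule degree_mult_eq) (use q0 in auto)
  hence dp: "degree p = Suc (degree q)" by simp
  have Tq: "T q \<noteq> 0" using min[OF q0] dp by auto
  \<comment> \<open>Multiplication by X shifts the coefficients and acts as f, so \<open>T p\<close>
    is \<open>f (T q) - l *s T q\<close>; and \<open>T p\<close> is 0.\<close>
  have "T p = (\<Sum>i\<le>Suc (degree q). coeff p i *s (f ^^ i) v)" by (simp add: T_def dp)
  also have "\<dots> = (\<Sum>i\<le>Suc (degree q). coeff (pCons 0 q) i *s (f ^^ i) v)
      - (\<Sum>i\<le>Suc (degree q). (l * coeff q i) *s (f ^^ i) v)"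
    unfolding sum_subtractf[symmetric] q by (intro sum.cong refl) (simp add: vec_eq_iff algebra_simps)
  also have "(\<Sum>i\<le>Suc (degree q). coeff (pCons 0 q) i *s (f ^^ i) v) = f (T q)"
    by (simp add: sum.atMost_Suc_shift T_def fsum fsc del: sum.atMost_Suc)
  also have "(\<Sum>i\<le>Suc (degree q). (l * coeff q i) *s (f ^^ i) v) = l *s T q"
    by (simp add: T_def vector_space_over_itself.scale_sum_right coeff_eq_0 vec_eq_iff sum_distrib_left mult_ac)
  finally have "f (T q) = l *s T q" using p by simp
  thus ?thesis using that TS Tq by blast
qed

text \<open>Here p and q are the real and imaginary parts of an eigenvector for the eigenvalue a +
  ib. The complexification of V is invariant because A is real.\<close>

lemma eigenpair_in_invariant_subspace:
  fixes A :: "real^'n^'n"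
  assumes V: "subspace V" and inv: "\<And>x. x \<in> V \<Longrightarrow> A *v x \<in> V" and v: "v \<in> V" "v \<noteq> 0"
  obtains a b p q where "p \<in> V" "q \<in> V" "p \<noteq> 0 \<or> q \<noteq> 0"
    "A *v p = a *\<^sub>R p - b *\<^sub>R q" "A *v q = b *\<^sub>R p + a *\<^sub>R q"
proof -
  define re where "re u = (\<chi> i. Re (u $ i))" for u :: "complex^'n"
  define im where "im u = (\<chi> i. Im (u $ i))" for u :: "complex^'n"
  define S where "S = {u. re u \<in> V \<and> im u \<in> V}"
  define f where "f u = map_matrix complex_of_real A *v u" for u
  have re_f: "re (f u) = A *v re u" for u
    by (simp add: re_def f_def map_matrix_def matrix_vector_mult_def vec_eq_iff)
  have im_f: "im (f u) = A *v im u" for u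
    by (simp add: im_def f_def map_matrix_def matrix_vector_mult_def vec_eq_iff)
  have re_s: "re (c *s u) = Re c *\<^sub>R re u - Im c *\<^sub>R im u" for c u
    by (simp add: re_def im_def vec_eq_iff)
  have im_s: "im (c *s u) = Im c *\<^sub>R re u + Re c *\<^sub>R im u" for c u
    by (simp add: re_def im_def vec_eq_iff algebra_simps)
  have re_a: "re (x + y) = re x + re y" "im (x + y) = im x + im y" for x y
    by (simp_all add: re_def im_def vec_eq_iff)
  define w :: "complex^'n" where "w = (\<chi> i. complex_of_real (v $ i))"
  have w: "re w = v" "im w = 0" by (simp_all add: re_def im_def w_def vec_eq_iff)
  have S0: "0 \<in> S" using subspace_0[OF V] by (simp add: S_def re_def im_def zero_vec_def)
  have "re 0 = 0" by (simp add: re_def zero_vec_def)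
  hence "w \<noteq> 0" using w v by auto
  moreover have "w \<in> S" using w v subspace_0[OF V] by (simp add: S_def)
  moreover have "f (x + y) = f x + f y" "f (c *s x) = c *s f x" for x y c
    by (simp_all add: f_def matrix_vector_right_distrib vector_scalar_commute)
  moreover have "x + y \<in> S" "c *s x \<in> S" "f x \<in> S" if "x \<in> S" "y \<in> S" for x y c
    using that V by (auto simp: S_def re_f im_f inv re_s im_s re_a intro!: subspace_add subspace_diff subspace_scale)
  ultimately obtain l u where u: "u \<in> S" "u \<noteq> 0" "f u = l *s u"
    using eigenvector_in_invariant_set[of f S w] S0 by metis
  have "A *v re u = Re l *\<^sub>R re u - Im l *\<^sub>R im u" "A *v im u = Im l *\<^sub>R re u + Re l *\<^sub>R im u"
    using u by (metis re_f re_s, metis im_f im_s)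
  moreover have "re u \<noteq> 0 \<or> im u \<noteq> 0" using u
    by (auto simp: re_def im_def vec_eq_iff complex_eq_iff)
  ultimately show ?thesis using that u by (auto simp: S_def)
qed

section \<open>A linear matrix inequality\<close>

text \<open>The rank-one matrix x y^T. The inner product of matrices is the Frobenius one, so a
  linear functional given by a matrix takes on x y^T the value of its bilinear form; this is how the
  separating functional below is tested.\<close>

definition outer :: "real^'n \<Rightarrow> real^'m \<Rightarrow> real^'m^'n" where
  "outer x y = (\<chi> i j. x $ i * y $ j)"

lemma inner_outer: "a \<bullet> outer x y = x \<bullet> (a *v y)"
  by (simp add: inner_vec_def outer_def matrix_vector_mult_def sum_distrib_left mult_ac)

lemma outer_vector_mult: "outer x y *v z = (y \<bullet> z) *\<^sub>R x"
  by (simp add: vec_eq_iff inner_vec_def outer_def matrix_vector_mult_def sum_distrib_left mult_ac sum_distrib_right)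

lemma transpose_outer: "transpose (outer x y) = outer y x"
  by (simp add: vec_eq_iff transpose_def outer_def mult.commute)

lemma matrix_mult_outer: "A ** outer x y = outer (A *v x) y"
  by (simp add: vec_eq_iff outer_def matrix_matrix_mult_def matrix_vector_mult_def sum_distrib_right mult.assoc)

lemma outer_matrix_mult: "outer x y ** A = outer x (transpose A *v y)"
  by (simp add: vec_eq_iff outer_def matrix_matrix_mult_def matrix_vector_mult_def transpose_def, subst sum_distrib_left, simp add: mult_ac)

lemma gram_eq_sum_outer:
  fixes C :: "real^'n^'m"
  shows "transpose C ** C = (\<Sum>k\<in>UNIV. outer (row k C) (row k C))"
  by (simp add: vec_eq_iff outer_def matrix_matrix_mult_def transpose_def row_def)

lemma inner_gram:
  fixes C :: "real^'n^'m"
  shows "x \<bullet> ((transpose C ** C) *v y) = (C *v x) \<bullet> (C *v y)"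
  using inner_matrix_vector_transpose[of x "transpose C" "C *v y"] by (simp add: matrix_vector_mul_assoc[symmetric])

lemma psd_outer: "psd (outer x x)"
  by (simp add: psd_def transpose_outer outer_vector_mult inner_commute flip: power2_eq_square)

lemma psd_0: "psd 0"
  by (simp add: psd_def transpose_def vec_eq_iff)

text \<open>A theorem of alternatives. If no A^T Y + Y A - \<kappa> C^T C is negative definite, a
  hyperplane separates these matrices from the negative definite ones. Its normal a is symmetric and
  positive semidefinite, C a = 0, and A a + a A^T is positive semidefinite. So the range of a is
  A-invariant, lies in the kernel of C, and carries a mode that is not decaying, against the
  hypothesis.\<close>

lemma detectability_inequality:
  fixes A :: "real^'n^'n" and C :: "real^'n^'m"
  assumes no_mode: "\<And>a b p q. A *v p = a *\<^sub>R p - b *\<^sub>R q \<Longrightarrow> A *v q = b *\<^sub>R p + a *\<^sub>R q \<Longrightarrow>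
      C *v p = 0 \<Longrightarrow> C *v q = 0 \<Longrightarrow> p \<noteq> 0 \<or> q \<noteq> 0 \<Longrightarrow> a < 0"
  obtains Y \<kappa> where "psd Y" "\<kappa> \<ge> 0"
    "\<And>x. 2 * ((Y *v x) \<bullet> (A *v x)) \<le> \<kappa> * (norm (C *v x))\<^sup>2 - (norm x)\<^sup>2"
proof -
  define L where "L Y \<kappa> = transpose A ** Y + Y ** A - \<kappa> *\<^sub>R (transpose C ** C)" for Y \<kappa>
  define U where "U = {L Y \<kappa> | Y \<kappa>. psd Y \<and> \<kappa> \<ge> 0}"
  define ND where "ND = {M :: real^'n^'n. \<forall>x. x \<noteq> 0 \<longrightarrow> x \<bullet> (M *v x) < 0}"
  have form: "x \<bullet> (L Y \<kappa> *v x) = 2 * ((Y *v x) \<bullet> (A *v x)) - \<kappa> * (norm (C *v x))\<^sup>2" if "psd Y" for Y \<kappa> x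
  proof -
    have "x \<bullet> ((transpose A ** Y) *v x) = (Y *v x) \<bullet> (A *v x)"
      using inner_matrix_vector_transpose[of x "transpose A" "Y *v x"]
      by (simp add: matrix_vector_mul_assoc[symmetric] inner_commute)
    moreover have "x \<bullet> ((Y ** A) *v x) = (Y *v x) \<bullet> (A *v x)"
      using that inner_matrix_vector_transpose[of x Y "A *v x"]
      by (simp add: matrix_vector_mul_assoc[symmetric] psd_def)
    ultimately show ?thesis
      by (simp add: L_def algebra_simps inner_add_right inner_diff_right scaleR_matrix_vector_assoc[symmetric] inner_gram
          power2_norm_eq_inner)
  qed
  have "U \<inter> ND \<noteq> {}"
  proof
    assume disj: "U \<inter> ND = {}"
    have "convex ND"
    proof (rule convexI)
      fix M N :: "real^'n^'n" and u v :: real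
      assume h: "M \<in> ND" "N \<in> ND" "0 \<le> u" "0 \<le> v" "u + v = 1"
      have "u * (x \<bullet> (M *v x)) + v * (x \<bullet> (N *v x)) < 0" if "x \<noteq> 0" for x
      proof -
        have "x \<bullet> (M *v x) < 0" "x \<bullet> (N *v x) < 0" using h that by (auto simp: ND_def)
        thus ?thesis using h(3-5) convex_bound_lt[of "x \<bullet> (M *v x)" 0 "x \<bullet> (N *v x)" u v] by simp
      qed
      thus "u *\<^sub>R M + v *\<^sub>R N \<in> ND"
        by (simp add: ND_def algebra_simps inner_add_right scaleR_matrix_vector_assoc[symmetric])
    qed
    moreover have "convex U"
    proof (rule convexI)
      fix M N :: "real^'n^'n" and u v :: real
      assume h: "M \<in> U" "N \<in> U" "0 \<le> u" "0 \<le> v" "u + v = 1"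
      then obtain Y1 k1 Y2 k2 where Y: "M = L Y1 k1" "psd Y1" "k1 \<ge> 0" "N = L Y2 k2" "psd Y2" "k2 \<ge> 0"
        by (auto simp: U_def)
      have "u *\<^sub>R M + v *\<^sub>R N = L (u *\<^sub>R Y1 + v *\<^sub>R Y2) (u * k1 + v * k2)"
        by (simp add: Y L_def vec_eq_iff matrix_matrix_mult_def sum.distrib sum_distrib_left algebra_simps)
      moreover have "psd (u *\<^sub>R Y1 + v *\<^sub>R Y2)"
        using Y h by (auto simp: psd_def algebra_simps inner_add_right scaleR_matrix_vector_assoc[symmetric]
            transpose_def vec_eq_iff)
      ultimately show "u *\<^sub>R M + v *\<^sub>R N \<in> U" unfolding U_def using Y h
        by (intro CollectI exI[of _ "u *\<^sub>R Y1 + v *\<^sub>R Y2"] exI[of _ "u * k1 + v * k2"] conjI) simp_all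
    qed
    \<comment> \<open>Skew parts do not change a quadratic form, so \<open>ND\<close> contains whole
      lines in skew directions.\<close>
    moreover have mI: "t *\<^sub>R (a - transpose a) - e *\<^sub>R mat 1 \<in> ND" if "e > 0" for t e and a :: "real^'n^'n"
    proof -
      have "x \<bullet> (transpose a *v x) = x \<bullet> (a *v x)" for x
        using inner_matrix_vector_transpose[of x "transpose a" x] by (simp add: inner_commute)
      thus ?thesis using that
        by (auto simp: ND_def algebra_simps inner_diff_right inner_add_right scaleR_matrix_vector_assoc[symmetric])
    qed
    have U0: "0 \<in> U"
      unfolding U_def by (auto intro!: exI[of _ 0] simp: L_def psd_def transpose_def vec_eq_iff)
    moreover have "ND \<noteq> {}" "U \<noteq> {}" "ND \<inter> U = {}" using mI[of 1 0 0] U0 disj by auto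
    ultimately have "\<exists>a b. a \<noteq> 0 \<and> (\<forall>M\<in>ND. a \<bullet> M \<le> b) \<and> (\<forall>M\<in>U. b \<le> a \<bullet> M)"
      using separating_hyperplane_sets[of ND U] by blast
    then obtain a b where a0: "a \<noteq> 0" and ND: "\<And>M. M \<in> ND \<Longrightarrow> a \<bullet> M \<le> b" and U: "\<And>M. M \<in> U \<Longrightarrow> b \<le> a \<bullet> M"
      by blast
    \<comment> \<open>Negative multiples of the identity lie in \<open>ND\<close> and approach 0, so
      the separating value cannot be negative.\<close>
    have b0: "b \<ge> 0"
    proof (rule ccontr)
      assume "\<not> b \<ge> 0"
      define e where "e = - b / (2 * (\<bar>a \<bullet> mat 1\<bar> + 1))"
      have e: "e > 0" using \<open>\<not> b \<ge> 0\<close> by (simp add: e_def field_simps)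
      have "- e * (a \<bullet> mat 1) \<le> b" using ND[OF mI[OF e, of 0 0]] by (simp add: inner_diff_right)
      moreover have "e * (a \<bullet> mat 1) \<le> e * \<bar>a \<bullet> mat 1\<bar>" using e by (intro mult_left_mono) auto
      moreover have "e * \<bar>a \<bullet> mat 1\<bar> < - b"
      proof -
        have "e * (\<bar>a \<bullet> mat 1\<bar> + 1) = - b / 2" by (simp add: e_def add_pos_nonneg field_simps)
        hence "e * \<bar>a \<bullet> mat 1\<bar> + e = - b / 2" by (simp add: algebra_simps)
        thus ?thesis using e \<open>\<not> b \<ge> 0\<close> by linarith
      qed
      ultimately show False by linarith
    qed
    have b: "b = 0" using b0 U[OF U0] by simp
    \<comment> \<open>The functional is bounded above along the skew line through a - a^T, hence
      constant there, which forces this direction to be 0.\<close>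
    have asym: "transpose a = a"
    proof (rule ccontr)
      assume ne: "transpose a \<noteq> a"
      define d where "d = a \<bullet> (a - transpose a)"
      have tt: "transpose a \<bullet> transpose a = a \<bullet> a"
        unfolding inner_vec_def transpose_def by simp (rule sum.swap)
      have "(a - transpose a) \<bullet> (a - transpose a) = 2 * d"
        by (simp add: d_def inner_diff_left inner_diff_right tt inner_commute)
      hence d: "d > 0" using ne by (metis inner_gt_zero_iff right_minus_eq zero_less_mult_iff zero_less_numeral not_numeral_less_zero)
      have "(\<bar>a \<bullet> mat 1\<bar> + 1) / d * d - a \<bullet> mat 1 \<le> 0"
        using ND[OF mI[of 1 "(\<bar>a \<bullet> mat 1\<bar> + 1) / d" a]] by (simp add: inner_diff_right d_def b)
      thus False using d by simp
    qed
    \<comment> \<open>The test matrix is -z z^T minus a small multiple of the identity.\<close>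
    have psda: "0 \<le> z \<bullet> (a *v z)" for z
    proof (rule ccontr)
      assume n: "\<not> 0 \<le> z \<bullet> (a *v z)"
      define e where "e = - (z \<bullet> (a *v z)) / (2 * (\<bar>a \<bullet> mat 1\<bar> + 1))"
      have e: "e > 0" using n by (simp add: e_def field_simps)
      have "x \<bullet> ((- outer z z - e *\<^sub>R mat 1) *v x) = - (z \<bullet> x)\<^sup>2 - e * (x \<bullet> x)" for x
        by (simp add: matrix_vector_mult_diff_rdistrib uminus_matrix_vector_mult outer_vector_mult inner_diff_right
            scaleR_matrix_vector_assoc[symmetric] inner_commute power2_eq_square)
      moreover have "- (z \<bullet> x)\<^sup>2 - e * (x \<bullet> x) < 0" if "x \<noteq> 0" for x
        using e that by (smt (verit) inner_gt_zero_iff mult_pos_pos zero_le_power2)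
      ultimately have "- outer z z - e *\<^sub>R mat 1 \<in> ND" by (simp add: ND_def)
      from ND[OF this] have "- (z \<bullet> (a *v z)) - e * (a \<bullet> mat 1) \<le> 0"
        by (simp add: inner_diff_right inner_outer b)
      moreover have "e * (a \<bullet> mat 1) \<le> e * \<bar>a \<bullet> mat 1\<bar>" using e by (intro mult_left_mono) auto
      moreover have "e * \<bar>a \<bullet> mat 1\<bar> < - (z \<bullet> (a *v z))"
      proof -
        have "e * (\<bar>a \<bullet> mat 1\<bar> + 1) = - (z \<bullet> (a *v z)) / 2" by (simp add: e_def add_pos_nonneg field_simps)
        hence "e * \<bar>a \<bullet> mat 1\<bar> + e = - (z \<bullet> (a *v z)) / 2" by (simp add: algebra_simps)
        thus ?thesis using e n by linarith
      qed
      ultimately show False by linarith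
    qed
    \<comment> \<open>With Y = 0 and \<kappa> = 1 the separation makes a sum of nonnegative numbers,
      the values of the form of a on the rows of C, at most 0.\<close>
    have Ca: "C *v (a *v z) = 0" for z
    proof -
      have "L 0 1 \<in> U" unfolding U_def using psd_0 zero_le_one by blast
      from U[OF this] have "(\<Sum>k\<in>UNIV. row k C \<bullet> (a *v row k C)) \<le> 0"
        by (simp add: L_def gram_eq_sum_outer inner_sum_right inner_outer b inner_diff_right)
      hence "(\<Sum>k\<in>UNIV. row k C \<bullet> (a *v row k C)) = 0"
        using psda by (simp add: sum_nonneg order_antisym)
      hence "row k C \<bullet> (a *v row k C) = 0" for k
        using psda by (simp add: sum_nonneg_eq_0_iff)
      hence "a *v row k C = 0" for k
        using psd_form_zero_imp_kernel[OF asym psda] by blast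
      hence "row k C \<bullet> (a *v z) = 0" for k
        by (simp add: inner_matrix_vector_transpose asym)
      thus ?thesis by (simp add: vec_eq_iff matrix_vector_mul_component row_def)
    qed
    \<comment> \<open>Y of rank one: this says that A a + a A^T is positive semidefinite.\<close>
    have W: "0 \<le> y \<bullet> (A *v (a *v y))" for y
    proof -
      have "L (outer y y) 0 \<in> U" unfolding U_def using psd_outer by blast
      from U[OF this] have "0 \<le> a \<bullet> (outer (transpose A *v y) y) + a \<bullet> (outer y (transpose A *v y))"
        by (simp add: L_def inner_add_right b matrix_mult_outer outer_matrix_mult)
      also have "\<dots> = (transpose A *v y) \<bullet> (a *v y) + y \<bullet> (a *v (transpose A *v y))"
        by (simp add: inner_outer)
      also have "y \<bullet> (a *v (transpose A *v y)) = (transpose A *v y) \<bullet> (a *v y)"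
        by (metis inner_matrix_vector_transpose asym inner_commute)
      finally show ?thesis by (simp add: inner_matrix_vector_transpose)
    qed
    \<comment> \<open>On ker a the form of A a + a A^T vanishes, so ker a lies in the kernel of that
      matrix. Hence ker a is invariant under A^T, and its orthogonal complement, the range of a,
      under A.\<close>
    have kerinv: "a *v (transpose A *v z) = 0" if z: "a *v z = 0" for z
    proof -
      define S where "S = A ** a + a ** transpose A"
      have Sz: "x \<bullet> (S *v x) = 2 * (x \<bullet> (A *v (a *v x)))" for x
      proof -
        have "x \<bullet> (a *v (transpose A *v x)) = x \<bullet> (A *v (a *v x))"
          by (metis inner_matrix_vector_transpose asym inner_commute)
        thus ?thesis by (simp add: S_def algebra_simps inner_add_right flip: matrix_vector_mul_assoc)
      qed
      have "transpose S = S"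
        by (simp add: S_def transpose_add_matrix matrix_transpose_mul asym add.commute)
      moreover have "0 \<le> x \<bullet> (S *v x)" for x using W by (simp add: Sz)
      moreover have "z \<bullet> (S *v z) = 0" by (simp add: Sz z)
      ultimately have "S *v z = 0" by (rule psd_form_zero_imp_kernel)
      thus ?thesis by (simp add: S_def algebra_simps z flip: matrix_vector_mul_assoc)
    qed
    define V where "V = range (\<lambda>z. a *v z)"
    have subV: "subspace V" unfolding V_def
      by (metis linear_subspace_image matrix_vector_mul_linear subspace_UNIV)
    have perp: "x \<in> V" if "\<And>z. a *v z = 0 \<Longrightarrow> x \<bullet> z = 0" for x
    proof -
      obtain y w where yw: "y \<in> V" "\<And>v. v \<in> V \<Longrightarrow> orthogonal w v" "x = y + w"
        using orthogonal_subspace_decomp_exists[of V x] subV by (metis span_eq_iff)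
      have "(a *v w) \<bullet> u = 0" for u
        using yw(2)[of "a *v u"] by (simp add: V_def orthogonal_def inner_symmetric_matrix asym)
      hence "a *v w = 0" by (metis inner_eq_zero_iff)
      with that have "x \<bullet> w = 0" by simp
      moreover have "y \<bullet> w = 0" using yw(2)[OF yw(1)] by (simp add: orthogonal_def inner_commute)
      ultimately have "w = 0" using yw(3) by (simp add: inner_add_left)
      thus ?thesis using yw by simp
    qed
    have invV: "A *v x \<in> V" if "x \<in> V" for x
    proof (rule perp)
      fix z assume z: "a *v z = 0"
      from that obtain y where y: "x = a *v y" by (auto simp: V_def)
      have "(A *v x) \<bullet> z = y \<bullet> (a *v (transpose A *v z))"
        by (metis y inner_matrix_vector_transpose asym inner_commute transpose_transpose)
      thus "(A *v x) \<bullet> z = 0" by (simp add: kerinv z)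
    qed
    obtain z where z: "a *v z \<noteq> 0" using a0 matrix_eq[of a 0] by auto
    have zV: "a *v z \<in> V" by (simp add: V_def)
    \<comment> \<open>C vanishes on this mode, so \<alpha> is negative by hypothesis; positivity of
      A a + a A^T then leaves only the zero mode.\<close>
    obtain \<alpha> \<beta> p q where pq: "p \<in> V" "q \<in> V" "p \<noteq> 0 \<or> q \<noteq> 0"
      "A *v p = \<alpha> *\<^sub>R p - \<beta> *\<^sub>R q" "A *v q = \<beta> *\<^sub>R p + \<alpha> *\<^sub>R q"
      by (rule eigenpair_in_invariant_subspace[OF subV invV zV z])
    from pq obtain p' q' where p': "p = a *v p'" and q': "q = a *v q'" by (auto simp: V_def)
    have "\<alpha> < 0" using no_mode[OF pq(4,5)] pq(3) Ca by (auto simp: p' q')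
    \<comment> \<open>Symmetry of a cancels the contributions of \<beta>.\<close>
    have cross: "p' \<bullet> q = q' \<bullet> p" by (metis p' q' inner_matrix_vector_transpose asym inner_commute)
    have "0 \<le> p' \<bullet> (A *v p) + q' \<bullet> (A *v q)" using W by (simp add: p' q')
    also have "\<dots> = \<alpha> * (p' \<bullet> p + q' \<bullet> q)"
      by (simp add: pq inner_add_right inner_diff_right cross algebra_simps)
    finally have "p' \<bullet> p + q' \<bullet> q \<le> 0" using \<open>\<alpha> < 0\<close> by (simp add: zero_le_mult_iff)
    moreover have "p' \<bullet> p \<ge> 0" "q' \<bullet> q \<ge> 0" using psda by (simp_all add: p' q')
    ultimately have "p' \<bullet> p = 0" "q' \<bullet> q = 0" by simp_all
    hence "p = 0" "q = 0" using psd_form_zero_imp_kernel[OF asym psda] by (auto simp: p' q')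
    with pq show False by simp
  qed
  then obtain Y \<kappa> where Y: "psd Y" "\<kappa> \<ge> 0" "L Y \<kappa> \<in> ND" by (auto simp: U_def)
  \<comment> \<open>By compactness of the sphere the definiteness is uniform; dividing by its margin
    normalizes the right-hand side to -|x|^2.\<close>
  have "0 < x \<bullet> ((- L Y \<kappa>) *v x)" if "x \<noteq> 0" for x
    using Y(3) that by (simp add: ND_def uminus_matrix_vector_mult)
  then obtain c where c: "c > 0" "\<And>x. c * (norm x)\<^sup>2 \<le> x \<bullet> ((- L Y \<kappa>) *v x)"
    using quadratic_form_lower_bound by blast
  have "psd ((1 / c) *\<^sub>R Y)" using Y c
    by (auto simp: psd_def scaleR_matrix_vector_assoc[symmetric] transpose_def vec_eq_iff)
  moreover have "\<kappa> / c \<ge> 0" using Y c by simp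
  moreover have "2 * ((((1 / c) *\<^sub>R Y) *v x) \<bullet> (A *v x)) \<le> \<kappa> / c * (norm (C *v x))\<^sup>2 - (norm x)\<^sup>2" for x
  proof -
    have "c * (norm x)\<^sup>2 \<le> \<kappa> * (norm (C *v x))\<^sup>2 - 2 * ((Y *v x) \<bullet> (A *v x))"
      using c(2)[of x] form[OF Y(1), of x \<kappa>] by (simp add: uminus_matrix_vector_mult)
    thus ?thesis using c(1) by (simp add: scaleR_matrix_vector_assoc[symmetric] field_simps)
  qed
  ultimately show ?thesis using that by blast
qed

text \<open>With output matrix 0 every mode is unobserved, so the hypothesis of
  \<open>detectability_inequality\<close> becomes the stability of all modes.\<close>

lemma hurwitz_lyapunov:
  fixes A :: "real^'n^'n"
  assumes "hurwitz A"
  obtains Y where "psd Y" "\<And>x. 2 * ((Y *v x) \<bullet> (A *v x)) \<le> - (norm x)\<^sup>2"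
proof -
  have neg: "a < 0" if h: "A *v p = a *\<^sub>R p - b *\<^sub>R q" "A *v q = b *\<^sub>R p + a *\<^sub>R q" "p \<noteq> 0 \<or> q \<noteq> 0" for a b p q
  proof -
    define v :: "complex^'n" where "v = (\<chi> i. Complex (p $ i) (q $ i))"
    have "v \<noteq> 0" using h by (auto simp: v_def vec_eq_iff complex_eq_iff)
    have R: "Re (\<Sum>j\<in>UNIV. complex_of_real (A $ i $ j) * v $ j) = (A *v p) $ i" for i
      by (simp add: v_def matrix_vector_mult_def)
    have I: "Im (\<Sum>j\<in>UNIV. complex_of_real (A $ i $ j) * v $ j) = (A *v q) $ i" for i
      by (simp add: v_def matrix_vector_mult_def)
    have "(map_matrix complex_of_real A *v v) $ i = (Complex a b *s v) $ i" for i
    proof -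
      have "(map_matrix complex_of_real A *v v) $ i = (\<Sum>j\<in>UNIV. complex_of_real (A $ i $ j) * v $ j)"
        by (simp add: matrix_vector_mult_def map_matrix_def)
      thus ?thesis using R[of i] I[of i] h(1,2) by (simp add: complex_eq_iff) (simp add: v_def)
    qed
    hence "map_matrix complex_of_real A *v v = Complex a b *s v" by (simp add: vec_eq_iff)
    with assms \<open>v \<noteq> 0\<close> have "Re (Complex a b) < 0" unfolding hurwitz_def by blast
    thus ?thesis by simp
  qed
  obtain Y \<kappa> where "psd Y" "\<kappa> \<ge> 0"
    "\<And>x. 2 * ((Y *v x) \<bullet> (A *v x)) \<le> \<kappa> * (norm ((0 :: real^'n^'n) *v x))\<^sup>2 - (norm x)\<^sup>2"
    using detectability_inequality[of A "0 :: real^'n^'n"] neg by auto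
  thus ?thesis using that by simp
qed

text \<open>An unobserved mode, decaying or not, would generate nonzero trajectories with the same
  output as the zero trajectory.\<close>

lemma observable_detectability:
  fixes A :: "real^'n^'n" and C :: "real^'n^'m"
  assumes "observable A C"
  obtains Y \<kappa> where "psd Y" "\<kappa> \<ge> 0"
    "\<And>x. 2 * ((Y *v x) \<bullet> (A *v x)) \<le> \<kappa> * (norm (C *v x))\<^sup>2 - (norm x)\<^sup>2"
proof -
  have False if h: "A *v p = a *\<^sub>R p - b *\<^sub>R q" "A *v q = b *\<^sub>R p + a *\<^sub>R q" "C *v p = 0" "C *v q = 0"
    "p \<noteq> 0 \<or> q \<noteq> 0" for a b p q
  proof -
    \<comment> \<open>x and y are the real and imaginary parts of exp((a + ib) t) (p + iq).\<close>
    define x where "x t = exp (a * t) *\<^sub>R (cos (b * t) *\<^sub>R p - sin (b * t) *\<^sub>R q)" for t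
    define y where "y t = exp (a * t) *\<^sub>R (sin (b * t) *\<^sub>R p + cos (b * t) *\<^sub>R q)" for t
    have "solves_linear A x" unfolding solves_linear_def x_def
      by (auto intro!: derivative_eq_intros simp: h(1,2) algebra_simps matrix_vector_mult_scaleR)
    moreover have "solves_linear A y" unfolding solves_linear_def y_def
      by (auto intro!: derivative_eq_intros simp: h(1,2) algebra_simps matrix_vector_mult_scaleR)
    moreover have "solves_linear A (\<lambda>_. 0)" by (simp add: solves_linear_def)
    moreover have "C *v x t = 0" "C *v y t = 0" for t
      by (simp_all add: x_def y_def algebra_simps matrix_vector_mult_scaleR h(3,4))
    ultimately have "x 0 = 0" "y 0 = 0"
      using assms unfolding observable_def by (metis matrix_vector_mult_0_right)+
    thus False using h(5) by (simp add: x_def y_def)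
  qed
  thus ?thesis using detectability_inequality[of A C] that by blast
qed

section \<open>Riccati equations\<close>

lemma inner_matrix_vector_left:
  fixes A :: "real^'n^'m"
  shows "(A *v x) \<bullet> y = x \<bullet> (transpose A *v y)"
  using inner_matrix_vector_transpose[of x "transpose A" y] by (simp add: transpose_transpose)

lemma continuous_on_quadratic_form:
  fixes S :: "real^'n^'n"
  shows "continuous_on U (\<lambda>x. x \<bullet> (S *v x))"
  by (intro continuous_on_inner continuous_on_id matrix_vector_mult_linear_continuous_on)

lemma quadratic_form_transpose:
  fixes A :: "real^'n^'n"
  shows "x \<bullet> (transpose A *v x) = x \<bullet> (A *v x)"
  using inner_matrix_vector_left[of A x x] by (simp add: inner_commute)

lemma posdef_invertible:
  assumes "posdef R"
  shows "R ** matrix_inv R = mat 1" "matrix_inv R ** R = mat 1"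
proof -
  have "R *v x = 0 \<Longrightarrow> x = 0" for x using assms unfolding posdef_def by (metis inner_zero_right less_irrefl)
  hence "\<exists>B. B ** R = mat 1" by (simp add: matrix_left_invertible_ker)
  hence "invertible R" by (simp add: invertible_left_inverse)
  hence "\<exists>B. R ** B = mat 1 \<and> B ** R = mat 1" by (simp add: invertible_def)
  hence "R ** matrix_inv R = mat 1 \<and> matrix_inv R ** R = mat 1"
    unfolding matrix_inv_def by (rule someI_ex)
  thus "R ** matrix_inv R = mat 1" "matrix_inv R ** R = mat 1" by auto
qed

lemma posdef_inv_vec:
  assumes "posdef R"
  shows "R *v (matrix_inv R *v x) = x" "matrix_inv R *v (R *v x) = x"
  by (simp_all add: matrix_vector_mul_assoc posdef_invertible[OF assms])

lemma posdef_inv_symmetric: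
  assumes "posdef R"
  shows "transpose (matrix_inv R) = matrix_inv R"
proof -
  have "transpose (matrix_inv R) ** R = mat 1"
    using arg_cong[OF posdef_invertible(1)[OF assms], of transpose] assms
    by (simp add: matrix_transpose_mul posdef_def transpose_mat)
  hence "transpose (matrix_inv R) ** (R ** matrix_inv R) = matrix_inv R"
    by (simp add: matrix_mul_assoc)
  thus ?thesis by (simp add: posdef_invertible[OF assms])
qed

lemma posdef_inv_form:
  assumes "posdef R"
  shows "y \<bullet> (matrix_inv R *v y) = wnorm2 R (matrix_inv R *v y)"
  by (simp add: wnorm2_def posdef_inv_vec[OF assms] inner_commute)

lemma posdef_wnorm2_nonneg: "posdef R \<Longrightarrow> 0 \<le> wnorm2 R x"
  by (cases "x = 0") (auto simp: posdef_def wnorm2_def less_imp_le)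

lemma psd_nonneg: "psd S \<Longrightarrow> 0 \<le> x \<bullet> (S *v x)"
  by (simp add: psd_def)

text \<open>D \<le> k I implies D^2 \<le> k D: evaluate the form at x - (1/k) D x.\<close>

lemma psd_image_bound:
  fixes D :: "real^'n^'n"
  assumes "psd D"
  obtains k where "k > 0" "\<And>x. (norm (D *v x))\<^sup>2 \<le> k * (x \<bullet> (D *v x))"
proof -
  obtain k where k: "k > 0" "\<And>x. x \<bullet> (D *v x) \<le> k * (norm x)\<^sup>2" using quadratic_form_upper_bound by blast
  have sym: "transpose D = D" using assms by (simp add: psd_def)
  have "(norm (D *v x))\<^sup>2 \<le> k * (x \<bullet> (D *v x))" for x
  proof -
    define y where "y = D *v x"
    have "0 \<le> (x - (1/k) *\<^sub>R y) \<bullet> (D *v (x - (1/k) *\<^sub>R y))" using assms by (rule psd_nonneg)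
    also have "\<dots> = x \<bullet> y - (1/k) * (x \<bullet> (D *v y)) - (1/k) * (y \<bullet> y) + (1/k)\<^sup>2 * (y \<bullet> (D *v y))"
      by (simp add: matrix_vector_mult_diff_distrib matrix_vector_mult_scaleR inner_diff_left inner_diff_right
          y_def[symmetric] power2_eq_square algebra_simps)
    also have "x \<bullet> (D *v y) = y \<bullet> y" using inner_symmetric_matrix[OF sym, of x y] by (simp add: y_def)
    also have "(1/k)\<^sup>2 * (y \<bullet> (D *v y)) \<le> (1/k)\<^sup>2 * (k * (norm y)\<^sup>2)" by (intro mult_left_mono k) simp
    also have "(1/k)\<^sup>2 * (k * (norm y)\<^sup>2) = (1/k) * (y \<bullet> y)" using k by (simp add: power2_norm_eq_inner) (simp add: power2_eq_square)
    finally have "(1/k) * (y \<bullet> y) \<le> x \<bullet> y" by simp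
    thus ?thesis using k by (simp add: y_def power2_norm_eq_inner field_simps)
  qed
  with k show ?thesis using that by blast
qed

text \<open>Linear algebra in place of trajectories. Let \<mu> be the minimum of the quotient of the
  forms of Z and Y. At a minimizer z one has Z z = \<mu> Y z, and for \<mu> < 0 the strict
  inequality for Y contradicts the weak one for Z.\<close>

lemma psd_from_lyapunov_inequality:
  fixes Y Z F :: "real^'n^'n"
  assumes Y: "psd Y" "\<And>x. 2 * ((Y *v x) \<bullet> (F *v x)) \<le> - (norm x)\<^sup>2"
    and Z: "transpose Z = Z" "\<And>x. 2 * ((Z *v x) \<bullet> (F *v x)) \<le> 0"
  shows "psd Z"
proof -
  \<comment> \<open>The strict inequality excludes a kernel of Y, so the quotient is defined on the
    sphere.\<close>
  have Ypos: "0 < x \<bullet> (Y *v x)" if "x \<noteq> 0" for x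
  proof -
    have "x \<bullet> (Y *v x) \<noteq> 0"
    proof
      assume "x \<bullet> (Y *v x) = 0"
      hence "Y *v x = 0" using Y(1) psd_form_zero_imp_kernel unfolding psd_def by blast
      with Y(2)[of x] that show False by simp
    qed
    with psd_nonneg[OF Y(1), of x] show ?thesis by simp
  qed
  let ?q = "\<lambda>x. (x \<bullet> (Z *v x)) / (x \<bullet> (Y *v x))"
  have "continuous_on (sphere (0::real^'n) 1) ?q"
  proof (rule continuous_on_divide)
    show "\<forall>x\<in>sphere 0 1. x \<bullet> (Y *v x) \<noteq> 0"
    proof
      fix x :: "real^'n" assume "x \<in> sphere 0 1"
      hence "x \<noteq> 0" by auto
      from Ypos[OF this] show "x \<bullet> (Y *v x) \<noteq> 0" by simp
    qed
  qed (rule continuous_on_quadratic_form)+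
  then obtain z where z: "z \<in> sphere (0::real^'n) 1" and min: "\<And>x. x \<in> sphere 0 1 \<Longrightarrow> ?q z \<le> ?q x"
    using continuous_attains_inf[of "sphere (0::real^'n) 1" ?q] by auto
  define \<mu> where "\<mu> = ?q z"
  have z0: "z \<noteq> 0" using z by auto
  have ge: "\<mu> * (x \<bullet> (Y *v x)) \<le> x \<bullet> (Z *v x)" for x
  proof (cases "x = 0")
    case False
    define w where "w = x /\<^sub>R norm x"
    have "w \<in> sphere 0 1" using False by (simp add: w_def)
    from min[OF this] have "\<mu> \<le> ?q w" by (simp add: \<mu>_def)
    also have "?q w = ?q x" using False by (simp add: w_def matrix_vector_mult_scaleR)
    finally show ?thesis using Ypos[OF False] by (simp add: field_simps)
  qed simp
  have "\<mu> \<ge> 0"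
  proof (rule ccontr)
    assume neg: "\<not> \<mu> \<ge> 0"
    define V where "V = Z - \<mu> *\<^sub>R Y"
    have form: "x \<bullet> (V *v x) = x \<bullet> (Z *v x) - \<mu> * (x \<bullet> (Y *v x))" for x
      by (simp add: V_def matrix_vector_mult_diff_rdistrib inner_diff_right scaleR_matrix_vector_assoc[symmetric])
    have "transpose V = V" using Y(1) Z(1) unfolding V_def psd_def by (simp add: vec_eq_iff transpose_def)
    moreover have "0 \<le> x \<bullet> (V *v x)" for x using ge[of x] by (simp add: form)
    moreover have "z \<bullet> (V *v z) = 0" using Ypos[OF z0] by (simp add: form \<mu>_def)
    ultimately have "V *v z = 0" by (rule psd_form_zero_imp_kernel)
    hence "Z *v z = \<mu> *\<^sub>R (Y *v z)"
      by (simp add: V_def matrix_vector_mult_diff_rdistrib scaleR_matrix_vector_assoc[symmetric])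
    hence "\<mu> * (2 * ((Y *v z) \<bullet> (F *v z))) \<le> 0" using Z(2)[of z] by simp
    moreover have "2 * ((Y *v z) \<bullet> (F *v z)) < 0"
      using Y(2)[of z] z0 by (smt (verit) zero_less_power2 norm_eq_zero)
    ultimately show False using neg by (simp add: mult_le_0_iff)
  qed
  moreover have "0 \<le> x \<bullet> (Y *v x)" for x using Y(1) by (rule psd_nonneg)
  ultimately show ?thesis unfolding psd_def using Z(1) ge by (meson mult_nonneg_nonneg order_trans)
qed

text \<open>For \<alpha> above the operator norm of D -> A^T D + D A the equation is uniquely
  solvable, and uniqueness makes D symmetric. If the least eigenvalue of D were negative, testing
  the equation with its eigenvector would contradict \<alpha> > 2a, where a bounds the form of A.
  The shift takes the place of stability of A.\<close>

lemma shifted_lyapunov_solution: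
  fixes A E :: "real^'n^'n"
  assumes E: "psd E"
  obtains D \<alpha> where "psd D" "\<alpha> > 0" "\<alpha> *\<^sub>R D = transpose A ** D + D ** A + E"
proof -
  define T where "T D = transpose A ** D + D ** A" for D
  have lT: "linear T" unfolding T_def
    by (rule linearI) (simp_all add: vec_eq_iff matrix_matrix_mult_def sum.distrib sum_distrib_left algebra_simps)
  obtain c where c: "c > 0" "\<And>D. norm (T D) \<le> c * norm D" using linear_bounded_pos[OF lT] by blast
  obtain a where a: "a > 0" "\<And>x. x \<bullet> (A *v x) \<le> a * (norm x)\<^sup>2" using quadratic_form_upper_bound by blast
  define \<alpha> where "\<alpha> = c + 2 * a"
  have \<alpha>: "\<alpha> > c" "\<alpha> > 2 * a" "\<alpha> > 0" using a c by (auto simp: \<alpha>_def)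
  define L where "L D = \<alpha> *\<^sub>R D - T D" for D
  have lL: "linear L" unfolding L_def
    by (intro linear_compose_sub linear_compose_scale_right lT linear_ident)
  have ker: "D = 0" if "L D = 0" for D
  proof (rule ccontr)
    assume "D \<noteq> 0"
    have "\<alpha> * norm D = norm (T D)" using that \<alpha> by (metis L_def right_minus_eq norm_scaleR abs_of_pos)
    also have "\<dots> \<le> c * norm D" by (rule c)
    finally show False using \<alpha> \<open>D \<noteq> 0\<close> by simp
  qed
  hence inj: "inj L" using lL linear_injective_0 by blast
  hence "surj L" using lL linear_injective_imp_surjective by blast
  then obtain D where D: "L D = E" by (metis surjD)
  have "L (transpose D) = transpose (L D)"
    by (simp add: L_def T_def vec_eq_iff transpose_def matrix_matrix_mult_def algebra_simps)
  hence sym: "transpose D = D" using D E inj unfolding psd_def by (metis injD)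
  let ?q = "\<lambda>x. x \<bullet> (D *v x)"
  have "continuous_on (sphere (0::real^'n) 1) ?q"
    by (rule continuous_on_quadratic_form)
  then obtain z where z: "z \<in> sphere (0::real^'n) 1" and min: "\<And>x. x \<in> sphere 0 1 \<Longrightarrow> ?q z \<le> ?q x"
    using continuous_attains_inf[of "sphere (0::real^'n) 1" ?q] by auto
  define \<mu> where "\<mu> = ?q z"
  have nz: "norm z = 1" using z by simp
  have ge: "\<mu> * (x \<bullet> x) \<le> ?q x" for x
  proof (cases "x = 0")
    case False
    define w where "w = x /\<^sub>R norm x"
    have "w \<in> sphere 0 1" using False by (simp add: w_def)
    from min[OF this] have "\<mu> \<le> ?q w" by (simp add: \<mu>_def)
    also have "?q w = ?q x / (norm x)\<^sup>2" using False by (simp add: w_def matrix_vector_mult_scaleR power2_eq_square field_simps)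
    finally show ?thesis using False by (simp add: field_simps power2_norm_eq_inner)
  qed simp
  have "\<mu> \<ge> 0"
  proof (rule ccontr)
    assume neg: "\<not> \<mu> \<ge> 0"
    define V where "V = D - \<mu> *\<^sub>R mat 1"
    have form: "x \<bullet> (V *v x) = ?q x - \<mu> * (x \<bullet> x)" for x
      by (simp add: V_def matrix_vector_mult_diff_rdistrib inner_diff_right scaleR_matrix_vector_assoc[symmetric])
    have "transpose V = V" using sym unfolding V_def by (simp add: vec_eq_iff transpose_def mat_def)
    moreover have "0 \<le> x \<bullet> (V *v x)" for x using ge[of x] by (simp add: form)
    moreover have "z \<bullet> (V *v z) = 0" using nz by (simp add: form \<mu>_def flip: power2_norm_eq_inner)
    ultimately have "V *v z = 0" by (rule psd_form_zero_imp_kernel)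
    hence Dz: "D *v z = \<mu> *\<^sub>R z"
      by (simp add: V_def matrix_vector_mult_diff_rdistrib scaleR_matrix_vector_assoc[symmetric])
    have "z \<bullet> (D *v (A *v z)) = \<mu> * (z \<bullet> (A *v z))"
      using inner_symmetric_matrix[OF sym, of z "A *v z"] by (simp add: Dz)
    moreover have "z \<bullet> (transpose A *v (D *v z)) = \<mu> * (z \<bullet> (A *v z))"
      by (simp add: Dz matrix_vector_mult_scaleR quadratic_form_transpose)
    ultimately have "z \<bullet> (L D *v z) = \<alpha> * \<mu> - 2 * (\<mu> * (z \<bullet> (A *v z)))"
      using nz by (simp add: L_def T_def matrix_vector_mult_diff_rdistrib matrix_vector_mult_add_rdistrib inner_diff_right
          inner_add_right scaleR_matrix_vector_assoc[symmetric] matrix_vector_mul_assoc[symmetric] \<mu>_def)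
    hence "0 \<le> \<mu> * (\<alpha> - 2 * (z \<bullet> (A *v z)))"
      using psd_nonneg[OF E, of z] D by (simp add: algebra_simps)
    moreover have "\<alpha> - 2 * (z \<bullet> (A *v z)) > 0" using a(2)[of z] \<alpha> nz by simp
    ultimately show False using neg by (simp add: zero_le_mult_iff)
  qed
  hence "0 \<le> ?q x" for x using ge[of x] by (meson inner_ge_zero mult_nonneg_nonneg order_trans)
  hence "psd D" using sym by (simp add: psd_def)
  moreover have "\<alpha> *\<^sub>R D = transpose A ** D + D ** A + E"
    using D by (simp add: L_def T_def algebra_simps)
  ultimately show ?thesis using that \<alpha> by blast
qed

text \<open>Testing with e_i + e_j and e_i - e_j bounds an off-diagonal entry by the mean of two
  diagonal ones. This turns a bound on forms into compactness.\<close>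

lemma psd_entry_bound:
  fixes X :: "real^'n^'n"
  assumes "psd X" "\<And>x. x \<bullet> (X *v x) \<le> c * (norm x)\<^sup>2"
  shows "\<bar>X $ i $ j\<bar> \<le> c"
proof -
  let ?e = "\<lambda>i. axis i (1::real)"
  have ent: "?e k \<bullet> (X *v ?e l) = X $ k $ l" for k l
    by (simp add: inner_axis' matrix_vector_mul_component) (simp add: inner_axis)
  have "transpose X $ i $ j = X $ i $ j" using assms(1) by (simp add: psd_def)
  hence sym: "X $ j $ i = X $ i $ j" by (simp add: transpose_def)
  have "0 \<le> (?e i + ?e j) \<bullet> (X *v (?e i + ?e j))" "0 \<le> (?e i - ?e j) \<bullet> (X *v (?e i - ?e j))"
    using psd_nonneg[OF assms(1)] by blast+
  hence "2 * \<bar>X $ i $ j\<bar> \<le> X $ i $ i + X $ j $ j"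
    by (simp add: matrix_vector_right_distrib matrix_vector_mult_diff_distrib inner_add_left inner_add_right
        inner_diff_left inner_diff_right ent sym)
  moreover have "X $ i $ i \<le> c" "X $ j $ j \<le> c" using assms(2)[of "?e i"] assms(2)[of "?e j"] by (auto simp: ent)
  ultimately show ?thesis by simp
qed

lemma psd_trace_zero:
  fixes X :: "real^'n^'n"
  assumes "psd X" "(\<Sum>i\<in>UNIV. X $ i $ i) = 0"
  shows "X = 0"
proof -
  let ?e = "\<lambda>i. axis i (1::real)"
  have ent: "?e k \<bullet> (X *v ?e l) = X $ k $ l" for k l
    by (simp add: inner_axis' matrix_vector_mul_component) (simp add: inner_axis)
  have nn: "0 \<le> X $ i $ i" for i using psd_nonneg[OF assms(1), of "?e i"] by (simp add: ent)
  have "X $ i $ i = 0" for i using assms(2) nn by (simp add: sum_nonneg_eq_0_iff)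
  hence "X *v ?e i = 0" for i
    using psd_form_zero_imp_kernel[of X "?e i"] assms(1) by (simp add: psd_def ent)
  hence "X $ k $ i = 0" for k i using ent[of k i] by simp
  thus ?thesis by (simp add: vec_eq_iff)
qed

section \<open>Subsolutions of the discounted Riccati equation\<close>

definition riccati_residual ::
  "real \<Rightarrow> real^'n^'n \<Rightarrow> real^'r^'n \<Rightarrow> real^'n^'n \<Rightarrow> real^'r^'r \<Rightarrow> real^'n^'n \<Rightarrow> real^'n^'n" where
  "riccati_residual \<rho> A B Q R X = transpose A ** X + X ** A - X ** B ** matrix_inv R ** transpose B ** X + Q - \<rho> *\<^sub>R X"

lemma riccati_residual_symmetric:
  assumes "posdef R" "transpose Q = Q" "transpose X = X"
  shows "transpose (riccati_residual \<rho> A B Q R X) = riccati_residual \<rho> A B Q R X"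
proof -
  have t: "transpose (U - V) = transpose U - transpose V" "transpose (c *\<^sub>R U) = c *\<^sub>R transpose U" for U V :: "real^'n^'n" and c
    by (simp_all add: vec_eq_iff transpose_def)
  show ?thesis
    by (simp add: riccati_residual_def t transpose_add_matrix matrix_transpose_mul assms posdef_inv_symmetric matrix_mul_assoc)
qed

lemma riccati_residual_form:
  assumes "posdef R" "transpose X = X"
  shows "x \<bullet> (riccati_residual \<rho> A B Q R X *v x) = 2 * ((X *v x) \<bullet> (A *v x)) - wnorm2 R (matrix_inv R *v (transpose B *v (X *v x)))
    + x \<bullet> (Q *v x) - \<rho> * (x \<bullet> (X *v x))"
proof -
  have 1: "x \<bullet> (transpose A *v (X *v x)) = (X *v x) \<bullet> (A *v x)"
    by (simp add: inner_commute flip: inner_matrix_vector_left)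
  have 2: "x \<bullet> (X *v (A *v x)) = (X *v x) \<bullet> (A *v x)"
    by (simp add: inner_matrix_vector_left assms)
  have 3: "x \<bullet> (X *v (B *v (matrix_inv R *v (transpose B *v (X *v x))))) = wnorm2 R (matrix_inv R *v (transpose B *v (X *v x)))"
    by (simp add: posdef_inv_form[OF assms(1), symmetric] inner_matrix_vector_left assms transpose_transpose)
  show ?thesis
    by (simp add: riccati_residual_def matrix_vector_mult_diff_rdistrib matrix_vector_mult_add_rdistrib inner_diff_right
          inner_add_right scaleR_matrix_vector_assoc[symmetric] matrix_vector_mul_assoc[symmetric] 1 2 3)
qed

lemma riccati_solution_iff:
  "riccati_solution \<rho> A B Q R X \<longleftrightarrow> transpose X = X \<and> riccati_residual \<rho> A B Q R X = 0"
  unfolding riccati_solution_def riccati_residual_def by (auto simp: algebra_simps)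

text \<open>The residual is quadratic in X, so this expansion is exact: the Lyapunov operator of the
  closed-loop matrix F in first order, minus a square in second order.\<close>

lemma riccati_residual_add:
  fixes A X D Q :: "real^'n^'n" and B :: "real^'r^'n" and R :: "real^'r^'r"
  assumes R: "posdef R" and X: "transpose X = X" and D: "transpose D = D"
  defines "F \<equiv> A - B ** matrix_inv R ** transpose B ** X"
  shows "x \<bullet> (riccati_residual \<rho> A B Q R (X + D) *v x) = x \<bullet> (riccati_residual \<rho> A B Q R X *v x)
    + 2 * ((D *v x) \<bullet> (F *v x)) - wnorm2 R (matrix_inv R *v (transpose B *v (D *v x))) - \<rho> * (x \<bullet> (D *v x))"
proof -
  let ?w = "\<lambda>X. matrix_inv R *v (transpose B *v (X *v x))"
  have XD: "transpose (X + D) = X + D" by (simp add: transpose_add_matrix X D)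
  have cr: "?w D \<bullet> (R *v ?w X) = (D *v x) \<bullet> (B *v ?w X)"
    by (simp add: posdef_inv_vec[OF R] inner_matrix_vector_left posdef_inv_symmetric[OF R] transpose_transpose)
  have cr': "?w X \<bullet> (R *v ?w D) = ?w D \<bullet> (R *v ?w X)"
    using R inner_symmetric_matrix[of R "?w X" "?w D"] by (simp add: posdef_def inner_commute)
  have "wnorm2 R (?w (X + D)) = wnorm2 R (?w X) + wnorm2 R (?w D) + 2 * ((D *v x) \<bullet> (B *v ?w X))"
    by (simp add: wnorm2_def matrix_vector_mult_add_rdistrib matrix_vector_right_distrib inner_add_left inner_add_right cr cr')
  moreover have "(D *v x) \<bullet> (F *v x) = (D *v x) \<bullet> (A *v x) - (D *v x) \<bullet> (B *v ?w X)"
    by (simp add: F_def matrix_vector_mult_diff_rdistrib inner_diff_right matrix_vector_mul_assoc[symmetric])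
  ultimately show ?thesis
    unfolding riccati_residual_form[OF R X] riccati_residual_form[OF R XD]
    by (simp add: matrix_vector_mult_add_rdistrib inner_add_left inner_add_right algebra_simps)
qed

text \<open>The form of a subsolution is a lower bound for the cost of every stabilizing feedback K.
  Algebraically, c Y minus X satisfies a weak Lyapunov inequality for the stabilized matrix, where Y
  is a strict Lyapunov matrix and c bounds the running cost Q + K^T R K.\<close>

lemma riccati_subsolution_bound:
  fixes A Q :: "real^'n^'n" and B :: "real^'r^'n" and R :: "real^'r^'r"
  assumes R: "posdef R" and stab: "stabilizable (A - (\<rho>/2) *\<^sub>R mat 1) B"
  obtains c where "\<And>X x. psd X \<Longrightarrow> (\<And>x. 0 \<le> x \<bullet> (riccati_residual \<rho> A B Q R X *v x)) \<Longrightarrow> x \<bullet> (X *v x) \<le> c * (norm x)\<^sup>2"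
proof -
  from stab obtain K where K: "hurwitz (A - (\<rho>/2) *\<^sub>R mat 1 + B ** K)" unfolding stabilizable_def by blast
  let ?F = "A - (\<rho>/2) *\<^sub>R mat 1 + B ** K"
  obtain Y where Y: "psd Y" "\<And>x. 2 * ((Y *v x) \<bullet> (?F *v x)) \<le> - (norm x)\<^sup>2" using hurwitz_lyapunov[OF K] by blast
  define S where "S = Q + transpose K ** R ** K"
  obtain c where c: "c > 0" "\<And>x. x \<bullet> (S *v x) \<le> c * (norm x)\<^sup>2" using quadratic_form_upper_bound by blast
  obtain d where d: "d > 0" "\<And>x. x \<bullet> (Y *v x) \<le> d * (norm x)\<^sup>2" using quadratic_form_upper_bound by blast
  have "x \<bullet> (X *v x) \<le> c * d * (norm x)\<^sup>2" if X: "psd X" and res: "\<And>x. 0 \<le> x \<bullet> (riccati_residual \<rho> A B Q R X *v x)" for X x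
  proof -
    have sym: "transpose X = X" using X by (simp add: psd_def)
    have "psd (c *\<^sub>R Y - X)"
    proof (rule psd_from_lyapunov_inequality[OF Y])
      show "transpose (c *\<^sub>R Y - X) = c *\<^sub>R Y - X"
        using Y(1) sym unfolding psd_def by (simp add: vec_eq_iff transpose_def)
      fix x
      let ?w = "matrix_inv R *v (transpose B *v (X *v x))"
      have cr: "?w \<bullet> (R *v (K *v x)) = (X *v x) \<bullet> (B *v (K *v x))"
      proof -
        have "?w \<bullet> (R *v (K *v x)) = (R *v ?w) \<bullet> (K *v x)"
          using R inner_symmetric_matrix[of R ?w "K *v x"] by (simp add: posdef_def)
        also have "\<dots> = (X *v x) \<bullet> (B *v (K *v x))"
          unfolding posdef_inv_vec[OF R] by (subst inner_matrix_vector_left) (simp add: transpose_transpose)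
        finally show ?thesis .
      qed
      have cr': "(K *v x) \<bullet> (R *v ?w) = ?w \<bullet> (R *v (K *v x))"
        using R inner_symmetric_matrix[of R "K *v x" ?w] by (simp add: posdef_def inner_commute)
      \<comment> \<open>Completing the square trades the gain belonging to X for the gain K.\<close>
      have "0 \<le> wnorm2 R (?w + K *v x)" using posdef_wnorm2_nonneg[OF R] .
      also have "\<dots> = wnorm2 R ?w + 2 * ((X *v x) \<bullet> (B *v (K *v x))) + wnorm2 R (K *v x)"
        by (simp add: wnorm2_def matrix_vector_right_distrib inner_add_left inner_add_right cr cr')
      finally have 1: "0 \<le> wnorm2 R ?w + 2 * ((X *v x) \<bullet> (B *v (K *v x))) + wnorm2 R (K *v x)" .
      have "x \<bullet> (S *v x) = x \<bullet> (Q *v x) + wnorm2 R (K *v x)"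
        unfolding wnorm2_def inner_matrix_vector_left S_def
        by (simp add: matrix_vector_mult_add_rdistrib inner_add_right matrix_vector_mul_assoc[symmetric])
      hence 2: "x \<bullet> (Q *v x) + wnorm2 R (K *v x) \<le> c * (norm x)\<^sup>2" using c(2)[of x] by simp
      have "(X *v x) \<bullet> x = x \<bullet> (X *v x)" by (rule inner_commute)
      hence "2 * ((X *v x) \<bullet> (?F *v x)) = 2 * ((X *v x) \<bullet> (A *v x)) - \<rho> * (x \<bullet> (X *v x)) + 2 * ((X *v x) \<bullet> (B *v (K *v x)))"
        by (simp add: matrix_vector_mult_diff_rdistrib matrix_vector_mult_add_rdistrib inner_diff_right
          inner_add_right scaleR_matrix_vector_assoc[symmetric] matrix_vector_mul_assoc[symmetric])
      with res[of x] 1 2 have "2 * ((X *v x) \<bullet> (?F *v x)) \<ge> - c * (norm x)\<^sup>2"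
        unfolding riccati_residual_form[OF R sym] by linarith
      moreover have "c * (2 * ((Y *v x) \<bullet> (?F *v x))) \<le> c * (- (norm x)\<^sup>2)" using Y(2)[of x] c(1) by (intro mult_left_mono) auto
      moreover have "((c *\<^sub>R Y - X) *v x) \<bullet> (?F *v x) = c * ((Y *v x) \<bullet> (?F *v x)) - (X *v x) \<bullet> (?F *v x)"
        by (simp only: matrix_vector_mult_diff_rdistrib inner_diff_left scaleR_matrix_vector_assoc[symmetric] inner_scaleR_left)
      ultimately show "2 * (((c *\<^sub>R Y - X) *v x) \<bullet> (?F *v x)) \<le> 0" by (simp only: ) (simp add: algebra_simps)
    qed
    from psd_nonneg[OF this, of x] have "x \<bullet> (X *v x) \<le> c * (x \<bullet> (Y *v x))"
      by (simp add: matrix_vector_mult_diff_rdistrib inner_diff_right scaleR_matrix_vector_assoc[symmetric])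
    also have "\<dots> \<le> c * (d * (norm x)\<^sup>2)" using c d by (intro mult_left_mono) auto
    finally show ?thesis by (simp add: mult.assoc)
  qed
  thus ?thesis using that by blast
qed

text \<open>A subsolution of maximal trace is a solution: a nonzero residual \<open>E\<close> would allow adding a small positive
  multiple of the solution \<open>D\<close> of a strongly shifted Lyapunov equation with right-hand side \<open>E\<close>.\<close>

lemma psd_riccati_solution_exists:
  fixes A Q :: "real^'n^'n" and B :: "real^'r^'n" and R :: "real^'r^'r"
  assumes R: "posdef R" and Q: "psd Q" and stab: "stabilizable (A - (\<rho>/2) *\<^sub>R mat 1) B"
  obtains X where "psd X" "riccati_solution \<rho> A B Q R X"
proof -
  let ?Ric = "riccati_residual \<rho> A B Q R"
  \<comment> \<open>Nonempty, since the residual of 0 is Q, and compact by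
    \<open>riccati_subsolution_bound\<close>.\<close>
  define \<Omega> where "\<Omega> = {X. psd X \<and> (\<forall>x. 0 \<le> x \<bullet> (?Ric X *v x))}"
  define tr where "tr X = (\<Sum>i\<in>UNIV. X $ i $ i)" for X :: "real^'n^'n"
  obtain c where c: "\<And>X x. psd X \<Longrightarrow> (\<And>x. 0 \<le> x \<bullet> (?Ric X *v x)) \<Longrightarrow> x \<bullet> (X *v x) \<le> c * (norm x)\<^sup>2"
    using riccati_subsolution_bound[OF R stab] by metis
  have vm: "(U *v x) = (\<chi> i. \<Sum>j\<in>UNIV. U $ i $ j * x $ j)" for U :: "real^'a^'b" and x
    by (simp add: matrix_vector_mult_def)
  have contv: "continuous_on UNIV (\<lambda>X. X *v g X)" if "continuous_on UNIV g" for g :: "real^'n^'n \<Rightarrow> real^'n"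
    unfolding vm using that by (intro continuous_intros)
  have contm: "continuous_on UNIV (\<lambda>X. U *v g X)" if "continuous_on UNIV g" for g :: "real^'n^'n \<Rightarrow> real^'a" and U :: "real^'a^'b"
    unfolding vm using that by (intro continuous_intros)
  have "closed \<Omega>"
  proof -
    have eq: "?Ric X *v x = transpose A *v (X *v x) + X *v (A *v x)
        - X *v (B *v (matrix_inv R *v (transpose B *v (X *v x)))) + Q *v x - \<rho> *\<^sub>R (X *v x)" for X x
      by (simp add: riccati_residual_def matrix_vector_mult_diff_rdistrib matrix_vector_mult_add_rdistrib
          scaleR_matrix_vector_assoc[symmetric] matrix_vector_mul_assoc[symmetric])
    have "\<Omega> = {X. transpose X = X} \<inter> (\<Inter>x. {X. 0 \<le> x \<bullet> (X *v x)}) \<inter> (\<Inter>x. {X. 0 \<le> x \<bullet> (?Ric X *v x)})"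
      by (auto simp: \<Omega>_def psd_def)
    moreover have "closed {X :: real^'n^'n. transpose X = X}"
      unfolding transpose_def by (intro closed_Collect_eq continuous_intros)
    moreover have "closed {X :: real^'n^'n. 0 \<le> x \<bullet> (X *v x)}" for x
      by (intro closed_Collect_le continuous_intros contv)
    moreover have "closed {X :: real^'n^'n. 0 \<le> x \<bullet> (?Ric X *v x)}" for x
      unfolding eq by (intro closed_Collect_le continuous_intros contv contm)
    ultimately show ?thesis by (auto intro!: closed_Int closed_INT)
  qed
  moreover have "bounded \<Omega>"
  proof -
    have "norm X \<le> real CARD('n) * (real CARD('n) * c)" if "X \<in> \<Omega>" for X
    proof -
      have "\<bar>X $ i $ j\<bar> \<le> c" for i j using that c unfolding \<Omega>_def by (intro psd_entry_bound) auto
      hence "norm (X $ i) \<le> real CARD('n) * c" for i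
        using norm_le_l1_cart[of "X $ i"] sum_bounded_above[of UNIV "\<lambda>j. \<bar>X $ i $ j\<bar>" c] by fastforce
      moreover have "norm X \<le> (\<Sum>i\<in>UNIV. norm (X $ i))"
        unfolding norm_vec_def[of X] by (rule L2_set_le_sum) simp
      ultimately show ?thesis
        using sum_bounded_above[of UNIV "\<lambda>i. norm (X $ i)" "real CARD('n) * c"] by fastforce
    qed
    thus ?thesis by (auto simp: bounded_iff)
  qed
  ultimately have "compact \<Omega>" by (simp add: compact_eq_bounded_closed)
  moreover have "0 \<in> \<Omega>"
    using psd_0 Q by (simp add: \<Omega>_def riccati_residual_def psd_def)
  moreover have "continuous_on \<Omega> tr" unfolding tr_def by (intro continuous_intros)
  ultimately obtain X where X: "X \<in> \<Omega>" and max: "\<And>X'. X' \<in> \<Omega> \<Longrightarrow> tr X' \<le> tr X"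
    using continuous_attains_sup[of \<Omega> tr] by auto
  have psdX: "psd X" and sym: "transpose X = X" using X by (auto simp: \<Omega>_def psd_def)
  define E where "E = ?Ric X"
  have psdE: "psd E" using X riccati_residual_symmetric[OF R _ sym, of Q \<rho> A B] Q by (simp add: \<Omega>_def E_def psd_def)
  define F where "F = A - B ** matrix_inv R ** transpose B ** X"
  \<comment> \<open>The shift by \<rho>/2 moves the discount into the Lyapunov equation.\<close>
  define F' where "F' = F - (\<rho>/2) *\<^sub>R mat 1"
  obtain D \<alpha> where D: "psd D" "\<alpha> > 0" "\<alpha> *\<^sub>R D = transpose F' ** D + D ** F' + E"
    using shifted_lyapunov_solution[OF psdE, of F'] by blast
  have symD: "transpose D = D" using D by (simp add: psd_def)
  obtain k where k: "k > 0" "\<And>x. (norm (D *v x))\<^sup>2 \<le> k * (x \<bullet> (D *v x))" using psd_image_bound[OF D(1)] by blast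
  obtain s where s: "s > 0" "\<And>y. y \<bullet> ((B ** matrix_inv R ** transpose B) *v y) \<le> s * (norm y)\<^sup>2"
    using quadratic_form_upper_bound by blast
  have s': "wnorm2 R (matrix_inv R *v (transpose B *v y)) \<le> s * (norm y)\<^sup>2" for y
    using s(2)[of y] by (simp add: posdef_inv_form[OF R, symmetric] inner_matrix_vector_left transpose_transpose
        matrix_vector_mul_assoc[symmetric])
  \<comment> \<open>With \<epsilon> s k \<le> \<alpha> the gain \<epsilon> \<alpha> D of first order
    pays for the quadratic loss of order \<epsilon>^2; with \<epsilon> \<le> 1 the remaining share 1
    - \<epsilon> of E is nonnegative.\<close>
  define \<epsilon> where "\<epsilon> = min 1 (\<alpha> / (s * k))"
  have \<epsilon>: "0 < \<epsilon>" "\<epsilon> \<le> 1" "\<epsilon> * (s * k) \<le> \<alpha>" using D s k by (auto simp: \<epsilon>_def min_def field_simps)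
  have "X + \<epsilon> *\<^sub>R D \<in> \<Omega>"
  proof -
    have psdD: "psd (\<epsilon> *\<^sub>R D)" using D \<epsilon> unfolding psd_def
      by (simp add: vec_eq_iff transpose_def scaleR_matrix_vector_assoc[symmetric])
    have "psd (X + \<epsilon> *\<^sub>R D)"
      using psdX psdD unfolding psd_def by (simp add: transpose_add_matrix matrix_vector_mult_add_rdistrib inner_add_right)
    moreover have "0 \<le> x \<bullet> (?Ric (X + \<epsilon> *\<^sub>R D) *v x)" for x
    proof -
      let ?d = "x \<bullet> (D *v x)"
      have d0: "?d \<ge> 0" using D(1) by (rule psd_nonneg)
      have sD: "transpose (\<epsilon> *\<^sub>R D) = \<epsilon> *\<^sub>R D" using psdD by (simp add: psd_def)
      have "x \<bullet> ((\<alpha> *\<^sub>R D) *v x) = 2 * ((D *v x) \<bullet> (F' *v x)) + x \<bullet> (E *v x)"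
        unfolding D(3)
        by (simp add: matrix_vector_mult_add_rdistrib inner_add_right matrix_vector_mul_assoc[symmetric]
            inner_matrix_vector_left symD)
           (metis inner_matrix_vector_left inner_commute symD transpose_transpose)
      hence l: "2 * ((D *v x) \<bullet> (F' *v x)) = \<alpha> * ?d - x \<bullet> (E *v x)"
        by (simp add: scaleR_matrix_vector_assoc[symmetric])
      have "(D *v x) \<bullet> (F' *v x) = (D *v x) \<bullet> (F *v x) - (\<rho>/2) * ?d"
        by (simp add: F'_def matrix_vector_mult_diff_rdistrib inner_diff_right scaleR_matrix_vector_assoc[symmetric] inner_commute)
      hence l': "2 * ((D *v x) \<bullet> (F *v x)) = \<alpha> * ?d - x \<bullet> (E *v x) + \<rho> * ?d" using l by (simp add: field_simps)
      have "wnorm2 R (matrix_inv R *v (transpose B *v ((\<epsilon> *\<^sub>R D) *v x))) \<le> s * (norm ((\<epsilon> *\<^sub>R D) *v x))\<^sup>2" by (rule s')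
      also have "\<dots> = \<epsilon>\<^sup>2 * (s * (norm (D *v x))\<^sup>2)"
        using \<epsilon> by (simp add: scaleR_matrix_vector_assoc[symmetric] power_mult_distrib)
      also have "\<dots> \<le> \<epsilon>\<^sup>2 * (s * (k * ?d))" using k s by (intro mult_left_mono) auto
      also have "\<dots> = \<epsilon> * ((\<epsilon> * (s * k)) * ?d)" by (simp add: power2_eq_square)
      also have "\<dots> \<le> \<epsilon> * (\<alpha> * ?d)" using \<epsilon> d0 by (intro mult_left_mono mult_right_mono) auto
      finally have w: "wnorm2 R (matrix_inv R *v (transpose B *v ((\<epsilon> *\<^sub>R D) *v x))) \<le> \<epsilon> * (\<alpha> * ?d)" .
      have "x \<bullet> (?Ric (X + \<epsilon> *\<^sub>R D) *v x) = x \<bullet> (E *v x) + \<epsilon> * (2 * ((D *v x) \<bullet> (F *v x)))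
          - wnorm2 R (matrix_inv R *v (transpose B *v ((\<epsilon> *\<^sub>R D) *v x))) - \<rho> * (\<epsilon> * ?d)"
        unfolding riccati_residual_add[OF R sym sD] E_def F_def
        by (simp add: scaleR_matrix_vector_assoc[symmetric])
      also have "\<dots> \<ge> (1 - \<epsilon>) * (x \<bullet> (E *v x))" using w unfolding l' by (simp add: algebra_simps)
      finally show ?thesis using psd_nonneg[OF psdE, of x] \<epsilon> by (meson diff_ge_0_iff_ge mult_nonneg_nonneg order_trans)
    qed
    ultimately show ?thesis by (simp add: \<Omega>_def)
  qed
  \<comment> \<open>The trace cannot grow although D is positive semidefinite; so D = 0, and the
    equation defining D gives E = 0.\<close>
  from max[OF this] have "\<epsilon> * tr D \<le> 0" by (simp add: tr_def sum.distrib sum_distrib_left)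
  hence "tr D \<le> 0" using \<epsilon> by (simp add: mult_le_0_iff)
  moreover have "0 \<le> D $ i $ i" for i
    using psd_nonneg[OF D(1), of "axis i 1"] by (simp add: inner_axis' matrix_vector_mul_component) (simp add: inner_axis)
  ultimately have "tr D = 0" unfolding tr_def by (simp add: order_antisym sum_nonneg)
  hence "D = 0" using psd_trace_zero[OF D(1)] by (simp add: tr_def)
  hence "E = 0" using D(3) by simp
  hence "riccati_solution \<rho> A B Q R X" using sym by (simp add: riccati_solution_iff E_def)
  thus ?thesis using that psdX by blast
qed

text \<open>Maximality makes P dominate the positive semidefinite solution constructed
  above.\<close>

lemma maximal_riccati_solution_psd:
  fixes A Q P :: "real^'n^'n" and B :: "real^'r^'n" and R :: "real^'r^'r"
  assumes R: "posdef R" and Q: "psd Q" and stab: "stabilizable (A - (\<rho>/2) *\<^sub>R mat 1) B"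
    and P: "maximal_riccati_solution \<rho> A B Q R P"
  shows "psd P"
proof -
  obtain X where X: "psd X" "riccati_solution \<rho> A B Q R X" using psd_riccati_solution_exists[OF R Q stab] by blast
  have "psd (P - X)" using P X(2) by (simp add: maximal_riccati_solution_def)
  moreover have "transpose P = P" using P by (simp add: maximal_riccati_solution_def riccati_solution_def)
  moreover have "x \<bullet> (P *v x) = x \<bullet> ((P - X) *v x) + x \<bullet> (X *v x)" for x
    by (simp add: matrix_vector_mult_diff_rdistrib inner_diff_right)
  ultimately show ?thesis using X(1) by (simp add: psd_def)
qed

text \<open>Along the closed loop the form of P decreases only by the output and the control energy.
  The detectability matrix Y of the open loop decreases by |x|^2 up to an output term and a feedback
  term, and a large multiple of P pays for both.\<close>

lemma riccati_closed_loop_lyapunov: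
  fixes A Q P C :: "real^'n^'n" and B :: "real^'r^'n" and R :: "real^'r^'r"
  assumes R: "posdef R" and P: "psd P" "riccati_solution \<rho> A B Q R P"
    and C: "\<And>x. x \<bullet> (Q *v x) = (norm (C *v x))\<^sup>2" and obs: "observable (A - (\<rho>/2) *\<^sub>R mat 1) C"
  obtains Y where "psd Y"
    "\<And>x. 2 * ((Y *v x) \<bullet> ((A - B ** matrix_inv R ** transpose B ** P) *v x)) - \<rho> * (x \<bullet> (Y *v x)) \<le> - (norm x)\<^sup>2"
proof -
  let ?F = "A - B ** matrix_inv R ** transpose B ** P"
  let ?w = "\<lambda>x. matrix_inv R *v (transpose B *v (P *v x))"
  have symP: "transpose P = P" using P by (simp add: psd_def)
  obtain Y \<kappa> where Y: "psd Y" "\<kappa> \<ge> 0"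
    "\<And>x. 2 * ((Y *v x) \<bullet> ((A - (\<rho>/2) *\<^sub>R mat 1) *v x)) \<le> \<kappa> * (norm (C *v x))\<^sup>2 - (norm x)\<^sup>2"
    using observable_detectability[OF obs] by blast
  have Y': "2 * ((Y *v x) \<bullet> (A *v x)) - \<rho> * (x \<bullet> (Y *v x)) \<le> \<kappa> * (norm (C *v x))\<^sup>2 - (norm x)\<^sup>2" for x
    using Y(3)[of x] by (simp add: matrix_vector_mult_diff_rdistrib inner_diff_right scaleR_matrix_vector_assoc[symmetric] inner_commute)
  have F: "?F *v x = A *v x - B *v ?w x" for x
    by (simp add: matrix_vector_mult_diff_rdistrib matrix_vector_mul_assoc[symmetric])
  obtain b where b: "b > 0" "\<And>x. norm ((transpose B ** Y) *v x) \<le> b * norm x" using norm_matrix_vector_le by blast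
  obtain r where r: "r > 0" "\<And>x. r * (norm x)\<^sup>2 \<le> x \<bullet> (R *v x)"
    using quadratic_form_lower_bound[of R] R unfolding posdef_def by metis
  \<comment> \<open>The summand 2 b^2 / r pays for the feedback term after Young's inequality,
    \<kappa> for the output term.\<close>
  define k where "k = \<kappa> + 2 * b\<^sup>2 / r"
  have k: "k \<ge> \<kappa>" "k * r \<ge> 2 * b\<^sup>2" "k \<ge> 0" using Y(2) r by (auto simp: k_def field_simps)
  have w: "- 2 * ((Y *v x) \<bullet> (B *v ?w x)) \<le> (norm x)\<^sup>2 / 2 + k * wnorm2 R (?w x)" for x
  proof -
    have "- ((Y *v x) \<bullet> (B *v ?w x)) = - (((transpose B ** Y) *v x) \<bullet> ?w x)"
      by (simp add: inner_matrix_vector_left matrix_transpose_mul transpose_transpose matrix_vector_mul_assoc[symmetric])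
    also have "\<dots> \<le> norm ((transpose B ** Y) *v x) * norm (?w x)" using norm_cauchy_schwarz[of "- ((transpose B ** Y) *v x)" "?w x"] by simp
    also have "\<dots> \<le> (b * norm x) * norm (?w x)" using b by (intro mult_right_mono) auto
    finally have "- 2 * ((Y *v x) \<bullet> (B *v ?w x)) \<le> 2 * (b * norm x * norm (?w x))" by simp
    also have "\<dots> \<le> (norm x)\<^sup>2 / 2 + 2 * b\<^sup>2 * (norm (?w x))\<^sup>2"
      using sum_squares_ge_zero[of "norm x - 2 * b * norm (?w x)" 0] by (simp add: power2_eq_square algebra_simps)
    also have "2 * b\<^sup>2 * (norm (?w x))\<^sup>2 \<le> k * (r * (norm (?w x))\<^sup>2)"
      using k(2) by (metis mult.assoc mult_right_mono zero_le_power2)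
    also have "\<dots> \<le> k * wnorm2 R (?w x)" using r k by (intro mult_left_mono) (auto simp: wnorm2_def)
    finally show ?thesis by simp
  qed
  have Pe: "2 * ((P *v x) \<bullet> (A *v x)) - \<rho> * (x \<bullet> (P *v x)) = wnorm2 R (?w x) - (norm (C *v x))\<^sup>2" for x
    using riccati_residual_form[OF R symP, of x \<rho> A B Q] P(2) by (simp add: riccati_solution_iff C)
  have PB: "(P *v x) \<bullet> (B *v ?w x) = wnorm2 R (?w x)" for x
    using inner_matrix_vector_transpose[of "P *v x" B "?w x"] by (simp add: posdef_inv_form[OF R, symmetric])
  \<comment> \<open>The factor 2 restores the margin halved by Young's inequality.\<close>
  define Z where "Z = 2 *\<^sub>R (Y + k *\<^sub>R P)"
  have Zv: "Z *v x = 2 *\<^sub>R (Y *v x + k *\<^sub>R (P *v x))" for x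
    by (simp add: Z_def scaleR_matrix_vector_assoc[symmetric] matrix_vector_mult_add_rdistrib)
  have "psd Z"
    using Y(1) P(1) k(3) unfolding psd_def by (simp add: Zv inner_add_right) (simp add: Z_def vec_eq_iff transpose_def)
  moreover have "2 * ((Z *v x) \<bullet> (?F *v x)) - \<rho> * (x \<bullet> (Z *v x)) \<le> - (norm x)\<^sup>2" for x
  proof -
    have "2 * ((Z *v x) \<bullet> (?F *v x)) - \<rho> * (x \<bullet> (Z *v x))
      = 2 * ((2 * ((Y *v x) \<bullet> (A *v x)) - \<rho> * (x \<bullet> (Y *v x))) - 2 * ((Y *v x) \<bullet> (B *v ?w x))
       + k * ((2 * ((P *v x) \<bullet> (A *v x)) - \<rho> * (x \<bullet> (P *v x))) - 2 * ((P *v x) \<bullet> (B *v ?w x))))"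
      unfolding F Zv by (simp add: inner_add_left inner_add_right inner_diff_right algebra_simps)
    also have "\<dots> \<le> 2 * ((\<kappa> * (norm (C *v x))\<^sup>2 - (norm x)\<^sup>2) + ((norm x)\<^sup>2 / 2 + k * wnorm2 R (?w x))
       + k * (- wnorm2 R (?w x) - (norm (C *v x))\<^sup>2))"
      using Y'[of x] w[of x] unfolding Pe PB by (simp add: algebra_simps)
    also have "\<dots> \<le> - (norm x)\<^sup>2" using mult_right_mono[OF k(1), of "(norm (C *v x))\<^sup>2"] by (simp add: algebra_simps)
    finally show ?thesis .
  qed
  ultimately show ?thesis using that by blast
qed

text \<open>Subtracting \<rho>/2 on the diagonal contributes exactly the discount term of the
  derivative of exp(-\<rho> t) times the form of Y.\<close>

lemma hurwitz_shifted_lyapunov: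
  fixes F :: "real^'n^'n"
  assumes "hurwitz (F - (\<rho>/2) *\<^sub>R mat 1)"
  obtains Y where "psd Y" "\<And>x. 2 * ((Y *v x) \<bullet> (F *v x)) - \<rho> * (x \<bullet> (Y *v x)) \<le> - (norm x)\<^sup>2"
proof -
  obtain Y where Y: "psd Y" "\<And>x. 2 * ((Y *v x) \<bullet> ((F - (\<rho>/2) *\<^sub>R mat 1) *v x)) \<le> - (norm x)\<^sup>2"
    using hurwitz_lyapunov[OF assms] by blast
  have "2 * ((Y *v x) \<bullet> (F *v x)) - \<rho> * (x \<bullet> (Y *v x)) \<le> - (norm x)\<^sup>2" for x
    using Y(2)[of x] by (simp add: matrix_vector_mult_diff_rdistrib inner_diff_right scaleR_matrix_vector_assoc[symmetric] inner_commute)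
  with Y(1) show ?thesis using that by blast
qed

lemma observable_shifted_detectability:
  fixes A :: "real^'n^'n" and C :: "real^'n^'m"
  assumes "observable (A - (\<rho>/2) *\<^sub>R mat 1) C"
  obtains Y \<kappa> where "psd Y" "\<kappa> \<ge> 0"
    "\<And>x. 2 * ((Y *v x) \<bullet> (A *v x)) - \<rho> * (x \<bullet> (Y *v x)) \<le> \<kappa> * (norm (C *v x))\<^sup>2 - (norm x)\<^sup>2"
proof -
  obtain Y \<kappa> where Y: "psd Y" "\<kappa> \<ge> 0"
    "\<And>x. 2 * ((Y *v x) \<bullet> ((A - (\<rho>/2) *\<^sub>R mat 1) *v x)) \<le> \<kappa> * (norm (C *v x))\<^sup>2 - (norm x)\<^sup>2"
    using observable_detectability[OF assms] by blast
  have "2 * ((Y *v x) \<bullet> (A *v x)) - \<rho> * (x \<bullet> (Y *v x)) \<le> \<kappa> * (norm (C *v x))\<^sup>2 - (norm x)\<^sup>2" for x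
    using Y(3)[of x] by (simp add: matrix_vector_mult_diff_rdistrib inner_diff_right scaleR_matrix_vector_assoc[symmetric] inner_commute)
  with Y(1,2) show ?thesis using that by blast
qed

section \<open>Square-integrable functions\<close>

definition sq_integrable :: "'a measure \<Rightarrow> ('a \<Rightarrow> real^'n) \<Rightarrow> bool" where
  "sq_integrable M f \<longleftrightarrow> f \<in> borel_measurable M \<and> integrable M (\<lambda>x. (norm (f x))\<^sup>2)"

lemma sq_integrable_measurable [measurable_dest]: "sq_integrable M f \<Longrightarrow> f \<in> borel_measurable M"
  by (simp add: sq_integrable_def)

lemma sq_integrable_norm2: "sq_integrable M f \<Longrightarrow> integrable M (\<lambda>x. (norm (f x))\<^sup>2)"
  by (simp add: sq_integrable_def)

lemma sq_integrable_iff_nn_integral: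
  "sq_integrable M f \<longleftrightarrow> f \<in> borel_measurable M \<and> (\<integral>\<^sup>+x. ennreal ((norm (f x))\<^sup>2) \<partial>M) < \<infinity>"
  unfolding sq_integrable_def by (auto simp: integrable_iff_bounded)

lemma sq_integrable_bound:
  assumes "sq_integrable M g" "f \<in> borel_measurable M" "\<And>x. x \<in> space M \<Longrightarrow> norm (f x) \<le> c * norm (g x)"
  shows "sq_integrable M f"
proof -
  have "integrable M (\<lambda>x. c\<^sup>2 * (norm (g x))\<^sup>2)" using assms(1) by (simp add: sq_integrable_def)
  hence "integrable M (\<lambda>x. (norm (f x))\<^sup>2)"
  proof (rule Bochner_Integration.integrable_bound)
    show "AE x in M. norm ((norm (f x))\<^sup>2) \<le> norm (c\<^sup>2 * (norm (g x))\<^sup>2)"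
      using assms(3) by (intro AE_I2) (auto simp: power_mult_distrib[symmetric] intro!: power_mono)
  qed (use assms(2) in measurable)
  thus ?thesis using assms(2) by (simp add: sq_integrable_def)
qed

lemma sq_integrable_inner:
  assumes "sq_integrable M f" "sq_integrable M g"
  shows "integrable M (\<lambda>x. f x \<bullet> g x)"
proof (rule Bochner_Integration.integrable_bound)
  show "integrable M (\<lambda>x. (norm (f x))\<^sup>2 + (norm (g x))\<^sup>2)"
    using assms by (simp add: sq_integrable_def)
  have "\<bar>f x \<bullet> g x\<bar> \<le> (norm (f x))\<^sup>2 + (norm (g x))\<^sup>2" for x
  proof -
    have "2 * (norm (f x) * norm (g x)) \<le> (norm (f x))\<^sup>2 + (norm (g x))\<^sup>2"
      using sum_squares_bound[of "norm (f x)" "norm (g x)"] by (simp add: mult.assoc)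
    moreover have "0 \<le> norm (f x) * norm (g x)" by simp
    ultimately show ?thesis using Cauchy_Schwarz_ineq2[of "f x" "g x"] by linarith
  qed
  thus "AE x in M. norm (f x \<bullet> g x) \<le> norm ((norm (f x))\<^sup>2 + (norm (g x))\<^sup>2)"
    by (intro AE_I2) (simp add: abs_of_nonneg)
qed (use assms in \<open>measurable\<close>)

lemma norm_add_squared_le:
  fixes a b :: "'a::real_inner"
  shows "(norm (a + b))\<^sup>2 \<le> 2 * (norm a)\<^sup>2 + 2 * (norm b)\<^sup>2"
proof -
  have "(norm (a + b))\<^sup>2 + (norm (a - b))\<^sup>2 = 2 * (norm a)\<^sup>2 + 2 * (norm b)\<^sup>2"
    by (simp add: power2_norm_eq_inner inner_add_left inner_add_right inner_diff_left inner_diff_right)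
  thus ?thesis by (smt (verit) zero_le_power2)
qed

lemma sq_integrable_add:
  assumes "sq_integrable M f" "sq_integrable M g"
  shows "sq_integrable M (\<lambda>x. f x + g x)"
  unfolding sq_integrable_def
proof
  show m: "(\<lambda>x. f x + g x) \<in> borel_measurable M" using assms by measurable
  show "integrable M (\<lambda>x. (norm (f x + g x))\<^sup>2)"
  proof (rule Bochner_Integration.integrable_bound)
    show "integrable M (\<lambda>x. 2 * (norm (f x))\<^sup>2 + 2 * (norm (g x))\<^sup>2)"
      using assms by (simp add: sq_integrable_def)
    show "AE x in M. norm ((norm (f x + g x))\<^sup>2) \<le> norm (2 * (norm (f x))\<^sup>2 + 2 * (norm (g x))\<^sup>2)"
      using norm_add_squared_le by (intro AE_I2) (simp add: abs_of_nonneg)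
  qed (use m in measurable)
qed

lemma sq_integrable_matrix:
  fixes Y :: "real^'n^'m"
  assumes "sq_integrable M f"
  shows "sq_integrable M (\<lambda>x. Y *v f x)"
proof -
  obtain c where "c > 0" "\<And>x. norm (Y *v x) \<le> c * norm x" using norm_matrix_vector_le by blast
  moreover have "(\<lambda>x. Y *v f x) \<in> borel_measurable M"
    using assms by (intro borel_measurable_continuous_on[OF matrix_vector_mult_linear_continuous_on] sq_integrable_measurable)
  ultimately show ?thesis using sq_integrable_bound[OF assms] by blast
qed

lemma sq_integrable_scaleR: "sq_integrable M f \<Longrightarrow> sq_integrable M (\<lambda>x. c *\<^sub>R f x)"
  by (rule sq_integrable_bound[of M f _ "\<bar>c\<bar>"]) auto

lemma sq_integrable_uminus: "sq_integrable M f \<Longrightarrow> sq_integrable M (\<lambda>x. - f x)"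
  by (rule sq_integrable_bound[of M f _ 1]) auto

lemma sq_integrable_diff: "sq_integrable M f \<Longrightarrow> sq_integrable M g \<Longrightarrow> sq_integrable M (\<lambda>x. f x - g x)"
  using sq_integrable_add[of M f "\<lambda>x. - g x"] sq_integrable_uminus[of M g] by simp

lemma sq_integrable_zero: "sq_integrable M (\<lambda>x. 0)"
  by (simp add: sq_integrable_def)

lemma sq_integrable_sum: "(\<And>i. i \<in> I \<Longrightarrow> sq_integrable M (f i)) \<Longrightarrow> sq_integrable M (\<lambda>x. \<Sum>i\<in>I. f i x)"
  by (induction I rule: infinite_finite_induct) (auto intro: sq_integrable_add sq_integrable_zero)

lemma sq_integrable_cong_AE:
  assumes "sq_integrable M f" "g \<in> borel_measurable M" "AE x in M. f x = g x"
  shows "sq_integrable M g"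
proof -
  have "integrable M (\<lambda>x. (norm (f x))\<^sup>2) \<longleftrightarrow> integrable M (\<lambda>x. (norm (g x))\<^sup>2)"
    by (rule integrable_cong_AE) (use assms in \<open>auto simp: sq_integrable_def\<close>)
  thus ?thesis using assms by (simp add: sq_integrable_def)
qed

lemma sq_integrable_const: "finite_measure M \<Longrightarrow> sq_integrable M (\<lambda>x. c)"
  using finite_measure.integrable_const by (auto simp: sq_integrable_def)

lemmas sq_integrable_intros = sq_integrable_add sq_integrable_diff sq_integrable_matrix sq_integrable_scaleR
  sq_integrable_uminus sq_integrable_zero sq_integrable_sum

text \<open>The integral of |f + t g|^2 is a nonnegative polynomial in t. The case c = 0 is separate
  because the polynomial is then linear, and nonnegativity forces its slope to vanish.\<close>

lemma integral_Cauchy_Schwarz: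
  assumes "sq_integrable M f" "sq_integrable M g"
  shows "(\<integral>x. f x \<bullet> g x \<partial>M)\<^sup>2 \<le> (\<integral>x. (norm (f x))\<^sup>2 \<partial>M) * (\<integral>x. (norm (g x))\<^sup>2 \<partial>M)"
proof -
  define a where "a = (\<integral>x. (norm (f x))\<^sup>2 \<partial>M)"
  define b where "b = (\<integral>x. f x \<bullet> g x \<partial>M)"
  define c where "c = (\<integral>x. (norm (g x))\<^sup>2 \<partial>M)"
  have a: "a \<ge> 0" and c: "c \<ge> 0" by (simp_all add: a_def c_def)
  have q: "0 \<le> a + 2 * t * b + t\<^sup>2 * c" for t
  proof -
    have "0 \<le> (\<integral>x. (norm (f x + t *\<^sub>R g x))\<^sup>2 \<partial>M)" by simp
    also have "\<dots> = (\<integral>x. (norm (f x))\<^sup>2 + 2 * t * (f x \<bullet> g x) + t\<^sup>2 * (norm (g x))\<^sup>2 \<partial>M)"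
      unfolding power2_norm_eq_inner
      by (intro Bochner_Integration.integral_cong refl)
        (simp add: inner_add_left inner_add_right inner_commute power2_eq_square algebra_simps)
    also have "\<dots> = a + 2 * t * b + t\<^sup>2 * c"
      using assms sq_integrable_inner[OF assms] by (simp add: sq_integrable_def a_def b_def c_def)
    finally show ?thesis .
  qed
  have "b\<^sup>2 \<le> a * c"
  proof (cases "c = 0")
    case True
    have "b = 0"
    proof (rule ccontr)
      assume "b \<noteq> 0"
      have "0 \<le> a + 2 * (- (a + 1) / (2 * b)) * b" using q[of "- (a + 1) / (2 * b)"] True by simp
      thus False using \<open>b \<noteq> 0\<close> by (simp add: field_simps)
    qed
    thus ?thesis using a c by simp
  next
    case False
    with c have "c > 0" by simp
    have "0 \<le> a + 2 * (- b / c) * b + (- b / c)\<^sup>2 * c" by (rule q)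
    also have "\<dots> = a - b\<^sup>2 / c" using \<open>c > 0\<close> by (simp add: field_simps power2_eq_square)
    finally show ?thesis using \<open>c > 0\<close> by (simp add: field_simps)
  qed
  thus ?thesis by (simp add: a_def b_def c_def)
qed

lemma tendsto_zero_of_square_le:
  fixes b x y :: "nat \<Rightarrow> real"
  assumes "x \<longlonglongrightarrow> 0" "y \<longlonglongrightarrow> l" "\<And>k. (b k)\<^sup>2 \<le> x k * y k"
  shows "b \<longlonglongrightarrow> 0"
proof -
  have "(\<lambda>k. x k * y k) \<longlonglongrightarrow> 0 * l" using assms by (intro tendsto_mult)
  hence "(\<lambda>k. sqrt (x k * y k)) \<longlonglongrightarrow> 0" using tendsto_real_sqrt by fastforce
  moreover have "norm (b k) \<le> sqrt (x k * y k)" for k using real_le_rsqrt[of "\<bar>b k\<bar>"] assms(3) by simp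
  ultimately show ?thesis by (metis (no_types, lifting) Lim_null_comparison always_eventually)
qed

text \<open>One finite distance suffices: f is the difference of \<open>S k\<close> and
  \<open>S k - f\<close>. Afterwards the convergence of extended integrals can be read as one of
  real integrals.\<close>

lemma L2_limit_sq_integrable:
  fixes S :: "nat \<Rightarrow> 'a \<Rightarrow> real^'n"
  assumes S: "\<And>k. sq_integrable M (S k)" and f: "f \<in> borel_measurable M"
    and lim: "(\<lambda>k. \<integral>\<^sup>+x. ennreal ((norm (S k x - f x))\<^sup>2) \<partial>M) \<longlonglongrightarrow> 0"
  shows "sq_integrable M f" "(\<lambda>k. \<integral>x. (norm (S k x - f x))\<^sup>2 \<partial>M) \<longlonglongrightarrow> 0"
proof -
  from order_tendstoD(2)[OF lim, of 1] obtain k where "(\<integral>\<^sup>+x. ennreal ((norm (S k x - f x))\<^sup>2) \<partial>M) < 1"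
    by (auto simp: eventually_sequentially)
  hence "sq_integrable M (\<lambda>x. S k x - f x)"
    using S[of k] f by (auto simp: sq_integrable_iff_nn_integral intro: less_trans)
  hence "sq_integrable M (\<lambda>x. S k x - (S k x - f x))" by (rule sq_integrable_diff[OF S])
  thus f': "sq_integrable M f" by simp
  have "(\<integral>\<^sup>+x. ennreal ((norm (S k x - f x))\<^sup>2) \<partial>M) = ennreal (\<integral>x. (norm (S k x - f x))\<^sup>2 \<partial>M)" for k
    using sq_integrable_diff[OF S f', of k] by (intro nn_integral_eq_integral) (auto simp: sq_integrable_def)
  with lim have "(\<lambda>k. ennreal (\<integral>x. (norm (S k x - f x))\<^sup>2 \<partial>M)) \<longlonglongrightarrow> ennreal 0" by simp
  thus "(\<lambda>k. \<integral>x. (norm (S k x - f x))\<^sup>2 \<partial>M) \<longlonglongrightarrow> 0"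
    by (subst (asm) tendsto_ennreal_iff) auto
qed

lemma L2_limit_inner:
  fixes S S' :: "nat \<Rightarrow> 'a \<Rightarrow> real^'n"
  assumes S: "\<And>k. sq_integrable M (S k)" "sq_integrable M f" "(\<lambda>k. \<integral>x. (norm (S k x - f x))\<^sup>2 \<partial>M) \<longlonglongrightarrow> 0"
    and S': "\<And>k. sq_integrable M (S' k)" "sq_integrable M g" "(\<lambda>k. \<integral>x. (norm (S' k x - g x))\<^sup>2 \<partial>M) \<longlonglongrightarrow> 0"
  shows "(\<lambda>k. \<integral>x. S k x \<bullet> S' k x \<partial>M) \<longlonglongrightarrow> (\<integral>x. f x \<bullet> g x \<partial>M)"
proof -
  have d: "sq_integrable M (\<lambda>x. S k x - f x)" "sq_integrable M (\<lambda>x. S' k x - g x)" for k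
    by (intro sq_integrable_diff S S')+
  have "(\<lambda>k. \<integral>x. (S k x - f x) \<bullet> (S' k x - g x) \<partial>M) \<longlonglongrightarrow> 0"
    by (rule tendsto_zero_of_square_le[OF S(3) S'(3)]) (intro integral_Cauchy_Schwarz d)
  moreover have "(\<lambda>k. \<integral>x. (S k x - f x) \<bullet> g x \<partial>M) \<longlonglongrightarrow> 0"
    by (rule tendsto_zero_of_square_le[OF S(3) tendsto_const[of "\<integral>x. (norm (g x))\<^sup>2 \<partial>M"]]) (intro integral_Cauchy_Schwarz d S'(2))
  moreover have "(\<lambda>k. \<integral>x. (S' k x - g x) \<bullet> f x \<partial>M) \<longlonglongrightarrow> 0"
    by (rule tendsto_zero_of_square_le[OF S'(3) tendsto_const[of "\<integral>x. (norm (f x))\<^sup>2 \<partial>M"]]) (intro integral_Cauchy_Schwarz d S(2))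
  ultimately have "(\<lambda>k. (\<integral>x. (S k x - f x) \<bullet> (S' k x - g x) \<partial>M) + (\<integral>x. (S k x - f x) \<bullet> g x \<partial>M)
     + (\<integral>x. (S' k x - g x) \<bullet> f x \<partial>M) + (\<integral>x. f x \<bullet> g x \<partial>M)) \<longlonglongrightarrow> 0 + 0 + 0 + (\<integral>x. f x \<bullet> g x \<partial>M)"
    by (intro tendsto_add tendsto_const)
  moreover have "(\<integral>x. (S k x - f x) \<bullet> (S' k x - g x) \<partial>M) + (\<integral>x. (S k x - f x) \<bullet> g x \<partial>M)
     + (\<integral>x. (S' k x - g x) \<bullet> f x \<partial>M) + (\<integral>x. f x \<bullet> g x \<partial>M) = (\<integral>x. S k x \<bullet> S' k x \<partial>M)" for k
  proof -
    note i = sq_integrable_inner[OF d(1) d(2), of k k] sq_integrable_inner[OF d(1) S'(2), of k]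
      sq_integrable_inner[OF d(2) S(2), of k] sq_integrable_inner[OF S(2) S'(2)]
    have "(\<integral>x. S k x \<bullet> S' k x \<partial>M) = (\<integral>x. (S k x - f x) \<bullet> (S' k x - g x) + (S k x - f x) \<bullet> g x + (S' k x - g x) \<bullet> f x + f x \<bullet> g x \<partial>M)"
      by (intro Bochner_Integration.integral_cong refl) (simp add: inner_diff_left inner_diff_right inner_commute)
    thus ?thesis using i by simp
  qed
  ultimately show ?thesis by simp
qed

lemma L2_limit_matrix:
  fixes S :: "nat \<Rightarrow> 'a \<Rightarrow> real^'n" and Y :: "real^'n^'m"
  assumes S: "\<And>k. sq_integrable M (S k)" "sq_integrable M f" "(\<lambda>k. \<integral>x. (norm (S k x - f x))\<^sup>2 \<partial>M) \<longlonglongrightarrow> 0"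
  shows "(\<lambda>k. \<integral>x. (norm (Y *v S k x - Y *v f x))\<^sup>2 \<partial>M) \<longlonglongrightarrow> 0"
proof -
  obtain c where c: "c > 0" "\<And>x. norm (Y *v x) \<le> c * norm x" using norm_matrix_vector_le by blast
  have "(\<integral>x. (norm (Y *v S k x - Y *v f x))\<^sup>2 \<partial>M) \<le> c\<^sup>2 * (\<integral>x. (norm (S k x - f x))\<^sup>2 \<partial>M)" for k
  proof -
    have "(\<integral>x. (norm (Y *v S k x - Y *v f x))\<^sup>2 \<partial>M) \<le> (\<integral>x. c\<^sup>2 * (norm (S k x - f x))\<^sup>2 \<partial>M)"
    proof (rule integral_mono)
      show "integrable M (\<lambda>x. (norm (Y *v S k x - Y *v f x))\<^sup>2)"
        by (intro sq_integrable_norm2 sq_integrable_intros S)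
      have "integrable M (\<lambda>x. (norm (S k x - f x))\<^sup>2)" by (intro sq_integrable_norm2 sq_integrable_intros S)
      thus "integrable M (\<lambda>x. c\<^sup>2 * (norm (S k x - f x))\<^sup>2)" by simp
      fix x
      have "(norm (Y *v (S k x - f x)))\<^sup>2 \<le> (c * norm (S k x - f x))\<^sup>2" by (intro power_mono c) simp
      thus "(norm (Y *v S k x - Y *v f x))\<^sup>2 \<le> c\<^sup>2 * (norm (S k x - f x))\<^sup>2"
        by (simp add: matrix_vector_mult_diff_distrib power_mult_distrib)
    qed
    thus ?thesis by simp
  qed
  hence le: "norm (\<integral>x. (norm (Y *v S k x - Y *v f x))\<^sup>2 \<partial>M) \<le> c\<^sup>2 * (\<integral>x. (norm (S k x - f x))\<^sup>2 \<partial>M)" for k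
    by simp
  have lim: "(\<lambda>k. c\<^sup>2 * (\<integral>x. (norm (S k x - f x))\<^sup>2 \<partial>M)) \<longlonglongrightarrow> 0" using tendsto_mult_right_zero[OF S(3)] .
  show ?thesis by (rule Lim_null_comparison[OF always_eventually lim]) (use le in blast)
qed

section \<open>Ito integrals of deterministic functions\<close>

locale filtered_prob = prob_space M for M :: "'w measure" and F :: "real \<Rightarrow> 'w measure" +
  assumes cfps: "complete_filtered_prob_space M F"
begin

lemma filtration_F: "filtration (space M) F"
  using cfps by (simp add: complete_filtered_prob_space_def)

lemma space_F: "space (F t) = space M"
  using filtration_F by (auto simp: filtration_def)

lemma sets_F_subset: "sets (F t) \<subseteq> sets M"
  using cfps by (auto simp: complete_filtered_prob_space_def)

lemma sets_F_mono: "s \<le> t \<Longrightarrow> sets (F s) \<subseteq> sets (F t)"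
  using filtration_F by (simp add: filtration_def)

lemma measurable_F: "f \<in> measurable (F t) N \<Longrightarrow> f \<in> measurable M N"
  using sets_F_subset by (auto simp: measurable_def space_F)

lemma measurable_F_mono: "f \<in> measurable (F s) N \<Longrightarrow> s \<le> t \<Longrightarrow> f \<in> measurable (F t) N"
  using sets_F_mono[of s t] unfolding measurable_def space_F by blast

lemma brownian_measurable:
  assumes "brownian_motion M F W" "0 \<le> t"
  shows "W t \<in> borel_measurable (F t)" "W t \<in> borel_measurable M"
  using assms measurable_F by (auto simp: brownian_motion_def)

lemma brownian_increment:
  assumes W: "brownian_motion M F W" and ab: "0 \<le> a" "a \<le> b"
  shows "integrable M (\<lambda>w. (W b w - W a w)\<^sup>2)" "expectation (\<lambda>w. W b w - W a w) = 0"
    "expectation (\<lambda>w. (W b w - W a w)\<^sup>2) = b - a" "integrable M (\<lambda>w. W b w - W a w)"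
proof -
  have "integrable M (\<lambda>w. (W b w - W a w)\<^sup>2) \<and> expectation (\<lambda>w. W b w - W a w) = 0 \<and>
    expectation (\<lambda>w. (W b w - W a w)\<^sup>2) = b - a \<and> integrable M (\<lambda>w. W b w - W a w)"
  proof (cases "a = b")
    case False
    with ab have lt: "a < b" by simp
    let ?\<sigma> = "sqrt (b - a)"
    have s: "?\<sigma> > 0" using lt by simp
    have D: "distributed M lborel (\<lambda>w. W b w - W a w) (\<lambda>y. ennreal (normal_density 0 ?\<sigma> y))"
      using W ab lt unfolding brownian_motion_def by blast
    have E: "expectation (\<lambda>w. W b w - W a w) = 0" using normal_distributed_expectation[OF s D] .
    have V: "expectation (\<lambda>w. (W b w - W a w)\<^sup>2) = b - a"
      using normal_distributed_variance[OF s D] lt by (simp add: E)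
    have "integrable lborel (\<lambda>x. normal_density 0 ?\<sigma> x * x\<^sup>2)"
      using integrable_normal_moment[OF s, of 0 2] by simp
    hence I2: "integrable M (\<lambda>w. (W b w - W a w)\<^sup>2)"
      using distributed_integrable[OF D, of "\<lambda>x. x\<^sup>2"] by simp
    have "integrable lborel (\<lambda>x. normal_density 0 ?\<sigma> x * x)"
      using integrable_normal_moment[OF s, of 0 1] by simp
    hence I1: "integrable M (\<lambda>w. W b w - W a w)"
      using distributed_integrable[OF D, of "\<lambda>x. x"] by simp
    from E V I1 I2 show ?thesis by simp
  qed simp
  thus "integrable M (\<lambda>w. (W b w - W a w)\<^sup>2)" "expectation (\<lambda>w. W b w - W a w) = 0"
    "expectation (\<lambda>w. (W b w - W a w)\<^sup>2) = b - a" "integrable M (\<lambda>w. W b w - W a w)" by auto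
qed

lemma brownian_increment_orthogonal:
  assumes W: "brownian_motion M F W" and ab: "0 \<le> a" "a \<le> b"
    and Z: "Z \<in> borel_measurable (F a)" "integrable M Z"
  shows "integrable M (\<lambda>w. Z w * (W b w - W a w))" "expectation (\<lambda>w. Z w * (W b w - W a w)) = 0"
proof -
  have "integrable M (\<lambda>w. Z w * (W b w - W a w)) \<and> expectation (\<lambda>w. Z w * (W b w - W a w)) = 0"
  proof (cases "a = b")
    case False
    let ?D = "\<lambda>w. W b w - W a w"
    have [measurable]: "W a \<in> borel_measurable M" "W b \<in> borel_measurable M" "Z \<in> borel_measurable M"
      using brownian_measurable[OF W] ab Z measurable_F by auto
    have D: "random_variable borel ?D" by measurable
    let ?G = "{?D -` S \<inter> space M | S. S \<in> sets borel}"
    \<comment> \<open>The preimages under the increment already form a sigma-algebra, so the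
      independence in \<open>brownian_motion\<close> is that of generated sigma-algebras.\<close>
    have "sigma_sets (space M) ?G = ?G"
      using sets_vimage_algebra2[of ?D "space M" borel] sets_vimage_algebra[of "space M" ?D borel] by simp
    moreover have "sigma_sets (space M) {Z -` S \<inter> space M | S. S \<in> sets borel} \<subseteq> sets (F a)"
      using Z(1) by (intro sets.sigma_sets_subset[of _ "F a", unfolded space_F]) (auto simp: measurable_def space_F)
    moreover have "indep_set (sets (F a)) ?G"
      using W ab False unfolding brownian_motion_def by auto
    ultimately have "indep_set (sigma_sets (space M) {Z -` S \<inter> space M | S. S \<in> sets borel}) (sigma_sets (space M) ?G)"
      unfolding indep_set_def by (elim indep_sets_mono_sets) (auto split: bool.split)
    hence "indep_var borel Z borel ?D" by (simp add: indep_var_eq)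
    from indep_var_lebesgue_integral[OF this Z(2)] indep_var_integrable[OF this Z(2)] brownian_increment[OF W ab]
    show ?thesis by simp
  qed simp
  thus "integrable M (\<lambda>w. Z w * (W b w - W a w))" "expectation (\<lambda>w. Z w * (W b w - W a w)) = 0" by auto
qed

end

section \<open>Covariances of increments and of step integrals\<close>

lemma lborel_integral_indicator_mult:
  fixes a b c d :: real
  assumes "a \<le> b" "c \<le> d"
  shows "(LINT r|lborel. indicator {a<..b} r * indicator {c<..d} r) = max 0 (min b d - max a c)"
proof -
  have "(LINT r|lborel. indicator {a<..b} r * indicator {c<..d} r) = (LINT r|lborel. (indicator {max a c<..min b d} r :: real))"
    by (intro Bochner_Integration.integral_cong refl) (auto simp: indicator_def)
  also have "\<dots> = measure lborel {max a c<..min b d}" by simp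
  also have "\<dots> = max 0 (min b d - max a c)"
  proof -
    have "measure lborel {l<..u} = max 0 (u - l)" for l u :: real
      by (cases "l \<le> u") (auto simp: measure_def)
    thus ?thesis .
  qed
  finally show ?thesis by simp
qed

lemma integrable_mult_of_squares:
  fixes f g :: "'a \<Rightarrow> real"
  assumes [measurable]: "f \<in> borel_measurable M" "g \<in> borel_measurable M"
    and i: "integrable M (\<lambda>x. (f x)\<^sup>2)" "integrable M (\<lambda>x. (g x)\<^sup>2)"
  shows "integrable M (\<lambda>x. f x * g x)"
proof (rule Bochner_Integration.integrable_bound)
  show "integrable M (\<lambda>x. (f x)\<^sup>2 + (g x)\<^sup>2)" using i by simp
  have "\<bar>f x * g x\<bar> \<le> (f x)\<^sup>2 + (g x)\<^sup>2" for x
  proof -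
    have "2 * (\<bar>f x\<bar> * \<bar>g x\<bar>) \<le> (f x)\<^sup>2 + (g x)\<^sup>2"
      using sum_squares_bound[of "\<bar>f x\<bar>" "\<bar>g x\<bar>"] by (simp add: mult.assoc)
    moreover have "0 \<le> \<bar>f x\<bar> * \<bar>g x\<bar>" by simp
    ultimately show ?thesis unfolding abs_mult by linarith
  qed
  thus "AE x in M. norm (f x * g x) \<le> norm ((f x)\<^sup>2 + (g x)\<^sup>2)" by (intro AE_I2) simp
qed measurable

text \<open>The number \<kappa> is 1 for a Brownian motion with itself and 0 for two independent
  ones. Writing the covariance as the L2 product of indicators makes the isometry for step functions
  pure bilinearity.\<close>

definition incr_cov ::
  "'w measure \<Rightarrow> real \<Rightarrow> (real \<Rightarrow> 'w \<Rightarrow> real) \<Rightarrow> (real \<Rightarrow> 'w \<Rightarrow> real) \<Rightarrow> bool" where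
  "incr_cov M \<kappa> W W' \<longleftrightarrow> (\<forall>a b c d. 0 \<le> a \<and> a \<le> b \<and> 0 \<le> c \<and> c \<le> d \<longrightarrow>
     (\<integral>w. (W b w - W a w) * (W' d w - W' c w) \<partial>M) = \<kappa> * (LINT r|lborel. indicator {a<..b} r * indicator {c<..d} r))"

definition valid_steps :: "real \<Rightarrow> (real \<times> real \<times> (real^'n)) list \<Rightarrow> bool" where
  "valid_steps t S \<longleftrightarrow> (\<forall>(a, b, c)\<in>set S. 0 \<le> a \<and> a \<le> b \<and> b \<le> t)"

lemma step_fun_Nil: "step_fun [] r = 0" and step_fun_Cons:
  "step_fun ((a, b, c) # S) r = indicator {a<..b} r *\<^sub>R c + step_fun S r"
  by (simp_all add: step_fun_def)

lemma step_integral_Nil: "step_integral W [] w = 0" and step_integral_Cons: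
  "step_integral W ((a, b, c) # S) w = (W b w - W a w) *\<^sub>R c + step_integral W S w"
  by (simp_all add: step_integral_def)

lemma valid_steps_Cons: "valid_steps t ((a, b, c) # S) \<longleftrightarrow> 0 \<le> a \<and> a \<le> b \<and> b \<le> t \<and> valid_steps t S"
  by (auto simp: valid_steps_def)

lemma step_fun_outside: "valid_steps t S \<Longrightarrow> r \<notin> {0..t} \<Longrightarrow> step_fun S r = 0"
proof (induction S)
  case (Cons x S)
  obtain a b c where x: "x = (a, b, c)" by (cases x)
  show ?case using Cons by (auto simp: x step_fun_Cons valid_steps_Cons indicator_def)
qed (simp add: step_fun_Nil)

lemma sq_integrable_indicator: "sq_integrable lborel (\<lambda>r::real. indicator {a<..b} r *\<^sub>R c)"
proof -
  have "integrable lborel (\<lambda>r::real. indicator {a<..b} r * (norm c)\<^sup>2)"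
    by (cases "a \<le> b") auto
  moreover have "(norm (indicator {a<..b} r *\<^sub>R c))\<^sup>2 = indicator {a<..b} r * (norm c)\<^sup>2" for r :: real
    by (simp add: indicator_def)
  ultimately show ?thesis by (simp add: sq_integrable_def)
qed

lemma sq_integrable_step_fun:
  fixes S :: "(real \<times> real \<times> (real^'n)) list"
  shows "sq_integrable lborel (step_fun S)"
proof (induction S)
  case Nil
  have "step_fun [] = (\<lambda>r. 0 :: real^'n)" by (simp add: fun_eq_iff step_fun_Nil)
  thus ?case by (simp add: sq_integrable_zero)
next
  case (Cons x S)
  obtain a b c where x: "x = (a, b, c)" by (cases x)
  have "step_fun (x # S) = (\<lambda>r. indicator {a<..b} r *\<^sub>R c + step_fun S r)" by (simp add: x step_fun_Cons fun_eq_iff)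
  thus ?case using sq_integrable_add[OF sq_integrable_indicator Cons] by simp
qed

abbreviation leb :: "real \<Rightarrow> real measure" where "leb t \<equiv> restrict_space lborel {0..t}"

lemma sq_integrable_leb: "sq_integrable lborel f \<Longrightarrow> sq_integrable (leb t) f"
  unfolding sq_integrable_iff_nn_integral
  by (auto simp: nn_integral_restrict_space intro!: measurable_restrict_space1
      intro: le_less_trans[OF nn_integral_mono] simp: indicator_def)

lemma integral_leb:
  fixes f :: "real \<Rightarrow> 'b::{banach, second_countable_topology}"
  shows "integral\<^sup>L (leb t) f = (LINT r:{0..t}|lborel. f r)"
  by (simp add: integral_restrict_space set_lebesgue_integral_def)

lemma integrable_leb:
  fixes f :: "real \<Rightarrow> 'b::{banach, second_countable_topology}"
  shows "integrable (leb t) f = set_integrable lborel {0..t} f"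
  by (simp add: integrable_restrict_space set_integrable_def)

lemma integral_leb_step_fun:
  fixes Y :: "real^'n^'n"
  assumes "valid_steps t S"
  shows "(LINT r|lborel. step_fun S r \<bullet> (Y *v step_fun S' r)) = (\<integral>r. step_fun S r \<bullet> (Y *v step_fun S' r) \<partial>leb t)"
  unfolding integral_leb set_lebesgue_integral_def
proof (intro Bochner_Integration.integral_cong refl)
  fix r
  show "step_fun S r \<bullet> (Y *v step_fun S' r) = indicator {0..t} r *\<^sub>R (step_fun S r \<bullet> (Y *v step_fun S' r))"
    using step_fun_outside[OF assms, of r] by (cases "r \<in> {0..t}") auto
qed

context filtered_prob begin

text \<open>Reduces to E (B_s B_t) = min s t, which holds since the increment after s is orthogonal
  to the past.\<close>

lemma incr_cov_same:
  assumes W: "brownian_motion M F W"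
  shows "incr_cov M 1 W W"
proof -
  \<comment> \<open>\<open>W 0\<close> vanishes only almost surely and is therefore
    subtracted.\<close>
  define B where "B t w = W t w - W 0 w" for t w
  have mB: "B t \<in> borel_measurable (F t)" if "0 \<le> t" for t
    using brownian_measurable[OF W that] measurable_F_mono[OF brownian_measurable(1)[OF W order_refl] that]
    unfolding B_def by measurable
  have mB': "B t \<in> borel_measurable M" if "0 \<le> t" for t using measurable_F[OF mB[OF that]] .
  have B2: "integrable M (\<lambda>w. (B t w)\<^sup>2)" "integrable M (B t)" "expectation (\<lambda>w. (B t w)\<^sup>2) = t" if "0 \<le> t" for t
    using brownian_increment[OF W order_refl that] unfolding B_def by auto
  have le: "expectation (\<lambda>w. B s w * B t w) = s" if st: "0 \<le> s" "s \<le> t" for s t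
  proof -
    have "expectation (\<lambda>w. B s w * B t w) = expectation (\<lambda>w. (B s w)\<^sup>2 + B s w * (W t w - W s w))"
      by (intro Bochner_Integration.integral_cong refl) (simp add: B_def power2_eq_square algebra_simps)
    also have "\<dots> = s"
      using brownian_increment_orthogonal[OF W st mB[OF st(1)] B2(2)[OF st(1)]] B2[OF st(1)] by simp
    finally show ?thesis .
  qed
  have EB: "expectation (\<lambda>w. B s w * B t w) = min s t" if st: "0 \<le> s" "0 \<le> t" for s t
  proof (cases "s \<le> t")
    case False
    have "expectation (\<lambda>w. B s w * B t w) = expectation (\<lambda>w. B t w * B s w)" by (simp add: mult.commute)
    thus ?thesis using le[of t s] False st by simp
  qed (use le st in simp)
  have iB: "integrable M (\<lambda>w. B s w * B t w)" if "0 \<le> s" "0 \<le> t" for s t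
    using that by (intro integrable_mult_of_squares mB' B2)
  show ?thesis unfolding incr_cov_def
  proof (intro allI impI)
    fix a b c d :: real assume h: "0 \<le> a \<and> a \<le> b \<and> 0 \<le> c \<and> c \<le> d"
    have "expectation (\<lambda>w. (W b w - W a w) * (W d w - W c w))
      = expectation (\<lambda>w. B b w * B d w - B b w * B c w - B a w * B d w + B a w * B c w)"
      by (intro Bochner_Integration.integral_cong refl) (simp add: B_def algebra_simps)
    also have "\<dots> = min b d - min b c - min a d + min a c"
      using h iB EB by simp
    also have "\<dots> = max 0 (min b d - max a c)" using h by (auto simp: min_def max_def)
    finally show "expectation (\<lambda>w. (W b w - W a w) * (W d w - W c w))
      = 1 * (LINT r|lborel. indicator {a<..b} r * indicator {c<..d} r)"
      using h by (simp add: lborel_integral_indicator_mult)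
  qed
qed

lemma incr_cov_indep:
  assumes W: "\<And>i. i \<in> I \<Longrightarrow> brownian_motion M F (W i)" and ij: "i \<in> I" "j \<in> I" "i \<noteq> j"
    and ind: "indep_vars (\<lambda>_. PiM {0..} (\<lambda>_. borel)) (\<lambda>i w. \<lambda>t\<in>{0..}. W i t w) I"
  shows "incr_cov M 0 (W i) (W j)"
  unfolding incr_cov_def
proof (intro allI impI)
  fix a b c d :: real assume h: "0 \<le> a \<and> a \<le> b \<and> 0 \<le> c \<and> c \<le> d"
  \<comment> \<open>One family indexed by {i, j}, each index with its own endpoints, so that
    independence of the paths passes to the two increments.\<close>
  define l where "l k = (if k = i then a else c)" for k
  define u where "u k = (if k = i then b else d)" for k
  have lu: "0 \<le> l k" "l k \<le> u k" "0 \<le> u k" for k using h by (auto simp: l_def u_def)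
  have "indep_vars (\<lambda>_. PiM {0..} (\<lambda>_. borel)) (\<lambda>i w. \<lambda>t\<in>{0..}. W i t w) {i, j}"
    by (rule indep_vars_subset[OF ind]) (use ij in auto)
  hence "indep_vars (\<lambda>_. borel) (\<lambda>k w. (\<lambda>t\<in>{0..}. W k t w) (u k) - (\<lambda>t\<in>{0..}. W k t w) (l k)) {i, j}"
    by (rule indep_vars_compose2) (intro borel_measurable_diff measurable_component_singleton, use lu in auto)
  hence "indep_vars (\<lambda>_. borel) (\<lambda>k w. W k (u k) w - W k (l k) w) {i, j}"
    using lu by simp
  hence "expectation (\<lambda>w. \<Prod>k\<in>{i, j}. W k (u k) w - W k (l k) w) = (\<Prod>k\<in>{i, j}. expectation (\<lambda>w. W k (u k) w - W k (l k) w))"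
    by (intro indep_vars_lebesgue_integral brownian_increment lu) (use W ij in auto)
  moreover have "expectation (\<lambda>w. W i (u i) w - W i (l i) w) = 0"
    by (intro brownian_increment lu W ij)
  ultimately show "expectation (\<lambda>w. (W i b w - W i a w) * (W j d w - W j c w))
      = 0 * (LINT r|lborel. indicator {a<..b} r * indicator {c<..d} r)"
    using ij by (simp add: l_def u_def)
qed

lemma sq_integrable_increment:
  assumes W: "brownian_motion M F W" and ab: "0 \<le> a" "a \<le> b"
  shows "sq_integrable M (\<lambda>w. (W b w - W a w) *\<^sub>R c)"
proof -
  have [measurable]: "W a \<in> borel_measurable M" "W b \<in> borel_measurable M"
    using brownian_measurable[OF W] ab by auto
  have "integrable M (\<lambda>w. (W b w - W a w)\<^sup>2 * (norm c)\<^sup>2)" using brownian_increment(1)[OF W ab] by simp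
  thus ?thesis by (simp add: sq_integrable_def power_mult_distrib)
qed

lemma sq_integrable_step_integral:
  fixes S :: "(real \<times> real \<times> (real^'n)) list"
  assumes W: "brownian_motion M F W" and "valid_steps t S"
  shows "sq_integrable M (step_integral W S)"
  using assms(2)
proof (induction S)
  case Nil
  have "step_integral W [] = (\<lambda>w. 0 :: real^'n)" by (simp add: fun_eq_iff step_integral_Nil)
  thus ?case by (simp add: sq_integrable_zero)
next
  case (Cons x S)
  obtain a b c where x: "x = (a, b, c)" by (cases x)
  have "step_integral W (x # S) = (\<lambda>w. (W b w - W a w) *\<^sub>R c + step_integral W S w)" by (simp add: x step_integral_Cons fun_eq_iff)
  moreover have "0 \<le> a" "a \<le> b" "valid_steps t S" using Cons(2) by (auto simp: x valid_steps_Cons)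
  ultimately show ?case using sq_integrable_add[OF sq_integrable_increment[OF W] Cons.IH] by simp
qed

text \<open>Both sides are bilinear in the two lists; a double induction reduces the claim to a pair
  of single steps. The matrix Y provides for arbitrary quadratic forms later.\<close>

lemma step_integral_cov:
  fixes Y :: "real^'n^'n"
  assumes W: "brownian_motion M F W" and W': "brownian_motion M F W'" and cov: "incr_cov M \<kappa> W W'"
    and S: "valid_steps t S" and S': "valid_steps t' S'"
  shows "expectation (\<lambda>w. step_integral W S w \<bullet> (Y *v step_integral W' S' w))
    = \<kappa> * (LINT r|lborel. step_fun S r \<bullet> (Y *v step_fun S' r))"
  using S
proof (induction S)
  case Nil
  show ?case by (simp add: step_fun_Nil step_integral_Nil)
next
  case (Cons x S)
  obtain a b c where x: "x = (a, b, c)" by (cases x)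
  have ab: "0 \<le> a" "a \<le> b" "valid_steps t S" using Cons(2) by (auto simp: x valid_steps_Cons)
  have one: "expectation (\<lambda>w. ((W b w - W a w) *\<^sub>R c) \<bullet> (Y *v step_integral W' S' w))
    = \<kappa> * (LINT r|lborel. (indicator {a<..b} r *\<^sub>R c) \<bullet> (Y *v step_fun S' r))"
    using S'
  proof (induction S')
    case Nil
    show ?case by (simp add: step_fun_Nil step_integral_Nil)
  next
    case (Cons x' S')
    obtain a' b' c' where x': "x' = (a', b', c')" by (cases x')
    have ab': "0 \<le> a'" "a' \<le> b'" "valid_steps t' S'" using Cons(2) by (auto simp: x' valid_steps_Cons)
    have i1: "integrable M (\<lambda>w. ((W b w - W a w) *\<^sub>R c) \<bullet> (Y *v ((W' b' w - W' a' w) *\<^sub>R c')))"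
      "integrable M (\<lambda>w. ((W b w - W a w) *\<^sub>R c) \<bullet> (Y *v step_integral W' S' w))"
      by (intro sq_integrable_inner sq_integrable_matrix sq_integrable_increment W W' ab ab' sq_integrable_step_integral[OF W' ab'(3)])+
    have i2: "integrable lborel (\<lambda>r::real. (indicator {a<..b} r *\<^sub>R c) \<bullet> (Y *v (indicator {a'<..b'} r *\<^sub>R c')))"
      "integrable lborel (\<lambda>r::real. (indicator {a<..b} r *\<^sub>R c) \<bullet> (Y *v step_fun S' r))"
      by (intro sq_integrable_inner sq_integrable_matrix sq_integrable_indicator sq_integrable_step_fun)+
    have "expectation (\<lambda>w. ((W b w - W a w) *\<^sub>R c) \<bullet> (Y *v ((W' b' w - W' a' w) *\<^sub>R c')))
      = expectation (\<lambda>w. ((W b w - W a w) * (W' b' w - W' a' w)) * (c \<bullet> (Y *v c')))"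
      by (intro Bochner_Integration.integral_cong refl) (simp add: matrix_vector_mult_scaleR)
    also have "\<dots> = (\<kappa> * (LINT r|lborel. indicator {a<..b} r * indicator {a'<..b'} r)) * (c \<bullet> (Y *v c'))"
      using cov ab ab' unfolding incr_cov_def by simp
    also have "\<dots> = \<kappa> * (LINT r|lborel. (indicator {a<..b} r *\<^sub>R c) \<bullet> (Y *v (indicator {a'<..b'} r *\<^sub>R c')))"
    proof -
      have "(indicator {a<..b} r *\<^sub>R c) \<bullet> (Y *v (indicator {a'<..b'} r *\<^sub>R c'))
        = (indicator {a<..b} r * indicator {a'<..b'} r) * (c \<bullet> (Y *v c'))" for r :: real
        by (simp add: matrix_vector_mult_scaleR)
      hence eq: "(\<lambda>r::real. (indicator {a<..b} r *\<^sub>R c) \<bullet> (Y *v (indicator {a'<..b'} r *\<^sub>R c')))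
        = (\<lambda>r. (indicator {a<..b} r * indicator {a'<..b'} r) * (c \<bullet> (Y *v c')))" by (rule ext)
      show ?thesis unfolding eq by simp
    qed
    finally have e: "expectation (\<lambda>w. ((W b w - W a w) *\<^sub>R c) \<bullet> (Y *v ((W' b' w - W' a' w) *\<^sub>R c')))
      = \<kappa> * (LINT r|lborel. (indicator {a<..b} r *\<^sub>R c) \<bullet> (Y *v (indicator {a'<..b'} r *\<^sub>R c')))" .
    show ?case
      using Cons.IH[OF ab'(3)] e i1 i2
      unfolding x' step_fun_Cons step_integral_Cons matrix_vector_right_distrib inner_add_right
      by (simp add: distrib_left)
  qed
  have i1: "integrable M (\<lambda>w. ((W b w - W a w) *\<^sub>R c) \<bullet> (Y *v step_integral W' S' w))"
    "integrable M (\<lambda>w. step_integral W S w \<bullet> (Y *v step_integral W' S' w))"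
    by (intro sq_integrable_inner sq_integrable_matrix sq_integrable_increment W W' ab
        sq_integrable_step_integral[OF W' S'] sq_integrable_step_integral[OF W ab(3)])+
  have i2: "integrable lborel (\<lambda>r::real. (indicator {a<..b} r *\<^sub>R c) \<bullet> (Y *v step_fun S' r))"
    "integrable lborel (\<lambda>r::real. step_fun S r \<bullet> (Y *v step_fun S' r))"
    by (intro sq_integrable_inner sq_integrable_matrix sq_integrable_indicator sq_integrable_step_fun)+
  show ?case
    using Cons.IH[OF ab(3)] one i1 i2
    unfolding x step_fun_Cons step_integral_Cons inner_add_left
    by (simp add: distrib_left)
qed

text \<open>Square integrability of g and I is a conclusion: \<open>is_ito_integral\<close> speaks
  only of distances that tend to 0.\<close>

lemma ito_approximation:
  assumes W: "brownian_motion M F W" and I: "is_ito_integral M W g t I" and g: "g \<in> borel_measurable (leb t)"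
  obtains S where "\<And>k. valid_steps t (S k)" "sq_integrable M I" "sq_integrable (leb t) g"
    "(\<lambda>k. \<integral>r. (norm (step_fun (S k) r - g r))\<^sup>2 \<partial>leb t) \<longlonglongrightarrow> 0"
    "(\<lambda>k. \<integral>w. (norm (step_integral W (S k) w - I w))\<^sup>2 \<partial>M) \<longlonglongrightarrow> 0"
proof -
  from I obtain S where S: "\<And>k. valid_steps t (S k)"
    and l1: "(\<lambda>k. \<integral>\<^sup>+r\<in>{0..t}. ennreal ((norm (step_fun (S k) r - g r))\<^sup>2) \<partial>lborel) \<longlonglongrightarrow> 0"
    and l2: "(\<lambda>k. \<integral>\<^sup>+w. ennreal ((norm (step_integral W (S k) w - I w))\<^sup>2) \<partial>M) \<longlonglongrightarrow> 0"
    and mI: "I \<in> borel_measurable M"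
    unfolding is_ito_integral_def valid_steps_def by blast
  have "(\<lambda>k. \<integral>\<^sup>+r. ennreal ((norm (step_fun (S k) r - g r))\<^sup>2) \<partial>leb t) \<longlonglongrightarrow> 0"
    using l1 by (simp add: nn_integral_restrict_space)
  from L2_limit_sq_integrable[OF sq_integrable_leb[OF sq_integrable_step_fun] g this]
    L2_limit_sq_integrable[OF sq_integrable_step_integral[OF W S] mI l2] S that
  show ?thesis by blast
qed

lemma ito_cov:
  fixes Y :: "real^'n^'n"
  assumes W: "brownian_motion M F W" and W': "brownian_motion M F W'" and cov: "incr_cov M \<kappa> W W'"
    and I: "is_ito_integral M W g t I" "g \<in> borel_measurable (leb t)"
    and I': "is_ito_integral M W' g' t I'" "g' \<in> borel_measurable (leb t)"
  shows "expectation (\<lambda>w. I w \<bullet> (Y *v I' w)) = \<kappa> * (\<integral>r. g r \<bullet> (Y *v g' r) \<partial>leb t)"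
proof -
  obtain S where S: "\<And>k. valid_steps t (S k)" "sq_integrable M I" "sq_integrable (leb t) g"
    "(\<lambda>k. \<integral>r. (norm (step_fun (S k) r - g r))\<^sup>2 \<partial>leb t) \<longlonglongrightarrow> 0"
    "(\<lambda>k. \<integral>w. (norm (step_integral W (S k) w - I w))\<^sup>2 \<partial>M) \<longlonglongrightarrow> 0"
    using ito_approximation[OF W I] by blast
  obtain S' where S': "\<And>k. valid_steps t (S' k)" "sq_integrable M I'" "sq_integrable (leb t) g'"
    "(\<lambda>k. \<integral>r. (norm (step_fun (S' k) r - g' r))\<^sup>2 \<partial>leb t) \<longlonglongrightarrow> 0"
    "(\<lambda>k. \<integral>w. (norm (step_integral W' (S' k) w - I' w))\<^sup>2 \<partial>M) \<longlonglongrightarrow> 0"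
    using ito_approximation[OF W' I'] by blast
  note sf = sq_integrable_leb[OF sq_integrable_step_fun]
  have "(\<lambda>k. expectation (\<lambda>w. step_integral W (S k) w \<bullet> (Y *v step_integral W' (S' k) w))) \<longlonglongrightarrow> expectation (\<lambda>w. I w \<bullet> (Y *v I' w))"
    by (intro L2_limit_inner L2_limit_matrix sq_integrable_matrix S S' sq_integrable_step_integral[OF W S(1)]
        sq_integrable_step_integral[OF W' S'(1)])
  moreover have "(\<lambda>k. \<integral>r. step_fun (S k) r \<bullet> (Y *v step_fun (S' k) r) \<partial>leb t) \<longlonglongrightarrow> (\<integral>r. g r \<bullet> (Y *v g' r) \<partial>leb t)"
    by (intro L2_limit_inner L2_limit_matrix sq_integrable_matrix S S' sf)
  hence "(\<lambda>k. \<kappa> * (\<integral>r. step_fun (S k) r \<bullet> (Y *v step_fun (S' k) r) \<partial>leb t)) \<longlonglongrightarrow> \<kappa> * (\<integral>r. g r \<bullet> (Y *v g' r) \<partial>leb t)"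
    by (rule tendsto_mult_left)
  ultimately show ?thesis
    by (simp add: step_integral_cov[OF W W' cov S(1) S'(1)] integral_leb_step_fun[OF S(1)] LIMSEQ_unique)
qed

text \<open>All covariances among I and I' equal the integral of |g|^2, so E |I - I'|^2 = 0. This
  identifies the noises in the state equations of two different controls.\<close>

lemma ito_unique:
  assumes W: "brownian_motion M F W" and g: "g \<in> borel_measurable (leb t)"
    and I: "is_ito_integral M W g t I" and I': "is_ito_integral M W g t I'"
  shows "AE w in M. I w = I' w"
proof -
  obtain sI: "sq_integrable M I" using ito_approximation[OF W I g] by blast
  obtain sI': "sq_integrable M I'" using ito_approximation[OF W I' g] by blast
  note c = ito_cov[OF W W incr_cov_same[OF W], where Y = "mat 1", simplified]
  have "expectation (\<lambda>w. (norm (I w - I' w))\<^sup>2) = expectation (\<lambda>w. I w \<bullet> I w - 2 * (I w \<bullet> I' w) + I' w \<bullet> I' w)"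
    unfolding power2_norm_eq_inner
    by (intro Bochner_Integration.integral_cong refl) (simp add: inner_diff_left inner_diff_right inner_commute)
  also have "\<dots> = 0"
    using sq_integrable_inner[OF sI sI] sq_integrable_inner[OF sI sI'] sq_integrable_inner[OF sI' sI'] c[OF I g I g] c[OF I g I' g] c[OF I' g I' g] by simp
  finally have "AE w in M. (norm (I w - I' w))\<^sup>2 = 0"
    using sq_integrable_norm2[OF sq_integrable_diff[OF sI sI']] by (subst (asm) integral_nonneg_eq_0_iff_AE) auto
  thus ?thesis by simp
qed

text \<open>An interval beyond t becomes the empty interval from t to t: the list stays valid and
  the step contributes 0.\<close>

definition cut_steps :: "real \<Rightarrow> (real \<times> real \<times> (real^'n)) list \<Rightarrow> (real \<times> real \<times> (real^'n)) list" where
  "cut_steps t S = map (\<lambda>(a, b, c). (min a t, min b t, c)) S"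

lemma valid_cut_steps: "valid_steps T S \<Longrightarrow> 0 \<le> t \<Longrightarrow> valid_steps t (cut_steps t S)"
  by (fastforce simp: valid_steps_def cut_steps_def)

lemma step_fun_cut_steps: "r \<le> t \<Longrightarrow> step_fun (cut_steps t S) r = step_fun S r"
proof (induction S)
  case (Cons x S)
  obtain a b c where x: "x = (a, b, c)" by (cases x)
  have "indicator {min a t<..min b t} r = (indicator {a<..b} r :: real)" using Cons(2) by (auto simp: indicator_def)
  moreover have "cut_steps t (x # S) = (min a t, min b t, c) # cut_steps t S" by (simp add: x cut_steps_def)
  ultimately show ?case using Cons by (simp add: step_fun_Cons x)
qed (simp add: cut_steps_def)

text \<open>Every increment splits at t, and the part after t is orthogonal to Z.\<close>

lemma step_integral_cut_steps:
  assumes W: "brownian_motion M F W" and S: "valid_steps T S" and t: "0 \<le> t"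
    and Z: "sq_integrable M Z" "Z \<in> borel_measurable (F t)"
  shows "expectation (\<lambda>w. step_integral W (cut_steps t S) w \<bullet> Z w) = expectation (\<lambda>w. step_integral W S w \<bullet> Z w)"
  using S
proof (induction S)
  case (Cons x S)
  obtain a b c where x: "x = (a, b, c)" by (cases x)
  have ab: "0 \<le> a" "a \<le> b" "valid_steps T S" using Cons(2) by (auto simp: x valid_steps_Cons)
  have cut: "cut_steps t (x # S) = (min a t, min b t, c) # cut_steps t S" by (simp add: x cut_steps_def)
  have i1: "integrable M (\<lambda>w. ((W (min b t) w - W (min a t) w) *\<^sub>R c) \<bullet> Z w)"
    by (rule sq_integrable_inner[OF sq_integrable_increment[OF W] Z(1)]) (use ab t in auto)
  note i = i1 sq_integrable_inner[OF sq_integrable_step_integral[OF W valid_cut_steps[OF ab(3) t]] Z(1)]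
    sq_integrable_inner[OF sq_integrable_step_integral[OF W ab(3)] Z(1)]
  have mc: "(\<lambda>w. c \<bullet> Z w) \<in> borel_measurable (F (max a t))"
    using measurable_F_mono[OF Z(2), of "max a t"] by measurable
  have ic: "integrable M (\<lambda>w. c \<bullet> Z w)"
    using sq_integrable_inner[OF sq_integrable_const Z(1)] finite_measure_axioms by blast
  have ab': "0 \<le> max a t" "max a t \<le> max b t" using ab t by auto
  note o = brownian_increment_orthogonal[OF W ab' mc ic]
  have eq: "W b w - W a w = (W (min b t) w - W (min a t) w) + (W (max b t) w - W (max a t) w)" for w
    using ab by (auto simp: min_def max_def)
  have "expectation (\<lambda>w. step_integral W (x # S) w \<bullet> Z w)
    = expectation (\<lambda>w. ((W (min b t) w - W (min a t) w) *\<^sub>R c) \<bullet> Z w + (c \<bullet> Z w) * (W (max b t) w - W (max a t) w) + step_integral W S w \<bullet> Z w)"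
    unfolding x step_integral_Cons inner_add_left eq
    by (intro Bochner_Integration.integral_cong refl) (simp add: algebra_simps)
  also have "\<dots> = expectation (\<lambda>w. ((W (min b t) w - W (min a t) w) *\<^sub>R c) \<bullet> Z w) + expectation (\<lambda>w. step_integral W (cut_steps t S) w \<bullet> Z w)"
    using i o Cons.IH[OF ab(3)] by simp
  also have "\<dots> = expectation (\<lambda>w. step_integral W (cut_steps t (x # S)) w \<bullet> Z w)"
    using i unfolding cut step_integral_Cons inner_add_left by simp
  finally show ?case by simp
qed (simp add: cut_steps_def)

text \<open>I and J come with unrelated approximating steps. Cutting those of I at t does not change
  the pairing with Z, and by the isometry on [0,t] the cut integrals converge to J as well.\<close>

lemma ito_martingale:
  assumes W: "brownian_motion M F W" and t: "0 \<le> t" "t \<le> T" and g: "g \<in> borel_measurable (leb T)" "g \<in> borel_measurable (leb t)"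
    and I: "is_ito_integral M W g T I" and J: "is_ito_integral M W g t J"
    and Z: "sq_integrable M Z" "Z \<in> borel_measurable (F t)"
  shows "expectation (\<lambda>w. I w \<bullet> Z w) = expectation (\<lambda>w. J w \<bullet> Z w)"
proof -
  obtain S where S: "\<And>k. valid_steps T (S k)" "sq_integrable M I" "sq_integrable (leb T) g"
    "(\<lambda>k. \<integral>r. (norm (step_fun (S k) r - g r))\<^sup>2 \<partial>leb T) \<longlonglongrightarrow> 0"
    "(\<lambda>k. \<integral>w. (norm (step_integral W (S k) w - I w))\<^sup>2 \<partial>M) \<longlonglongrightarrow> 0"
    using ito_approximation[OF W I g(1)] by blast
  obtain S' where S': "\<And>k. valid_steps t (S' k)" "sq_integrable M J" "sq_integrable (leb t) g"
    "(\<lambda>k. \<integral>r. (norm (step_fun (S' k) r - g r))\<^sup>2 \<partial>leb t) \<longlonglongrightarrow> 0"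
    "(\<lambda>k. \<integral>w. (norm (step_integral W (S' k) w - J w))\<^sup>2 \<partial>M) \<longlonglongrightarrow> 0"
    using ito_approximation[OF W J g(2)] by blast
  let ?A = "\<lambda>k. step_integral W (cut_steps t (S k))" and ?B = "\<lambda>k. step_integral W (S' k)"
  note vc = valid_cut_steps[OF S(1) t(1)]
  note sA = sq_integrable_step_integral[OF W vc] and sB = sq_integrable_step_integral[OF W S'(1)]
  note c = step_integral_cov[OF W W incr_cov_same[OF W], where Y = "mat 1", simplified]
  note cc = integral_leb_step_fun[where Y = "mat 1", simplified]
  note sf = sq_integrable_leb[OF sq_integrable_step_fun]
  \<comment> \<open>On [0,t] the cut steps agree with the uncut ones, so both sequences approximate
    the same g there.\<close>
  have AB: "expectation (\<lambda>w. (norm (?A k w - ?B k w))\<^sup>2) \<le> 2 * (\<integral>r. (norm (step_fun (S k) r - g r))\<^sup>2 \<partial>leb T)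
     + 2 * (\<integral>r. (norm (step_fun (S' k) r - g r))\<^sup>2 \<partial>leb t)" for k
  proof -
    let ?a = "step_fun (cut_steps t (S k))" and ?b = "step_fun (S' k)"
    have "expectation (\<lambda>w. (norm (?A k w - ?B k w))\<^sup>2) = expectation (\<lambda>w. ?A k w \<bullet> ?A k w - 2 * (?A k w \<bullet> ?B k w) + ?B k w \<bullet> ?B k w)"
      unfolding power2_norm_eq_inner
      by (intro Bochner_Integration.integral_cong refl) (simp add: inner_diff_left inner_diff_right inner_commute)
    also have "\<dots> = (\<integral>r. ?a r \<bullet> ?a r \<partial>leb t) - 2 * (\<integral>r. ?a r \<bullet> ?b r \<partial>leb t) + (\<integral>r. ?b r \<bullet> ?b r \<partial>leb t)"
      using sq_integrable_inner[OF sA sA] sq_integrable_inner[OF sA sB] sq_integrable_inner[OF sB sB]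
      by (simp add: c[OF vc vc] c[OF vc S'(1)] c[OF S'(1) S'(1)] cc[OF vc] cc[OF S'(1)])
    also have "\<dots> = (\<integral>r. ?a r \<bullet> ?a r - 2 * (?a r \<bullet> ?b r) + ?b r \<bullet> ?b r \<partial>leb t)"
    proof -
      have "integrable (leb t) (\<lambda>r. ?a r \<bullet> ?a r)" "integrable (leb t) (\<lambda>r. ?a r \<bullet> ?b r)" "integrable (leb t) (\<lambda>r. ?b r \<bullet> ?b r)"
        by (intro sq_integrable_inner sf)+
      thus ?thesis by simp
    qed
    also have "\<dots> = (\<integral>r. (norm (step_fun (S k) r - ?b r))\<^sup>2 \<partial>leb t)"
      unfolding power2_norm_eq_inner
      by (intro Bochner_Integration.integral_cong refl)
         (simp add: inner_diff_left inner_diff_right inner_commute step_fun_cut_steps space_restrict_space)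
    also have "\<dots> \<le> (\<integral>r. 2 * (norm (step_fun (S k) r - g r))\<^sup>2 + 2 * (norm (?b r - g r))\<^sup>2 \<partial>leb t)"
    proof (rule integral_mono)
      show "integrable (leb t) (\<lambda>r. (norm (step_fun (S k) r - ?b r))\<^sup>2)" by (intro sq_integrable_norm2 sq_integrable_diff sf)
      have "integrable (leb t) (\<lambda>r. (norm (step_fun (S k) r - g r))\<^sup>2)" "integrable (leb t) (\<lambda>r. (norm (?b r - g r))\<^sup>2)"
        by (intro sq_integrable_norm2 sq_integrable_diff sf S'(3))+
      thus "integrable (leb t) (\<lambda>r. 2 * (norm (step_fun (S k) r - g r))\<^sup>2 + 2 * (norm (?b r - g r))\<^sup>2)" by simp
      show "(norm (step_fun (S k) r - ?b r))\<^sup>2 \<le> 2 * (norm (step_fun (S k) r - g r))\<^sup>2 + 2 * (norm (?b r - g r))\<^sup>2" for r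
        using norm_add_squared_le[of "step_fun (S k) r - g r" "g r - ?b r"] by (simp add: norm_minus_commute)
    qed
    also have "\<dots> = 2 * (\<integral>r. (norm (step_fun (S k) r - g r))\<^sup>2 \<partial>leb t) + 2 * (\<integral>r. (norm (?b r - g r))\<^sup>2 \<partial>leb t)"
      using sq_integrable_norm2[OF sq_integrable_diff[OF sf S'(3)]] by simp
    also have "(\<integral>r. (norm (step_fun (S k) r - g r))\<^sup>2 \<partial>leb t) \<le> (\<integral>r. (norm (step_fun (S k) r - g r))\<^sup>2 \<partial>leb T)"
    proof -
      have "set_integrable lborel {0..T} (\<lambda>r. (norm (step_fun (S k) r - g r))\<^sup>2)"
        using sq_integrable_norm2[OF sq_integrable_diff[OF sf S(3)]] by (simp add: integrable_leb)
      note iT = this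
      have "set_integrable lborel {0..t} (\<lambda>r. (norm (step_fun (S k) r - g r))\<^sup>2)"
        by (rule set_integrable_subset[OF iT]) (use t in auto)
      from integral_mono[OF this[unfolded set_integrable_def] iT[unfolded set_integrable_def]]
      show ?thesis unfolding integral_leb set_lebesgue_integral_def
        using t by (auto simp: indicator_def)
    qed
    finally show ?thesis by simp
  qed
  have "expectation (\<lambda>w. (norm (?A k w - J w))\<^sup>2) \<le> 2 * expectation (\<lambda>w. (norm (?A k w - ?B k w))\<^sup>2)
      + 2 * expectation (\<lambda>w. (norm (?B k w - J w))\<^sup>2)" for k
  proof -
    note i = sq_integrable_norm2[OF sq_integrable_diff[OF sA sB]] sq_integrable_norm2[OF sq_integrable_diff[OF sB S'(2)]]
    have "expectation (\<lambda>w. (norm (?A k w - J w))\<^sup>2) \<le> expectation (\<lambda>w. 2 * (norm (?A k w - ?B k w))\<^sup>2 + 2 * (norm (?B k w - J w))\<^sup>2)"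
    proof (rule integral_mono)
      show "integrable M (\<lambda>w. (norm (?A k w - J w))\<^sup>2)" by (intro sq_integrable_norm2 sq_integrable_diff sA S'(2))
      show "integrable M (\<lambda>w. 2 * (norm (?A k w - ?B k w))\<^sup>2 + 2 * (norm (?B k w - J w))\<^sup>2)" using i by simp
      show "(norm (?A k w - J w))\<^sup>2 \<le> 2 * (norm (?A k w - ?B k w))\<^sup>2 + 2 * (norm (?B k w - J w))\<^sup>2" for w
        using norm_add_squared_le[of "?A k w - ?B k w" "?B k w - J w"] by simp
    qed
    thus ?thesis using i by simp
  qed
  note le = this
  have le: "norm (expectation (\<lambda>w. (norm (?A k w - J w))\<^sup>2)) \<le> 4 * (\<integral>r. (norm (step_fun (S k) r - g r))\<^sup>2 \<partial>leb T)
     + 4 * (\<integral>r. (norm (step_fun (S' k) r - g r))\<^sup>2 \<partial>leb t) + 2 * expectation (\<lambda>w. (norm (?B k w - J w))\<^sup>2)" for k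
  proof -
    have "norm (expectation (\<lambda>w. (norm (?A k w - J w))\<^sup>2)) = expectation (\<lambda>w. (norm (?A k w - J w))\<^sup>2)" by simp
    thus ?thesis using AB[of k] le[of k] by linarith
  qed
  have "(\<lambda>k. 4 * (\<integral>r. (norm (step_fun (S k) r - g r))\<^sup>2 \<partial>leb T)
     + 4 * (\<integral>r. (norm (step_fun (S' k) r - g r))\<^sup>2 \<partial>leb t) + 2 * expectation (\<lambda>w. (norm (?B k w - J w))\<^sup>2)) \<longlonglongrightarrow> 4 * 0 + 4 * 0 + 2 * 0"
    by (intro tendsto_intros S S')
  hence lim: "(\<lambda>k. 4 * (\<integral>r. (norm (step_fun (S k) r - g r))\<^sup>2 \<partial>leb T)
     + 4 * (\<integral>r. (norm (step_fun (S' k) r - g r))\<^sup>2 \<partial>leb t) + 2 * expectation (\<lambda>w. (norm (?B k w - J w))\<^sup>2)) \<longlonglongrightarrow> 0" by simp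
  have AJ: "(\<lambda>k. expectation (\<lambda>w. (norm (?A k w - J w))\<^sup>2)) \<longlonglongrightarrow> 0"
    by (rule Lim_null_comparison[OF always_eventually lim]) (use le in blast)
  have Z0: "(\<lambda>k. expectation (\<lambda>w. (norm (Z w - Z w))\<^sup>2)) \<longlonglongrightarrow> 0" by simp
  have "(\<lambda>k. expectation (\<lambda>w. ?A k w \<bullet> Z w)) \<longlonglongrightarrow> expectation (\<lambda>w. J w \<bullet> Z w)"
    by (rule L2_limit_inner[OF sA S'(2) AJ Z(1) Z(1) Z0])
  moreover have "(\<lambda>k. expectation (\<lambda>w. step_integral W (S k) w \<bullet> Z w)) \<longlonglongrightarrow> expectation (\<lambda>w. I w \<bullet> Z w)"
    by (rule L2_limit_inner[OF sq_integrable_step_integral[OF W S(1)] S(2) S(5) Z(1) Z(1) Z0])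
  ultimately show ?thesis
    by (simp add: step_integral_cut_steps[OF W S(1) t(1) Z] LIMSEQ_unique)
qed

end

section \<open>Primitives and integration by parts\<close>

lemma finite_measure_leb: "finite_measure (leb t)"
  by (rule finite_measureI, cases "0 \<le> t") (auto simp: emeasure_restrict_space space_restrict_space)

lemma sigma_finite_leb: "sigma_finite_measure (leb t)"
  using finite_measure_leb finite_measure.axioms(1) by blast

lemma measure_leb: "0 \<le> t \<Longrightarrow> measure (leb t) (space (leb t)) = t"
  by (simp add: measure_restrict_space space_restrict_space)

lemma integrable_leb_mono:
  fixes f :: "real \<Rightarrow> 'b::{banach, second_countable_topology}"
  shows "integrable (leb T) f \<Longrightarrow> t \<le> T \<Longrightarrow> integrable (leb t) f"
  unfolding integrable_leb by (erule set_integrable_subset) auto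

lemma integrable_leb_continuous:
  fixes f :: "real \<Rightarrow> 'b::{euclidean_space}"
  shows "continuous_on {0..} f \<Longrightarrow> integrable (leb T) f"
  unfolding integrable_leb set_integrable_def
  by (intro borel_integrable_compact) (auto intro: continuous_on_subset)

definition prim :: "(real \<Rightarrow> 'b::{banach, second_countable_topology}) \<Rightarrow> real \<Rightarrow> 'b" where
  "prim h t = integral\<^sup>L (leb t) h"

lemma prim_indicator:
  assumes "0 \<le> t" "t \<le> T"
  shows "prim h t = (\<integral>r. indicator {0..t} r *\<^sub>R h r \<partial>leb T)"
proof -
  have "(\<lambda>r. indicator {0..t} r *\<^sub>R h r) = (\<lambda>r. indicator {0..T} r *\<^sub>R (indicator {0..t} r *\<^sub>R h r))"
    using assms by (auto simp: fun_eq_iff indicator_def)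
  thus ?thesis unfolding prim_def integral_leb set_lebesgue_integral_def by simp
qed

lemma prim_mult_prim:
  fixes h k :: "real \<Rightarrow> 'b::{euclidean_space}"
  assumes h: "integrable (leb T) h" and k: "integrable (leb T) k" and T: "0 \<le> T"
  shows "prim h T \<bullet> prim k T = (\<integral>t. h t \<bullet> prim k t + prim h t \<bullet> k t \<partial>leb T)"
    "integrable (leb T) (\<lambda>t. h t \<bullet> prim k t)" "integrable (leb T) (\<lambda>t. prim h t \<bullet> k t)"
proof -
  interpret L: sigma_finite_measure "leb T" by (rule sigma_finite_leb)
  interpret P: pair_sigma_finite "leb T" "leb T" ..
  have [measurable]: "h \<in> borel_measurable (leb T)" "k \<in> borel_measurable (leb T)" using h k by auto
  have [measurable]: "(\<lambda>x. x) \<in> borel_measurable (leb T)" by (rule measurable_restrict_space1) simp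
  have m: "(\<lambda>(r, t). h r \<bullet> k t) \<in> borel_measurable (leb T \<Otimes>\<^sub>M leb T)" by measurable
  have hk: "integrable (leb T \<Otimes>\<^sub>M leb T) (\<lambda>(r, t). h r \<bullet> k t)"
  proof (rule P.Fubini_integrable[OF m])
    have i: "integrable (leb T) (\<lambda>t. h r \<bullet> k t)" for r using k by (rule integrable_inner_right)
    show "AE x in leb T. integrable (leb T) (\<lambda>y. case (x, y) of (r, t) \<Rightarrow> h r \<bullet> k t)" using i by simp
    show "integrable (leb T) (\<lambda>x. \<integral>y. norm (case (x, y) of (r, t) \<Rightarrow> h r \<bullet> k t) \<partial>leb T)"
    proof (rule Bochner_Integration.integrable_bound)
      show "integrable (leb T) (\<lambda>x. norm (h x) * (\<integral>y. norm (k y) \<partial>leb T))" using h by simp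
      have "\<bar>\<integral>y. \<bar>h x \<bullet> k y\<bar> \<partial>leb T\<bar> \<le> \<bar>norm (h x) * (\<integral>y. norm (k y) \<partial>leb T)\<bar>" for x
      proof -
        have "(\<integral>y. \<bar>h x \<bullet> k y\<bar> \<partial>leb T) \<le> (\<integral>y. norm (h x) * norm (k y) \<partial>leb T)"
          by (intro integral_mono integrable_abs i) (use k Cauchy_Schwarz_ineq2 in auto)
        moreover have "0 \<le> (\<integral>y. \<bar>h x \<bullet> k y\<bar> \<partial>leb T)" by simp
        ultimately show ?thesis by simp
      qed
      thus "AE x in leb T. norm (\<integral>y. norm (case (x, y) of (r, t) \<Rightarrow> h r \<bullet> k t) \<partial>leb T) \<le> norm (norm (h x) * (\<integral>y. norm (k y) \<partial>leb T))"
        by simp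
    qed measurable
  qed
  have s1: "{p \<in> space (leb T \<Otimes>\<^sub>M leb T). fst p \<le> snd p} \<in> sets (leb T \<Otimes>\<^sub>M leb T)" by measurable
  have s2: "{p \<in> space (leb T \<Otimes>\<^sub>M leb T). fst p > snd p} \<in> sets (leb T \<Otimes>\<^sub>M leb T)" by measurable
  \<comment> \<open>The half-open interval in \<open>f2\<close> makes the two triangles disjoint;
    the missing point is a null set in each section.\<close>
  define f1 where "f1 = (\<lambda>(r::real, t). indicator {0..t} r *\<^sub>R (h r \<bullet> k t))"
  define f2 where "f2 = (\<lambda>(r, t::real). indicator {0..<r} t *\<^sub>R (h r \<bullet> k t))"
  have sp: "space (leb T) = {0..T}" by (simp add: space_restrict_space)
  have i1: "integrable (leb T \<Otimes>\<^sub>M leb T) f1"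
  proof -
    have "integrable (leb T \<Otimes>\<^sub>M leb T) (\<lambda>p. indicator {p \<in> space (leb T \<Otimes>\<^sub>M leb T). fst p \<le> snd p} p *\<^sub>R (case p of (r, t) \<Rightarrow> h r \<bullet> k t))"
      by (rule integrable_mult_indicator[OF s1 hk])
    thus ?thesis by (rule Bochner_Integration.integrable_cong[THEN iffD1, rotated -1]) (auto simp: f1_def space_pair_measure sp indicator_def)
  qed
  have i2: "integrable (leb T \<Otimes>\<^sub>M leb T) f2"
  proof -
    have "integrable (leb T \<Otimes>\<^sub>M leb T) (\<lambda>p. indicator {p \<in> space (leb T \<Otimes>\<^sub>M leb T). fst p > snd p} p *\<^sub>R (case p of (r, t) \<Rightarrow> h r \<bullet> k t))"
      by (rule integrable_mult_indicator[OF s2 hk])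
    thus ?thesis by (rule Bochner_Integration.integrable_cong[THEN iffD1, rotated -1]) (auto simp: f2_def space_pair_measure sp indicator_def)
  qed
  have int_ind: "integrable (leb T) (\<lambda>r. indicator A r *\<^sub>R g r)" if "integrable (leb T) g" "A \<in> sets borel" for A and g :: "real \<Rightarrow> 'b"
  proof (rule Bochner_Integration.integrable_bound[OF that(1)])
    have "(\<lambda>r. indicator A r :: real) \<in> borel_measurable (leb T)" using that(2) by (intro measurable_restrict_space1) simp
    thus "(\<lambda>r. indicator A r *\<^sub>R g r) \<in> borel_measurable (leb T)" using that(1) by measurable
  qed (auto simp: indicator_def)
  have e1: "(\<integral>r. f1 (r, t) \<partial>leb T) = prim h t \<bullet> k t" if "t \<in> space (leb T)" for t
  proof -
    have "(\<integral>r. f1 (r, t) \<partial>leb T) = (\<integral>r. (indicator {0..t} r *\<^sub>R h r) \<bullet> k t \<partial>leb T)" by (simp add: f1_def)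
    also have "\<dots> = (\<integral>r. indicator {0..t} r *\<^sub>R h r \<partial>leb T) \<bullet> k t"
      by (rule integral_inner_left) (intro impI int_ind h, simp)
    also have "(\<integral>r. indicator {0..t} r *\<^sub>R h r \<partial>leb T) = prim h t" using that sp by (intro prim_indicator[symmetric]) auto
    finally show ?thesis .
  qed
  have e2: "(\<integral>t. f2 (r, t) \<partial>leb T) = h r \<bullet> prim k r" if "r \<in> space (leb T)" for r
  proof -
    have "(\<integral>t. f2 (r, t) \<partial>leb T) = (\<integral>t. h r \<bullet> (indicator {0..<r} t *\<^sub>R k t) \<partial>leb T)" by (simp add: f2_def)
    also have "\<dots> = h r \<bullet> (\<integral>t. indicator {0..<r} t *\<^sub>R k t \<partial>leb T)"
      by (rule integral_inner_right) (intro impI int_ind k, simp)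
    also have "(\<integral>t. indicator {0..<r} t *\<^sub>R k t \<partial>leb T) = (\<integral>t. indicator {0..r} t *\<^sub>R k t \<partial>leb T)"
    proof (rule integral_cong_AE)
      have "AE t in lborel. t \<noteq> r" by (rule AE_lborel_singleton)
      hence "AE t in leb T. t \<noteq> r" by (auto simp: AE_restrict_space_iff)
      thus "AE t in leb T. indicator {0..<r} t *\<^sub>R k t = indicator {0..r} t *\<^sub>R k t" by eventually_elim (auto simp: indicator_def)
    qed (use int_ind[OF k] in auto)
    also have "\<dots> = prim k r" using that sp by (intro prim_indicator[symmetric]) auto
    finally show ?thesis .
  qed
  have "integrable (leb T) (\<lambda>t. \<integral>r. f1 (r, t) \<partial>leb T)" using P.integrable_snd[of "\<lambda>r t. f1 (r, t)"] i1 by simp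
  thus I1: "integrable (leb T) (\<lambda>t. prim h t \<bullet> k t)" by (rule Bochner_Integration.integrable_cong[THEN iffD1, rotated -1]) (auto simp: e1)
  have "integrable (leb T) (\<lambda>r. \<integral>t. f2 (r, t) \<partial>leb T)" using P.integrable_fst[of "\<lambda>r t. f2 (r, t)"] i2 by simp
  thus I2: "integrable (leb T) (\<lambda>t. h t \<bullet> prim k t)" by (rule Bochner_Integration.integrable_cong[THEN iffD1, rotated -1]) (auto simp: e2)
  have "prim h T \<bullet> prim k T = (\<integral>r. h r \<bullet> prim k T \<partial>leb T)"
    unfolding prim_def[of h] using h by (simp add: integral_inner_left)
  also have "\<dots> = (\<integral>r. (\<integral>t. h r \<bullet> k t \<partial>leb T) \<partial>leb T)" unfolding prim_def using k by simp
  also have "\<dots> = (\<integral>p. (case p of (r, t) \<Rightarrow> h r \<bullet> k t) \<partial>(leb T \<Otimes>\<^sub>M leb T))" using P.integral_fst[OF hk] by simp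
  also have "\<dots> = (\<integral>p. f1 p + f2 p \<partial>(leb T \<Otimes>\<^sub>M leb T))"
    by (intro Bochner_Integration.integral_cong refl) (auto simp: f1_def f2_def space_pair_measure sp indicator_def)
  also have "\<dots> = (\<integral>p. f1 p \<partial>(leb T \<Otimes>\<^sub>M leb T)) + (\<integral>p. f2 p \<partial>(leb T \<Otimes>\<^sub>M leb T))" using i1 i2 by simp
  also have "(\<integral>p. f1 p \<partial>(leb T \<Otimes>\<^sub>M leb T)) = (\<integral>t. (\<integral>r. f1 (r, t) \<partial>leb T) \<partial>leb T)"
    using P.integral_snd[of "\<lambda>r t. f1 (r, t)"] i1 by simp
  also have "\<dots> = (\<integral>t. prim h t \<bullet> k t \<partial>leb T)" by (intro Bochner_Integration.integral_cong refl e1)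
  also have "(\<integral>p. f2 p \<partial>(leb T \<Otimes>\<^sub>M leb T)) = (\<integral>r. (\<integral>t. f2 (r, t) \<partial>leb T) \<partial>leb T)"
    using P.integral_fst[of "\<lambda>r t. f2 (r, t)"] i2 by simp
  also have "\<dots> = (\<integral>t. h t \<bullet> prim k t \<partial>leb T)" by (intro Bochner_Integration.integral_cong refl e2)
  finally show "prim h T \<bullet> prim k T = (\<integral>t. h t \<bullet> prim k t + prim h t \<bullet> k t \<partial>leb T)" using I1 I2 by simp
qed

lemma prim_continuous_derivative:
  fixes f f' :: "real \<Rightarrow> 'b::euclidean_space"
  assumes "\<And>t. 0 \<le> t \<Longrightarrow> (f has_vector_derivative f' t) (at t within {0..})" "continuous_on {0..} f'" "0 \<le> T"
  shows "f T = f 0 + prim f' T"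
proof -
  have "set_integrable lborel {0..T} f'" using integrable_leb_continuous[OF assms(2)] by (simp add: integrable_leb)
  hence "(LINT r:{0..T}|lborel. f' r) = integral {0..T} f'" by (rule set_borel_integral_eq_integral(2))
  also have "\<dots> = f T - f 0"
    by (rule integral_unique, rule fundamental_theorem_of_calculus[OF assms(3)])
       (auto intro: has_vector_derivative_within_subset[OF assms(1)])
  finally show ?thesis by (simp add: prim_def integral_leb)
qed

text \<open>The product rule against exp(-a t), itself 1 plus a primitive. \<phi> need not be
  differentiable, which suits energies known only through an integral identity.\<close>

lemma exp_weighted_primitive:
  fixes \<phi> \<psi> :: "real \<Rightarrow> real"
  assumes \<psi>: "\<And>T. 0 \<le> T \<Longrightarrow> integrable (leb T) \<psi>" and \<phi>: "\<And>t. 0 \<le> t \<Longrightarrow> \<phi> t = cst + prim \<psi> t" and T: "0 \<le> T"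
  shows "exp (- a * T) * \<phi> T = cst + (\<integral>t. exp (- a * t) * (\<psi> t - a * \<phi> t) \<partial>leb T)"
    "integrable (leb T) (\<lambda>t. exp (- a * t) * (\<psi> t - a * \<phi> t))"
proof -
  define h where "h t = - a * exp (- a * t)" for t
  have hc: "continuous_on {0..} h" unfolding h_def by (intro continuous_intros)
  have H: "exp (- a * t) = 1 + prim h t" if "0 \<le> t" for t
    using prim_continuous_derivative[of "\<lambda>t. exp (- a * t)" h t] that hc unfolding h_def
    by (force intro!: derivative_eq_intros simp: has_real_derivative_iff_has_vector_derivative[symmetric])
  have ih: "integrable (leb T) h" using hc by (rule integrable_leb_continuous)
  note P = prim_mult_prim[OF ih \<psi>[OF T] T, unfolded inner_real_def]
  have sp: "space (leb T) = {0..T}" by (simp add: space_restrict_space)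
  have eq: "exp (- a * t) * (\<psi> t - a * \<phi> t) = cst * h t + \<psi> t + (h t * prim \<psi> t + prim h t * \<psi> t)" if "t \<in> space (leb T)" for t
  proof -
    have t: "0 \<le> t" using that sp by auto
    have "exp (- a * t) * (\<psi> t - a * \<phi> t) = exp (- a * t) * \<psi> t + h t * \<phi> t" by (simp add: h_def algebra_simps)
    also have "\<dots> = (1 + prim h t) * \<psi> t + h t * (cst + prim \<psi> t)" using H[OF t] \<phi>[OF t] by simp
    finally show ?thesis by (simp add: algebra_simps)
  qed
  have i: "integrable (leb T) (\<lambda>t. cst * h t + \<psi> t + (h t * prim \<psi> t + prim h t * \<psi> t))" using ih \<psi>[OF T] P by simp
  thus "integrable (leb T) (\<lambda>t. exp (- a * t) * (\<psi> t - a * \<phi> t))"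
  proof -
    have "integrable (leb T) (\<lambda>t. exp (- a * t) * (\<psi> t - a * \<phi> t))
      = integrable (leb T) (\<lambda>t. cst * h t + \<psi> t + (h t * prim \<psi> t + prim h t * \<psi> t))"
      by (rule Bochner_Integration.integrable_cong[OF refl]) (rule eq)
    thus "integrable (leb T) (\<lambda>t. cst * h t + \<psi> t + (h t * prim \<psi> t + prim h t * \<psi> t)) \<Longrightarrow>
      integrable (leb T) (\<lambda>t. exp (- a * t) * (\<psi> t - a * \<phi> t))" by simp
  qed
  have "(\<integral>t. exp (- a * t) * (\<psi> t - a * \<phi> t) \<partial>leb T) = (\<integral>t. cst * h t + \<psi> t + (h t * prim \<psi> t + prim h t * \<psi> t) \<partial>leb T)"
    by (intro Bochner_Integration.integral_cong refl eq)
  also have "\<dots> = cst * prim h T + prim \<psi> T + prim h T * prim \<psi> T"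
    using ih \<psi>[OF T] P by (simp add: prim_def)
  also have "cst + \<dots> = (1 + prim h T) * (cst + prim \<psi> T)" by (simp add: algebra_simps)
  also have "\<dots> = exp (- a * T) * \<phi> T" using H[OF T] \<phi>[OF T] by simp
  finally show "exp (- a * T) * \<phi> T = cst + (\<integral>t. exp (- a * t) * (\<psi> t - a * \<phi> t) \<partial>leb T)" by simp
qed

text \<open>Cauchy-Schwarz for h against the constant function with value v =
  \<open>prim h t\<close> bounds |v|^4 by t |v|^2 times the energy of h; then |v|^2 is
  cancelled.\<close>

lemma norm_prim_square_le:
  fixes h :: "real \<Rightarrow> real^'n"
  assumes "sq_integrable (leb t) h" "0 \<le> t"
  shows "(norm (prim h t))\<^sup>2 \<le> t * (\<integral>r. (norm (h r))\<^sup>2 \<partial>leb t)" "integrable (leb t) h"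
proof -
  have c: "sq_integrable (leb t) (\<lambda>r. v)" for v :: "real^'n" by (rule sq_integrable_const[OF finite_measure_leb])
  show i: "integrable (leb t) h"
  proof (rule Bochner_Integration.integrable_bound)
    have "integrable (leb t) (\<lambda>r. 1::real)" using finite_measure.integrable_const[OF finite_measure_leb] by blast
    thus "integrable (leb t) (\<lambda>r. (norm (h r))\<^sup>2 + 1)" using assms(1) by (simp add: sq_integrable_def)
    have "norm (h r) \<le> (norm (h r))\<^sup>2 + 1" for r
      using sum_squares_bound[of "norm (h r)" 1] norm_ge_zero[of "h r"] by (simp, linarith)
    thus "AE r in leb t. norm (h r) \<le> norm ((norm (h r))\<^sup>2 + 1)" by simp
  qed (use assms in measurable)
  let ?v = "prim h t" and ?s = "\<integral>r. (norm (h r))\<^sup>2 \<partial>leb t"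
  have "(\<integral>r. h r \<bullet> ?v \<partial>leb t)\<^sup>2 \<le> ?s * (\<integral>r. (norm ?v)\<^sup>2 \<partial>leb t)" by (rule integral_Cauchy_Schwarz[OF assms(1) c])
  also have "(\<integral>r. h r \<bullet> ?v \<partial>leb t) = (norm ?v)\<^sup>2" using i by (simp add: prim_def power2_norm_eq_inner)
  also have "(\<integral>r. (norm ?v)\<^sup>2 \<partial>leb t) = t * (norm ?v)\<^sup>2" using measure_leb[OF assms(2)] by simp
  finally have "(norm ?v)\<^sup>2 * (norm ?v)\<^sup>2 \<le> (t * ?s) * (norm ?v)\<^sup>2" by (simp add: power2_eq_square mult_ac)
  moreover have "0 \<le> t * ?s" using assms(2) by (intro mult_nonneg_nonneg) simp_all
  moreover have "0 < (norm ?v)\<^sup>2" if "?v \<noteq> 0" using that by simp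
  ultimately show "(norm ?v)\<^sup>2 \<le> t * ?s" by (cases "?v = 0") (simp, blast intro: mult_right_le_imp_le)
qed

text \<open>The exponential weight absorbs the primitive on the right-hand side of the Volterra equation.\<close>

lemma gronwall_L2:
  fixes F :: "real^'n^'n" and X \<xi> :: "real \<Rightarrow> real^'n"
  assumes c: "c > 0" "\<And>x. norm (F *v x) \<le> c * norm x"
    and X: "continuous_on {0..} X" "\<And>t. 0 \<le> t \<Longrightarrow> X t = \<xi> t + prim (\<lambda>r. F *v X r) t"
    and \<xi>: "sq_integrable (leb T) \<xi>" and T: "0 \<le> T"
  shows "(\<integral>t. (norm (X t))\<^sup>2 \<partial>leb T) \<le> exp (2 * c\<^sup>2 * T * T) * (2 * (\<integral>t. (norm (\<xi> t))\<^sup>2 \<partial>leb T))"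
proof -
  define g where "g t = (norm (X t))\<^sup>2" for t
  \<comment> \<open>The 2 comes from squaring a sum, c^2 from the matrix, T from Cauchy-Schwarz in
    time; this makes \<open>g - a * prim g\<close> bounded by the forcing alone.\<close>
  define a where "a = 2 * c\<^sup>2 * T"
  have a: "a \<ge> 0" using T by (simp add: a_def)
  have gc: "continuous_on {0..} g" unfolding g_def by (intro continuous_intros X)
  have ig: "integrable (leb t) g" for t using gc by (rule integrable_leb_continuous)
  have Xc: "sq_integrable (leb t) X" for t
  proof -
    have "g = (\<lambda>t. (norm (X t))\<^sup>2)" by (simp add: fun_eq_iff g_def)
    thus ?thesis using ig[of t] integrable_leb_continuous[OF X(1), of t] by (auto simp: sq_integrable_def)
  qed
  have G0: "0 \<le> prim g t" for t by (simp add: prim_def g_def)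
  have le: "g t - a * prim g t \<le> 2 * (norm (\<xi> t))\<^sup>2" if t: "t \<in> {0..T}" for t
  proof -
    have "(norm (prim (\<lambda>r. F *v X r) t))\<^sup>2 \<le> t * (\<integral>r. (norm (F *v X r))\<^sup>2 \<partial>leb t)"
      by (rule norm_prim_square_le[OF sq_integrable_matrix[OF Xc]]) (use t in auto)
    also have "(\<integral>r. (norm (F *v X r))\<^sup>2 \<partial>leb t) \<le> (\<integral>r. c\<^sup>2 * g r \<partial>leb t)"
    proof (rule integral_mono)
      show "integrable (leb t) (\<lambda>r. (norm (F *v X r))\<^sup>2)" by (intro sq_integrable_norm2 sq_integrable_matrix Xc)
      show "integrable (leb t) (\<lambda>r. c\<^sup>2 * g r)" using ig by simp
      show "(norm (F *v X r))\<^sup>2 \<le> c\<^sup>2 * g r" for r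
        using power_mono[OF c(2)[of "X r"], of 2] by (simp add: g_def power_mult_distrib)
    qed
    also have "(\<integral>r. c\<^sup>2 * g r \<partial>leb t) = c\<^sup>2 * prim g t" by (simp add: prim_def)
    also have "t * (c\<^sup>2 * prim g t) \<le> T * (c\<^sup>2 * prim g t)" using t G0 by (intro mult_right_mono) auto
    finally have "(norm (prim (\<lambda>r. F *v X r) t))\<^sup>2 \<le> T * (c\<^sup>2 * prim g t)" using t by (auto intro: mult_left_mono)
    moreover have "g t \<le> 2 * (norm (\<xi> t))\<^sup>2 + 2 * (norm (prim (\<lambda>r. F *v X r) t))\<^sup>2"
      unfolding g_def using X(2)[of t] t norm_add_squared_le by auto
    moreover have "a * prim g t = 2 * (T * (c\<^sup>2 * prim g t))" by (simp add: a_def)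
    ultimately show ?thesis by linarith
  qed
  have ix: "integrable (leb T) (\<lambda>t. 2 * (norm (\<xi> t))\<^sup>2)" using sq_integrable_norm2[OF \<xi>] by simp
  note w = exp_weighted_primitive[where \<psi> = g and \<phi> = "prim g" and cst = 0 and a = a and T = T, OF ig _ T]
  have "exp (- a * T) * prim g T = (\<integral>t. exp (- a * t) * (g t - a * prim g t) \<partial>leb T)" using w by simp
  also have "\<dots> \<le> (\<integral>t. 2 * (norm (\<xi> t))\<^sup>2 \<partial>leb T)"
  proof (rule integral_mono[OF _ ix])
    show "integrable (leb T) (\<lambda>t. exp (- a * t) * (g t - a * prim g t))" using w by simp
    fix t assume "t \<in> space (leb T)"
    hence t: "t \<in> {0..T}" by (simp add: space_restrict_space)
    have "exp (- a * t) * (g t - a * prim g t) \<le> exp (- a * t) * (2 * (norm (\<xi> t))\<^sup>2)" using le[OF t] by (intro mult_left_mono) auto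
    also have "\<dots> \<le> 1 * (2 * (norm (\<xi> t))\<^sup>2)" using t a by (intro mult_right_mono) auto
    finally show "exp (- a * t) * (g t - a * prim g t) \<le> 2 * (norm (\<xi> t))\<^sup>2" by simp
  qed
  finally have "exp (- a * T) * prim g T \<le> (\<integral>t. 2 * (norm (\<xi> t))\<^sup>2 \<partial>leb T)" .
  hence "exp (a * T) * (exp (- a * T) * prim g T) \<le> exp (a * T) * (\<integral>t. 2 * (norm (\<xi> t))\<^sup>2 \<partial>leb T)"
    by (intro mult_left_mono) auto
  hence "prim g T \<le> exp (a * T) * (\<integral>t. 2 * (norm (\<xi> t))\<^sup>2 \<partial>leb T)"
    by (simp add: mult.assoc[symmetric] exp_add[symmetric])
  moreover have "g = (\<lambda>t. (norm (X t))\<^sup>2)" by (simp add: fun_eq_iff g_def)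
  ultimately show ?thesis by (simp add: prim_def a_def mult.assoc)
qed

section \<open>Square-integrable processes\<close>

abbreviation lebh :: "real measure" where "lebh \<equiv> restrict_space lborel {0..}"

lemma sigma_finite_lebh: "sigma_finite_measure lebh"
  by (rule sigma_finite_measure_restrict_space) (auto intro: lborel.sigma_finite_measure_axioms)

definition jmeas :: "'w measure \<Rightarrow> (real \<Rightarrow> 'w \<Rightarrow> 'b::topological_space) \<Rightarrow> bool" where
  "jmeas M X \<longleftrightarrow> (\<lambda>p. X (fst p) (snd p)) \<in> borel_measurable (lebh \<Otimes>\<^sub>M M)"

definition L2proc :: "'w measure \<Rightarrow> (real \<Rightarrow> 'w \<Rightarrow> real^'n) \<Rightarrow> bool" where
  "L2proc M X \<longleftrightarrow> jmeas M X \<and> (\<forall>T\<ge>0. sq_integrable (leb T \<Otimes>\<^sub>M M) (\<lambda>p. X (fst p) (snd p)))"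

lemma measurable_leb_lebh: "f \<in> measurable lebh N \<Longrightarrow> f \<in> measurable (leb T) N"
proof -
  assume f: "f \<in> measurable lebh N"
  have "leb T = restrict_space lebh {0..T}" by (simp add: restrict_restrict_space Int_absorb1)
  thus ?thesis using measurable_restrict_space1[OF f, of "{0..T}"] by simp
qed

lemma jmeas_leb:
  assumes "jmeas M X"
  shows "(\<lambda>p. X (fst p) (snd p)) \<in> borel_measurable (leb T \<Otimes>\<^sub>M M)"
proof -
  have id: "(\<lambda>x. x) \<in> measurable (leb T) lebh" by (rule measurable_leb_lebh) simp
  have m: "(\<lambda>p. (fst p, snd p)) \<in> measurable (leb T \<Otimes>\<^sub>M M) (lebh \<Otimes>\<^sub>M M)"
    by (rule measurable_Pair[OF measurable_compose[OF measurable_fst id] measurable_snd])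
  show ?thesis using measurable_compose[OF m assms[unfolded jmeas_def]] by (simp only: fst_conv snd_conv)
qed

lemma jmeas_section: "jmeas M X \<Longrightarrow> 0 \<le> t \<Longrightarrow> X t \<in> borel_measurable M"
proof -
  assume X: "jmeas M X" and t: "0 \<le> t"
  have "(\<lambda>w. (t, w)) \<in> measurable M (lebh \<Otimes>\<^sub>M M)" using t by (intro measurable_Pair1') (simp add: space_restrict_space)
  from measurable_compose[OF this, of "\<lambda>p. X (fst p) (snd p)"] X show ?thesis by (simp add: jmeas_def)
qed

lemma jmeas_path: "jmeas M X \<Longrightarrow> w \<in> space M \<Longrightarrow> (\<lambda>t. X t w) \<in> borel_measurable lebh"
proof -
  assume X: "jmeas M X" and w: "w \<in> space M"
  have "(\<lambda>t. (t, w)) \<in> measurable lebh (lebh \<Otimes>\<^sub>M M)" using w by (rule measurable_Pair2')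
  from measurable_compose[OF this, of "\<lambda>p. X (fst p) (snd p)"] X show ?thesis by (simp add: jmeas_def)
qed

lemma jmeas_const: "Z \<in> borel_measurable M \<Longrightarrow> jmeas M (\<lambda>t. Z)"
  unfolding jmeas_def by (rule measurable_compose[OF measurable_snd])

lemma jmeas_det: "f \<in> borel_measurable lebh \<Longrightarrow> jmeas M (\<lambda>t w. f t)"
  unfolding jmeas_def by (rule measurable_compose[OF measurable_fst])

lemma jmeas_add:
  fixes X Y :: "real \<Rightarrow> 'w \<Rightarrow> 'b::{second_countable_topology, real_normed_vector}"
  shows "jmeas M X \<Longrightarrow> jmeas M Y \<Longrightarrow> jmeas M (\<lambda>t w. X t w + Y t w)"
  unfolding jmeas_def by (rule borel_measurable_add)

lemma jmeas_diff:
  fixes X Y :: "real \<Rightarrow> 'w \<Rightarrow> 'b::{second_countable_topology, real_normed_vector}"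
  shows "jmeas M X \<Longrightarrow> jmeas M Y \<Longrightarrow> jmeas M (\<lambda>t w. X t w - Y t w)"
  unfolding jmeas_def by (rule borel_measurable_diff)

lemma jmeas_scaleR:
  fixes X :: "real \<Rightarrow> 'w \<Rightarrow> 'b::{second_countable_topology, real_normed_vector}"
  shows "jmeas M X \<Longrightarrow> jmeas M (\<lambda>t w. c *\<^sub>R X t w)"
  unfolding jmeas_def by (intro borel_measurable_scaleR borel_measurable_const)

lemma jmeas_matrix:
  fixes Y :: "real^'n^'m"
  shows "jmeas M X \<Longrightarrow> jmeas M (\<lambda>t w. Y *v X t w)"
  unfolding jmeas_def by (intro borel_measurable_continuous_on[OF matrix_vector_mult_linear_continuous_on])

lemma jmeas_sum:
  fixes X :: "'i \<Rightarrow> real \<Rightarrow> 'w \<Rightarrow> 'b::{second_countable_topology, real_normed_vector}"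
  shows "(\<And>i. i \<in> I \<Longrightarrow> jmeas M (X i)) \<Longrightarrow> jmeas M (\<lambda>t w. \<Sum>i\<in>I. X i t w)"
  unfolding jmeas_def by (rule borel_measurable_sum)

lemma jmeas_prim:
  fixes h :: "real \<Rightarrow> 'w \<Rightarrow> 'b::{euclidean_space}"
  assumes h: "jmeas M h"
  shows "jmeas M (\<lambda>t w. prim (\<lambda>r. h r w) t)"
proof -
  interpret L: sigma_finite_measure lebh by (rule sigma_finite_lebh)
  \<comment> \<open>An indicator moves the dependence on t from the measure into the integrand, so
    that joint measurability of a parameter integral applies.\<close>
  have eq: "prim (\<lambda>r. h r w) t = (\<integral>r. indicator {0..t} r *\<^sub>R h r w \<partial>lebh)" for t w
  proof -
    have "(\<integral>r. indicator {0..t} r *\<^sub>R h r w \<partial>lebh) = (LINT r:{0..}|lborel. indicator {0..t} r *\<^sub>R h r w)"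
      unfolding set_lebesgue_integral_def by (rule integral_restrict_space) simp
    also have "\<dots> = (LINT r:{0..t}|lborel. h r w)" unfolding set_lebesgue_integral_def
      by (intro Bochner_Integration.integral_cong refl) (auto simp: indicator_def)
    finally show ?thesis by (simp add: prim_def integral_leb)
  qed
  have id: "(\<lambda>x. x) \<in> borel_measurable lebh" by (rule measurable_restrict_space1) simp
  have [measurable]: "fst \<in> borel_measurable (lebh \<Otimes>\<^sub>M M)" "snd \<in> borel_measurable ((lebh \<Otimes>\<^sub>M M) \<Otimes>\<^sub>M lebh)"
    "(\<lambda>q. fst (fst q)) \<in> borel_measurable ((lebh \<Otimes>\<^sub>M M) \<Otimes>\<^sub>M lebh)"
    using measurable_compose[OF measurable_fst id, of M] measurable_compose[OF measurable_snd id, of "lebh \<Otimes>\<^sub>M M"]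
      measurable_compose[OF measurable_fst measurable_compose[OF measurable_fst id, of M], of lebh] by auto
  have "(\<lambda>q. (snd q, snd (fst q))) \<in> measurable ((lebh \<Otimes>\<^sub>M M) \<Otimes>\<^sub>M lebh) (lebh \<Otimes>\<^sub>M M)"
    by (intro measurable_Pair measurable_snd measurable_compose[OF measurable_fst measurable_snd])
  from measurable_compose[OF this, of "\<lambda>p. h (fst p) (snd p)"] h
  have [measurable]: "(\<lambda>q. h (snd q) (snd (fst q))) \<in> borel_measurable ((lebh \<Otimes>\<^sub>M M) \<Otimes>\<^sub>M lebh)" by (simp add: jmeas_def)
  have m: "(\<lambda>q. (if 0 \<le> snd q \<and> snd q \<le> fst (fst q) then 1 else 0 :: real) *\<^sub>R h (snd q) (snd (fst q))) \<in> borel_measurable ((lebh \<Otimes>\<^sub>M M) \<Otimes>\<^sub>M lebh)"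
    by measurable
  have "(\<lambda>p. \<integral>r. (if 0 \<le> r \<and> r \<le> fst p then 1 else 0 :: real) *\<^sub>R h r (snd p) \<partial>lebh) \<in> borel_measurable (lebh \<Otimes>\<^sub>M M)"
    using m by (intro L.borel_measurable_lebesgue_integral) (simp add: split_beta')
  moreover have "(\<lambda>r. (if 0 \<le> r \<and> r \<le> t then 1 else 0 :: real) *\<^sub>R h r w) = (\<lambda>r. indicator {0..t} r *\<^sub>R h r w)" for t w
    by (auto simp: indicator_def)
  ultimately show ?thesis unfolding jmeas_def eq by simp
qed

lemma L2proc_jmeas: "L2proc M X \<Longrightarrow> jmeas M X" by (simp add: L2proc_def)

lemma L2proc_add: "L2proc M X \<Longrightarrow> L2proc M Y \<Longrightarrow> L2proc M (\<lambda>t w. X t w + Y t w)"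
  by (auto simp: L2proc_def intro: jmeas_add sq_integrable_add)

lemma L2proc_scaleR: "L2proc M X \<Longrightarrow> L2proc M (\<lambda>t w. c *\<^sub>R X t w)"
  by (auto simp: L2proc_def intro: jmeas_scaleR sq_integrable_scaleR)

lemma L2proc_matrix:
  fixes Y :: "real^'n^'m"
  shows "L2proc M X \<Longrightarrow> L2proc M (\<lambda>t w. Y *v X t w)"
  by (auto simp: L2proc_def intro: jmeas_matrix sq_integrable_matrix)

context filtered_prob begin

lemma pair_sigma_finite_leb: "pair_sigma_finite (leb T) M"
  using sigma_finite_leb sigma_finite_measure_axioms by (simp add: pair_sigma_finite_def)

lemma L2proc_iff_nn:
  "L2proc M X \<longleftrightarrow> jmeas M X \<and> (\<forall>T\<ge>0. (\<integral>\<^sup>+w. (\<integral>\<^sup>+t. ennreal ((norm (X t w))\<^sup>2) \<partial>leb T) \<partial>M) < \<infinity>)"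
proof -
  have eq: "(\<integral>\<^sup>+w. (\<integral>\<^sup>+t. ennreal ((norm (X t w))\<^sup>2) \<partial>leb T) \<partial>M) = (\<integral>\<^sup>+p. ennreal ((norm (X (fst p) (snd p)))\<^sup>2) \<partial>(leb T \<Otimes>\<^sub>M M))"
    if "jmeas M X" for T
  proof -
    interpret P: pair_sigma_finite "leb T" M by (rule pair_sigma_finite_leb)
    show ?thesis
      by (subst P.nn_integral_snd[symmetric]) (use jmeas_leb[OF that] in \<open>auto simp: split_beta'\<close>)
  qed
  show ?thesis unfolding L2proc_def sq_integrable_iff_nn_integral using eq jmeas_leb by auto
qed

lemma L2proc_const: "sq_integrable M Z \<Longrightarrow> L2proc M (\<lambda>t. Z)"
proof -
  assume Z: "sq_integrable M Z"
  have "(\<integral>\<^sup>+w. (\<integral>\<^sup>+t. ennreal ((norm (Z w))\<^sup>2) \<partial>leb T) \<partial>M) < \<infinity>" if "0 \<le> T" for T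
  proof -
    have "(\<integral>\<^sup>+t. ennreal c \<partial>leb T) = ennreal c * ennreal T" for c
      using that by (simp add: emeasure_restrict_space space_restrict_space)
    moreover have "(\<lambda>w. ennreal ((norm (Z w))\<^sup>2)) \<in> borel_measurable M" using Z by measurable
    ultimately show ?thesis using Z
      by (simp only: nn_integral_multc) (simp add: sq_integrable_iff_nn_integral ennreal_mult_less_top)
  qed
  thus ?thesis using Z by (auto simp: L2proc_iff_nn intro: jmeas_const)
qed

lemma L2proc_AE_path:
  assumes "L2proc M X" "0 \<le> T"
  shows "AE w in M. sq_integrable (leb T) (\<lambda>t. X t w)"
proof -
  interpret P: pair_sigma_finite "leb T" M by (rule pair_sigma_finite_leb)
  have "integrable (leb T \<Otimes>\<^sub>M M) (\<lambda>(t, w). (norm (X t w))\<^sup>2)"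
    using assms by (simp add: L2proc_def sq_integrable_def split_beta')
  from P.AE_integrable_snd[OF this] AE_space show ?thesis
  proof eventually_elim
    case (elim w)
    thus ?case using measurable_leb_lebh[OF jmeas_path[OF L2proc_jmeas[OF assms(1)]]] by (simp add: sq_integrable_def)
  qed
qed

lemma L2proc_AE_section:
  assumes "L2proc M X" "0 \<le> T"
  shows "AE t in leb T. sq_integrable M (X t)"
proof -
  interpret P: pair_sigma_finite "leb T" M by (rule pair_sigma_finite_leb)
  have "integrable (leb T \<Otimes>\<^sub>M M) (\<lambda>(t, w). (norm (X t w))\<^sup>2)"
    using assms by (simp add: L2proc_def sq_integrable_def split_beta')
  from P.AE_integrable_fst[OF this] AE_space show ?thesis
  proof eventually_elim
    case (elim t)
    thus ?case using jmeas_section[OF L2proc_jmeas[OF assms(1)]] by (simp add: sq_integrable_def space_restrict_space)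
  qed
qed

lemma L2proc_inner:
  assumes "L2proc M X" "L2proc M Y" "0 \<le> T"
  shows "integrable (leb T) (\<lambda>t. expectation (\<lambda>w. X t w \<bullet> Y t w))"
    "integrable M (\<lambda>w. \<integral>t. X t w \<bullet> Y t w \<partial>leb T)"
    "expectation (\<lambda>w. \<integral>t. X t w \<bullet> Y t w \<partial>leb T) = (\<integral>t. expectation (\<lambda>w. X t w \<bullet> Y t w) \<partial>leb T)"
    "integrable (leb T \<Otimes>\<^sub>M M) (\<lambda>(t, w). X t w \<bullet> Y t w)"
proof -
  interpret P: pair_sigma_finite "leb T" M by (rule pair_sigma_finite_leb)
  show i: "integrable (leb T \<Otimes>\<^sub>M M) (\<lambda>(t, w). X t w \<bullet> Y t w)"
    using sq_integrable_inner[of "leb T \<Otimes>\<^sub>M M" "\<lambda>p. X (fst p) (snd p)" "\<lambda>p. Y (fst p) (snd p)"] assms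
    by (simp add: L2proc_def split_beta')
  show "integrable (leb T) (\<lambda>t. expectation (\<lambda>w. X t w \<bullet> Y t w))" using P.integrable_fst[OF i] .
  show "integrable M (\<lambda>w. \<integral>t. X t w \<bullet> Y t w \<partial>leb T)" using P.integrable_snd[OF i] .
  show "expectation (\<lambda>w. \<integral>t. X t w \<bullet> Y t w \<partial>leb T) = (\<integral>t. expectation (\<lambda>w. X t w \<bullet> Y t w) \<partial>leb T)"
    using P.Fubini_integral[OF i] .
qed

lemma prim_second_moment:
  assumes h: "L2proc M h" and t: "0 \<le> t" "t \<le> T"
  shows "(\<integral>\<^sup>+w. ennreal ((norm (prim (\<lambda>r. h r w) t))\<^sup>2) \<partial>M)
    \<le> ennreal T * (\<integral>\<^sup>+w. (\<integral>\<^sup>+t. ennreal ((norm (h t w))\<^sup>2) \<partial>leb T) \<partial>M)"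
proof -
  have T: "0 \<le> T" using t by simp
  have "AE w in M. ennreal ((norm (prim (\<lambda>r. h r w) t))\<^sup>2) \<le> ennreal T * (\<integral>\<^sup>+t. ennreal ((norm (h t w))\<^sup>2) \<partial>leb T)"
    using L2proc_AE_path[OF h t(1)] L2proc_AE_path[OF h T]
  proof eventually_elim
    case (elim w)
    have "(norm (prim (\<lambda>r. h r w) t))\<^sup>2 \<le> t * (\<integral>r. (norm (h r w))\<^sup>2 \<partial>leb t)" by (rule norm_prim_square_le[OF elim(1) t(1)])
    also have "\<dots> \<le> T * (\<integral>r. (norm (h r w))\<^sup>2 \<partial>leb T)"
    proof (rule mult_mono[OF t(2) _ T])
      have iT: "set_integrable lborel {0..T} (\<lambda>r. (norm (h r w))\<^sup>2)" using sq_integrable_norm2[OF elim(2)] by (simp add: integrable_leb)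
      have it: "set_integrable lborel {0..t} (\<lambda>r. (norm (h r w))\<^sup>2)" using sq_integrable_norm2[OF elim(1)] by (simp add: integrable_leb)
      from integral_mono[OF it[unfolded set_integrable_def] iT[unfolded set_integrable_def]]
      show "(\<integral>r. (norm (h r w))\<^sup>2 \<partial>leb t) \<le> (\<integral>r. (norm (h r w))\<^sup>2 \<partial>leb T)"
        unfolding integral_leb set_lebesgue_integral_def using t by (auto simp: indicator_def)
    qed simp
    finally have "ennreal ((norm (prim (\<lambda>r. h r w) t))\<^sup>2) \<le> ennreal (T * (\<integral>r. (norm (h r w))\<^sup>2 \<partial>leb T))" by (rule ennreal_leI)
    also have "\<dots> = ennreal T * (\<integral>\<^sup>+t. ennreal ((norm (h t w))\<^sup>2) \<partial>leb T)"
      using sq_integrable_norm2[OF elim(2)] T by (simp add: ennreal_mult nn_integral_eq_integral)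
    finally show ?case .
  qed
  hence "(\<integral>\<^sup>+w. ennreal ((norm (prim (\<lambda>r. h r w) t))\<^sup>2) \<partial>M)
    \<le> (\<integral>\<^sup>+w. ennreal T * (\<integral>\<^sup>+t. ennreal ((norm (h t w))\<^sup>2) \<partial>leb T) \<partial>M)" by (rule nn_integral_mono_AE)
  also have "\<dots> = ennreal T * (\<integral>\<^sup>+w. (\<integral>\<^sup>+t. ennreal ((norm (h t w))\<^sup>2) \<partial>leb T) \<partial>M)"
  proof (rule nn_integral_cmult)
    interpret L: sigma_finite_measure "leb T" by (rule sigma_finite_leb)
    interpret P: pair_sigma_finite "leb T" M by (rule pair_sigma_finite_leb)
    have "(\<lambda>(w, t). ennreal ((norm (h t w))\<^sup>2)) \<in> borel_measurable (M \<Otimes>\<^sub>M leb T)"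
      using measurable_compose[OF measurable_pair_swap' jmeas_leb[OF L2proc_jmeas[OF h], of T]] by (simp add: split_beta')
    thus "(\<lambda>w. \<integral>\<^sup>+t. ennreal ((norm (h t w))\<^sup>2) \<partial>leb T) \<in> borel_measurable M"
      by (rule L.borel_measurable_nn_integral)
  qed
  finally show ?thesis .
qed

lemma sq_integrable_prim:
  assumes h: "L2proc M h" and t: "0 \<le> t"
  shows "sq_integrable M (\<lambda>w. prim (\<lambda>r. h r w) t)"
proof -
  have "(\<lambda>w. prim (\<lambda>r. h r w) t) \<in> borel_measurable M"
    using jmeas_section[OF jmeas_prim[OF L2proc_jmeas[OF h]] t] .
  thus ?thesis unfolding sq_integrable_iff_nn_integral
    using prim_second_moment[OF h t order_refl] h t
    by (auto simp: L2proc_iff_nn ennreal_mult_less_top intro: le_less_trans)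
qed

lemma L2proc_prim:
  assumes h: "L2proc M h"
  shows "L2proc M (\<lambda>t w. prim (\<lambda>r. h r w) t)"
proof -
  have j: "jmeas M (\<lambda>t w. prim (\<lambda>r. h r w) t)" by (rule jmeas_prim[OF L2proc_jmeas[OF h]])
  have "(\<integral>\<^sup>+w. (\<integral>\<^sup>+t. ennreal ((norm (prim (\<lambda>r. h r w) t))\<^sup>2) \<partial>leb T) \<partial>M) < \<infinity>" if T: "0 \<le> T" for T
  proof -
    interpret P: pair_sigma_finite "leb T" M by (rule pair_sigma_finite_leb)
    let ?c = "ennreal T * (\<integral>\<^sup>+w. (\<integral>\<^sup>+t. ennreal ((norm (h t w))\<^sup>2) \<partial>leb T) \<partial>M)"
    have "(\<integral>\<^sup>+w. (\<integral>\<^sup>+t. ennreal ((norm (prim (\<lambda>r. h r w) t))\<^sup>2) \<partial>leb T) \<partial>M)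
      = (\<integral>\<^sup>+t. (\<integral>\<^sup>+w. ennreal ((norm (prim (\<lambda>r. h r w) t))\<^sup>2) \<partial>M) \<partial>leb T)"
      by (rule P.Fubini') (use jmeas_leb[OF j, of T] in \<open>simp add: split_beta'\<close>)
    also have "\<dots> \<le> (\<integral>\<^sup>+t. ?c \<partial>leb T)"
      by (intro nn_integral_mono prim_second_moment[OF h]) (auto simp: space_restrict_space)
    also have "\<dots> < \<infinity>" using h T
      by (auto simp: L2proc_iff_nn ennreal_mult_less_top emeasure_restrict_space space_restrict_space)
    finally show ?thesis .
  qed
  with j show ?thesis by (simp add: L2proc_iff_nn)
qed

text \<open>The martingale property is stated weakly, by pairing with square-integrable variables of
  the past. This is the form in which integration by parts uses it, and it passes to sums at
  once.\<close>

definition martingale_noise :: "(real \<Rightarrow> 'w \<Rightarrow> real^'n) \<Rightarrow> bool" where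
  "martingale_noise I \<longleftrightarrow> L2proc M I \<and> (\<forall>t\<ge>0. sq_integrable M (I t)) \<and> (AE w in M. I 0 w = 0) \<and>
     (\<forall>s t Y. 0 \<le> s \<and> s \<le> t \<and> sq_integrable M Y \<and> Y \<in> borel_measurable (F s) \<longrightarrow>
        expectation (\<lambda>w. I t w \<bullet> Y w) = expectation (\<lambda>w. I s w \<bullet> Y w))"

lemma martingale_noise_zero: "martingale_noise (\<lambda>t w. 0)"
  by (auto simp: martingale_noise_def sq_integrable_zero intro: L2proc_const)

text \<open>Only \<open>X\<close> carries noise, so no bracket term appears.\<close>

lemma expectation_integration_by_parts:
  fixes X Z :: "real \<Rightarrow> 'w \<Rightarrow> real^'n"
  assumes h: "L2proc M h" and k: "L2proc M k" and X0: "sq_integrable M X0" and Z0: "sq_integrable M Z0"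
    and I: "martingale_noise I" and kF: "\<And>t. 0 \<le> t \<Longrightarrow> k t \<in> borel_measurable (F t)" and ZF: "Z0 \<in> borel_measurable (F 0)"
    and T: "0 \<le> T"
  defines "X \<equiv> \<lambda>t w. X0 w + prim (\<lambda>r. h r w) t + I t w" and "Z \<equiv> \<lambda>t w. Z0 w + prim (\<lambda>r. k r w) t"
  shows "expectation (\<lambda>w. X T w \<bullet> Z T w) = expectation (\<lambda>w. X0 w \<bullet> Z0 w)
      + prim (\<lambda>t. expectation (\<lambda>w. h t w \<bullet> Z t w) + expectation (\<lambda>w. X t w \<bullet> k t w)) T"
    "integrable (leb T) (\<lambda>t. expectation (\<lambda>w. h t w \<bullet> Z t w) + expectation (\<lambda>w. X t w \<bullet> k t w))"
proof -
  \<comment> \<open>The noise-free part of X. It is handled path by path with the product rule, the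
    noise by its martingale property.\<close>
  define H where "H t w = X0 w + prim (\<lambda>r. h r w) t" for t w
  have LI: "L2proc M I" and sI: "\<And>t. 0 \<le> t \<Longrightarrow> sq_integrable M (I t)" and I0: "AE w in M. I 0 w = 0"
    and mart: "\<And>s t Y. 0 \<le> s \<Longrightarrow> s \<le> t \<Longrightarrow> sq_integrable M Y \<Longrightarrow> Y \<in> borel_measurable (F s) \<Longrightarrow>
        expectation (\<lambda>w. I t w \<bullet> Y w) = expectation (\<lambda>w. I s w \<bullet> Y w)"
    using I by (auto simp: martingale_noise_def)
  have LH: "L2proc M H" unfolding H_def by (intro L2proc_add L2proc_const X0 L2proc_prim h)
  have LZ: "L2proc M Z" unfolding Z_def by (intro L2proc_add L2proc_const Z0 L2proc_prim k)
  have sH: "sq_integrable M (H t)" if "0 \<le> t" for t unfolding H_def by (intro sq_integrable_add X0 sq_integrable_prim h that)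
  have sZ: "sq_integrable M (Z t)" if "0 \<le> t" for t unfolding Z_def by (intro sq_integrable_add Z0 sq_integrable_prim k that)
  have XH: "X t w = H t w + I t w" for t w by (simp add: X_def H_def)
  have LX: "L2proc M X" unfolding XH[abs_def] by (intro L2proc_add LH LI)
  note i1 = L2proc_inner[OF h LZ T] and i2 = L2proc_inner[OF LH k T] and i3 = L2proc_inner[OF LI k T]
    and i4 = L2proc_inner[OF L2proc_const[OF sI[OF T]] k T] and i5 = L2proc_inner[OF LX k T]
  show "integrable (leb T) (\<lambda>t. expectation (\<lambda>w. h t w \<bullet> Z t w) + expectation (\<lambda>w. X t w \<bullet> k t w))"
    using i1(1) i5(1) by simp
  have AEH: "AE w in M. H T w \<bullet> Z T w = X0 w \<bullet> Z0 w + ((\<integral>t. h t w \<bullet> Z t w \<partial>leb T) + (\<integral>t. H t w \<bullet> k t w \<partial>leb T))"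
    using L2proc_AE_path[OF h T] L2proc_AE_path[OF k T]
  proof eventually_elim
    case (elim w)
    have ih: "integrable (leb T) (\<lambda>t. h t w)" and ik: "integrable (leb T) (\<lambda>t. k t w)"
      using norm_prim_square_le(2)[OF elim(1) T] norm_prim_square_le(2)[OF elim(2) T] by auto
    note P = prim_mult_prim[OF ih ik T]
    have "(\<integral>t. h t w \<bullet> Z t w \<partial>leb T) = prim (\<lambda>r. h r w) T \<bullet> Z0 w + (\<integral>t. h t w \<bullet> prim (\<lambda>r. k r w) t \<partial>leb T)"
      using ih P by (simp add: Z_def inner_add_right prim_def)
    moreover have "(\<integral>t. H t w \<bullet> k t w \<partial>leb T) = X0 w \<bullet> prim (\<lambda>r. k r w) T + (\<integral>t. prim (\<lambda>r. h r w) t \<bullet> k t w \<partial>leb T)"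
      using ik P by (simp add: H_def inner_add_left prim_def)
    ultimately show ?case using P by (simp add: H_def Z_def inner_add_left inner_add_right)
  qed
  have EH: "expectation (\<lambda>w. H T w \<bullet> Z T w) = expectation (\<lambda>w. X0 w \<bullet> Z0 w)
     + ((\<integral>t. expectation (\<lambda>w. h t w \<bullet> Z t w) \<partial>leb T) + (\<integral>t. expectation (\<lambda>w. H t w \<bullet> k t w) \<partial>leb T))"
  proof -
    have "expectation (\<lambda>w. H T w \<bullet> Z T w)
      = expectation (\<lambda>w. X0 w \<bullet> Z0 w + ((\<integral>t. h t w \<bullet> Z t w \<partial>leb T) + (\<integral>t. H t w \<bullet> k t w \<partial>leb T)))"
      by (rule integral_cong_AE[OF _ _ AEH])
         (use sq_integrable_inner[OF sH[OF T] sZ[OF T]] sq_integrable_inner[OF X0 Z0] i1(2) i2(2) in \<open>auto intro!: borel_measurable_add\<close>)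
    thus ?thesis using sq_integrable_inner[OF X0 Z0] i1(2,3) i2(2,3) by simp
  qed
  have AEI: "AE w in M. I T w \<bullet> Z T w = I T w \<bullet> Z0 w + (\<integral>t. I T w \<bullet> k t w \<partial>leb T)"
    using L2proc_AE_path[OF k T]
  proof eventually_elim
    case (elim w)
    have ik: "integrable (leb T) (\<lambda>t. k t w)" using norm_prim_square_le(2)[OF elim T] .
    thus ?case by (simp add: Z_def inner_add_right prim_def)
  qed
  \<comment> \<open>The value of the noise at the final time may be replaced under the time integral
    by its value at t, because \<open>k t\<close> belongs to the past of t.\<close>
  have EI: "expectation (\<lambda>w. I T w \<bullet> Z T w) = (\<integral>t. expectation (\<lambda>w. I t w \<bullet> k t w) \<partial>leb T)"
  proof -
    have "expectation (\<lambda>w. I T w \<bullet> Z T w) = expectation (\<lambda>w. I T w \<bullet> Z0 w + (\<integral>t. I T w \<bullet> k t w \<partial>leb T))"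
      by (rule integral_cong_AE[OF _ _ AEI])
         (use sq_integrable_inner[OF sI[OF T] sZ[OF T]] sq_integrable_inner[OF sI[OF T] Z0] i4(2) in \<open>auto intro!: borel_measurable_add\<close>)
    also have "\<dots> = expectation (\<lambda>w. I T w \<bullet> Z0 w) + (\<integral>t. expectation (\<lambda>w. I T w \<bullet> k t w) \<partial>leb T)"
      using sq_integrable_inner[OF sI[OF T] Z0] i4(2,3) by simp
    also have "expectation (\<lambda>w. I T w \<bullet> Z0 w) = expectation (\<lambda>w. I 0 w \<bullet> Z0 w)" by (rule mart[OF order_refl T Z0 ZF])
    also have "\<dots> = 0"
      by (rule integral_eq_zero_AE) (use I0 in eventually_elim, simp)
    also have "(\<integral>t. expectation (\<lambda>w. I T w \<bullet> k t w) \<partial>leb T) = (\<integral>t. expectation (\<lambda>w. I t w \<bullet> k t w) \<partial>leb T)"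
    proof (rule integral_cong_AE)
      show "AE t in leb T. expectation (\<lambda>w. I T w \<bullet> k t w) = expectation (\<lambda>w. I t w \<bullet> k t w)"
        using L2proc_AE_section[OF k T] AE_space
      proof eventually_elim
        case (elim t)
        hence t: "0 \<le> t" "t \<le> T" by (auto simp: space_restrict_space)
        show ?case by (rule mart[OF t elim(1) kF[OF t(1)]])
      qed
    qed (use i4(1) i3(1) in auto)
    finally show ?thesis by simp
  qed
  have sec: "expectation (\<lambda>w. X t w \<bullet> k t w) = expectation (\<lambda>w. H t w \<bullet> k t w) + expectation (\<lambda>w. I t w \<bullet> k t w)"
    if "sq_integrable M (k t)" "0 \<le> t" for t
    using sq_integrable_inner[OF sH[OF that(2)] that(1)] sq_integrable_inner[OF sI[OF that(2)] that(1)]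
    by (simp add: XH inner_add_left)
  have "(\<integral>t. expectation (\<lambda>w. X t w \<bullet> k t w) \<partial>leb T)
    = (\<integral>t. expectation (\<lambda>w. H t w \<bullet> k t w) + expectation (\<lambda>w. I t w \<bullet> k t w) \<partial>leb T)"
  proof (rule integral_cong_AE)
    show "AE t in leb T. expectation (\<lambda>w. X t w \<bullet> k t w) = expectation (\<lambda>w. H t w \<bullet> k t w) + expectation (\<lambda>w. I t w \<bullet> k t w)"
      using L2proc_AE_section[OF k T] AE_space
      by eventually_elim (auto simp: space_restrict_space sec)
  qed (use i5(1) i2(1) i3(1) in \<open>auto intro!: borel_measurable_add\<close>)
  also have "\<dots> = (\<integral>t. expectation (\<lambda>w. H t w \<bullet> k t w) \<partial>leb T) + (\<integral>t. expectation (\<lambda>w. I t w \<bullet> k t w) \<partial>leb T)"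
    using i2(1) i3(1) by simp
  finally have EX: "(\<integral>t. expectation (\<lambda>w. X t w \<bullet> k t w) \<partial>leb T) = \<dots>" .
  have "expectation (\<lambda>w. X T w \<bullet> Z T w) = expectation (\<lambda>w. H T w \<bullet> Z T w) + expectation (\<lambda>w. I T w \<bullet> Z T w)"
    using sq_integrable_inner[OF sH[OF T] sZ[OF T]] sq_integrable_inner[OF sI[OF T] sZ[OF T]] by (simp add: XH inner_add_left)
  thus "expectation (\<lambda>w. X T w \<bullet> Z T w) = expectation (\<lambda>w. X0 w \<bullet> Z0 w)
      + prim (\<lambda>t. expectation (\<lambda>w. h t w \<bullet> Z t w) + expectation (\<lambda>w. X t w \<bullet> k t w)) T"
    using EH EI EX i1(1) i5(1) by (simp add: prim_def)
qed

end

section \<open>Discounted infinite horizon\<close>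

text \<open>Half of the discount goes to each factor, so products carry exp(-\<rho> t) and the
  discounted space becomes an ordinary L2 space over the half-line.\<close>

definition disc :: "real \<Rightarrow> (real \<Rightarrow> 'w \<Rightarrow> real^'n) \<Rightarrow> real \<Rightarrow> 'w \<Rightarrow> real^'n" where
  "disc \<rho> X t w = exp (- (\<rho>/2) * t) *\<^sub>R X t w"

definition L2disc :: "'w measure \<Rightarrow> real \<Rightarrow> (real \<Rightarrow> 'w \<Rightarrow> real^'n) \<Rightarrow> bool" where
  "L2disc M \<rho> X \<longleftrightarrow> jmeas M X \<and> sq_integrable (lebh \<Otimes>\<^sub>M M) (\<lambda>p. disc \<rho> X (fst p) (snd p))"

lemma exp_half_square: "exp (- (\<rho>/2) * t) * exp (- (\<rho>/2) * t) = exp (- \<rho> * t)" for \<rho> t :: real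
  by (simp add: exp_add[symmetric])

lemma disc_inner: "disc \<rho> X t w \<bullet> disc \<rho> Y t w = exp (- \<rho> * t) * (X t w \<bullet> Y t w)"
  unfolding disc_def by (simp only: inner_scaleR_left inner_scaleR_right exp_half_square mult.assoc[symmetric])

lemma disc_norm: "(norm (disc \<rho> X t w))\<^sup>2 = exp (- \<rho> * t) * (norm (X t w))\<^sup>2"
  unfolding power2_norm_eq_inner disc_inner ..

lemma id_measurable_lebh: "(\<lambda>x. x) \<in> borel_measurable lebh"
  by (rule measurable_restrict_space1) simp

lemma jmeas_disc: "jmeas M X \<Longrightarrow> jmeas M (disc \<rho> X)"
proof -
  assume X: "jmeas M X"
  have "(\<lambda>t. exp (- (\<rho>/2) * t)) \<in> borel_measurable lebh" using id_measurable_lebh by measurable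
  from measurable_compose[OF measurable_fst this, of M] X show ?thesis
    unfolding jmeas_def disc_def by (intro borel_measurable_scaleR)
qed

lemma L2disc_jmeas: "L2disc M \<rho> X \<Longrightarrow> jmeas M X" by (simp add: L2disc_def)

lemma L2disc_add: "L2disc M \<rho> X \<Longrightarrow> L2disc M \<rho> Y \<Longrightarrow> L2disc M \<rho> (\<lambda>t w. X t w + Y t w)"
  unfolding L2disc_def disc_def scaleR_add_right by (auto intro: jmeas_add sq_integrable_add)

lemma L2disc_diff: "L2disc M \<rho> X \<Longrightarrow> L2disc M \<rho> Y \<Longrightarrow> L2disc M \<rho> (\<lambda>t w. X t w - Y t w)"
  unfolding L2disc_def disc_def scaleR_diff_right by (auto intro: jmeas_diff sq_integrable_diff)

lemma L2disc_matrix: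
  fixes Y :: "real^'n^'m"
  shows "L2disc M \<rho> X \<Longrightarrow> L2disc M \<rho> (\<lambda>t w. Y *v X t w)"
  unfolding L2disc_def disc_def matrix_vector_mult_scaleR[symmetric] by (auto intro: jmeas_matrix sq_integrable_matrix)

lemma L2disc_scaleR: "L2disc M \<rho> X \<Longrightarrow> L2disc M \<rho> (\<lambda>t w. c *\<^sub>R X t w)"
  unfolding L2disc_def disc_def scaleR_left_commute[of _ c] by (elim conjE, intro conjI, erule jmeas_scaleR, erule sq_integrable_scaleR)

lemma L2disc_sum: "(\<And>i. i \<in> I \<Longrightarrow> L2disc M \<rho> (X i)) \<Longrightarrow> L2disc M \<rho> (\<lambda>t w. \<Sum>i\<in>I. X i t w)"
  unfolding L2disc_def disc_def scaleR_sum_right by (auto intro: jmeas_sum sq_integrable_sum)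

lemma L2disc_inner:
  assumes "L2disc M \<rho> X" "L2disc M \<rho> Y"
  shows "integrable (lebh \<Otimes>\<^sub>M M) (\<lambda>p. exp (- \<rho> * fst p) * (X (fst p) (snd p) \<bullet> Y (fst p) (snd p)))"
  using sq_integrable_inner[of "lebh \<Otimes>\<^sub>M M" "\<lambda>p. disc \<rho> X (fst p) (snd p)" "\<lambda>p. disc \<rho> Y (fst p) (snd p)"] assms
  by (simp only: L2disc_def disc_inner)

lemma integral_leb_lebh:
  fixes f :: "real \<Rightarrow> real"
  shows "integral\<^sup>L (leb T) f = (\<integral>t. indicator {0..T} t * f t \<partial>lebh)"
    "integrable lebh f \<Longrightarrow> integrable (leb T) f"
    "(\<integral>\<^sup>+t. g t \<partial>leb T) = (\<integral>\<^sup>+t. g t * indicator {0..T} t \<partial>lebh)"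
proof -
  have eq: "leb T = restrict_space lebh {0..T}" by (simp add: restrict_restrict_space Int_absorb1)
  have s: "{0..T} \<inter> space lebh \<in> sets lebh" by (auto simp: sets_restrict_space space_restrict_space intro!: image_eqI[of _ _ "{0..T}"])
  show "integral\<^sup>L (leb T) f = (\<integral>t. indicator {0..T} t * f t \<partial>lebh)"
    unfolding eq using integral_restrict_space[OF s, of f] by simp
  have "integrable lebh (\<lambda>t. indicator ({0..T} \<inter> space lebh) t *\<^sub>R f t)" if "integrable lebh f"
    using integrable_mult_indicator[OF s that] .
  moreover have "(\<lambda>t. indicator ({0..T} \<inter> space lebh) t *\<^sub>R f t) = (\<lambda>t. indicator {0..T} t *\<^sub>R f t)"
    by (auto simp: space_restrict_space indicator_def fun_eq_iff)
  ultimately show "integrable lebh f \<Longrightarrow> integrable (leb T) f"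
    unfolding eq using integrable_restrict_space[OF s, of f] by metis
  show "(\<integral>\<^sup>+t. g t \<partial>leb T) = (\<integral>\<^sup>+t. g t * indicator {0..T} t \<partial>lebh)"
    unfolding eq using nn_integral_restrict_space[OF s, of g] by simp
qed

lemma indicator_measurable_lebh: "(\<lambda>t. indicator {a..b} t :: 'b::{zero_neq_one, topological_space}) \<in> borel_measurable lebh"
  by (rule measurable_restrict_space1) simp

lemma integral_leb_tendsto:
  fixes f :: "real \<Rightarrow> real"
  assumes f: "integrable lebh f"
  shows "((\<lambda>T. integral\<^sup>L (leb T) f) \<longlongrightarrow> integral\<^sup>L lebh f) at_top"
  unfolding integral_leb_lebh(1)
proof (rule integral_dominated_convergence_at_top[where w = "\<lambda>t. \<bar>f t\<bar>"])
  show "AE x in lebh. ((\<lambda>T. indicator {0..T} x * f x) \<longlongrightarrow> f x) at_top"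
  proof (rule AE_I2)
    fix x assume "x \<in> space lebh"
    hence x: "0 \<le> x" by (simp add: space_restrict_space)
    have "\<forall>\<^sub>F T in at_top. indicator {0..T} x * f x = f x"
      using eventually_ge_at_top[of x] by eventually_elim (use x in auto)
    thus "((\<lambda>T. indicator {0..T} x * f x) \<longlongrightarrow> f x) at_top" by (rule tendsto_eventually)
  qed
  show "\<forall>\<^sub>F T in at_top. AE x in lebh. norm (indicator {0..T} x * f x) \<le> \<bar>f x\<bar>"
    by (auto simp: indicator_def)
  show "(\<lambda>t. indicator {0..T} t * f t) \<in> borel_measurable lebh" for T
    using f indicator_measurable_lebh by measurable
qed (use f in auto)

lemma nn_integral_lebh_bound:
  assumes g: "g \<in> borel_measurable lebh" and le: "\<And>T. 0 \<le> T \<Longrightarrow> (\<integral>\<^sup>+t. g t \<partial>leb T) \<le> C"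
  shows "(\<integral>\<^sup>+t. g t \<partial>lebh) \<le> C"
proof -
  have "(\<integral>\<^sup>+t. g t \<partial>lebh) = (\<integral>\<^sup>+t. (SUP n. g t * indicator {0..real n} t) \<partial>lebh)"
  proof (rule nn_integral_cong)
    fix t assume "t \<in> space lebh"
    hence t: "0 \<le> t" by (simp add: space_restrict_space)
    obtain n where n: "t \<le> real n" using real_arch_simple by blast
    show "g t = (SUP n. g t * indicator {0..real n} t)"
    proof (rule antisym)
      have "g t = g t * indicator {0..real n} t" using t n by simp
      also have "\<dots> \<le> (SUP n. g t * indicator {0..real n} t)" by (rule SUP_upper) simp
      finally show "g t \<le> (SUP n. g t * indicator {0..real n} t)" .
    qed (auto intro!: SUP_least simp: indicator_def)
  qed
  also have "\<dots> = (SUP n. \<integral>\<^sup>+t. g t * indicator {0..real n} t \<partial>lebh)"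
  proof (rule nn_integral_monotone_convergence_SUP)
    show "incseq (\<lambda>n t. g t * indicator {0..real n} t)"
      by (auto simp: incseq_def le_fun_def indicator_def)
    show "(\<lambda>t. g t * indicator {0..real n} t) \<in> borel_measurable lebh" for n
      using g indicator_measurable_lebh by measurable
  qed
  also have "\<dots> \<le> C" unfolding integral_leb_lebh(3)[symmetric] by (intro SUP_least le) simp
  finally show ?thesis .
qed

text \<open>A nonzero limit would bound g below by a positive constant near infinity. This disposes
  of boundary terms for which only a limit and an integrable bound are available.\<close>

lemma limit_zero_if_integrable_at_top:
  fixes \<tau> :: "real \<Rightarrow> real"
  assumes lim: "(\<tau> \<longlongrightarrow> L) at_top" and g: "integrable lebh g" and le: "\<And>t. 0 \<le> t \<Longrightarrow> \<bar>\<tau> t\<bar> \<le> g t"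
  shows "L = 0"
proof (rule ccontr)
  assume "L \<noteq> 0"
  have "((\<lambda>t. \<bar>\<tau> t\<bar>) \<longlongrightarrow> \<bar>L\<bar>) at_top" using lim by (rule tendsto_rabs)
  from order_tendstoD(1)[OF this, of "\<bar>L\<bar> / 2"] \<open>L \<noteq> 0\<close> obtain T0 where T0: "\<And>t. t \<ge> T0 \<Longrightarrow> \<bar>\<tau> t\<bar> > \<bar>L\<bar> / 2"
    by (auto simp: eventually_at_top_linorder)
  define T where "T = max 0 T0"
  have gL: "\<bar>L\<bar> / 2 \<le> g t" if "t \<ge> T" for t using T0[of t] le[of t] that by (simp add: T_def)
  have g0: "0 \<le> g t" if "0 \<le> t" for t using le[OF that] by simp
  have b: "\<bar>L\<bar> / 2 * real n \<le> integral\<^sup>L lebh g" for n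
  proof -
    have "\<bar>L\<bar> / 2 * real n = (\<integral>t. \<bar>L\<bar> / 2 * indicator {T..T + real n} t \<partial>lborel)"
      by simp
    also have "\<dots> \<le> (\<integral>t. indicator {0..} t *\<^sub>R g t \<partial>lborel)"
    proof (rule integral_mono)
      show "integrable lborel (\<lambda>t. \<bar>L\<bar> / 2 * indicator {T..T + real n} t)" by simp
      show "integrable lborel (\<lambda>t. indicator {0..} t *\<^sub>R g t)" using g by (simp add: integrable_restrict_space)
      show "\<bar>L\<bar> / 2 * indicator {T..T + real n} t \<le> indicator {0..} t *\<^sub>R g t" for t
        using gL[of t] g0[of t] by (auto simp: indicator_def T_def)
    qed
    also have "\<dots> = integral\<^sup>L lebh g" by (simp add: integral_restrict_space)
    finally show ?thesis .
  qed
  obtain n where "integral\<^sup>L lebh g / (\<bar>L\<bar> / 2) < real n" using reals_Archimedean2 by blast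
  hence "integral\<^sup>L lebh g < \<bar>L\<bar> / 2 * real n" using \<open>L \<noteq> 0\<close> by (simp add: field_simps)
  with b[of n] show False by simp
qed

context filtered_prob begin

lemma pair_sigma_finite_lebh: "pair_sigma_finite lebh M"
  using sigma_finite_lebh sigma_finite_measure_axioms by (simp add: pair_sigma_finite_def)

lemma L2disc_iff_nn:
  "L2disc M \<rho> X \<longleftrightarrow> jmeas M X \<and> (\<integral>\<^sup>+w. (\<integral>\<^sup>+t. ennreal (exp (- \<rho> * t) * (norm (X t w))\<^sup>2) \<partial>lebh) \<partial>M) < \<infinity>"
proof -
  have eq: "(\<integral>\<^sup>+w. (\<integral>\<^sup>+t. ennreal (exp (- \<rho> * t) * (norm (X t w))\<^sup>2) \<partial>lebh) \<partial>M)
    = (\<integral>\<^sup>+p. ennreal ((norm (disc \<rho> X (fst p) (snd p)))\<^sup>2) \<partial>(lebh \<Otimes>\<^sub>M M))" if "jmeas M X"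
  proof -
    interpret P: pair_sigma_finite lebh M by (rule pair_sigma_finite_lebh)
    have "(\<lambda>p. disc \<rho> X (fst p) (snd p)) \<in> borel_measurable (lebh \<Otimes>\<^sub>M M)" using jmeas_disc[OF that] by (simp only: jmeas_def)
    thus ?thesis unfolding disc_norm[symmetric]
      by (subst P.nn_integral_snd[symmetric]) (auto simp: split_beta')
  qed
  show ?thesis unfolding L2disc_def sq_integrable_iff_nn_integral
    using eq jmeas_disc[of M X \<rho>] by (auto simp: jmeas_def)
qed

lemma L2proc_disc:
  assumes X: "L2proc M X" and \<rho>: "0 \<le> \<rho>"
  shows "L2proc M (disc \<rho> X)"
proof -
  have j: "jmeas M (disc \<rho> X)" using jmeas_disc[OF L2proc_jmeas[OF X]] .
  have "sq_integrable (leb T \<Otimes>\<^sub>M M) (\<lambda>p. disc \<rho> X (fst p) (snd p))" if T: "0 \<le> T" for T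
  proof (rule sq_integrable_bound[OF _ jmeas_leb[OF j]])
    show "sq_integrable (leb T \<Otimes>\<^sub>M M) (\<lambda>p. X (fst p) (snd p))" using X T by (simp add: L2proc_def)
    fix p assume "p \<in> space (leb T \<Otimes>\<^sub>M M)"
    hence "0 \<le> fst p" by (auto simp: space_pair_measure space_restrict_space)
    thus "norm (disc \<rho> X (fst p) (snd p)) \<le> 1 * norm (X (fst p) (snd p))"
      using \<rho> by (auto simp: disc_def intro!: mult_left_le_one_le)
  qed
  with j show ?thesis by (simp add: L2proc_def)
qed

lemma L2disc_L2proc:
  assumes X: "L2disc M \<rho> X" and \<rho>: "0 \<le> \<rho>"
  shows "L2proc M X"
proof -
  have j: "jmeas M X" using X by (rule L2disc_jmeas)
  have "(\<integral>\<^sup>+w. (\<integral>\<^sup>+t. ennreal ((norm (X t w))\<^sup>2) \<partial>leb T) \<partial>M) < \<infinity>" if T: "0 \<le> T" for T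
  proof -
    let ?I = "\<lambda>w. \<integral>\<^sup>+t. ennreal (exp (- \<rho> * t) * (norm (X t w))\<^sup>2) \<partial>lebh"
    have "(\<integral>\<^sup>+t. ennreal ((norm (X t w))\<^sup>2) \<partial>leb T) \<le> ennreal (exp (\<rho> * T)) * ?I w" if w: "w \<in> space M" for w
    proof -
      have [measurable]: "(\<lambda>t. X t w) \<in> borel_measurable lebh" using jmeas_path[OF j w] .
      have [measurable]: "(\<lambda>t. exp (- \<rho> * t)) \<in> borel_measurable lebh" using id_measurable_lebh by measurable
      have "(\<integral>\<^sup>+t. ennreal ((norm (X t w))\<^sup>2) \<partial>leb T) = (\<integral>\<^sup>+t. ennreal ((norm (X t w))\<^sup>2) * indicator {0..T} t \<partial>lebh)"
        by (rule integral_leb_lebh(3))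
      also have "\<dots> \<le> (\<integral>\<^sup>+t. ennreal (exp (\<rho> * T)) * ennreal (exp (- \<rho> * t) * (norm (X t w))\<^sup>2) \<partial>lebh)"
      proof (rule nn_integral_mono)
        fix t
        have "(norm (X t w))\<^sup>2 \<le> exp (\<rho> * T) * (exp (- \<rho> * t) * (norm (X t w))\<^sup>2)" if "t \<le> T"
        proof -
          have "1 \<le> exp (\<rho> * T) * exp (- \<rho> * t)" using that \<rho> by (simp add: exp_add[symmetric] mult_left_mono)
          from mult_right_mono[OF this, of "(norm (X t w))\<^sup>2"] show ?thesis by (simp add: mult.assoc)
        qed
        thus "ennreal ((norm (X t w))\<^sup>2) * indicator {0..T} t \<le> ennreal (exp (\<rho> * T)) * ennreal (exp (- \<rho> * t) * (norm (X t w))\<^sup>2)"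
          by (auto simp: indicator_def ennreal_mult[symmetric] intro!: ennreal_leI)
      qed
      also have "\<dots> = ennreal (exp (\<rho> * T)) * ?I w" by (rule nn_integral_cmult) measurable
      finally show ?thesis .
    qed
    hence "(\<integral>\<^sup>+w. (\<integral>\<^sup>+t. ennreal ((norm (X t w))\<^sup>2) \<partial>leb T) \<partial>M) \<le> (\<integral>\<^sup>+w. ennreal (exp (\<rho> * T)) * ?I w \<partial>M)"
      by (rule nn_integral_mono)
    also have "\<dots> = ennreal (exp (\<rho> * T)) * (\<integral>\<^sup>+w. ?I w \<partial>M)"
    proof (rule nn_integral_cmult)
      interpret L: sigma_finite_measure lebh by (rule sigma_finite_lebh)
      have "(\<lambda>p. disc \<rho> X (fst p) (snd p)) \<in> borel_measurable (lebh \<Otimes>\<^sub>M M)" using jmeas_disc[OF j] by (simp only: jmeas_def)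
      from measurable_compose[OF measurable_pair_swap' this]
      have "(\<lambda>(w, t). ennreal ((norm (disc \<rho> X t w))\<^sup>2)) \<in> borel_measurable (M \<Otimes>\<^sub>M lebh)" by (simp add: split_beta')
      thus "?I \<in> borel_measurable M" unfolding disc_norm[symmetric] by (rule L.borel_measurable_nn_integral)
    qed
    also have "\<dots> < \<infinity>" using X by (simp add: L2disc_iff_nn ennreal_mult_less_top)
    finally show ?thesis .
  qed
  with j show ?thesis by (simp add: L2proc_iff_nn)
qed

text \<open>Bounds uniform in the horizon pass to the half-line by monotone convergence. All
  infinite-horizon integrability of random states is obtained this way.\<close>

lemma L2disc_bound:
  assumes X: "L2proc M X" and \<rho>: "0 \<le> \<rho>"
    and le: "\<And>T. 0 \<le> T \<Longrightarrow> (\<integral>t. exp (- \<rho> * t) * expectation (\<lambda>w. (norm (X t w))\<^sup>2) \<partial>leb T) \<le> C"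
  shows "L2disc M \<rho> X" "(\<integral>p. exp (- \<rho> * fst p) * (norm (X (fst p) (snd p)))\<^sup>2 \<partial>(lebh \<Otimes>\<^sub>M M)) \<le> C"
proof -
  interpret P: pair_sigma_finite lebh M by (rule pair_sigma_finite_lebh)
  have j: "jmeas M X" using X by (rule L2proc_jmeas)
  have D: "L2proc M (disc \<rho> X)" using L2proc_disc[OF X \<rho>] .
  let ?f = "\<lambda>p. ennreal ((norm (disc \<rho> X (fst p) (snd p)))\<^sup>2)"
  have dm: "(\<lambda>p. disc \<rho> X (fst p) (snd p)) \<in> borel_measurable (lebh \<Otimes>\<^sub>M M)" using jmeas_disc[OF j] by (simp only: jmeas_def)
  have m: "?f \<in> borel_measurable (lebh \<Otimes>\<^sub>M M)" using dm by measurable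
  let ?g = "\<lambda>t. \<integral>\<^sup>+w. ?f (t, w) \<partial>M"
  have gm: "?g \<in> borel_measurable lebh" using borel_measurable_nn_integral_fst[OF m] .
  have "(\<integral>\<^sup>+t. ?g t \<partial>leb T) \<le> ennreal C" if T: "0 \<le> T" for T
  proof -
    have "AE t in leb T. ?g t = ennreal (expectation (\<lambda>w. (norm (disc \<rho> X t w))\<^sup>2))"
      using L2proc_AE_section[OF D T]
      by eventually_elim (auto simp: sq_integrable_def intro!: nn_integral_eq_integral)
    hence "(\<integral>\<^sup>+t. ?g t \<partial>leb T) = (\<integral>\<^sup>+t. ennreal (expectation (\<lambda>w. (norm (disc \<rho> X t w))\<^sup>2)) \<partial>leb T)"
      by (rule nn_integral_cong_AE)
    also have "\<dots> = ennreal (\<integral>t. expectation (\<lambda>w. (norm (disc \<rho> X t w))\<^sup>2) \<partial>leb T)"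
      using L2proc_inner(1)[OF D D T] by (intro nn_integral_eq_integral) (auto simp: power2_norm_eq_inner)
    also have "\<dots> \<le> ennreal C" using le[OF T] by (intro ennreal_leI) (simp add: disc_norm)
    finally show ?thesis .
  qed
  from nn_integral_lebh_bound[OF gm this] have "(\<integral>\<^sup>+t. ?g t \<partial>lebh) \<le> ennreal C" .
  hence b: "(\<integral>\<^sup>+p. ?f p \<partial>(lebh \<Otimes>\<^sub>M M)) \<le> ennreal C" using nn_integral_fst[OF m] by simp
  thus L: "L2disc M \<rho> X"
    using j dm unfolding L2disc_def sq_integrable_iff_nn_integral by (auto intro: le_less_trans)
  have C: "0 \<le> C" using le[of 0] by (simp add: integral_leb_lebh(1)) (smt (verit, ccfv_SIG) Bochner_Integration.integral_nonneg exp_ge_zero indicator_pos_le mult_nonneg_nonneg zero_le_power2)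
  have "integrable (lebh \<Otimes>\<^sub>M M) (\<lambda>p. (norm (disc \<rho> X (fst p) (snd p)))\<^sup>2)" using L by (simp add: L2disc_def sq_integrable_def)
  from nn_integral_eq_integral[OF this] b
  have "ennreal (\<integral>p. (norm (disc \<rho> X (fst p) (snd p)))\<^sup>2 \<partial>(lebh \<Otimes>\<^sub>M M)) \<le> ennreal C" by simp
  thus "(\<integral>p. exp (- \<rho> * fst p) * (norm (X (fst p) (snd p)))\<^sup>2 \<partial>(lebh \<Otimes>\<^sub>M M)) \<le> C"
    using C by (simp add: disc_norm ennreal_le_iff)
qed

lemma L2disc_le:
  assumes X: "L2disc M \<rho> X" and \<rho>: "0 \<le> \<rho>" and T: "0 \<le> T"
  shows "(\<integral>t. exp (- \<rho> * t) * expectation (\<lambda>w. (norm (X t w))\<^sup>2) \<partial>leb T)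
    \<le> (\<integral>p. exp (- \<rho> * fst p) * (norm (X (fst p) (snd p)))\<^sup>2 \<partial>(lebh \<Otimes>\<^sub>M M))"
    "integrable lebh (\<lambda>t. exp (- \<rho> * t) * expectation (\<lambda>w. (norm (X t w))\<^sup>2))"
proof -
  interpret P: pair_sigma_finite lebh M by (rule pair_sigma_finite_lebh)
  have i: "integrable (lebh \<Otimes>\<^sub>M M) (\<lambda>(t, w). exp (- \<rho> * t) * (norm (X t w))\<^sup>2)"
    using L2disc_inner[OF X X] by (simp add: split_beta' power2_norm_eq_inner)
  show i1: "integrable lebh (\<lambda>t. exp (- \<rho> * t) * expectation (\<lambda>w. (norm (X t w))\<^sup>2))"
    using P.integrable_fst[OF i] by simp
  have "(\<integral>t. exp (- \<rho> * t) * expectation (\<lambda>w. (norm (X t w))\<^sup>2) \<partial>leb T)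
    \<le> (\<integral>t. exp (- \<rho> * t) * expectation (\<lambda>w. (norm (X t w))\<^sup>2) \<partial>lebh)"
    unfolding integral_leb_lebh(1)
  proof (rule integral_mono[OF _ i1])
    show "integrable lebh (\<lambda>t. indicator {0..T} t * (exp (- \<rho> * t) * expectation (\<lambda>w. (norm (X t w))\<^sup>2)))"
      by (rule Bochner_Integration.integrable_bound[OF i1])
         (rule borel_measurable_times[OF indicator_measurable_lebh borel_measurable_integrable[OF i1]], simp add: indicator_def)
  qed (auto simp: indicator_def)
  also have "\<dots> = (\<integral>p. exp (- \<rho> * fst p) * (norm (X (fst p) (snd p)))\<^sup>2 \<partial>(lebh \<Otimes>\<^sub>M M))"
    using P.integral_fst[OF i] by (simp add: split_beta')
  finally show "(\<integral>t. exp (- \<rho> * t) * expectation (\<lambda>w. (norm (X t w))\<^sup>2) \<partial>leb T)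
    \<le> (\<integral>p. exp (- \<rho> * fst p) * (norm (X (fst p) (snd p)))\<^sup>2 \<partial>(lebh \<Otimes>\<^sub>M M))" .
qed

end

lemma prim_cong: "(\<And>t. t \<in> space (leb T) \<Longrightarrow> f t = g t) \<Longrightarrow> prim f T = prim g T"
  unfolding prim_def by (rule Bochner_Integration.integral_cong[OF refl])

context filtered_prob begin

lemma expectation_inner_cong:
  assumes "X \<in> borel_measurable M" "X' \<in> borel_measurable M" "Z \<in> borel_measurable M" "Z' \<in> borel_measurable M"
    and "AE w in M. X w = X' w" "AE w in M. Z w = Z' w"
  shows "expectation (\<lambda>w. (X w :: real^'n) \<bullet> Z w) = expectation (\<lambda>w. X' w \<bullet> Z' w)"
proof (rule integral_cong_AE)
  show "AE w in M. X w \<bullet> Z w = X' w \<bullet> Z' w" using assms(5,6) by eventually_elim simp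
qed (use assms in measurable)

text \<open>The identity involves each time separately, under an expectation, so it is enough that X
  and Z satisfy their equations almost surely at each time.\<close>

lemma integration_by_parts:
  fixes X Z :: "real \<Rightarrow> 'w \<Rightarrow> real^'n"
  assumes h: "L2proc M h" and k: "L2proc M k" and X0: "sq_integrable M X0" and Z0: "sq_integrable M Z0"
    and I: "martingale_noise I" and kF: "\<And>t. 0 \<le> t \<Longrightarrow> k t \<in> borel_measurable (F t)" and ZF: "Z0 \<in> borel_measurable (F 0)"
    and jX: "jmeas M X" and jZ: "jmeas M Z"
    and X: "\<And>t. 0 \<le> t \<Longrightarrow> AE w in M. X t w = X0 w + prim (\<lambda>r. h r w) t + I t w"
    and Z: "\<And>t. 0 \<le> t \<Longrightarrow> AE w in M. Z t w = Z0 w + prim (\<lambda>r. k r w) t"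
    and T: "0 \<le> T"
  shows "expectation (\<lambda>w. X T w \<bullet> Z T w) = expectation (\<lambda>w. X0 w \<bullet> Z0 w)
      + prim (\<lambda>t. expectation (\<lambda>w. h t w \<bullet> Z t w) + expectation (\<lambda>w. X t w \<bullet> k t w)) T"
    "integrable (leb T) (\<lambda>t. expectation (\<lambda>w. h t w \<bullet> Z t w) + expectation (\<lambda>w. X t w \<bullet> k t w))"
    "sq_integrable M (X T)" "sq_integrable M (Z T)"
proof -
  let ?X = "\<lambda>t w. X0 w + prim (\<lambda>r. h r w) t + I t w" and ?Z = "\<lambda>t w. Z0 w + prim (\<lambda>r. k r w) t"
  have LI: "L2proc M I" and sI: "\<And>t. 0 \<le> t \<Longrightarrow> sq_integrable M (I t)" using I by (auto simp: martingale_noise_def)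
  have sX: "sq_integrable M (?X t)" and sZ: "sq_integrable M (?Z t)" if "0 \<le> t" for t
    by (intro sq_integrable_add X0 Z0 sq_integrable_prim h k that sI)+
  have mX: "?X t \<in> borel_measurable M" and mZ: "?Z t \<in> borel_measurable M" and mX': "X t \<in> borel_measurable M"
    and mZ': "Z t \<in> borel_measurable M" and mh: "h t \<in> borel_measurable M" and mk: "k t \<in> borel_measurable M" if "0 \<le> t" for t
    using sX[OF that] sZ[OF that] jmeas_section[OF jX that] jmeas_section[OF jZ that] jmeas_section[OF L2proc_jmeas[OF h] that]
      jmeas_section[OF L2proc_jmeas[OF k] that] by (auto intro: sq_integrable_measurable)
  have X': "AE w in M. ?X t w = X t w" and Z': "AE w in M. ?Z t w = Z t w" if "0 \<le> t" for t
    using X[OF that] Z[OF that] by (auto elim: eventually_mono)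
  show "sq_integrable M (X T)" "sq_integrable M (Z T)"
    using sq_integrable_cong_AE[OF sX[OF T] mX'[OF T] X'[OF T]] sq_integrable_cong_AE[OF sZ[OF T] mZ'[OF T] Z'[OF T]] by auto
  have e1: "expectation (\<lambda>w. h t w \<bullet> ?Z t w) = expectation (\<lambda>w. h t w \<bullet> Z t w)" if "0 \<le> t" for t
    by (rule expectation_inner_cong[OF mh mh mZ mZ' _ Z']) (use that in auto)
  have e2: "expectation (\<lambda>w. ?X t w \<bullet> k t w) = expectation (\<lambda>w. X t w \<bullet> k t w)" if "0 \<le> t" for t
    by (rule expectation_inner_cong[OF mX mX' mk mk X']) (use that in auto)
  have e3: "expectation (\<lambda>w. ?X T w \<bullet> ?Z T w) = expectation (\<lambda>w. X T w \<bullet> Z T w)"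
    by (rule expectation_inner_cong[OF mX mX' mZ mZ' X' Z']) (use T in auto)
  have s: "0 \<le> t" if "t \<in> space (leb T)" for t using that by (simp add: space_restrict_space)
  have e12: "expectation (\<lambda>w. h t w \<bullet> ?Z t w) + expectation (\<lambda>w. ?X t w \<bullet> k t w)
    = expectation (\<lambda>w. h t w \<bullet> Z t w) + expectation (\<lambda>w. X t w \<bullet> k t w)" if "t \<in> space (leb T)" for t
    by (rule arg_cong2[where f = "(+)", OF e1[OF s[OF that]] e2[OF s[OF that]]])
  have c: "integrable (leb T) (\<lambda>t. expectation (\<lambda>w. h t w \<bullet> ?Z t w) + expectation (\<lambda>w. ?X t w \<bullet> k t w))
    \<longleftrightarrow> integrable (leb T) (\<lambda>t. expectation (\<lambda>w. h t w \<bullet> Z t w) + expectation (\<lambda>w. X t w \<bullet> k t w))"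
    by (rule Bochner_Integration.integrable_cong[OF refl e12])
  have p: "prim (\<lambda>t. expectation (\<lambda>w. h t w \<bullet> ?Z t w) + expectation (\<lambda>w. ?X t w \<bullet> k t w)) T
    = prim (\<lambda>t. expectation (\<lambda>w. h t w \<bullet> Z t w) + expectation (\<lambda>w. X t w \<bullet> k t w)) T"
    by (rule prim_cong[OF e12])
  show "integrable (leb T) (\<lambda>t. expectation (\<lambda>w. h t w \<bullet> Z t w) + expectation (\<lambda>w. X t w \<bullet> k t w))"
    using expectation_integration_by_parts(2)[OF h k X0 Z0 I kF ZF T] unfolding c .
  show "expectation (\<lambda>w. X T w \<bullet> Z T w) = expectation (\<lambda>w. X0 w \<bullet> Z0 w)
      + prim (\<lambda>t. expectation (\<lambda>w. h t w \<bullet> Z t w) + expectation (\<lambda>w. X t w \<bullet> k t w)) T"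
    using expectation_integration_by_parts(1)[OF h k X0 Z0 I kF ZF T] unfolding e3 p .
qed

section \<open>Energy identities and estimates for linear equations\<close>

lemma jmeas_adapted_matrix:
  fixes Y :: "real^'n^'m"
  shows "X \<in> borel_measurable N \<Longrightarrow> (\<lambda>w. Y *v X w) \<in> borel_measurable N"
  by (rule borel_measurable_continuous_on[OF matrix_vector_mult_linear_continuous_on])

lemma prim_matrix:
  fixes Y :: "real^'n^'m"
  assumes "integrable (leb T) h"
  shows "prim (\<lambda>r. Y *v h r) T = Y *v prim h T"
  unfolding prim_def using integral_bounded_linear[OF matrix_vector_mul_bounded_linear assms, of Y] .

lemma AE_integrable_path:
  assumes "L2proc M h" "0 \<le> T"
  shows "AE w in M. integrable (leb T) (\<lambda>t. h t w)"
  using L2proc_AE_path[OF assms] by eventually_elim (rule norm_prim_square_le(2)[OF _ assms(2)])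

lemma AE_primitive_matrix:
  fixes Y :: "real^'n^'m"
  assumes h: "L2proc M h" and X: "\<And>t. 0 \<le> t \<Longrightarrow> AE w in M. X t w = X0 w + prim (\<lambda>r. h r w) t" and t: "0 \<le> t"
  shows "AE w in M. Y *v X t w = Y *v X0 w + prim (\<lambda>r. Y *v h r w) t"
  using X[OF t] AE_integrable_path[OF h t]
  by eventually_elim (simp add: prim_matrix matrix_vector_right_distrib)

text \<open>Quantifying over all Y encodes the matrix identity that the covariance of
  \<open>I t\<close> is \<kappa> times the integral of \<sigma> \<sigma>^T.\<close>

definition noise_variance :: "(real \<Rightarrow> real^'n) \<Rightarrow> real \<Rightarrow> (real \<Rightarrow> 'w \<Rightarrow> real^'n) \<Rightarrow> bool" where
  "noise_variance \<sigma> \<kappa> I \<longleftrightarrow> (\<forall>t\<ge>0. \<forall>Y :: real^'n^'n.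
     expectation (\<lambda>w. I t w \<bullet> (Y *v I t w)) = \<kappa> * prim (\<lambda>r. \<sigma> r \<bullet> (Y *v \<sigma> r)) t)"

text \<open>The Ito formula for a quadratic form, in expectation: apply integration by parts to \<open>Y\<close> times the noise-free part
  against \<open>X\<close> and against the noise.\<close>

lemma quadratic_energy:
  fixes X I :: "real \<Rightarrow> 'w \<Rightarrow> real^'n" and Y A :: "real^'n^'n"
  assumes LX: "L2proc M X" and XF: "\<And>t. 0 \<le> t \<Longrightarrow> X t \<in> borel_measurable (F t)"
    and X0: "sq_integrable M X0" "X0 \<in> borel_measurable (F 0)"
    and I: "martingale_noise I" and var: "noise_variance \<sigma> \<kappa> I" and Y: "transpose Y = Y"
    and X: "\<And>t. 0 \<le> t \<Longrightarrow> AE w in M. X t w = X0 w + prim (\<lambda>r. A *v X r w) t + I t w"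
    and \<sigma>: "\<And>T. 0 \<le> T \<Longrightarrow> integrable (leb T) (\<lambda>r. \<sigma> r \<bullet> (Y *v \<sigma> r))" and T: "0 \<le> T"
  shows "expectation (\<lambda>w. X T w \<bullet> (Y *v X T w)) = expectation (\<lambda>w. X0 w \<bullet> (Y *v X0 w))
      + prim (\<lambda>t. 2 * expectation (\<lambda>w. (Y *v X t w) \<bullet> (A *v X t w)) + \<kappa> * (\<sigma> t \<bullet> (Y *v \<sigma> t))) T"
    "integrable (leb T) (\<lambda>t. 2 * expectation (\<lambda>w. (Y *v X t w) \<bullet> (A *v X t w)) + \<kappa> * (\<sigma> t \<bullet> (Y *v \<sigma> t)))"
    "sq_integrable M (X T)"
proof -
  define h where "h t w = A *v X t w" for t w
  define k where "k t w = Y *v h t w" for t w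
  \<comment> \<open>The noise-free part of X. The facts \<open>a\<close> and \<open>b\<close> pair X
    and the noise with Y Z.\<close>
  define Z where "Z t w = X0 w + prim (\<lambda>r. h r w) t" for t w
  have sI: "\<And>t. 0 \<le> t \<Longrightarrow> sq_integrable M (I t)" and LI: "L2proc M I" using I by (auto simp: martingale_noise_def)
  have h: "L2proc M h" unfolding h_def by (rule L2proc_matrix[OF LX])
  have k: "L2proc M k" unfolding k_def by (rule L2proc_matrix[OF h])
  have kF: "k t \<in> borel_measurable (F t)" if "0 \<le> t" for t
    unfolding k_def h_def by (intro jmeas_adapted_matrix XF that)
  have Z: "L2proc M Z" unfolding Z_def by (intro L2proc_add L2proc_const X0 L2proc_prim h)
  have sZ: "sq_integrable M (Z t)" if "0 \<le> t" for t unfolding Z_def by (intro sq_integrable_add X0 sq_integrable_prim h that)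
  have YZ: "AE w in M. Y *v Z t w = Y *v X0 w + prim (\<lambda>r. k r w) t" if "0 \<le> t" for t
    unfolding k_def by (rule AE_primitive_matrix[OF h _ that]) (simp add: Z_def)
  have X': "AE w in M. X t w = Z t w + I t w" if "0 \<le> t" for t
    using X[OF that] by (simp add: Z_def h_def)
  note a = integration_by_parts[OF h k X0(1) sq_integrable_matrix[OF X0(1), of Y] I kF jmeas_adapted_matrix[OF X0(2)]
      L2proc_jmeas[OF LX] jmeas_matrix[OF L2proc_jmeas[OF Z]] X[folded h_def] YZ T]
  note b = integration_by_parts[OF L2proc_const[OF sq_integrable_zero] k sq_integrable_zero sq_integrable_matrix[OF X0(1), of Y] I kF
      jmeas_adapted_matrix[OF X0(2)] L2proc_jmeas[OF LI] jmeas_matrix[OF L2proc_jmeas[OF Z]] _ YZ T, simplified prim_def, simplified]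
  show sX: "sq_integrable M (X T)" using a(3) .
  have sX': "sq_integrable M (X t)" if "0 \<le> t" for t
    using integration_by_parts(3)[OF h k X0(1) sq_integrable_matrix[OF X0(1), of Y] I kF jmeas_adapted_matrix[OF X0(2)]
      L2proc_jmeas[OF LX] jmeas_matrix[OF L2proc_jmeas[OF Z]] X[folded h_def] YZ that] .
  have sh: "sq_integrable M (h t)" "sq_integrable M (k t)" if "0 \<le> t" for t
    unfolding k_def h_def by (intro sq_integrable_matrix sX' that)+
  have sym: "x \<bullet> (Y *v y) = (Y *v x) \<bullet> y" for x y using inner_symmetric_matrix[OF Y, of x y] by simp
  \<comment> \<open>By symmetry of Y, the form of X = Z + I is X.YZ + I.YZ + I.YI: integration by
    parts handles the first two terms, the covariance of the noise the third.\<close>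
  have E1: "expectation (\<lambda>w. X T w \<bullet> (Y *v X T w)) = expectation (\<lambda>w. X T w \<bullet> (Y *v Z T w))
    + expectation (\<lambda>w. I T w \<bullet> (Y *v Z T w)) + expectation (\<lambda>w. I T w \<bullet> (Y *v I T w))"
  proof -
    have "expectation (\<lambda>w. X T w \<bullet> (Y *v X T w))
      = expectation (\<lambda>w. X T w \<bullet> (Y *v Z T w) + I T w \<bullet> (Y *v Z T w) + I T w \<bullet> (Y *v I T w))"
    proof (rule integral_cong_AE)
      show "AE w in M. X T w \<bullet> (Y *v X T w) = X T w \<bullet> (Y *v Z T w) + I T w \<bullet> (Y *v Z T w) + I T w \<bullet> (Y *v I T w)"
        using X'[OF T]
      proof eventually_elim
        case (elim w)
        have "Z T w \<bullet> (Y *v I T w) = I T w \<bullet> (Y *v Z T w)" by (simp only: sym[of "Z T w"] inner_commute)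
        thus ?case by (simp add: elim inner_add_left inner_add_right matrix_vector_right_distrib)
      qed
    qed (use sq_integrable_inner[OF sX sq_integrable_matrix[OF sX, of Y]] sq_integrable_inner[OF sX sq_integrable_matrix[OF sZ[OF T], of Y]]
        sq_integrable_inner[OF sI[OF T] sq_integrable_matrix[OF sZ[OF T], of Y]]
        sq_integrable_inner[OF sI[OF T] sq_integrable_matrix[OF sI[OF T], of Y]] in \<open>auto intro!: borel_measurable_add\<close>)
    also have "\<dots> = expectation (\<lambda>w. X T w \<bullet> (Y *v Z T w))
      + expectation (\<lambda>w. I T w \<bullet> (Y *v Z T w)) + expectation (\<lambda>w. I T w \<bullet> (Y *v I T w))"
      using sq_integrable_inner[OF sX sq_integrable_matrix[OF sZ[OF T], of Y]]
        sq_integrable_inner[OF sI[OF T] sq_integrable_matrix[OF sZ[OF T], of Y]]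
        sq_integrable_inner[OF sI[OF T] sq_integrable_matrix[OF sI[OF T], of Y]] by simp
    finally show ?thesis .
  qed
  \<comment> \<open>The three drift terms recombine into one expression in X, so Z leaves the
    identity.\<close>
  have E2: "expectation (\<lambda>w. h t w \<bullet> (Y *v Z t w)) + expectation (\<lambda>w. X t w \<bullet> k t w) + expectation (\<lambda>w. I t w \<bullet> k t w)
     = 2 * expectation (\<lambda>w. (Y *v X t w) \<bullet> (A *v X t w))" if t: "0 \<le> t" for t
  proof -
    note i = sq_integrable_inner[OF sh(1)[OF t] sq_integrable_matrix[OF sZ[OF t], of Y]]
        sq_integrable_inner[OF sX'[OF t] sh(2)[OF t]] sq_integrable_inner[OF sI[OF t] sh(2)[OF t]]
    have "expectation (\<lambda>w. h t w \<bullet> (Y *v Z t w)) + expectation (\<lambda>w. X t w \<bullet> k t w) + expectation (\<lambda>w. I t w \<bullet> k t w)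
      = expectation (\<lambda>w. h t w \<bullet> (Y *v Z t w) + X t w \<bullet> k t w + I t w \<bullet> k t w)" using i by simp
    also have "\<dots> = expectation (\<lambda>w. 2 * ((Y *v X t w) \<bullet> (A *v X t w)))"
    proof (rule integral_cong_AE)
      show "AE w in M. h t w \<bullet> (Y *v Z t w) + X t w \<bullet> k t w + I t w \<bullet> k t w = 2 * ((Y *v X t w) \<bullet> (A *v X t w))"
        using X'[OF t]
      proof eventually_elim
        case (elim w)
        have "h t w \<bullet> (Y *v Z t w) + I t w \<bullet> k t w = (Y *v X t w) \<bullet> h t w"
          by (simp only: elim k_def sym[of "I t w"] inner_add_left matrix_vector_right_distrib inner_commute[of "h t w"])
        moreover have "X t w \<bullet> k t w = (Y *v X t w) \<bullet> h t w" by (simp add: k_def sym)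
        ultimately show ?case by (simp add: h_def)
      qed
      have "sq_integrable M (\<lambda>w. Y *v X t w)" "sq_integrable M (\<lambda>w. A *v X t w)" by (intro sq_integrable_matrix sX' t)+
      from sq_integrable_inner[OF this] show "(\<lambda>w. 2 * ((Y *v X t w) \<bullet> (A *v X t w))) \<in> borel_measurable M" by measurable
    qed (use i in \<open>auto intro!: borel_measurable_add\<close>)
    finally show ?thesis by simp
  qed
  have v: "expectation (\<lambda>w. I T w \<bullet> (Y *v I T w)) = \<kappa> * prim (\<lambda>r. \<sigma> r \<bullet> (Y *v \<sigma> r)) T"
    using var T by (simp add: noise_variance_def)
  let ?\<psi> = "\<lambda>t. (expectation (\<lambda>w. h t w \<bullet> (Y *v Z t w)) + expectation (\<lambda>w. X t w \<bullet> k t w)) + expectation (\<lambda>w. I t w \<bullet> k t w) + \<kappa> * (\<sigma> t \<bullet> (Y *v \<sigma> t))"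
  have ip: "integrable (leb T) ?\<psi>" using a(2) b(2) \<sigma>[OF T] by simp
  have s: "0 \<le> t" if "t \<in> space (leb T)" for t using that by (simp add: space_restrict_space)
  have cong: "integrable (leb T) ?\<psi> = integrable (leb T) (\<lambda>t. 2 * expectation (\<lambda>w. (Y *v X t w) \<bullet> (A *v X t w)) + \<kappa> * (\<sigma> t \<bullet> (Y *v \<sigma> t)))"
    "prim ?\<psi> T = prim (\<lambda>t. 2 * expectation (\<lambda>w. (Y *v X t w) \<bullet> (A *v X t w)) + \<kappa> * (\<sigma> t \<bullet> (Y *v \<sigma> t))) T"
    by (rule Bochner_Integration.integrable_cong[OF refl], simp only: E2[OF s]) (rule prim_cong, simp only: E2[OF s])
  show "integrable (leb T) (\<lambda>t. 2 * expectation (\<lambda>w. (Y *v X t w) \<bullet> (A *v X t w)) + \<kappa> * (\<sigma> t \<bullet> (Y *v \<sigma> t)))"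
    using ip unfolding cong .
  have "prim ?\<psi> T = prim (\<lambda>t. expectation (\<lambda>w. h t w \<bullet> (Y *v Z t w)) + expectation (\<lambda>w. X t w \<bullet> k t w)) T
     + prim (\<lambda>t. expectation (\<lambda>w. I t w \<bullet> k t w)) T + \<kappa> * prim (\<lambda>r. \<sigma> r \<bullet> (Y *v \<sigma> r)) T"
    using a(2) b(2) \<sigma>[OF T] by (simp add: prim_def)
  hence "expectation (\<lambda>w. X T w \<bullet> (Y *v X T w)) = expectation (\<lambda>w. X0 w \<bullet> (Y *v X0 w)) + prim ?\<psi> T"
    using E1 v a(1) b(1) by (simp add: prim_def)
  thus "expectation (\<lambda>w. X T w \<bullet> (Y *v X T w)) = expectation (\<lambda>w. X0 w \<bullet> (Y *v X0 w))
      + prim (\<lambda>t. 2 * expectation (\<lambda>w. (Y *v X t w) \<bullet> (A *v X t w)) + \<kappa> * (\<sigma> t \<bullet> (Y *v \<sigma> t))) T"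
    unfolding cong .
qed

lemma integrable_exp_weight:
  fixes f :: "real \<Rightarrow> real"
  assumes "integrable (leb T) f" "0 \<le> \<rho>"
  shows "integrable (leb T) (\<lambda>t. exp (- \<rho> * t) * f t)"
proof (rule Bochner_Integration.integrable_bound[OF assms(1)])
  have "(\<lambda>t. exp (- \<rho> * t)) \<in> borel_measurable (leb T)" using measurable_leb_lebh[OF id_measurable_lebh, of T] by measurable
  thus "(\<lambda>t. exp (- \<rho> * t) * f t) \<in> borel_measurable (leb T)" using assms(1) by measurable
  show "AE t in leb T. norm (exp (- \<rho> * t) * f t) \<le> norm (f t)"
    using AE_space by eventually_elim (use assms(2) in \<open>auto simp: abs_mult space_restrict_space intro!: mult_left_le_one_le\<close>)
qed

lemma stable_energy_bound:
  fixes X I :: "real \<Rightarrow> 'w \<Rightarrow> real^'n" and Y A :: "real^'n^'n"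
  assumes LX: "L2proc M X" and XF: "\<And>t. 0 \<le> t \<Longrightarrow> X t \<in> borel_measurable (F t)"
    and X0: "sq_integrable M X0" "X0 \<in> borel_measurable (F 0)"
    and I: "martingale_noise I" and var: "noise_variance \<sigma> \<kappa> I"
    and X: "\<And>t. 0 \<le> t \<Longrightarrow> AE w in M. X t w = X0 w + prim (\<lambda>r. A *v X r w) t + I t w"
    and Y: "psd Y" "\<And>x. 2 * ((Y *v x) \<bullet> (A *v x)) - \<rho> * (x \<bullet> (Y *v x)) \<le> - (norm x)\<^sup>2"
    and \<rho>: "0 \<le> \<rho>" and \<kappa>: "0 \<le> \<kappa>"
    and \<sigma>: "\<And>T. 0 \<le> T \<Longrightarrow> integrable (leb T) (\<lambda>r. \<sigma> r \<bullet> (Y *v \<sigma> r))"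
    and C: "\<And>T. 0 \<le> T \<Longrightarrow> (\<integral>t. exp (- \<rho> * t) * (\<sigma> t \<bullet> (Y *v \<sigma> t)) \<partial>leb T) \<le> C"
  shows "L2disc M \<rho> X"
    "(\<integral>p. exp (- \<rho> * fst p) * (norm (X (fst p) (snd p)))\<^sup>2 \<partial>(lebh \<Otimes>\<^sub>M M)) \<le> expectation (\<lambda>w. X0 w \<bullet> (Y *v X0 w)) + \<kappa> * C"
proof -
  have symY: "transpose Y = Y" using Y by (simp add: psd_def)
  note q = quadratic_energy[OF LX XF X0 I var symY X \<sigma>]
  let ?\<phi> = "\<lambda>t. expectation (\<lambda>w. X t w \<bullet> (Y *v X t w))"
  let ?\<psi> = "\<lambda>t. 2 * expectation (\<lambda>w. (Y *v X t w) \<bullet> (A *v X t w)) + \<kappa> * (\<sigma> t \<bullet> (Y *v \<sigma> t))"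
  let ?n = "\<lambda>t. expectation (\<lambda>w. (norm (X t w))\<^sup>2)"
  have le: "(\<integral>t. exp (- \<rho> * t) * ?n t \<partial>leb T) \<le> expectation (\<lambda>w. X0 w \<bullet> (Y *v X0 w)) + \<kappa> * C" if T: "0 \<le> T" for T
  proof -
    have in': "integrable (leb T) ?n" using L2proc_inner(1)[OF LX LX T] by (simp add: power2_norm_eq_inner)
    note ie = integrable_exp_weight[OF in' \<rho>] integrable_exp_weight[OF \<sigma>[OF T] \<rho>]
    note w = exp_weighted_primitive[where \<psi> = ?\<psi> and \<phi> = ?\<phi> and a = \<rho>, OF q(2) q(1) T]
    have "0 \<le> exp (- \<rho> * T) * ?\<phi> T"
      using psd_nonneg[OF Y(1)] by (intro mult_nonneg_nonneg Bochner_Integration.integral_nonneg) auto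
    also have "\<dots> = expectation (\<lambda>w. X0 w \<bullet> (Y *v X0 w)) + (\<integral>t. exp (- \<rho> * t) * (?\<psi> t - \<rho> * ?\<phi> t) \<partial>leb T)"
      by (rule w(1)) auto
    also have "(\<integral>t. exp (- \<rho> * t) * (?\<psi> t - \<rho> * ?\<phi> t) \<partial>leb T)
      \<le> (\<integral>t. \<kappa> * (exp (- \<rho> * t) * (\<sigma> t \<bullet> (Y *v \<sigma> t))) - exp (- \<rho> * t) * ?n t \<partial>leb T)"
    proof (rule integral_mono)
      show "integrable (leb T) (\<lambda>t. exp (- \<rho> * t) * (?\<psi> t - \<rho> * ?\<phi> t))" by (rule w(2)) auto
      show "integrable (leb T) (\<lambda>t. \<kappa> * (exp (- \<rho> * t) * (\<sigma> t \<bullet> (Y *v \<sigma> t))) - exp (- \<rho> * t) * ?n t)" using ie by simp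
      fix t assume "t \<in> space (leb T)"
      hence t: "0 \<le> t" by (simp add: space_restrict_space)
      have sX: "sq_integrable M (X t)" by (rule q(3)) (use t in auto)
      note i = sq_integrable_inner[OF sq_integrable_matrix[OF sX, of Y] sq_integrable_matrix[OF sX, of A]]
        sq_integrable_inner[OF sX sq_integrable_matrix[OF sX, of Y]] sq_integrable_norm2[OF sX]
      have "2 * expectation (\<lambda>w. (Y *v X t w) \<bullet> (A *v X t w)) - \<rho> * ?\<phi> t
        = expectation (\<lambda>w. 2 * ((Y *v X t w) \<bullet> (A *v X t w)) - \<rho> * (X t w \<bullet> (Y *v X t w)))" using i by simp
      also have "\<dots> \<le> expectation (\<lambda>w. - (norm (X t w))\<^sup>2)" using i Y(2) by (intro integral_mono) auto
      finally have "?\<psi> t - \<rho> * ?\<phi> t \<le> \<kappa> * (\<sigma> t \<bullet> (Y *v \<sigma> t)) - ?n t" by simp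
      from mult_left_mono[OF this, of "exp (- \<rho> * t)"]
      show "exp (- \<rho> * t) * (?\<psi> t - \<rho> * ?\<phi> t) \<le> \<kappa> * (exp (- \<rho> * t) * (\<sigma> t \<bullet> (Y *v \<sigma> t))) - exp (- \<rho> * t) * ?n t"
        by (simp add: right_diff_distrib mult_ac)
    qed
    also have "\<dots> = \<kappa> * (\<integral>t. exp (- \<rho> * t) * (\<sigma> t \<bullet> (Y *v \<sigma> t)) \<partial>leb T) - (\<integral>t. exp (- \<rho> * t) * ?n t \<partial>leb T)" using ie by simp
    finally show ?thesis using mult_left_mono[OF C[OF T] \<kappa>] by simp
  qed
  show "L2disc M \<rho> X" by (rule L2disc_bound(1)[OF LX \<rho> le])
  show "(\<integral>p. exp (- \<rho> * fst p) * (norm (X (fst p) (snd p)))\<^sup>2 \<partial>(lebh \<Otimes>\<^sub>M M)) \<le> expectation (\<lambda>w. X0 w \<bullet> (Y *v X0 w)) + \<kappa> * C"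
    by (rule L2disc_bound(2)[OF LX \<rho> le])
qed

text \<open>The same energy balance for an equation without noise that starts at 0. The
  detectability inequality bounds the state by the output and the input.\<close>

lemma detectable_L2disc:
  fixes X :: "real \<Rightarrow> 'w \<Rightarrow> real^'n" and v :: "real \<Rightarrow> 'w \<Rightarrow> real^'r" and A Y :: "real^'n^'n" and B :: "real^'r^'n" and C :: "real^'n^'m"
  assumes LX: "L2proc M X" and XF: "\<And>t. 0 \<le> t \<Longrightarrow> X t \<in> borel_measurable (F t)" and vF: "\<And>t. 0 \<le> t \<Longrightarrow> v t \<in> borel_measurable (F t)"
    and X: "\<And>t. 0 \<le> t \<Longrightarrow> AE w in M. X t w = prim (\<lambda>r. A *v X r w + B *v v r w) t"
    and v: "L2disc M \<rho> v" and CX: "L2disc M \<rho> (\<lambda>t w. C *v X t w)"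
    and Y: "psd Y" "0 \<le> \<kappa>" "\<And>x. 2 * ((Y *v x) \<bullet> (A *v x)) - \<rho> * (x \<bullet> (Y *v x)) \<le> \<kappa> * (norm (C *v x))\<^sup>2 - (norm x)\<^sup>2"
    and \<rho>: "0 \<le> \<rho>"
  shows "L2disc M \<rho> X"
proof -
  define h where "h t w = A *v X t w + B *v v t w" for t w
  have symY: "transpose Y = Y" using Y by (simp add: psd_def)
  have Lv: "L2proc M v" using L2disc_L2proc[OF v \<rho>] .
  have LC: "L2proc M (\<lambda>t w. C *v X t w)" by (rule L2proc_matrix[OF LX])
  have h: "L2proc M h" unfolding h_def by (intro L2proc_add L2proc_matrix LX Lv)
  have hF: "(\<lambda>w. Y *v h t w) \<in> borel_measurable (F t)" if "0 \<le> t" for t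
    unfolding h_def by (intro jmeas_adapted_matrix borel_measurable_add XF vF that)
  have X1: "AE w in M. X t w = 0 + prim (\<lambda>r. h r w) t + 0" if "0 \<le> t" for t using X[OF that] by (simp add: h_def)
  have X2: "AE w in M. Y *v X t w = 0 + prim (\<lambda>r. Y *v h r w) t" if "0 \<le> t" for t
    using AE_primitive_matrix[OF h, of X "\<lambda>_. 0" t Y] X1 that by simp
  note p = integration_by_parts[OF h L2proc_matrix[OF h, of Y] sq_integrable_zero sq_integrable_zero martingale_noise_zero hF _
      L2proc_jmeas[OF LX] jmeas_matrix[OF L2proc_jmeas[OF LX]] X1 X2]
  let ?\<psi> = "\<lambda>t. expectation (\<lambda>w. h t w \<bullet> (Y *v X t w)) + expectation (\<lambda>w. X t w \<bullet> (Y *v h t w))"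
  let ?\<phi> = "\<lambda>t. expectation (\<lambda>w. X t w \<bullet> (Y *v X t w))"
  let ?n = "\<lambda>t. expectation (\<lambda>w. (norm (X t w))\<^sup>2)"
  let ?nC = "\<lambda>t. expectation (\<lambda>w. (norm (C *v X t w))\<^sup>2)"
  let ?nv = "\<lambda>t. expectation (\<lambda>w. (norm (v t w))\<^sup>2)"
  obtain b where b: "b > 0" "\<And>x. norm ((transpose B ** Y) *v x) \<le> b * norm x" using norm_matrix_vector_le by blast
  \<comment> \<open>Young's inequality charges half of the margin |x|^2 for the input term; hence
    the factor 2 in the bound \<open>le\<close> below.\<close>
  have pt: "2 * ((Y *v x) \<bullet> (A *v x + B *v w)) - \<rho> * (x \<bullet> (Y *v x)) \<le> \<kappa> * (norm (C *v x))\<^sup>2 + 2 * b\<^sup>2 * (norm w)\<^sup>2 - (norm x)\<^sup>2 / 2" for x w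
  proof -
    have "(Y *v x) \<bullet> (B *v w) = ((transpose B ** Y) *v x) \<bullet> w"
      using inner_matrix_vector_transpose[of "Y *v x" B w] by (simp add: matrix_vector_mul_assoc)
    also have "\<dots> \<le> norm ((transpose B ** Y) *v x) * norm w" by (rule norm_cauchy_schwarz)
    also have "\<dots> \<le> (b * norm x) * norm w" using b by (intro mult_right_mono) auto
    finally have "2 * ((Y *v x) \<bullet> (B *v w)) \<le> 2 * (b * norm x * norm w)" by simp
    also have "\<dots> \<le> (norm x)\<^sup>2 / 2 + 2 * b\<^sup>2 * (norm w)\<^sup>2"
      using sum_squares_ge_zero[of "norm x - 2 * b * norm w" 0] by (simp add: power2_eq_square algebra_simps)
    finally show ?thesis using Y(3)[of x] by (simp add: inner_add_right algebra_simps)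
  qed
  define KC where "KC = (\<integral>p. exp (- \<rho> * fst p) * (norm (C *v X (fst p) (snd p)))\<^sup>2 \<partial>(lebh \<Otimes>\<^sub>M M))"
  define Kv where "Kv = (\<integral>p. exp (- \<rho> * fst p) * (norm (v (fst p) (snd p)))\<^sup>2 \<partial>(lebh \<Otimes>\<^sub>M M))"
  have le: "(\<integral>t. exp (- \<rho> * t) * ?n t \<partial>leb T) \<le> 2 * (\<kappa> * KC + 2 * b\<^sup>2 * Kv)" if T: "0 \<le> T" for T
  proof -
    have i': "integrable (leb T) ?n" "integrable (leb T) ?nC" "integrable (leb T) ?nv"
      using L2proc_inner(1)[OF LX LX T] L2proc_inner(1)[OF LC LC T] L2proc_inner(1)[OF Lv Lv T] by (simp_all add: power2_norm_eq_inner)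
    note ie = integrable_exp_weight[OF i'(1) \<rho>] integrable_exp_weight[OF i'(2) \<rho>] integrable_exp_weight[OF i'(3) \<rho>]
    have p1: "?\<phi> t = 0 + prim ?\<psi> t" and p2: "integrable (leb t) ?\<psi>" if "0 \<le> t" for t
      using p(1,2) that by simp_all
    note w1 = exp_weighted_primitive[where \<psi> = ?\<psi> and \<phi> = ?\<phi> and a = \<rho> and cst = 0, OF p2 p1 T]
    have "0 \<le> exp (- \<rho> * T) * ?\<phi> T"
      using psd_nonneg[OF Y(1)] by (intro mult_nonneg_nonneg Bochner_Integration.integral_nonneg) auto
    also have "\<dots> = (\<integral>t. exp (- \<rho> * t) * (?\<psi> t - \<rho> * ?\<phi> t) \<partial>leb T)" using w1(1) by simp
    also have "\<dots> \<le> (\<integral>t. \<kappa> * (exp (- \<rho> * t) * ?nC t) + 2 * b\<^sup>2 * (exp (- \<rho> * t) * ?nv t) - (exp (- \<rho> * t) * ?n t) / 2 \<partial>leb T)"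
    proof (rule integral_mono_AE)
      show "integrable (leb T) (\<lambda>t. \<kappa> * (exp (- \<rho> * t) * ?nC t) + 2 * b\<^sup>2 * (exp (- \<rho> * t) * ?nv t) - (exp (- \<rho> * t) * ?n t) / 2)"
        using ie by simp
      show "AE t in leb T. exp (- \<rho> * t) * (?\<psi> t - \<rho> * ?\<phi> t) \<le> \<kappa> * (exp (- \<rho> * t) * ?nC t) + 2 * b\<^sup>2 * (exp (- \<rho> * t) * ?nv t) - (exp (- \<rho> * t) * ?n t) / 2"
        using L2proc_AE_section[OF LX T] L2proc_AE_section[OF Lv T]
      proof eventually_elim
        case (elim t)
        have sh: "sq_integrable M (h t)" unfolding h_def by (intro sq_integrable_add sq_integrable_matrix elim)
        note i = sq_integrable_inner[OF sh sq_integrable_matrix[OF elim(1), of Y]] sq_integrable_inner[OF elim(1) sq_integrable_matrix[OF sh, of Y]]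
          sq_integrable_inner[OF elim(1) sq_integrable_matrix[OF elim(1), of Y]] sq_integrable_norm2[OF elim(1)] sq_integrable_norm2[OF elim(2)]
          sq_integrable_norm2[OF sq_integrable_matrix[OF elim(1), of C]]
        have "?\<psi> t - \<rho> * ?\<phi> t = expectation (\<lambda>w. h t w \<bullet> (Y *v X t w) + X t w \<bullet> (Y *v h t w) - \<rho> * (X t w \<bullet> (Y *v X t w)))" using i by simp
        also have "\<dots> \<le> expectation (\<lambda>w. \<kappa> * (norm (C *v X t w))\<^sup>2 + 2 * b\<^sup>2 * (norm (v t w))\<^sup>2 - (norm (X t w))\<^sup>2 / 2)"
        proof (rule integral_mono)
          fix w
          have "X t w \<bullet> (Y *v h t w) = (Y *v X t w) \<bullet> h t w" using inner_symmetric_matrix[OF symY, of "X t w" "h t w"] by simp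
          thus "h t w \<bullet> (Y *v X t w) + X t w \<bullet> (Y *v h t w) - \<rho> * (X t w \<bullet> (Y *v X t w))
            \<le> \<kappa> * (norm (C *v X t w))\<^sup>2 + 2 * b\<^sup>2 * (norm (v t w))\<^sup>2 - (norm (X t w))\<^sup>2 / 2"
            using pt[of "X t w" "v t w"] by (simp add: h_def inner_commute)
        qed (use i in auto)
        also have "\<dots> = \<kappa> * ?nC t + 2 * b\<^sup>2 * ?nv t - ?n t / 2" using i by simp
        finally have "?\<psi> t - \<rho> * ?\<phi> t \<le> \<kappa> * ?nC t + 2 * b\<^sup>2 * ?nv t - ?n t / 2" .
        from mult_left_mono[OF this, of "exp (- \<rho> * t)"] show ?case by (simp add: right_diff_distrib distrib_left mult_ac)
      qed
    qed (rule w1(2))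
    also have "\<dots> = \<kappa> * (\<integral>t. exp (- \<rho> * t) * ?nC t \<partial>leb T) + 2 * b\<^sup>2 * (\<integral>t. exp (- \<rho> * t) * ?nv t \<partial>leb T)
       - (\<integral>t. exp (- \<rho> * t) * ?n t \<partial>leb T) / 2" using ie by simp
    finally have 1: "(\<integral>t. exp (- \<rho> * t) * ?n t \<partial>leb T) \<le> 2 * (\<kappa> * (\<integral>t. exp (- \<rho> * t) * ?nC t \<partial>leb T) + 2 * b\<^sup>2 * (\<integral>t. exp (- \<rho> * t) * ?nv t \<partial>leb T))" by simp
    have "\<kappa> * (\<integral>t. exp (- \<rho> * t) * ?nC t \<partial>leb T) \<le> \<kappa> * KC" unfolding KC_def by (intro mult_left_mono L2disc_le(1)[OF CX \<rho> T] Y)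
    moreover have "2 * b\<^sup>2 * (\<integral>t. exp (- \<rho> * t) * ?nv t \<partial>leb T) \<le> 2 * b\<^sup>2 * Kv" unfolding Kv_def by (intro mult_left_mono L2disc_le(1)[OF v \<rho> T]) simp
    ultimately have "\<kappa> * (\<integral>t. exp (- \<rho> * t) * ?nC t \<partial>leb T) + 2 * b\<^sup>2 * (\<integral>t. exp (- \<rho> * t) * ?nv t \<partial>leb T) \<le> \<kappa> * KC + 2 * b\<^sup>2 * Kv"
      by (rule add_mono)
    from order_trans[OF 1 mult_left_mono[OF this]] show ?thesis by simp
  qed
  show ?thesis by (rule L2disc_bound(1)[OF LX \<rho> le])
qed

text \<open>The integrand is the derivative of exp(-\<rho> t) X.Z in expectation. Z starts at 0, so
  no initial term occurs, and the boundary term at infinity vanishes.\<close>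

lemma infinite_horizon_orthogonality:
  fixes X Z :: "real \<Rightarrow> 'w \<Rightarrow> real^'n"
  assumes D: "L2disc M \<rho> X" "L2disc M \<rho> Z" "L2disc M \<rho> h" "L2disc M \<rho> k" and X0: "sq_integrable M X0"
    and I: "martingale_noise I" and kF: "\<And>t. 0 \<le> t \<Longrightarrow> k t \<in> borel_measurable (F t)"
    and X: "\<And>t. 0 \<le> t \<Longrightarrow> AE w in M. X t w = X0 w + prim (\<lambda>r. h r w) t + I t w"
    and Z: "\<And>t. 0 \<le> t \<Longrightarrow> AE w in M. Z t w = prim (\<lambda>r. k r w) t"
    and \<rho>: "0 \<le> \<rho>"
  shows "(\<integral>p. exp (- \<rho> * fst p) * (h (fst p) (snd p) \<bullet> Z (fst p) (snd p) + X (fst p) (snd p) \<bullet> k (fst p) (snd p)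
     - \<rho> * (X (fst p) (snd p) \<bullet> Z (fst p) (snd p))) \<partial>(lebh \<Otimes>\<^sub>M M)) = 0"
proof -
  interpret P: pair_sigma_finite lebh M by (rule pair_sigma_finite_lebh)
  have L: "L2proc M X" "L2proc M Z" "L2proc M h" "L2proc M k" using D by (auto intro: L2disc_L2proc[OF _ \<rho>])
  have Z': "AE w in M. Z t w = 0 + prim (\<lambda>r. k r w) t" if "0 \<le> t" for t using Z[OF that] by simp
  note p = integration_by_parts[OF L(3,4) X0 sq_integrable_zero I kF _ L2proc_jmeas[OF L(1)] L2proc_jmeas[OF L(2)] X Z']
  let ?\<psi> = "\<lambda>t. expectation (\<lambda>w. h t w \<bullet> Z t w) + expectation (\<lambda>w. X t w \<bullet> k t w)"
  let ?\<phi> = "\<lambda>t. expectation (\<lambda>w. X t w \<bullet> Z t w)"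
  have p1: "?\<phi> t = 0 + prim ?\<psi> t" and p2: "integrable (leb t) ?\<psi>" if "0 \<le> t" for t
    using p(1,2) that by simp_all
  let ?g = "\<lambda>(t, w). exp (- \<rho> * t) * (h t w \<bullet> Z t w + X t w \<bullet> k t w - \<rho> * (X t w \<bullet> Z t w))"
  have ig: "integrable (lebh \<Otimes>\<^sub>M M) ?g"
  proof -
    have "integrable (lebh \<Otimes>\<^sub>M M) (\<lambda>p. exp (- \<rho> * fst p) * (h (fst p) (snd p) \<bullet> Z (fst p) (snd p))
      + exp (- \<rho> * fst p) * (X (fst p) (snd p) \<bullet> k (fst p) (snd p)) - \<rho> * (exp (- \<rho> * fst p) * (X (fst p) (snd p) \<bullet> Z (fst p) (snd p))))"
      using L2disc_inner[OF D(3,2)] L2disc_inner[OF D(1,4)] L2disc_inner[OF D(1,2)] by simp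
    thus ?thesis by (simp add: split_beta' algebra_simps)
  qed
  define \<gamma> where "\<gamma> t = expectation (\<lambda>w. ?g (t, w))" for t
  have \<gamma>eq: "\<gamma> = (\<lambda>t. expectation (\<lambda>w. ?g (t, w)))" by (rule ext) (rule \<gamma>_def)
  have i\<gamma>: "integrable lebh \<gamma>" unfolding \<gamma>eq by (rule P.integrable_fst'[OF ig])
  have \<tau>: "exp (- \<rho> * T) * ?\<phi> T = integral\<^sup>L (leb T) \<gamma>" if T: "0 \<le> T" for T
  proof -
    have "exp (- \<rho> * T) * ?\<phi> T = 0 + (\<integral>t. exp (- \<rho> * t) * (?\<psi> t - \<rho> * ?\<phi> t) \<partial>leb T)"
      by (rule exp_weighted_primitive(1)[where cst = 0, OF p2 p1 T])
    also have "0 + (\<integral>t. exp (- \<rho> * t) * (?\<psi> t - \<rho> * ?\<phi> t) \<partial>leb T) = integral\<^sup>L (leb T) \<gamma>"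
    proof (simp only: add_0, rule integral_cong_AE)
      show "AE t in leb T. exp (- \<rho> * t) * (?\<psi> t - \<rho> * ?\<phi> t) = \<gamma> t"
        using L2proc_AE_section[OF L(1) T] L2proc_AE_section[OF L(2) T] L2proc_AE_section[OF L(3) T] L2proc_AE_section[OF L(4) T]
        by eventually_elim (simp add: \<gamma>_def sq_integrable_inner)
      show "(\<lambda>t. exp (- \<rho> * t) * (?\<psi> t - \<rho> * ?\<phi> t)) \<in> borel_measurable (leb T)"
        by (rule borel_measurable_integrable, rule exp_weighted_primitive(2)[where cst = 0, OF p2 p1 T])
      show "\<gamma> \<in> borel_measurable (leb T)" using i\<gamma> by (intro measurable_leb_lebh) auto
    qed
    finally show ?thesis .
  qed
  \<comment> \<open>The boundary term is an integral up to T of an integrable function, so it has a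
    limit; being dominated by the discounted second moments, it can only tend to 0.\<close>
  have lim: "((\<lambda>T. exp (- \<rho> * T) * ?\<phi> T) \<longlongrightarrow> integral\<^sup>L lebh \<gamma>) at_top"
  proof (rule Lim_transform_eventually[OF integral_leb_tendsto[OF i\<gamma>]])
    show "\<forall>\<^sub>F T in at_top. integral\<^sup>L (leb T) \<gamma> = exp (- \<rho> * T) * ?\<phi> T"
      using eventually_ge_at_top[of 0] by eventually_elim (simp only: \<tau>)
  qed
  let ?b = "\<lambda>t. exp (- \<rho> * t) * expectation (\<lambda>w. (norm (X t w))\<^sup>2) + exp (- \<rho> * t) * expectation (\<lambda>w. (norm (Z t w))\<^sup>2)"
  have "integral\<^sup>L lebh \<gamma> = 0"
  proof (rule limit_zero_if_integrable_at_top[OF lim])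
    show "integrable lebh ?b"
      by (intro Bochner_Integration.integrable_add L2disc_le(2)[OF D(1) \<rho> order_refl] L2disc_le(2)[OF D(2) \<rho> order_refl])
    fix t :: real assume t: "0 \<le> t"
    have s: "sq_integrable M (X t)" "sq_integrable M (Z t)" by (rule p(3), use t in auto) (rule p(4), use t in auto)
    have "\<bar>?\<phi> t\<bar> \<le> expectation (\<lambda>w. \<bar>X t w \<bullet> Z t w\<bar>)" by (rule integral_abs_bound)
    also have "\<dots> \<le> expectation (\<lambda>w. (norm (X t w))\<^sup>2 + (norm (Z t w))\<^sup>2)"
    proof (rule integral_mono)
      show "\<bar>X t w \<bullet> Z t w\<bar> \<le> (norm (X t w))\<^sup>2 + (norm (Z t w))\<^sup>2" for w
      proof -
        have "2 * (norm (X t w) * norm (Z t w)) \<le> (norm (X t w))\<^sup>2 + (norm (Z t w))\<^sup>2"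
          using sum_squares_bound[of "norm (X t w)" "norm (Z t w)"] by (simp add: mult.assoc)
        moreover have "0 \<le> norm (X t w) * norm (Z t w)" by simp
        ultimately show ?thesis using Cauchy_Schwarz_ineq2[of "X t w" "Z t w"] by linarith
      qed
    qed (use s sq_integrable_inner[OF s] in \<open>auto simp: sq_integrable_def\<close>)
    also have "\<dots> = expectation (\<lambda>w. (norm (X t w))\<^sup>2) + expectation (\<lambda>w. (norm (Z t w))\<^sup>2)"
      using s by (simp add: sq_integrable_def)
    finally have "exp (- \<rho> * t) * \<bar>?\<phi> t\<bar> \<le> exp (- \<rho> * t) * (expectation (\<lambda>w. (norm (X t w))\<^sup>2) + expectation (\<lambda>w. (norm (Z t w))\<^sup>2))"
      by (intro mult_left_mono) auto
    thus "\<bar>exp (- \<rho> * t) * ?\<phi> t\<bar> \<le> ?b t" by (simp add: abs_mult distrib_left)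
  qed
  moreover have "integral\<^sup>L lebh \<gamma> = integral\<^sup>L (lebh \<Otimes>\<^sub>M M) ?g" unfolding \<gamma>eq by (rule P.integral_fst'[OF ig])
  ultimately show ?thesis by (simp add: split_beta')
qed

end

section \<open>Versions of continuous processes\<close>

lemma continuous_on_prim:
  fixes f :: "real \<Rightarrow> 'b::euclidean_space"
  assumes f: "\<And>T. 0 \<le> T \<Longrightarrow> integrable (leb T) f"
  shows "continuous_on {0..} (prim f)"
proof -
  have eq: "prim f t = integral {0..t} f" if "0 \<le> t" for t
    using f[OF that] set_borel_integral_eq_integral(2)[of "{0..t}" f] by (simp add: prim_def integral_leb integrable_leb)
  have c: "continuous_on {0..T} (prim f)" if "0 \<le> T" for T
  proof -
    have "f integrable_on {0..T}"
      using f[OF that] set_borel_integral_eq_integral(1)[of "{0..T}" f] by (simp add: integrable_leb)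
    from indefinite_integral_continuous_1[OF this] show ?thesis by (rule continuous_on_eq) (simp add: eq)
  qed
  have "continuous (at t within {0..}) (prim f)" if t: "0 \<le> t" for t
  proof -
    have "continuous (at t within {0..t+1}) (prim f)" using c[of "t+1"] t by (auto simp: continuous_on_eq_continuous_within)
    moreover have "at t within {0..t+1} = at t within {0..}"
      by (rule at_within_nhd[of _ "{..<t+1}"]) auto
    ultimately show ?thesis by (simp add: continuous_within)
  qed
  thus ?thesis by (simp add: continuous_on_eq_continuous_within)
qed

lemma norm_prim_le:
  fixes f :: "real \<Rightarrow> 'b::euclidean_space"
  assumes "integrable (leb T) f" "integrable (leb T) g" "\<And>t. t \<in> {0..T} \<Longrightarrow> norm (f t) \<le> g t"
  shows "norm (prim f T) \<le> prim g T"
proof -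
  have "norm (prim f T) \<le> (\<integral>t. norm (f t) \<partial>leb T)" unfolding prim_def by (rule integral_norm_bound)
  also have "\<dots> \<le> prim g T" unfolding prim_def
    using assms by (intro integral_mono) (auto simp: space_restrict_space)
  finally show ?thesis .
qed

text \<open>Rounding down preserves adaptedness: the value at \<open>dyadic k t\<close> is known at
  time t.\<close>

definition dyadic :: "nat \<Rightarrow> real \<Rightarrow> real" where
  "dyadic k t = real_of_int \<lfloor>2 ^ k * t\<rfloor> / 2 ^ k"

lemma dyadic_bounds: "dyadic k t \<le> t" "t - 1 / 2 ^ k \<le> dyadic k t" "0 \<le> t \<Longrightarrow> 0 \<le> dyadic k t"
proof -
  show "dyadic k t \<le> t" by (simp add: dyadic_def divide_le_eq mult.commute)
  have "2 ^ k * t - 1 \<le> real_of_int \<lfloor>2 ^ k * t\<rfloor>" by linarith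
  hence "(2 ^ k * t - 1) / 2 ^ k \<le> real_of_int \<lfloor>2 ^ k * t\<rfloor> / 2 ^ k" by (rule divide_right_mono) simp
  thus "t - 1 / 2 ^ k \<le> dyadic k t" by (simp add: dyadic_def diff_divide_distrib)
qed (simp add: dyadic_def)

lemma dyadic_tendsto: "(\<lambda>k. dyadic k t) \<longlonglongrightarrow> t"
proof (rule tendsto_sandwich[of "\<lambda>k. t - 1 / 2 ^ k"])
  have "(\<lambda>k. t - (1/2) ^ k) \<longlonglongrightarrow> t - 0" by (intro tendsto_diff tendsto_const LIMSEQ_power_zero) simp
  thus "(\<lambda>k. t - 1 / 2 ^ k) \<longlonglongrightarrow> t" by (simp add: power_one_over)
qed (use dyadic_bounds in auto)

text \<open>With S the half-line and H the whole sigma-algebra this gives joint measurability; with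
  S = [0,t] and the sigma-algebra of time t it gives progressive measurability.\<close>

lemma dyadic_measurable:
  fixes Z :: "real \<Rightarrow> 'w \<Rightarrow> real^'n"
  assumes Z: "\<And>r s. 0 \<le> r \<Longrightarrow> r \<le> s \<Longrightarrow> s \<in> S \<Longrightarrow> Z r \<in> borel_measurable H" and S: "S \<subseteq> {0..}"
  shows "(\<lambda>p. Z (dyadic k (fst p)) (snd p)) \<in> borel_measurable (restrict_space lborel S \<Otimes>\<^sub>M H)"
proof -
  \<comment> \<open>The index is the value of the floor, so countably many sections occur. The
    default 0 covers grid times at which Z is not known to be measurable.\<close>
  define g where "g i p = (if 0 \<le> real_of_int i / 2 ^ k \<and> (\<exists>s\<in>S. real_of_int i / 2 ^ k \<le> s) then Z (real_of_int i / 2 ^ k) (snd p) else 0)"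
    for i :: int and p :: "real \<times> 'w"
  have "(\<lambda>x. x) \<in> borel_measurable (restrict_space lborel S)" by (rule measurable_restrict_space1) simp
  hence [measurable]: "(\<lambda>p. fst p) \<in> borel_measurable (restrict_space lborel S \<Otimes>\<^sub>M H)"
    using measurable_compose[OF measurable_fst] by blast
  have "g i \<in> borel_measurable (restrict_space lborel S \<Otimes>\<^sub>M H)" for i
    unfolding g_def using Z by (cases "0 \<le> real_of_int i / 2 ^ k \<and> (\<exists>s\<in>S. real_of_int i / 2 ^ k \<le> s)")
      (auto intro!: measurable_compose[OF measurable_snd])
  moreover have "(\<lambda>p. \<lfloor>2 ^ k * fst p\<rfloor>) \<in> measurable (restrict_space lborel S \<Otimes>\<^sub>M H) (count_space UNIV)" by measurable
  ultimately have "(\<lambda>p. g \<lfloor>2 ^ k * fst p\<rfloor> p) \<in> borel_measurable (restrict_space lborel S \<Otimes>\<^sub>M H)"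
    by (rule measurable_compose_countable)
  moreover have "g \<lfloor>2 ^ k * fst p\<rfloor> p = Z (dyadic k (fst p)) (snd p)" if "p \<in> space (restrict_space lborel S \<Otimes>\<^sub>M H)" for p
  proof -
    have p: "fst p \<in> S" using that by (auto simp: space_pair_measure space_restrict_space)
    hence "0 \<le> dyadic k (fst p) \<and> (\<exists>s\<in>S. dyadic k (fst p) \<le> s)" using S dyadic_bounds by blast
    thus ?thesis by (auto simp: g_def dyadic_def)
  qed
  ultimately show ?thesis by (rule measurable_cong[THEN iffD1, rotated])
qed

text \<open>Measurability up to a null set, in place of adding null sets to H. It is preserved by
  all operations used to build the feedback.\<close>

definition has_version :: "'w measure \<Rightarrow> 'w measure \<Rightarrow> ('w \<Rightarrow> real^'n) \<Rightarrow> bool" where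
  "has_version M H X \<longleftrightarrow> (\<exists>Z\<in>borel_measurable H. AE w in M. X w = Z w)"

lemma has_versionI: "Z \<in> borel_measurable H \<Longrightarrow> AE w in M. X w = Z w \<Longrightarrow> has_version M H X"
  by (auto simp: has_version_def)

lemma has_version_measurable: "X \<in> borel_measurable H \<Longrightarrow> has_version M H X"
  by (rule has_versionI) auto

lemma has_version_add: "has_version M H X \<Longrightarrow> has_version M H Y \<Longrightarrow> has_version M H (\<lambda>w. X w + Y w)"
proof -
  assume "has_version M H X" "has_version M H Y"
  then obtain Z Z' where "Z \<in> borel_measurable H" "AE w in M. X w = Z w" "Z' \<in> borel_measurable H" "AE w in M. Y w = Z' w"
    by (auto simp: has_version_def)
  thus ?thesis by (intro has_versionI[of "\<lambda>w. Z w + Z' w"]) (auto elim: eventually_elim2)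
qed

lemma has_version_matrix:
  fixes Y :: "real^'n^'m"
  shows "has_version M H X \<Longrightarrow> has_version M H (\<lambda>w. Y *v X w)"
proof -
  assume "has_version M H X"
  then obtain Z where "Z \<in> borel_measurable H" "AE w in M. X w = Z w" by (auto simp: has_version_def)
  thus ?thesis by (intro has_versionI[of "\<lambda>w. Y *v Z w"]
     borel_measurable_continuous_on[OF matrix_vector_mult_linear_continuous_on]) (auto elim: eventually_mono)
qed

lemma has_version_scaleR: "has_version M H X \<Longrightarrow> has_version M H (\<lambda>w. c *\<^sub>R X w)"
proof -
  assume "has_version M H X"
  then obtain Z where "Z \<in> borel_measurable H" "AE w in M. X w = Z w" by (auto simp: has_version_def)
  thus ?thesis by (intro has_versionI[of "\<lambda>w. c *\<^sub>R Z w"]) (auto elim: eventually_mono)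
qed

lemma has_version_diff: "has_version M H X \<Longrightarrow> has_version M H Y \<Longrightarrow> has_version M H (\<lambda>w. X w - Y w)"
  using has_version_add[of M H X "\<lambda>w. (-1) *\<^sub>R Y w"] has_version_scaleR[of M H Y "-1"] by simp

lemma has_version_const: "has_version M H (\<lambda>w. c)"
  by (rule has_version_measurable) simp

lemma has_version_sum: "(\<And>i. i \<in> I \<Longrightarrow> has_version M H (X i)) \<Longrightarrow> has_version M H (\<lambda>w. \<Sum>i\<in>I. X i w)"
  by (induction I rule: infinite_finite_induct) (auto intro: has_version_add has_version_const)

lemma has_version_lim:
  assumes "\<And>n. has_version M H (X n)" "AE w in M. (\<lambda>n. X n w) \<longlonglongrightarrow> Y w"
  shows "has_version M H Y"
proof -
  from assms(1) obtain Z where Z: "\<And>n. Z n \<in> borel_measurable H" "\<And>n. AE w in M. X n w = Z n w"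
    unfolding has_version_def by metis
  have "AE w in M. \<forall>n. X n w = Z n w" using Z(2) by (simp add: AE_all_countable)
  hence "AE w in M. Y w = lim (\<lambda>n. Z n w)"
    using assms(2) by eventually_elim (simp add: limI)
  moreover have "(\<lambda>w. lim (\<lambda>n. Z n w)) \<in> borel_measurable H" using Z(1) by (rule borel_measurable_lim_metric)
  ultimately show ?thesis by (rule has_versionI[rotated])
qed

text \<open>Two instances matter: H = F, to make given states jointly measurable, and the filtration
  generated by initial states and Brownian motions.\<close>

locale subfiltration = filtered_prob M F for M :: "'w measure" and F +
  fixes H :: "real \<Rightarrow> 'w measure"
  assumes space_H: "space (H t) = space M" and sets_H: "sets (H t) \<subseteq> sets M"
    and H_mono: "s \<le> t \<Longrightarrow> sets (H s) \<subseteq> sets (H t)"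
begin

lemma measurable_H: "f \<in> measurable (H t) N \<Longrightarrow> f \<in> measurable M N"
  using sets_H by (auto simp: measurable_def space_H)

lemma measurable_H_mono: "f \<in> measurable (H s) N \<Longrightarrow> s \<le> t \<Longrightarrow> f \<in> measurable (H t) N"
  using H_mono[of s t] unfolding measurable_def space_H by blast

text \<open>V is the limit of the versions at dyadic times below t, so it is measurable for every
  sample point. On the paths that are continuous and agree with their versions at all dyadic times,
  V equals X at all times.\<close>

lemma nice_version:
  fixes X :: "real \<Rightarrow> 'w \<Rightarrow> real^'n"
  assumes ver: "\<And>t. 0 \<le> t \<Longrightarrow> has_version M (H t) (X t)"
    and cont: "AE w in M. continuous_on {0..} (\<lambda>t. X t w)"
  obtains V where "jmeas M V" "\<forall>t\<ge>0. V t \<in> borel_measurable (H t)"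
    "\<forall>t\<ge>0. (\<lambda>p. V (fst p) (snd p)) \<in> borel_measurable (leb t \<Otimes>\<^sub>M H t)"
    "AE w in M. \<forall>t\<ge>0. V t w = X t w"
proof -
  from ver obtain Z where Z: "\<And>t. 0 \<le> t \<Longrightarrow> Z t \<in> borel_measurable (H t)" "\<And>t. 0 \<le> t \<Longrightarrow> AE w in M. X t w = Z t w"
    unfolding has_version_def by metis
  define V where "V t w = lim (\<lambda>k. Z (dyadic k t) w)" for t w
  have "jmeas M V" unfolding jmeas_def V_def
    by (rule borel_measurable_lim_metric, rule dyadic_measurable[OF measurable_H[OF Z(1)]]) auto
  moreover have "V t \<in> borel_measurable (H t)" if "0 \<le> t" for t
  proof -
    have "Z (dyadic k t) \<in> borel_measurable (H t)" for k
      using measurable_H_mono[OF Z(1)[OF dyadic_bounds(3)[OF that]] dyadic_bounds(1)] .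
    thus ?thesis unfolding V_def by (rule borel_measurable_lim_metric)
  qed
  moreover have "(\<lambda>p. V (fst p) (snd p)) \<in> borel_measurable (leb t \<Otimes>\<^sub>M H t)" if "0 \<le> t" for t
    unfolding V_def by (rule borel_measurable_lim_metric, rule dyadic_measurable[OF measurable_H_mono[OF Z(1)]]) auto
  moreover have "AE w in M. \<forall>t\<ge>0. V t w = X t w"
  proof -
    have "AE w in M. \<forall>k. \<forall>i. 0 \<le> real_of_int i / 2 ^ k \<longrightarrow> X (real_of_int i / 2 ^ k) w = Z (real_of_int i / 2 ^ k) w"
      unfolding AE_all_countable by (intro allI AE_impI Z(2))
    with cont show ?thesis
    proof eventually_elim
      case (elim w)
      show ?case
      proof (intro allI impI)
        fix t :: real assume t: "0 \<le> t"
        have "(\<lambda>k. X (dyadic k t) w) \<longlonglongrightarrow> X t w"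
          by (rule continuous_on_tendsto_compose[OF elim(1) dyadic_tendsto]) (use t dyadic_bounds(3)[OF t] in auto)
        moreover have "X (dyadic k t) w = Z (dyadic k t) w" for k
          using elim(2) dyadic_bounds(3)[OF t, of k] unfolding dyadic_def by blast
        ultimately show "V t w = X t w" unfolding V_def by (simp add: limI)
      qed
    qed
  qed
  ultimately show ?thesis using that by blast
qed

text \<open>The progressively measurable version is integrated in its place; its sections on [0,t]
  involve the sigma-algebra of time t only.\<close>

lemma has_version_prim:
  fixes X :: "real \<Rightarrow> 'w \<Rightarrow> real^'n"
  assumes ver: "\<And>t. 0 \<le> t \<Longrightarrow> has_version M (H t) (X t)"
    and cont: "AE w in M. continuous_on {0..} (\<lambda>t. X t w)" and t: "0 \<le> t"
  shows "has_version M (H t) (\<lambda>w. prim (\<lambda>r. X r w) t)"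
proof -
  obtain V where "jmeas M V" "\<forall>t\<ge>0. V t \<in> borel_measurable (H t)"
    and Vj: "\<forall>t\<ge>0. (\<lambda>p. V (fst p) (snd p)) \<in> borel_measurable (leb t \<Otimes>\<^sub>M H t)"
    and VX: "AE w in M. \<forall>t\<ge>0. V t w = X t w"
    by (rule nice_version[OF ver cont])
  note V = Vj[rule_format, OF t] VX
  interpret L: sigma_finite_measure "leb t" by (rule sigma_finite_leb)
  have "(\<lambda>(w, r). V r w) \<in> borel_measurable (H t \<Otimes>\<^sub>M leb t)"
    using measurable_compose[OF measurable_pair_swap' V(1)] by (simp add: split_beta')
  hence "(\<lambda>w. prim (\<lambda>r. V r w) t) \<in> borel_measurable (H t)" unfolding prim_def by (rule L.borel_measurable_lebesgue_integral)
  moreover have "AE w in M. prim (\<lambda>r. X r w) t = prim (\<lambda>r. V r w) t"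
    using V(2) by eventually_elim (rule prim_cong, simp add: space_restrict_space)
  ultimately show ?thesis by (rule has_versionI)
qed

text \<open>Picard iterates starting from 0 keep versions, and on each path they differ from X by at
  most sup |X| (c t)^n / n!. Hence X inherits a version from the forcing.\<close>

lemma linear_volterra_has_version:
  fixes X \<xi> :: "real \<Rightarrow> 'w \<Rightarrow> real^'n" and A :: "real^'n^'n"
  assumes ver: "\<And>t. 0 \<le> t \<Longrightarrow> has_version M (H t) (\<xi> t)"
    and c\<xi>: "AE w in M. continuous_on {0..} (\<lambda>t. \<xi> t w)" and cX: "AE w in M. continuous_on {0..} (\<lambda>t. X t w)"
    and X: "AE w in M. \<forall>t\<ge>0. X t w = \<xi> t w + prim (\<lambda>r. A *v X r w) t" and t: "0 \<le> t"
  shows "has_version M (H t) (X t)"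
proof -
  define Y where "Y = rec_nat (\<lambda>t w. 0 :: real^'n) (\<lambda>n Y t w. \<xi> t w + prim (\<lambda>r. A *v Y r w) t)"
  have Y0: "Y 0 t w = 0" and YS: "Y (Suc n) t w = \<xi> t w + prim (\<lambda>r. A *v Y n r w) t" for n t w by (simp_all add: Y_def)
  have cA: "continuous_on {0..} (\<lambda>r. A *v f r)" if "continuous_on {0..} f" for f :: "real \<Rightarrow> real^'n"
    by (rule continuous_on_compose2[OF matrix_vector_mult_linear_continuous_on[of UNIV A] that]) auto
  have cY: "AE w in M. \<forall>n. continuous_on {0..} (\<lambda>t. Y n t w)"
    using c\<xi>
  proof eventually_elim
    case (elim w)
    have "continuous_on {0..} (\<lambda>t. Y n t w)" for n
    proof (induction n)
      case (Suc n)
      have "continuous_on {0..} (prim (\<lambda>r. A *v Y n r w))" by (intro continuous_on_prim integrable_leb_continuous cA Suc)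
      thus ?case unfolding YS using elim by (intro continuous_on_add)
    qed (simp add: Y0)
    thus ?case by blast
  qed
  have vY: "has_version M (H t) (Y n t)" if "0 \<le> t" for n t
    using that
  proof (induction n arbitrary: t)
    case 0
    show ?case using has_version_const[of M "H t" 0] by (simp add: Y0[abs_def])
  next
    case (Suc n)
    have "AE w in M. continuous_on {0..} (\<lambda>t. A *v Y n t w)" using cY by eventually_elim (auto intro: cA)
    from has_version_prim[OF has_version_matrix[OF Suc.IH] this Suc.prems] ver[OF Suc.prems]
    show ?case unfolding YS[abs_def] by (intro has_version_add) simp_all
  qed
  obtain c where c: "c > 0" "\<And>x. norm (A *v x) \<le> c * norm x" using norm_matrix_vector_le by blast
  have "AE w in M. (\<lambda>n. Y n t w) \<longlonglongrightarrow> X t w"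
    using cX cY X
  proof eventually_elim
    case (elim w)
    have "continuous_on {0..t} (\<lambda>r. norm (X r w))" using elim(1) by (auto intro!: continuous_intros intro: continuous_on_subset)
    hence "\<exists>r0\<in>{0..t}. \<forall>r\<in>{0..t}. norm (X r w) \<le> norm (X r0 w)"
      using t by (intro continuous_attains_sup) auto
    then obtain r0 where r0: "\<And>r. r \<in> {0..t} \<Longrightarrow> norm (X r w) \<le> norm (X r0 w)" by blast
    define S where "S = norm (X r0 w)"
    have b: "norm (Y n r w - X r w) \<le> S * ((c * r) ^ n / fact n)" if "r \<in> {0..t}" for n r
      using that
    proof (induction n arbitrary: r)
      case 0
      thus ?case using r0 by (simp add: Y0 S_def)
    next
      case (Suc n)
      have i1: "integrable (leb r) (\<lambda>s. A *v Y n s w)" "integrable (leb r) (\<lambda>s. A *v X s w)"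
        using elim(1,2) by (auto intro!: integrable_leb_continuous cA)
      have cp: "continuous_on {0..} (\<lambda>s. S * c * ((c * s) ^ n / fact n))" by (intro continuous_intros) auto
      have "Y (Suc n) r w - X r w = prim (\<lambda>s. A *v Y n s w - A *v X s w) r"
        using elim(3) Suc.prems i1 by (simp add: YS prim_def)
      also have "norm \<dots> \<le> prim (\<lambda>s. S * c * ((c * s) ^ n / fact n)) r"
      proof (rule norm_prim_le)
        fix s assume s: "s \<in> {0..r}"
        have "norm (A *v Y n s w - A *v X s w) \<le> c * norm (Y n s w - X s w)"
          using c(2)[of "Y n s w - X s w"] by (simp add: matrix_vector_mult_diff_distrib)
        also have "\<dots> \<le> c * (S * ((c * s) ^ n / fact n))" using c s Suc.prems by (intro mult_left_mono Suc.IH) auto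
        finally show "norm (A *v Y n s w - A *v X s w) \<le> S * c * ((c * s) ^ n / fact n)" by (simp add: mult_ac)
      qed (use i1 integrable_leb_continuous[OF cp] in auto)
      also have "\<dots> = S * ((c * r) ^ Suc n / fact (Suc n))"
      proof -
        have "((\<lambda>s. S * ((c * s) ^ Suc n / fact (Suc n))) has_vector_derivative S * c * ((c * s) ^ n / fact n)) (at s within {0..})" for s
          unfolding has_real_derivative_iff_has_vector_derivative[symmetric]
          by (rule derivative_eq_intros refl | simp)+
        from prim_continuous_derivative[OF this cp, of r] Suc.prems show ?thesis by simp
      qed
      finally show ?case .
    qed
    have "(\<lambda>n. S * ((c * t) ^ n / fact n)) \<longlonglongrightarrow> S * 0"
      using summable_LIMSEQ_zero[OF summable_exp[of "c * t"]] by (intro tendsto_mult tendsto_const) (simp add: field_simps)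
    hence "(\<lambda>n. Y n t w - X t w) \<longlonglongrightarrow> 0"
      using b[of t] t by (intro Lim_null_comparison[OF always_eventually, of "\<lambda>n. Y n t w - X t w"]) auto
    thus ?case by (simp add: LIM_zero_iff)
  qed
  from has_version_lim[OF vY[OF t] this] show ?thesis .
qed

text \<open>Step integrals involve W only up to time t, and a subsequence of them converges almost
  surely.\<close>

lemma ito_has_version:
  fixes g :: "real \<Rightarrow> real^'n"
  assumes W: "brownian_motion M F W" and WH: "\<And>r. 0 \<le> r \<Longrightarrow> W r \<in> borel_measurable (H r)"
    and g: "g \<in> borel_measurable (leb t)" and I: "is_ito_integral M W g t I"
  shows "has_version M (H t) I"
proof -
  obtain S where S: "\<And>k. valid_steps t (S k)" "sq_integrable M I"
    "(\<lambda>k. \<integral>w. (norm (step_integral W (S k) w - I w))\<^sup>2 \<partial>M) \<longlonglongrightarrow> 0"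
    using ito_approximation[OF W I g] by blast
  have m: "step_integral W L \<in> borel_measurable (H t)" if "valid_steps t L" for L :: "(real \<times> real \<times> (real^'n)) list"
    using that
  proof (induction L)
    case Nil
    show ?case by (simp add: step_integral_Nil[abs_def])
  next
    case (Cons x L)
    obtain a b c where x: "x = (a, b, c)" by (cases x)
    have ab: "0 \<le> a" "a \<le> b" "b \<le> t" "valid_steps t L" using Cons(2) by (auto simp: x valid_steps_Cons)
    have [measurable]: "W a \<in> borel_measurable (H t)" "W b \<in> borel_measurable (H t)" "step_integral W L \<in> borel_measurable (H t)"
      using measurable_H_mono[OF WH] ab Cons.IH by auto
    have "step_integral W (x # L) = (\<lambda>w. (W b w - W a w) *\<^sub>R c + step_integral W L w)" by (simp add: x step_integral_Cons fun_eq_iff)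
    thus ?case by simp
  qed
  have i: "integrable M (\<lambda>w. (norm (step_integral W (S k) w - I w))\<^sup>2)" for k
    by (intro sq_integrable_norm2 sq_integrable_diff S sq_integrable_step_integral[OF W S(1)])
  have "(\<lambda>k. \<integral>w. norm ((norm (step_integral W (S k) w - I w))\<^sup>2) \<partial>M) \<longlonglongrightarrow> 0" using S(3) by simp
  then obtain r where "strict_mono r" and r: "AE w in M. (\<lambda>k. (norm (step_integral W (S (r k)) w - I w))\<^sup>2) \<longlonglongrightarrow> 0"
    using tendsto_L1_AE_subseq[of M "\<lambda>k w. (norm (step_integral W (S k) w - I w))\<^sup>2", OF i] by blast
  have "AE w in M. (\<lambda>k. step_integral W (S (r k)) w) \<longlonglongrightarrow> I w"
    using r
  proof eventually_elim
    case (elim w)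
    have "(\<lambda>k. sqrt ((norm (step_integral W (S (r k)) w - I w))\<^sup>2)) \<longlonglongrightarrow> sqrt 0" by (rule tendsto_real_sqrt[OF elim])
    thus ?case by (simp add: tendsto_norm_zero_iff LIM_zero_iff)
  qed
  from has_version_lim[OF has_version_measurable[OF m[OF S(1)]] this] show ?thesis .
qed

end

context filtered_prob begin

text \<open>The pathwise estimate, integrated over the sample space. It supplies the square
  integrability on finite horizons that the energy identities presuppose.\<close>

lemma gronwall_process:
  fixes X \<xi> :: "real \<Rightarrow> 'w \<Rightarrow> real^'n" and A :: "real^'n^'n"
  assumes jX: "jmeas M X" and \<xi>: "L2proc M \<xi>" and cX: "AE w in M. continuous_on {0..} (\<lambda>t. X t w)"
    and X: "AE w in M. \<forall>t\<ge>0. X t w = \<xi> t w + prim (\<lambda>r. A *v X r w) t"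
  shows "L2proc M X"
proof -
  obtain c where c: "c > 0" "\<And>x. norm (A *v x) \<le> c * norm x" using norm_matrix_vector_le by blast
  have "(\<integral>\<^sup>+w. (\<integral>\<^sup>+t. ennreal ((norm (X t w))\<^sup>2) \<partial>leb T) \<partial>M) < \<infinity>" if T: "0 \<le> T" for T
  proof -
    let ?K = "exp (2 * c\<^sup>2 * T * T) * 2"
    have "AE w in M. (\<integral>\<^sup>+t. ennreal ((norm (X t w))\<^sup>2) \<partial>leb T) \<le> ennreal (?K * (\<integral>t. (norm (\<xi> t w))\<^sup>2 \<partial>leb T))"
      using cX X L2proc_AE_path[OF \<xi> T] AE_space
    proof eventually_elim
      case (elim w)
      have "continuous_on {0..} (\<lambda>t. (norm (X t w))\<^sup>2)" using elim(1) by (intro continuous_intros)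
      hence "integrable (leb T) (\<lambda>t. (norm (X t w))\<^sup>2)" by (rule integrable_leb_continuous)
      hence "(\<integral>\<^sup>+t. ennreal ((norm (X t w))\<^sup>2) \<partial>leb T) = ennreal (\<integral>t. (norm (X t w))\<^sup>2 \<partial>leb T)" by (rule nn_integral_eq_integral) simp
      also have "\<dots> \<le> ennreal (?K * (\<integral>t. (norm (\<xi> t w))\<^sup>2 \<partial>leb T))"
        using gronwall_L2[OF c elim(1) _ elim(3) T] elim(2) by (intro ennreal_leI) (simp add: mult.assoc)
      finally show ?case .
    qed
    hence "(\<integral>\<^sup>+w. (\<integral>\<^sup>+t. ennreal ((norm (X t w))\<^sup>2) \<partial>leb T) \<partial>M) \<le> (\<integral>\<^sup>+w. ennreal (?K * (\<integral>t. (norm (\<xi> t w))\<^sup>2 \<partial>leb T)) \<partial>M)"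
      by (rule nn_integral_mono_AE)
    also have "\<dots> < \<infinity>"
    proof -
      have "integrable M (\<lambda>w. ?K * (\<integral>t. (norm (\<xi> t w))\<^sup>2 \<partial>leb T))"
        using L2proc_inner(2)[OF \<xi> \<xi> T] by (simp add: power2_norm_eq_inner)
      from nn_integral_eq_integral[OF this] show ?thesis by simp
    qed
    finally show ?thesis .
  qed
  with jX show ?thesis by (simp add: L2proc_iff_nn)
qed

end

section \<open>Noise and state processes\<close>

lemma continuous_on_measurable_lebh:
  fixes f :: "real \<Rightarrow> 'b::topological_space"
  shows "continuous_on {0..} f \<Longrightarrow> f \<in> borel_measurable lebh"
  using borel_measurable_continuous_on_restrict[of "{0..}" f] by (simp add: cong: measurable_cong_sets sets_restrict_space_cong)

lemma prim_at_0: "prim f 0 = 0"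
  unfolding prim_def integral_leb set_lebesgue_integral_def
proof (rule integral_eq_zero_AE)
  show "AE x in lborel. indicator {0..0::real} x *\<^sub>R f x = 0"
    using AE_lborel_singleton[of "0::real"] by eventually_elim simp
qed

context filtered_prob begin

lemma is_ito_integral_cong:
  assumes I: "is_ito_integral M W g t I" and J: "J \<in> borel_measurable M" "AE w in M. J w = I w"
  shows "is_ito_integral M W g t J"
proof -
  have "(\<integral>\<^sup>+w. ennreal ((norm (Z w - J w))\<^sup>2) \<partial>M) = (\<integral>\<^sup>+w. ennreal ((norm (Z w - I w))\<^sup>2) \<partial>M)" for Z
    by (rule nn_integral_cong_AE) (use J(2) in eventually_elim, simp)
  with I J(1) show ?thesis by (simp add: is_ito_integral_def)
qed

text \<open>By the isometry the second moments are the primitive of |\<sigma>|^2: nondecreasing, so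
  the process is square integrable on [0,T], and 0 at time 0.\<close>

lemma martingale_noise_ito:
  fixes \<sigma> :: "real \<Rightarrow> real^'n"
  assumes W: "brownian_motion M F W" and \<sigma>: "continuous_on {0..} \<sigma>" and j: "jmeas M I"
    and I: "\<And>t. 0 \<le> t \<Longrightarrow> is_ito_integral M W \<sigma> t (I t)"
  shows "martingale_noise I"
proof -
  have m: "\<sigma> \<in> borel_measurable (leb t)" for t by (rule measurable_leb_lebh[OF continuous_on_measurable_lebh[OF \<sigma>]])
  have s: "sq_integrable M (I t)" if "0 \<le> t" for t using ito_approximation[OF W I[OF that] m] by blast
  have cov: "expectation (\<lambda>w. (norm (I t w))\<^sup>2) = prim (\<lambda>r. (norm (\<sigma> r))\<^sup>2) t" if "0 \<le> t" for t
    using ito_cov[OF W W incr_cov_same[OF W] I[OF that] m I[OF that] m, of "mat 1"] by (simp add: power2_norm_eq_inner prim_def)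
  have c: "continuous_on {0..} (\<lambda>r. (norm (\<sigma> r))\<^sup>2)" using \<sigma> by (intro continuous_intros)
  have mono: "prim (\<lambda>r. (norm (\<sigma> r))\<^sup>2) t \<le> prim (\<lambda>r. (norm (\<sigma> r))\<^sup>2) T" if "0 \<le> t" "t \<le> T" for t T
  proof -
    have i: "set_integrable lborel {0..t} (\<lambda>r. (norm (\<sigma> r))\<^sup>2)" for t using integrable_leb_continuous[OF c] by (simp add: integrable_leb)
    from integral_mono[OF i[of t, unfolded set_integrable_def] i[of T, unfolded set_integrable_def]] that
    show ?thesis unfolding prim_def integral_leb set_lebesgue_integral_def by (auto simp: indicator_def)
  qed
  have "(\<integral>\<^sup>+w. (\<integral>\<^sup>+t. ennreal ((norm (I t w))\<^sup>2) \<partial>leb T) \<partial>M) < \<infinity>" if T: "0 \<le> T" for T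
  proof -
    interpret P: pair_sigma_finite "leb T" M by (rule pair_sigma_finite_leb)
    have "(\<integral>\<^sup>+w. (\<integral>\<^sup>+t. ennreal ((norm (I t w))\<^sup>2) \<partial>leb T) \<partial>M) = (\<integral>\<^sup>+t. (\<integral>\<^sup>+w. ennreal ((norm (I t w))\<^sup>2) \<partial>M) \<partial>leb T)"
      by (rule P.Fubini') (use jmeas_leb[OF j, of T] in \<open>simp add: split_beta'\<close>)
    also have "\<dots> \<le> (\<integral>\<^sup>+t. ennreal (prim (\<lambda>r. (norm (\<sigma> r))\<^sup>2) T) \<partial>leb T)"
    proof (rule nn_integral_mono)
      fix t assume "t \<in> space (leb T)"
      hence t: "0 \<le> t" "t \<le> T" by (auto simp: space_restrict_space)
      have "(\<integral>\<^sup>+w. ennreal ((norm (I t w))\<^sup>2) \<partial>M) = ennreal (expectation (\<lambda>w. (norm (I t w))\<^sup>2))"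
        using s[OF t(1)] by (intro nn_integral_eq_integral) (auto simp: sq_integrable_def)
      thus "(\<integral>\<^sup>+w. ennreal ((norm (I t w))\<^sup>2) \<partial>M) \<le> ennreal (prim (\<lambda>r. (norm (\<sigma> r))\<^sup>2) T)"
        using cov[OF t(1)] mono[OF t] by (simp add: ennreal_leI)
    qed
    also have "\<dots> < \<infinity>" using T by (simp add: emeasure_restrict_space space_restrict_space ennreal_mult_less_top)
    finally show ?thesis .
  qed
  hence L: "L2proc M I" using j by (simp add: L2proc_iff_nn)
  have "expectation (\<lambda>w. (norm (I 0 w))\<^sup>2) = 0" using cov[of 0] by (simp add: prim_at_0)
  hence "AE w in M. (norm (I 0 w))\<^sup>2 = 0"
    using sq_integrable_norm2[OF s[of 0]] by (subst (asm) integral_nonneg_eq_0_iff_AE) auto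
  hence "AE w in M. I 0 w = 0" by simp
  moreover have "expectation (\<lambda>w. I t w \<bullet> Z w) = expectation (\<lambda>w. I r w \<bullet> Z w)"
    if "0 \<le> r" "r \<le> t" "sq_integrable M Z" "Z \<in> borel_measurable (F r)" for r t Z
    by (rule ito_martingale[OF W that(1,2) m m I I that(3,4)]) (use that in auto)
  ultimately show ?thesis using L s by (auto simp: martingale_noise_def)
qed

lemma martingale_noise_scaleR: "martingale_noise I \<Longrightarrow> martingale_noise (\<lambda>t w. c *\<^sub>R I t w)"
  unfolding martingale_noise_def by (auto intro: L2proc_scaleR sq_integrable_scaleR)

lemma martingale_noise_add:
  assumes I: "martingale_noise I" and J: "martingale_noise J"
  shows "martingale_noise (\<lambda>t w. I t w + J t w)"
proof -
  have s: "sq_integrable M (I t)" "sq_integrable M (J t)" if "0 \<le> t" for t using I J that by (auto simp: martingale_noise_def)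
  have e: "expectation (\<lambda>w. (I t w + J t w) \<bullet> Z w) = expectation (\<lambda>w. I t w \<bullet> Z w) + expectation (\<lambda>w. J t w \<bullet> Z w)"
    if "0 \<le> t" "sq_integrable M Z" for t Z
    using sq_integrable_inner[OF s(1)[OF that(1)] that(2)] sq_integrable_inner[OF s(2)[OF that(1)] that(2)] by (simp add: inner_add_left)
  have "AE w in M. I 0 w + J 0 w = 0"
  proof -
    have "AE w in M. I 0 w = 0" "AE w in M. J 0 w = 0" using I J by (auto simp: martingale_noise_def)
    thus ?thesis by eventually_elim simp
  qed
  moreover have "expectation (\<lambda>w. (I t w + J t w) \<bullet> Z w) = expectation (\<lambda>w. (I r w + J r w) \<bullet> Z w)"
    if "0 \<le> r" "r \<le> t" "sq_integrable M Z" "Z \<in> borel_measurable (F r)" for r t Z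
  proof -
    have "expectation (\<lambda>w. I t w \<bullet> Z w) = expectation (\<lambda>w. I r w \<bullet> Z w)" "expectation (\<lambda>w. J t w \<bullet> Z w) = expectation (\<lambda>w. J r w \<bullet> Z w)"
      using I J that unfolding martingale_noise_def by blast+
    thus ?thesis using that e by simp
  qed
  moreover have "L2proc M (\<lambda>t w. I t w + J t w)" using I J by (auto simp: martingale_noise_def intro: L2proc_add)
  ultimately show ?thesis using s by (auto simp: martingale_noise_def intro: sq_integrable_add)
qed

lemma martingale_noise_sum:
  "(\<And>j. j \<in> U \<Longrightarrow> martingale_noise (I j)) \<Longrightarrow> martingale_noise (\<lambda>t w. \<Sum>j\<in>U. I j t w)"
  by (induction U rule: infinite_finite_induct) (auto intro: martingale_noise_add martingale_noise_zero)

text \<open>Noises of different agents are uncorrelated, so coefficients enter through their squares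
  only. For the average, all coefficients 1/N, the factor is 1/N.\<close>

lemma noise_variance_combination:
  fixes \<sigma> :: "real \<Rightarrow> real^'n"
  assumes W: "\<And>j. j \<in> U \<Longrightarrow> brownian_motion M F (W j)" and fin: "finite U"
    and ind: "indep_vars (\<lambda>_. PiM {0..} (\<lambda>_. borel)) (\<lambda>i w. \<lambda>t\<in>{0..}. W i t w) U"
    and \<sigma>: "continuous_on {0..} \<sigma>" and I: "\<And>j t. j \<in> U \<Longrightarrow> 0 \<le> t \<Longrightarrow> is_ito_integral M (W j) \<sigma> t (I j t)"
  shows "noise_variance \<sigma> (\<Sum>j\<in>U. (c j)\<^sup>2) (\<lambda>t w. \<Sum>j\<in>U. c j *\<^sub>R I j t w)"
  unfolding noise_variance_def
proof (intro allI impI)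
  fix t :: real and Y :: "real^'n^'n" assume t: "0 \<le> t"
  have m: "\<sigma> \<in> borel_measurable (leb t)" by (rule measurable_leb_lebh[OF continuous_on_measurable_lebh[OF \<sigma>]])
  have s: "sq_integrable M (I j t)" if "j \<in> U" for j using ito_approximation[OF W[OF that] I[OF that t] m] by blast
  let ?v = "prim (\<lambda>r. \<sigma> r \<bullet> (Y *v \<sigma> r)) t"
  have cov: "expectation (\<lambda>w. I i t w \<bullet> (Y *v I j t w)) = (if i = j then ?v else 0)" if ij: "i \<in> U" "j \<in> U" for i j
  proof (cases "i = j")
    case True
    thus ?thesis using ito_cov[OF W[OF ij(1)] W[OF ij(1)] incr_cov_same[OF W[OF ij(1)]] I[OF ij(1) t] m I[OF ij(1) t] m, of Y]
      by (simp add: prim_def)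
  next
    case False
    from ito_cov[OF W[OF ij(1)] W[OF ij(2)] incr_cov_indep[OF W ij False ind] I[OF ij(1) t] m I[OF ij(2) t] m, of Y] False
    show ?thesis by simp
  qed
  have i: "integrable M (\<lambda>w. c i * (c j * (I i t w \<bullet> (Y *v I j t w))))" if ij: "i \<in> U" "j \<in> U" for i j
    using sq_integrable_inner[OF s[OF ij(1)] sq_integrable_matrix[OF s[OF ij(2)], of Y]] by simp
  have "expectation (\<lambda>w. (\<Sum>j\<in>U. c j *\<^sub>R I j t w) \<bullet> (Y *v (\<Sum>j\<in>U. c j *\<^sub>R I j t w)))
    = expectation (\<lambda>w. \<Sum>i\<in>U. \<Sum>j\<in>U. c i * (c j * (I i t w \<bullet> (Y *v I j t w))))"
    by (intro Bochner_Integration.integral_cong refl)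
       (simp add: inner_sum_left inner_sum_right linear_sum[OF matrix_vector_mul_linear] matrix_vector_mult_scaleR sum_distrib_left,
        subst sum.swap, simp add: mult.left_commute)
  also have "\<dots> = (\<Sum>i\<in>U. \<Sum>j\<in>U. expectation (\<lambda>w. c i * (c j * (I i t w \<bullet> (Y *v I j t w)))))"
    using i by (subst Bochner_Integration.integral_sum) (auto intro!: sum.cong)
  also have "\<dots> = (\<Sum>i\<in>U. \<Sum>j\<in>U. if i = j then (c i)\<^sup>2 * ?v else 0)"
    by (intro sum.cong refl) (simp add: cov power2_eq_square)
  also have "\<dots> = (\<Sum>i\<in>U. (c i)\<^sup>2) * ?v" using fin by (simp add: sum_distrib_right)
  finally show "expectation (\<lambda>w. (\<Sum>j\<in>U. c j *\<^sub>R I j t w) \<bullet> (Y *v (\<Sum>j\<in>U. c j *\<^sub>R I j t w))) = (\<Sum>j\<in>U. (c j)\<^sup>2) * ?v" .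
qed

lemma measurable_drift:
  assumes "\<And>j. j \<in> {1..N} \<Longrightarrow> jmeas M (x j)" "jmeas M (u i)" "f \<in> borel_measurable lebh" "i \<in> {1..N}"
  shows "jmeas M (drift A B G f N x u i)"
  unfolding drift_def[abs_def] average_def using assms
  by (intro jmeas_add jmeas_matrix jmeas_scaleR jmeas_sum jmeas_det)

lemma AE_ball_finite_all: "finite U \<Longrightarrow> (\<And>i. i \<in> U \<Longrightarrow> AE w in M. P i w) \<Longrightarrow> AE w in M. \<forall>i\<in>U. P i w"
  by (simp add: AE_finite_all)

lemma nice_versions:
  fixes x :: "nat \<Rightarrow> real \<Rightarrow> 'w \<Rightarrow> real^'n"
  assumes st: "is_state A B G f \<sigma> N M F W x0 u x"
  obtains x' where "\<forall>i\<in>{1..N}. jmeas M (x' i)" "\<forall>i\<in>{1..N}. \<forall>t\<ge>0. x' i t \<in> borel_measurable (F t)"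
    "AE w in M. \<forall>i\<in>{1..N}. \<forall>t\<ge>0. x' i t w = x i t w" "AE w in M. \<forall>i\<in>{1..N}. continuous_on {0..} (\<lambda>t. x' i t w)"
proof -
  interpret S: subfiltration M F F
    by (unfold_locales; (rule space_F sets_F_subset | erule sets_F_mono))
  have "\<exists>V. jmeas M V \<and> (\<forall>t\<ge>0. V t \<in> borel_measurable (F t)) \<and> (AE w in M. \<forall>t\<ge>0. V t w = x i t w)" if i: "i \<in> {1..N}" for i
  proof -
    have "has_version M (F t) (x i t)" if "0 \<le> t" for t
      using st i that by (intro has_version_measurable) (simp add: is_state_def)
    moreover have "AE w in M. continuous_on {0..} (\<lambda>t. x i t w)" using st i by (simp add: is_state_def)
    ultimately show ?thesis by (rule S.nice_version) blast+
  qed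
  hence "\<forall>i\<in>{1..N}. \<exists>V. jmeas M V \<and> (\<forall>t\<ge>0. V t \<in> borel_measurable (F t)) \<and> (AE w in M. \<forall>t\<ge>0. V t w = x i t w)" by blast
  from bchoice[OF this] obtain x' where "\<forall>i\<in>{1..N}. jmeas M (x' i) \<and> (\<forall>t\<ge>0. x' i t \<in> borel_measurable (F t))
    \<and> (AE w in M. \<forall>t\<ge>0. x' i t w = x i t w)" by blast
  hence x': "\<And>i. i \<in> {1..N} \<Longrightarrow> jmeas M (x' i)" "\<And>i t. i \<in> {1..N} \<Longrightarrow> 0 \<le> t \<Longrightarrow> x' i t \<in> borel_measurable (F t)"
    "\<And>i. i \<in> {1..N} \<Longrightarrow> AE w in M. \<forall>t\<ge>0. x' i t w = x i t w" by blast+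
  have eq: "AE w in M. \<forall>i\<in>{1..N}. \<forall>t\<ge>0. x' i t w = x i t w" by (rule AE_ball_finite_all) (use x'(3) in auto)
  have "AE w in M. \<forall>i\<in>{1..N}. continuous_on {0..} (\<lambda>t. x i t w)"
    by (rule AE_ball_finite_all) (use st in \<open>auto simp: is_state_def\<close>)
  with eq have cont: "AE w in M. \<forall>i\<in>{1..N}. continuous_on {0..} (\<lambda>t. x' i t w)"
  proof eventually_elim
    case (elim w)
    show ?case
    proof
      fix i assume i: "i \<in> {1..N}"
      show "continuous_on {0..} (\<lambda>t. x' i t w)"
        by (rule continuous_on_eq[of _ "\<lambda>t. x i t w"]) (use elim i in auto)
    qed
  qed
  show ?thesis by (rule that[of x']) (use x' eq cont in blast)+
qed

text \<open>\<open>is_state\<close> provides an unrelated Ito integral for each time. The residual I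
  of the state equation is one jointly measurable process that agrees with it almost surely at each
  time.\<close>

lemma state_noise:
  fixes x x' :: "nat \<Rightarrow> real \<Rightarrow> 'w \<Rightarrow> real^'n" and u u' :: "nat \<Rightarrow> real \<Rightarrow> 'w \<Rightarrow> real^'r"
  assumes st: "is_state A B G f \<sigma> N M F W x0 u x" and u: "\<And>i. i \<in> {1..N} \<Longrightarrow> jmeas M (u' i)"
    and x'1: "\<And>i. i \<in> {1..N} \<Longrightarrow> jmeas M (x' i)"
    and eq: "AE w in M. \<forall>i\<in>{1..N}. \<forall>t\<ge>0. x' i t w = x i t w" and ueq: "AE w in M. \<forall>i\<in>{1..N}. \<forall>t\<ge>0. u' i t w = u i t w"
    and f: "continuous_on {0..} f" and x0: "\<And>i. i \<in> {1..N} \<Longrightarrow> x0 i \<in> borel_measurable M"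
  defines "I \<equiv> \<lambda>i t w. x' i t w - x0 i w - prim (\<lambda>r. drift A B G f N x' u' i r w) t"
  shows "AE w in M. \<forall>i\<in>{1..N}. \<forall>T\<ge>0. integrable (leb T) (\<lambda>r. drift A B G f N x' u' i r w)"
    "\<And>i. i \<in> {1..N} \<Longrightarrow> jmeas M (I i)" "\<And>i t. i \<in> {1..N} \<Longrightarrow> 0 \<le> t \<Longrightarrow> is_ito_integral M (W i) \<sigma> t (I i t)"
proof -
  have deq: "AE w in M. \<forall>i\<in>{1..N}. \<forall>r\<ge>0. drift A B G f N x' u' i r w = drift A B G f N x u i r w"
    using eq ueq by eventually_elim (auto simp: drift_def average_def)
  have jd: "jmeas M (drift A B G f N x' u' i)" if "i \<in> {1..N}" for i
    by (rule measurable_drift[OF x'1 u continuous_on_measurable_lebh[OF f]]) (use that in auto)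
  show jI: "jmeas M (I i)" if "i \<in> {1..N}" for i
    unfolding I_def using that by (intro jmeas_diff x'1 jmeas_const x0 jmeas_prim jd)
  \<comment> \<open>The exceptional set in \<open>is_state\<close> depends on t; integer horizons
    keep it countable and exceed every T.\<close>
  have int: "AE w in M. \<forall>i\<in>{1..N}. \<forall>n::nat. set_integrable lborel {0..real n} (\<lambda>r. drift A B G f N x u i r w)"
  proof (rule AE_ball_finite_all)
    fix i assume i: "i \<in> {1..N}"
    have "AE w in M. set_integrable lborel {0..real n} (\<lambda>r. drift A B G f N x u i r w)" for n
    proof -
      have "(\<exists>I. is_ito_integral M (W i) \<sigma> (real n) I \<and> (AE w in M. set_integrable lborel {0..real n} (\<lambda>r. drift A B G f N x u i r w) \<and>
         x i (real n) w = x0 i w + (LINT r:{0..real n}|lborel. drift A B G f N x u i r w) + I w))"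
        using st i by (simp add: is_state_def)
      thus ?thesis by (auto elim: eventually_mono)
    qed
    thus "AE w in M. \<forall>n::nat. set_integrable lborel {0..real n} (\<lambda>r. drift A B G f N x u i r w)" by (simp add: AE_all_countable)
  qed simp
  have lcong: "integrable (leb T) g \<longleftrightarrow> integrable (leb T) h" if "\<And>r. 0 \<le> r \<Longrightarrow> g r = h r" for T and g h :: "real \<Rightarrow> real^'n"
    by (rule Bochner_Integration.integrable_cong) (use that in \<open>auto simp: space_restrict_space\<close>)
  show int': "AE w in M. \<forall>i\<in>{1..N}. \<forall>T\<ge>0. integrable (leb T) (\<lambda>r. drift A B G f N x' u' i r w)"
    using int deq
  proof eventually_elim
    case (elim w)
    show ?case
    proof (intro ballI allI impI)
      fix i and T :: real assume i: "i \<in> {1..N}" and T: "0 \<le> T"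
      obtain n where n: "T \<le> real n" using real_arch_simple by blast
      have "integrable (leb (real n)) (\<lambda>r. drift A B G f N x u i r w)" using elim(1) i by (simp add: integrable_leb)
      from integrable_leb_mono[OF this n] lcong[of "\<lambda>r. drift A B G f N x' u' i r w" "\<lambda>r. drift A B G f N x u i r w" T] elim(2) i
      show "integrable (leb T) (\<lambda>r. drift A B G f N x' u' i r w)" by blast
    qed
  qed
  show "is_ito_integral M (W i) \<sigma> t (I i t)" if i: "i \<in> {1..N}" and t: "0 \<le> t" for i t
  proof -
    obtain J where J: "is_ito_integral M (W i) \<sigma> t J" "AE w in M. set_integrable lborel {0..t} (\<lambda>r. drift A B G f N x u i r w) \<and>
         x i t w = x0 i w + (LINT r:{0..t}|lborel. drift A B G f N x u i r w) + J w"
      using st i t unfolding is_state_def by meson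
    have "AE w in M. I i t w = J w"
      using J(2) eq deq
    proof eventually_elim
      case (elim w)
      have "prim (\<lambda>r. drift A B G f N x' u' i r w) t = prim (\<lambda>r. drift A B G f N x u i r w) t"
        by (rule prim_cong) (use elim(3) i in \<open>auto simp: space_restrict_space\<close>)
      also have "\<dots> = (LINT r:{0..t}|lborel. drift A B G f N x u i r w)" by (simp only: prim_def integral_leb)
      finally show ?case using elim i t by (simp add: I_def)
    qed
    from is_ito_integral_cong[OF J(1) jmeas_section[OF jI[OF i] t] this] show ?thesis .
  qed
qed

end

section \<open>The closed loop\<close>

lemma C_half_continuous: "h \<in> C_half \<rho> \<Longrightarrow> continuous_on {0..} h"
  by (simp add: C_half_def)

lemma C_half_integrable: "h \<in> C_half \<rho> \<Longrightarrow> integrable lebh (\<lambda>t. exp (- \<rho> * t) * (norm (h t))\<^sup>2)"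
  by (simp add: C_half_def integrable_restrict_space set_integrable_def)

context filtered_prob begin

lemma L2disc_deterministic:
  assumes h: "h \<in> C_half \<rho>"
  shows "L2disc M \<rho> (\<lambda>t w. h t)"
proof -
  have "(\<integral>\<^sup>+w. (\<integral>\<^sup>+t. ennreal (exp (- \<rho> * t) * (norm (h t))\<^sup>2) \<partial>lebh) \<partial>M)
    = (\<integral>\<^sup>+w. ennreal (\<integral>t. exp (- \<rho> * t) * (norm (h t))\<^sup>2 \<partial>lebh) \<partial>M)"
    using C_half_integrable[OF h] by (intro nn_integral_cong nn_integral_eq_integral) auto
  also have "\<dots> < \<infinity>" by (simp add: emeasure_space_1)
  finally show ?thesis using jmeas_det[OF continuous_on_measurable_lebh[OF C_half_continuous[OF h]]] by (simp add: L2disc_iff_nn)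
qed

text \<open>The exceptional sets at dyadic times are countably many; continuity of both paths does
  the rest.\<close>

lemma AE_all_times:
  fixes g h :: "real \<Rightarrow> 'w \<Rightarrow> real^'n"
  assumes "\<And>t. 0 \<le> t \<Longrightarrow> AE w in M. g t w = h t w"
    and "AE w in M. continuous_on {0..} (\<lambda>t. g t w)" "AE w in M. continuous_on {0..} (\<lambda>t. h t w)"
  shows "AE w in M. \<forall>t\<ge>0. g t w = h t w"
proof -
  have "AE w in M. \<forall>k. \<forall>i. 0 \<le> real_of_int i / 2 ^ k \<longrightarrow> g (real_of_int i / 2 ^ k) w = h (real_of_int i / 2 ^ k) w"
    unfolding AE_all_countable by (intro allI AE_impI assms(1))
  with assms(2,3) show ?thesis
  proof eventually_elim
    case (elim w)
    show ?case
    proof (intro allI impI)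
      fix t :: real assume t: "0 \<le> t"
      have "(\<lambda>k. g (dyadic k t) w) \<longlonglongrightarrow> g t w" "(\<lambda>k. h (dyadic k t) w) \<longlonglongrightarrow> h t w"
        by (rule continuous_on_tendsto_compose[OF elim(1) dyadic_tendsto] continuous_on_tendsto_compose[OF elim(2) dyadic_tendsto],
            use t dyadic_bounds(3)[OF t] in auto)+
      moreover have "g (dyadic k t) w = h (dyadic k t) w" for k
        using elim(3) dyadic_bounds(3)[OF t, of k] unfolding dyadic_def by blast
      ultimately show "g t w = h t w" by (simp add: LIMSEQ_unique)
    qed
  qed
qed

end

section \<open>Averages over the agents\<close>

lemma average_add: "average N (\<lambda>i t w. X i t w + Y i t w) t w = average N X t w + average N Y t w"
  by (simp add: average_def sum.distrib scaleR_add_right)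

lemma average_diff: "average N (\<lambda>i t w. X i t w - Y i t w) t w = average N X t w - average N Y t w"
  by (simp add: average_def sum_subtractf scaleR_diff_right)

lemma average_matrix:
  fixes A :: "real^'n^'m"
  shows "average N (\<lambda>i t w. A *v X i t w) t w = A *v average N X t w"
  by (simp add: average_def matrix_vector_mult_scaleR linear_sum[OF matrix_vector_mul_linear])

lemma average_const: "N \<ge> 1 \<Longrightarrow> average N (\<lambda>i t w. c t w) t w = c t w"
  by (simp add: average_def sum_constant_scaleR del: sum_constant)

lemma average_prim:
  assumes "\<And>i. i \<in> {1..N} \<Longrightarrow> integrable (leb t) (\<lambda>r. X i r w)"
  shows "average N (\<lambda>i t w. prim (\<lambda>r. X i r w) t) t w = prim (\<lambda>r. average N X r w) t"
    "integrable (leb t) (\<lambda>r. average N X r w)"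
  unfolding average_def prim_def using assms by (simp, intro integrable_scaleR_right Bochner_Integration.integrable_sum)

lemma average_drift:
  assumes "N \<ge> 1"
  shows "average N (drift A B G f N x u) t w = (A + G) *v average N x t w + B *v average N u t w + f t"
proof -
  have "average N (drift A B G f N x u) t w = average N (\<lambda>i t w. A *v x i t w + B *v u i t w + G *v average N x t w + f t) t w"
    by (simp add: drift_def[abs_def])
  also have "\<dots> = A *v average N x t w + B *v average N u t w + G *v average N x t w + f t"
    using assms by (simp only: average_add average_matrix average_const)
  finally show ?thesis by (simp add: matrix_vector_mult_add_rdistrib algebra_simps)
qed

text \<open>The coupling through G and the forcing f are common to all agents and cancel, so
  deviations obey a single-agent equation.\<close>

lemma drift_deviation:
  assumes "N \<ge> 1"
  shows "drift A B G f N x u i t w - average N (drift A B G f N x u) t w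
    = A *v (x i t w - average N x t w) + B *v (u i t w - average N u t w)"
  unfolding average_drift[OF assms] drift_def
  by (simp add: matrix_vector_mult_add_rdistrib matrix_vector_mult_diff_distrib algebra_simps)

text \<open>The game for one fixed N. C stands for the square root of Q, and bounds derived here
  must be expressed through data that do not vary with N.\<close>

locale social_game = filtered_prob M F for M :: "'w measure" and F +
  fixes N :: nat and W :: "nat \<Rightarrow> real \<Rightarrow> 'w \<Rightarrow> real" and x0 :: "nat \<Rightarrow> 'w \<Rightarrow> real^'n"
    and A G \<Gamma> Q P \<Pi>\<^sub>m C :: "real^'n^'n" and B :: "real^'r^'n" and R :: "real^'r^'r"
    and f \<sigma> \<eta> s xbar :: "real \<Rightarrow> real^'n" and xbar0 :: "real^'n" and \<rho> C0 :: real
  assumes N: "N \<ge> 1" and \<rho>: "\<rho> > 0" and R: "posdef R" and symQ: "transpose Q = Q"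
    and QC: "\<And>x. x \<bullet> (Q *v x) = (norm (C *v x))\<^sup>2"
    and ricP: "riccati_solution \<rho> A B Q R P" and ric\<Pi>: "riccati_solution \<rho> (A + G) B (Q - Xi \<Gamma> Q) R \<Pi>\<^sub>m"
    and Ch: "f \<in> C_half \<rho>" "\<sigma> \<in> C_half \<rho>" "\<eta> \<in> C_half \<rho>" "s \<in> C_half \<rho>" "xbar \<in> C_half \<rho>"
    and seq: "solves_s_equation \<rho> A B G \<Gamma> Q R f \<eta> \<Pi>\<^sub>m s" and xeq: "solves_xbar_equation A B G R f \<Pi>\<^sub>m s xbar0 xbar"
    and W: "\<And>i. i \<in> {1..N} \<Longrightarrow> brownian_motion M F (W i)"
    and Wind: "indep_vars (\<lambda>_. PiM {0..} (\<lambda>_. borel)) (\<lambda>i w. \<lambda>t\<in>{0..}. W i t w) {1..N}"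
    and x0F: "\<And>i. i \<in> {1..N} \<Longrightarrow> x0 i \<in> borel_measurable (F 0)"
    and x0ind: "indep_vars (\<lambda>_. borel) x0 {1..N}"
    and x0E: "\<And>i. i \<in> {1..N} \<Longrightarrow> expectation (x0 i) = xbar0"
    and x0sq: "\<And>i. i \<in> {1..N} \<Longrightarrow> sq_integrable M (x0 i)"
    and x0C: "\<And>i. i \<in> {1..N} \<Longrightarrow> expectation (\<lambda>w. (norm (x0 i w))\<^sup>2) \<le> C0"
begin

section \<open>Closed-loop matrix, costates and adjoint identities\<close>

definition Abar where "Abar = A - B ** matrix_inv R ** transpose B ** P"

definition costate where "costate t = \<Pi>\<^sub>m *v xbar t + s t"

lemma symP: "transpose P = P" using ricP by (simp add: riccati_solution_def)

lemma sym\<Pi>: "transpose \<Pi>\<^sub>m = \<Pi>\<^sub>m" using ric\<Pi> by (simp add: riccati_solution_def)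

lemma \<rho>0: "0 \<le> \<rho>" using \<rho> by simp

text \<open>The Riccati equation in polarized form, since a closed-loop quantity is paired with a
  difference of states.\<close>

lemma riccati_bilinear:
  fixes A' Q' X :: "real^'n^'n"
  assumes "riccati_solution \<rho> A' B Q' R X"
  shows "(X *v y) \<bullet> (A' *v d) + (A' *v y) \<bullet> (X *v d)
    = (X *v y) \<bullet> (B *v (matrix_inv R *v (transpose B *v (X *v d)))) - y \<bullet> (Q' *v d) + \<rho> * ((X *v y) \<bullet> d)"
proof -
  have sym: "transpose X = X" and eq: "\<rho> *\<^sub>R X = transpose A' ** X + X ** A' - X ** B ** matrix_inv R ** transpose B ** X + Q'"
    using assms by (auto simp: riccati_solution_def)
  have "y \<bullet> ((\<rho> *\<^sub>R X) *v d) = y \<bullet> (transpose A' *v (X *v d)) + y \<bullet> (X *v (A' *v d))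
    - y \<bullet> (X *v (B *v (matrix_inv R *v (transpose B *v (X *v d))))) + y \<bullet> (Q' *v d)"
    unfolding eq by (simp add: matrix_vector_mult_diff_rdistrib matrix_vector_mult_add_rdistrib inner_diff_right
          inner_add_right matrix_vector_mul_assoc[symmetric])
  moreover have "y \<bullet> ((\<rho> *\<^sub>R X) *v d) = \<rho> * ((X *v y) \<bullet> d)"
    by (simp add: scaleR_matrix_vector_assoc[symmetric] inner_symmetric_matrix[OF sym])
  moreover have "y \<bullet> (transpose A' *v (X *v d)) = (A' *v y) \<bullet> (X *v d)" by (rule inner_matrix_vector_left[symmetric])
  moreover have "y \<bullet> (X *v z) = (X *v y) \<bullet> z" for z by (rule inner_symmetric_matrix[OF sym, symmetric])
  ultimately show ?thesis by simp
qed

text \<open>The left-hand side is the integrand of \<open>infinite_horizon_orthogonality\<close> for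
  a deviation y and P d. The Riccati equation cancels A and the discount and leaves the first-order
  change of the cost of a deviation.\<close>

lemma deviation_adjoint:
  "(Abar *v y) \<bullet> (P *v d) + y \<bullet> (P *v (A *v d + B *v v)) - \<rho> * (y \<bullet> (P *v d)) = (P *v y) \<bullet> (B *v v) - y \<bullet> (Q *v d)"
proof -
  let ?S = "\<lambda>z. B *v (matrix_inv R *v (transpose B *v z))"
  have Ab: "Abar *v y = A *v y - ?S (P *v y)"
    by (simp add: Abar_def matrix_vector_mult_diff_rdistrib matrix_vector_mul_assoc[symmetric])
  have S: "?S a \<bullet> b = a \<bullet> ?S b" for a b
    by (simp add: inner_matrix_vector_left posdef_inv_symmetric[OF R] transpose_transpose)
  have PP: "y \<bullet> (P *v z) = (P *v y) \<bullet> z" for z by (rule inner_symmetric_matrix[OF symP, symmetric])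
  show ?thesis using riccati_bilinear[OF ricP, of y d]
    unfolding Ab PP by (simp add: inner_diff_left S inner_add_right)
qed

definition xbar' where "xbar' t = (A + G) *v xbar t - (B ** matrix_inv R ** transpose B) *v (\<Pi>\<^sub>m *v xbar t + s t) + f t"

definition s' where "s' t = \<rho> *\<^sub>R s t - transpose (A + G - B ** matrix_inv R ** transpose B ** \<Pi>\<^sub>m) *v s t
          - \<Pi>\<^sub>m *v f t + eta_bar \<Gamma> Q \<eta> t"

definition costate' where "costate' t = \<Pi>\<^sub>m *v xbar' t + s' t"

lemma Xi_form: "x \<bullet> ((Q - Xi \<Gamma> Q) *v d) = (x - \<Gamma> *v x) \<bullet> (Q *v (d - \<Gamma> *v d))"
  by (simp add: Xi_def matrix_vector_mult_diff_rdistrib matrix_vector_mult_add_rdistrib inner_diff_right inner_add_right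
     matrix_vector_mul_assoc[symmetric] matrix_vector_mult_diff_distrib inner_diff_left inner_matrix_vector_left)

lemma eta_bar_form: "eta_bar \<Gamma> Q \<eta> t \<bullet> d = \<eta> t \<bullet> (Q *v (d - \<Gamma> *v d))"
  by (simp add: eta_bar_def inner_diff_left inner_matrix_vector_left symQ matrix_transpose_mul transpose_transpose
     matrix_vector_mul_assoc[symmetric] matrix_vector_mult_diff_distrib inner_diff_right)

text \<open>The counterpart for the mean. The equation of s is made so that f cancels and \<eta>
  completes the tracking error of \<open>xbar\<close>.\<close>

lemma mean_adjoint:
  "costate' t \<bullet> d + costate t \<bullet> ((A + G) *v d + B *v w) - \<rho> * (costate t \<bullet> d)
    = costate t \<bullet> (B *v w) - (xbar t - \<Gamma> *v xbar t - \<eta> t) \<bullet> (Q *v (d - \<Gamma> *v d))"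
proof -
  let ?S = "\<lambda>z. B *v (matrix_inv R *v (transpose B *v z))"
  have S: "?S a \<bullet> b = a \<bullet> ?S b" for a b
    by (simp add: inner_matrix_vector_left posdef_inv_symmetric[OF R] transpose_transpose)
  have PP: "(\<Pi>\<^sub>m *v z) \<bullet> d = z \<bullet> (\<Pi>\<^sub>m *v d)" for z by (rule inner_symmetric_matrix[OF sym\<Pi>])
  have xb: "xbar' t = (A + G) *v xbar t - ?S (costate t) + f t"
    by (simp add: xbar'_def costate_def matrix_vector_mul_assoc[symmetric])
  have "(transpose (A + G - B ** matrix_inv R ** transpose B ** \<Pi>\<^sub>m) *v s t) \<bullet> d = s t \<bullet> ((A + G) *v d) - s t \<bullet> ?S (\<Pi>\<^sub>m *v d)"
    using inner_matrix_vector_transpose[of "s t" "A + G - B ** matrix_inv R ** transpose B ** \<Pi>\<^sub>m" d]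
    by (simp add: matrix_vector_mult_diff_rdistrib inner_diff_right matrix_vector_mul_assoc[symmetric])
  hence sd: "s' t \<bullet> d = \<rho> * (s t \<bullet> d) - s t \<bullet> ((A + G) *v d) + s t \<bullet> ?S (\<Pi>\<^sub>m *v d) - (\<Pi>\<^sub>m *v f t) \<bullet> d + \<eta> t \<bullet> (Q *v (d - \<Gamma> *v d))"
    by (simp add: s'_def inner_diff_left inner_add_left eta_bar_form)
  have xd: "(\<Pi>\<^sub>m *v xbar' t) \<bullet> d = ((A + G) *v xbar t) \<bullet> (\<Pi>\<^sub>m *v d) - (\<Pi>\<^sub>m *v xbar t) \<bullet> ?S (\<Pi>\<^sub>m *v d) - s t \<bullet> ?S (\<Pi>\<^sub>m *v d) + (\<Pi>\<^sub>m *v f t) \<bullet> d"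
  proof -
    have "(\<Pi>\<^sub>m *v xbar' t) \<bullet> d = xbar' t \<bullet> (\<Pi>\<^sub>m *v d)" by (rule PP)
    thus ?thesis unfolding xb inner_add_left inner_diff_left S by (simp add: costate_def inner_add_left PP[of "f t"])
  qed
  show ?thesis using riccati_bilinear[OF ric\<Pi>, of "xbar t" d] Xi_form[of "xbar t" d]
    unfolding costate'_def costate_def inner_add_left inner_add_right sd xd by (simp add: inner_diff_left algebra_simps)
qed

lemma xbar_prim: "0 \<le> t \<Longrightarrow> xbar t = xbar0 + prim xbar' t"
  and xbar'_continuous: "continuous_on {0..} xbar'"
  and costate_prim: "0 \<le> t \<Longrightarrow> costate t = costate 0 + prim costate' t"
  and costate'_continuous: "continuous_on {0..} costate'"
proof -
  have mc: "continuous_on {0..} (\<lambda>t. Y *v h t)" if "continuous_on {0..} h" for Y :: "real^'n^'n" and h :: "real \<Rightarrow> real^'n"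
    by (rule continuous_on_compose2[OF matrix_vector_mult_linear_continuous_on[of UNIV Y] that]) auto
  note c = C_half_continuous[OF Ch(1)] C_half_continuous[OF Ch(3)] C_half_continuous[OF Ch(4)] C_half_continuous[OF Ch(5)]
  show cx: "continuous_on {0..} xbar'" unfolding xbar'_def by (intro continuous_intros mc c)
  have cs: "continuous_on {0..} s'" unfolding s'_def eta_bar_def by (intro continuous_intros mc c)
  show cc: "continuous_on {0..} costate'" unfolding costate'_def by (intro continuous_intros mc cx cs)
  have dx: "(xbar has_vector_derivative xbar' t) (at t within {0..})" if "0 \<le> t" for t
    using xeq that by (simp add: solves_xbar_equation_def xbar'_def)
  have ds: "(s has_vector_derivative s' t) (at t within {0..})" if "0 \<le> t" for t
    using seq that by (simp add: solves_s_equation_def s'_def)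
  have dc: "(costate has_vector_derivative costate' t) (at t within {0..})" if "0 \<le> t" for t
    unfolding costate_def[abs_def] costate'_def
    by (intro has_vector_derivative_add ds that bounded_linear.has_vector_derivative[OF matrix_vector_mul_bounded_linear dx])
  have "xbar 0 = xbar0" using xeq by (simp add: solves_xbar_equation_def)
  with prim_continuous_derivative[OF dx cx] show "0 \<le> t \<Longrightarrow> xbar t = xbar0 + prim xbar' t" by simp
  show "0 \<le> t \<Longrightarrow> costate t = costate 0 + prim costate' t" by (rule prim_continuous_derivative[OF dc cc])
qed

lemma L2disc_det_intros:
  "L2disc M \<rho> (\<lambda>t w. f t)" "L2disc M \<rho> (\<lambda>t w. \<eta> t)" "L2disc M \<rho> (\<lambda>t w. s t)" "L2disc M \<rho> (\<lambda>t w. xbar t)"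
  "L2disc M \<rho> (\<lambda>t w. costate t)" "L2disc M \<rho> (\<lambda>t w. costate' t)"
proof -
  show d: "L2disc M \<rho> (\<lambda>t w. f t)" "L2disc M \<rho> (\<lambda>t w. \<eta> t)" "L2disc M \<rho> (\<lambda>t w. s t)" "L2disc M \<rho> (\<lambda>t w. xbar t)"
    using Ch L2disc_deterministic by auto
  show "L2disc M \<rho> (\<lambda>t w. costate t)" "L2disc M \<rho> (\<lambda>t w. costate' t)"
    unfolding costate_def costate'_def xbar'_def s'_def eta_bar_def
    by (intro L2disc_add L2disc_diff L2disc_matrix L2disc_scaleR d)+
qed

section \<open>Moments of the initial states and energy of the noise\<close>

lemma x0_measurable: "i \<in> {1..N} \<Longrightarrow> x0 i \<in> borel_measurable M"
  using x0sq by (simp add: sq_integrable_def)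

lemma initial_cross_moment:
  fixes Y :: "real^'n^'n"
  assumes ij: "i \<in> {1..N}" "j \<in> {1..N}" "i \<noteq> j"
  shows "expectation (\<lambda>w. (x0 i w - xbar0) \<bullet> (Y *v (x0 j w - xbar0))) = 0"
proof -
  have s: "sq_integrable M (\<lambda>w. x0 k w - xbar0)" if "k \<in> {1..N}" for k
    using that by (intro sq_integrable_diff x0sq sq_integrable_const[OF finite_measure_axioms])
  have i1: "integrable M (\<lambda>w. b \<bullet> Z w)" if "sq_integrable M Z" for Z :: "'w \<Rightarrow> real^'n" and b
    by (rule sq_integrable_inner[OF sq_integrable_const[OF finite_measure_axioms] that])
  have nth: "Z $ k = axis k 1 \<bullet> Z" for Z :: "real^'n" and k by (simp add: inner_axis')
  have z: "expectation (\<lambda>w. (x0 i w - xbar0) $ k * (Y *v (x0 j w - xbar0)) $ k) = 0" for k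
  proof -
    \<comment> \<open>One family of functions indexed like \<open>x0\<close>, so that independence
      of the two states passes to the two coordinates.\<close>
    define g where "g m x = (if m = i then (x - xbar0) $ k else (Y *v (x - xbar0)) $ k)" for m :: nat and x :: "real^'n"
    have gm: "g m \<in> borel_measurable borel" for m
    proof -
      have "(\<lambda>x. (Y *v (x - xbar0)) $ k) \<in> borel_measurable borel"
        by (intro borel_measurable_continuous_onI continuous_intros continuous_on_compose2[OF matrix_vector_mult_linear_continuous_on[of UNIV Y]]) auto
      thus ?thesis unfolding g_def by (cases "m = i") auto
    qed
    have "indep_vars (\<lambda>_. borel) x0 {i, j}" by (rule indep_vars_subset[OF x0ind]) (use ij in auto)
    hence ind: "indep_vars (\<lambda>_. borel) (\<lambda>m w. g m (x0 m w)) {i, j}" by (rule indep_vars_compose2) (rule gm)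
    have gi: "integrable M (\<lambda>w. g m (x0 m w))" if "m \<in> {i, j}" for m
      using i1[OF s[OF ij(1)], of "axis k 1"] i1[OF sq_integrable_matrix[OF s[OF ij(2)], of Y], of "axis k 1"] that ij
      by (auto simp: g_def nth)
    have "expectation (\<lambda>w. \<Prod>m\<in>{i, j}. g m (x0 m w)) = (\<Prod>m\<in>{i, j}. expectation (\<lambda>w. g m (x0 m w)))"
      by (rule indep_vars_lebesgue_integral[OF _ ind gi]) auto
    moreover have "expectation (\<lambda>w. g i (x0 i w)) = 0"
    proof -
      have si: "integrable M (x0 i)"
      proof (rule Bochner_Integration.integrable_bound)
        show "integrable M (\<lambda>w. (norm (x0 i w))\<^sup>2 + 1)" using x0sq[OF ij(1)] by (simp add: sq_integrable_def)
        have "norm (x0 i w) \<le> (norm (x0 i w))\<^sup>2 + 1" for w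
          using sum_squares_bound[of "norm (x0 i w)" 1] norm_ge_zero[of "x0 i w"] by (simp, linarith)
        thus "AE w in M. norm (x0 i w) \<le> norm ((norm (x0 i w))\<^sup>2 + 1)" by simp
      qed (rule x0_measurable[OF ij(1)])
      have "expectation (\<lambda>w. axis k 1 \<bullet> x0 i w) = axis k 1 \<bullet> xbar0"
        using si x0E[OF ij(1)] by simp
      moreover have "integrable M (\<lambda>w. axis k (1::real) \<bullet> x0 i w)" by (rule i1[OF x0sq[OF ij(1)]])
      ultimately show ?thesis by (simp add: g_def nth inner_diff_right prob_space)
    qed
    ultimately show ?thesis using ij by (simp add: g_def)
  qed
  have "expectation (\<lambda>w. (x0 i w - xbar0) \<bullet> (Y *v (x0 j w - xbar0)))
    = expectation (\<lambda>w. \<Sum>k\<in>UNIV. (x0 i w - xbar0) $ k * (Y *v (x0 j w - xbar0)) $ k)" by (simp add: inner_vec_def)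
  also have "\<dots> = (\<Sum>k\<in>UNIV. expectation (\<lambda>w. (x0 i w - xbar0) $ k * (Y *v (x0 j w - xbar0)) $ k))"
  proof (rule Bochner_Integration.integral_sum)
    fix k
    have b: "\<bar>a $ k * b $ k\<bar> \<le> (norm a)\<^sup>2 + (norm b)\<^sup>2" for a b :: "real^'n"
    proof -
      have "\<bar>a $ k * b $ k\<bar> \<le> norm a * norm b" unfolding abs_mult by (intro mult_mono component_le_norm_cart) auto
      moreover have "2 * (norm a * norm b) \<le> (norm a)\<^sup>2 + (norm b)\<^sup>2" using sum_squares_bound[of "norm a" "norm b"] by (simp add: mult.assoc)
      moreover have "0 \<le> norm a * norm b" by simp
      ultimately show ?thesis by linarith
    qed
    show "integrable M (\<lambda>w. (x0 i w - xbar0) $ k * (Y *v (x0 j w - xbar0)) $ k)"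
    proof (rule Bochner_Integration.integrable_bound)
      show "integrable M (\<lambda>w. (norm (x0 i w - xbar0))\<^sup>2 + (norm (Y *v (x0 j w - xbar0)))\<^sup>2)"
        using sq_integrable_norm2[OF s[OF ij(1)]] sq_integrable_norm2[OF sq_integrable_matrix[OF s[OF ij(2)], of Y]] by simp
      show "(\<lambda>w. (x0 i w - xbar0) $ k * (Y *v (x0 j w - xbar0)) $ k) \<in> borel_measurable M"
        using sq_integrable_measurable[OF s[OF ij(1)]] sq_integrable_measurable[OF sq_integrable_matrix[OF s[OF ij(2)], of Y]]
        unfolding nth by (intro borel_measurable_times borel_measurable_inner borel_measurable_const)
      show "AE w in M. norm ((x0 i w - xbar0) $ k * (Y *v (x0 j w - xbar0)) $ k)
        \<le> norm ((norm (x0 i w - xbar0))\<^sup>2 + (norm (Y *v (x0 j w - xbar0)))\<^sup>2)"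
        unfolding real_norm_def by (rule AE_I2, rule order_trans[OF b abs_ge_self])
    qed
  qed
  finally show ?thesis by (simp only: z sum.neutral_const)
qed

text \<open>The cross terms vanish, so N diagonal terms remain under the factor 1/N^2.\<close>

lemma initial_average_moment:
  fixes Y :: "real^'n^'n"
  assumes c: "0 \<le> c" "\<And>x. x \<bullet> (Y *v x) \<le> c * (norm x)\<^sup>2"
  shows "expectation (\<lambda>w. (average N (\<lambda>i t. x0 i) t w - xbar0) \<bullet> (Y *v (average N (\<lambda>i t. x0 i) t w - xbar0)))
    \<le> c * (2 * C0 + 2 * (norm xbar0)\<^sup>2) / real N"
proof -
  let ?d = "\<lambda>i w. x0 i w - xbar0"
  have s: "sq_integrable M (?d k)" if "k \<in> {1..N}" for k
    using that by (intro sq_integrable_diff x0sq sq_integrable_const[OF finite_measure_axioms])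
  have av: "average N (\<lambda>i t. x0 i) t w - xbar0 = (1 / real N) *\<^sub>R (\<Sum>i\<in>{1..N}. ?d i w)" for w
    using N by (simp add: average_def sum_subtractf scaleR_diff_right sum_constant_scaleR del: sum_constant)
  have i: "integrable M (\<lambda>w. ?d i w \<bullet> (Y *v ?d j w))" if "i \<in> {1..N}" "j \<in> {1..N}" for i j
    by (rule sq_integrable_inner[OF s[OF that(1)] sq_integrable_matrix[OF s[OF that(2)], of Y]])
  have "expectation (\<lambda>w. (average N (\<lambda>i t. x0 i) t w - xbar0) \<bullet> (Y *v (average N (\<lambda>i t. x0 i) t w - xbar0)))
    = expectation (\<lambda>w. (1 / real N)\<^sup>2 * (\<Sum>i\<in>{1..N}. \<Sum>j\<in>{1..N}. ?d j w \<bullet> (Y *v ?d i w)))"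
    unfolding av by (intro Bochner_Integration.integral_cong refl)
      (simp add: matrix_vector_mult_scaleR linear_sum[OF matrix_vector_mul_linear] inner_sum_left inner_sum_right power2_eq_square mult.assoc
        sum_divide_distrib[symmetric])
  also have "\<dots> = (1 / real N)\<^sup>2 * (\<Sum>i\<in>{1..N}. \<Sum>j\<in>{1..N}. expectation (\<lambda>w. ?d j w \<bullet> (Y *v ?d i w)))"
  proof -
    have "expectation (\<lambda>w. \<Sum>i\<in>{1..N}. \<Sum>j\<in>{1..N}. ?d j w \<bullet> (Y *v ?d i w))
      = (\<Sum>i\<in>{1..N}. expectation (\<lambda>w. \<Sum>j\<in>{1..N}. ?d j w \<bullet> (Y *v ?d i w)))"
      by (rule Bochner_Integration.integral_sum, rule Bochner_Integration.integrable_sum, rule i)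
    also have "\<dots> = (\<Sum>i\<in>{1..N}. \<Sum>j\<in>{1..N}. expectation (\<lambda>w. ?d j w \<bullet> (Y *v ?d i w)))"
      by (rule sum.cong[OF refl], rule Bochner_Integration.integral_sum, rule i)
    finally show ?thesis by simp
  qed
  also have "(\<Sum>i\<in>{1..N}. \<Sum>j\<in>{1..N}. expectation (\<lambda>w. ?d j w \<bullet> (Y *v ?d i w)))
    = (\<Sum>i\<in>{1..N}. \<Sum>j\<in>{1..N}. if j = i then expectation (\<lambda>w. ?d i w \<bullet> (Y *v ?d i w)) else 0)"
    by (intro sum.cong refl) (auto simp: initial_cross_moment)
  also have "\<dots> = (\<Sum>i\<in>{1..N}. expectation (\<lambda>w. ?d i w \<bullet> (Y *v ?d i w)))" by simp
  also have "(1 / real N)\<^sup>2 * \<dots> \<le> (1 / real N)\<^sup>2 * (\<Sum>i\<in>{1..N}. c * (2 * C0 + 2 * (norm xbar0)\<^sup>2))"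
  proof (intro mult_left_mono sum_mono)
    fix k assume k: "k \<in> {1..N}"
    have "expectation (\<lambda>w. ?d k w \<bullet> (Y *v ?d k w)) \<le> expectation (\<lambda>w. c * (2 * (norm (x0 k w))\<^sup>2 + 2 * (norm xbar0)\<^sup>2))"
    proof (rule integral_mono[OF i[OF k k]])
      show "integrable M (\<lambda>w. c * (2 * (norm (x0 k w))\<^sup>2 + 2 * (norm xbar0)\<^sup>2))" using x0sq[OF k] by (simp add: sq_integrable_def)
      show "?d k w \<bullet> (Y *v ?d k w) \<le> c * (2 * (norm (x0 k w))\<^sup>2 + 2 * (norm xbar0)\<^sup>2)" for w
        using c(2)[of "?d k w"] mult_left_mono[OF norm_add_squared_le[of "x0 k w" "- xbar0"] c(1)] by simp
    qed
    also have "\<dots> = c * (2 * expectation (\<lambda>w. (norm (x0 k w))\<^sup>2) + 2 * (norm xbar0)\<^sup>2)"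
      using x0sq[OF k] by (simp add: sq_integrable_def prob_space)
    also have "\<dots> \<le> c * (2 * C0 + 2 * (norm xbar0)\<^sup>2)" using x0C[OF k] c(1) by (intro mult_left_mono add_mono) auto
    finally show "expectation (\<lambda>w. ?d k w \<bullet> (Y *v ?d k w)) \<le> c * (2 * C0 + 2 * (norm xbar0)\<^sup>2)" .
  qed simp
  also have "\<dots> = c * (2 * C0 + 2 * (norm xbar0)\<^sup>2) / real N" using N by (simp add: power2_eq_square)
  finally show ?thesis .
qed

text \<open>Determined by \<sigma>, \<rho> and Y, hence the same for every N.\<close>

definition noise_energy where "noise_energy Y = (\<integral>t. exp (- \<rho> * t) * (\<sigma> t \<bullet> (Y *v \<sigma> t)) \<partial>lebh)"

lemma noise_energy:
  assumes "psd Y"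
  shows "0 \<le> T \<Longrightarrow> integrable (leb T) (\<lambda>r. \<sigma> r \<bullet> (Y *v \<sigma> r))"
    "(\<integral>t. exp (- \<rho> * t) * (\<sigma> t \<bullet> (Y *v \<sigma> t)) \<partial>leb T) \<le> noise_energy Y" "0 \<le> noise_energy Y"
proof -
  have c: "continuous_on {0..} (\<lambda>t. \<sigma> t \<bullet> (Y *v \<sigma> t))"
    by (intro continuous_intros C_half_continuous[OF Ch(2)] continuous_on_compose2[OF matrix_vector_mult_linear_continuous_on[of UNIV Y]]) auto
  show "0 \<le> T \<Longrightarrow> integrable (leb T) (\<lambda>r. \<sigma> r \<bullet> (Y *v \<sigma> r))" by (rule integrable_leb_continuous[OF c])
  obtain b where b: "b > 0" "\<And>x. x \<bullet> (Y *v x) \<le> b * (norm x)\<^sup>2" using quadratic_form_upper_bound by blast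
  have nn: "0 \<le> x \<bullet> (Y *v x)" for x using assms by (rule psd_nonneg)
  have m: "(\<lambda>t. exp (- \<rho> * t) * (\<sigma> t \<bullet> (Y *v \<sigma> t))) \<in> borel_measurable lebh"
    by (intro continuous_on_measurable_lebh continuous_intros c)
  have i: "integrable lebh (\<lambda>t. exp (- \<rho> * t) * (\<sigma> t \<bullet> (Y *v \<sigma> t)))"
  proof (rule Bochner_Integration.integrable_bound[OF _ m])
    show "integrable lebh (\<lambda>t. b * (exp (- \<rho> * t) * (norm (\<sigma> t))\<^sup>2))" using C_half_integrable[OF Ch(2)] by simp
    have "exp (- \<rho> * t) * (\<sigma> t \<bullet> (Y *v \<sigma> t)) \<le> b * (exp (- \<rho> * t) * (norm (\<sigma> t))\<^sup>2)" for t
      using mult_left_mono[OF b(2)[of "\<sigma> t"], of "exp (- \<rho> * t)"] by (simp add: mult_ac)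
    thus "AE t in lebh. norm (exp (- \<rho> * t) * (\<sigma> t \<bullet> (Y *v \<sigma> t))) \<le> norm (b * (exp (- \<rho> * t) * (norm (\<sigma> t))\<^sup>2))"
      using nn b(1) by (intro AE_I2) (simp add: abs_mult)
  qed
  show "(\<integral>t. exp (- \<rho> * t) * (\<sigma> t \<bullet> (Y *v \<sigma> t)) \<partial>leb T) \<le> noise_energy Y"
    unfolding integral_leb_lebh(1) noise_energy_def
  proof (rule integral_mono[OF _ i])
    show "integrable lebh (\<lambda>t. indicator {0..T} t * (exp (- \<rho> * t) * (\<sigma> t \<bullet> (Y *v \<sigma> t))))"
      by (rule Bochner_Integration.integrable_bound[OF i borel_measurable_times[OF indicator_measurable_lebh m]]) (simp add: indicator_def)
  qed (use nn in \<open>auto simp: indicator_def\<close>)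
  show "0 \<le> noise_energy Y" unfolding noise_energy_def using nn by simp
qed

section \<open>The cost as an integral over time and sample space\<close>

definition tracking where "tracking x i t w = x i t w - \<Gamma> *v average N x t w - \<eta> t"

definition cost_density where
  "cost_density u x i p = exp (- \<rho> * fst p) * (wnorm2 Q (tracking x i (fst p) (snd p)) + wnorm2 R (u i (fst p) (snd p)))"

lemma wnorm2_Q: "wnorm2 Q z = (norm (C *v z))\<^sup>2"
  by (simp add: wnorm2_def QC)

lemma wnorm2_nonneg: "0 \<le> wnorm2 Q z" "0 \<le> wnorm2 R v"
  using posdef_wnorm2_nonneg[OF R] by (auto simp: wnorm2_Q)

lemma jmeas_average: "(\<And>i. i \<in> {1..N} \<Longrightarrow> jmeas M (x i)) \<Longrightarrow> jmeas M (average N x)"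
  unfolding average_def[abs_def] by (intro jmeas_scaleR jmeas_sum)

lemma jmeas_tracking:
  assumes "\<And>i. i \<in> {1..N} \<Longrightarrow> jmeas M (x i)" "i \<in> {1..N}"
  shows "jmeas M (tracking x i)"
  unfolding tracking_def[abs_def]
  by (intro jmeas_diff jmeas_matrix jmeas_average jmeas_det continuous_on_measurable_lebh C_half_continuous[OF Ch(3)] assms)

lemma agent_cost_cong:
  assumes eq: "AE w in M. \<forall>i\<in>{1..N}. \<forall>t\<ge>0. x' i t w = x i t w" "AE w in M. \<forall>i\<in>{1..N}. \<forall>t\<ge>0. u' i t w = u i t w"
    and i: "i \<in> {1..N}"
  shows "agent_cost \<rho> \<Gamma> Q R \<eta> N M u' x' i = agent_cost \<rho> \<Gamma> Q R \<eta> N M u x i"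
  unfolding agent_cost_def
proof (rule nn_integral_cong_AE)
  show "AE w in M. (\<integral>\<^sup>+t\<in>{0..}. ennreal (exp (- \<rho> * t) * (wnorm2 Q (x' i t w - \<Gamma> *v average N x' t w - \<eta> t) + wnorm2 R (u' i t w))) \<partial>lborel)
    = (\<integral>\<^sup>+t\<in>{0..}. ennreal (exp (- \<rho> * t) * (wnorm2 Q (x i t w - \<Gamma> *v average N x t w - \<eta> t) + wnorm2 R (u i t w))) \<partial>lborel)"
    using eq
  proof eventually_elim
    case (elim w)
    show ?case
    proof (rule nn_integral_cong)
      fix t :: real
      show "ennreal (exp (- \<rho> * t) * (wnorm2 Q (x' i t w - \<Gamma> *v average N x' t w - \<eta> t) + wnorm2 R (u' i t w))) * indicator {0..} t
        = ennreal (exp (- \<rho> * t) * (wnorm2 Q (x i t w - \<Gamma> *v average N x t w - \<eta> t) + wnorm2 R (u i t w))) * indicator {0..} t"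
      proof (cases "0 \<le> t")
        case True
        hence "average N x' t w = average N x t w" using elim by (simp add: average_def)
        thus ?thesis using elim i True by simp
      qed simp
    qed
  qed
qed

lemma measurable_cost_density:
  assumes x: "\<And>i. i \<in> {1..N} \<Longrightarrow> jmeas M (x i)" and u: "jmeas M (u i)" and i: "i \<in> {1..N}"
  shows "cost_density u x i \<in> borel_measurable (lebh \<Otimes>\<^sub>M M)"
proof -
  have w: "(\<lambda>p. wnorm2 S (Z (fst p) (snd p))) \<in> borel_measurable (lebh \<Otimes>\<^sub>M M)" if "jmeas M Z" for S :: "real^'k^'k" and Z
    unfolding wnorm2_def using that jmeas_matrix[OF that, of S] unfolding jmeas_def by (rule borel_measurable_inner)
  have "(\<lambda>t. exp (- \<rho> * t)) \<in> borel_measurable lebh" by (intro continuous_on_measurable_lebh continuous_intros)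
  from measurable_compose[OF measurable_fst this, of M] have "(\<lambda>p. exp (- \<rho> * fst p)) \<in> borel_measurable (lebh \<Otimes>\<^sub>M M)" .
  thus ?thesis unfolding cost_density_def[abs_def]
    by (intro borel_measurable_times borel_measurable_add w jmeas_tracking x u i)
qed

lemma agent_cost_nn_integral:
  assumes x: "\<And>i. i \<in> {1..N} \<Longrightarrow> jmeas M (x i)" and u: "jmeas M (u i)" and i: "i \<in> {1..N}"
  shows "agent_cost \<rho> \<Gamma> Q R \<eta> N M u x i = (\<integral>\<^sup>+p. ennreal (cost_density u x i p) \<partial>(lebh \<Otimes>\<^sub>M M))"
proof -
  interpret P: pair_sigma_finite lebh M by (rule pair_sigma_finite_lebh)
  have "(\<lambda>(t, w). ennreal (cost_density u x i (t, w))) \<in> borel_measurable (lebh \<Otimes>\<^sub>M M)"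
    using measurable_cost_density[where u = u and x = x and i = i, OF x u i] by (simp add: split_beta')
  from P.nn_integral_snd[OF this] have "(\<integral>\<^sup>+p. ennreal (cost_density u x i p) \<partial>(lebh \<Otimes>\<^sub>M M))
    = (\<integral>\<^sup>+w. (\<integral>\<^sup>+t. ennreal (cost_density u x i (t, w)) \<partial>lebh) \<partial>M)" by (simp add: split_beta')
  thus ?thesis by (simp add: agent_cost_def cost_density_def tracking_def nn_integral_restrict_space)
qed

lemma cost_density_nonneg: "0 \<le> cost_density u x i p"
  unfolding cost_density_def using wnorm2_nonneg by (intro mult_nonneg_nonneg add_nonneg_nonneg) auto

text \<open>This is all that a finite cost yields: control and output of the tracking error are
  square integrable with the discount. The state itself is recovered only later, for differences, by
  detectability.\<close>

lemma finite_agent_cost: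
  assumes x: "\<And>i. i \<in> {1..N} \<Longrightarrow> jmeas M (x i)" and u: "jmeas M (u i)" and i: "i \<in> {1..N}"
    and fin: "agent_cost \<rho> \<Gamma> Q R \<eta> N M u x i < \<infinity>"
  shows "integrable (lebh \<Otimes>\<^sub>M M) (cost_density u x i)"
    "agent_cost \<rho> \<Gamma> Q R \<eta> N M u x i = ennreal (\<integral>p. cost_density u x i p \<partial>(lebh \<Otimes>\<^sub>M M))"
    "L2disc M \<rho> (\<lambda>t w. C *v tracking x i t w)" "L2disc M \<rho> (u i)"
proof -
  let ?L = "lebh \<Otimes>\<^sub>M M"
  note m = measurable_cost_density[where u = u and x = x and i = i, OF x u i]
  have "norm (cost_density u x i p) = cost_density u x i p" for p by (simp only: real_norm_def abs_of_nonneg[OF cost_density_nonneg])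
  hence "(\<integral>\<^sup>+p. ennreal (norm (cost_density u x i p)) \<partial>?L) < \<infinity>"
    using fin agent_cost_nn_integral[where u = u and x = x and i = i, OF x u i] by (simp only:)
  thus I: "integrable ?L (cost_density u x i)" using m by (simp add: integrable_iff_bounded)
  show "agent_cost \<rho> \<Gamma> Q R \<eta> N M u x i = ennreal (\<integral>p. cost_density u x i p \<partial>?L)"
    by (rule trans[OF agent_cost_nn_integral nn_integral_eq_integral[OF I]]) ((rule x, assumption) | rule u i | (rule AE_I2, rule cost_density_nonneg))+
  \<comment> \<open>Both claims bound a multiple of |Z|^2 by the cost density: the multiple is 1 for
    the output and the lower bound of R for the control.\<close>
  have L: "L2disc M \<rho> Z" if j: "jmeas M Z" and le: "\<And>t w. c * (norm (Z t w))\<^sup>2 \<le> wnorm2 Q (tracking x i t w) + wnorm2 R (u i t w)" and c: "c > 0"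
    for Z :: "real \<Rightarrow> 'w \<Rightarrow> real^'k" and c
  proof -
    have dm: "(\<lambda>p. disc \<rho> Z (fst p) (snd p)) \<in> borel_measurable ?L" using jmeas_disc[OF j] by (simp only: jmeas_def)
    have "integrable ?L (\<lambda>p. (norm (disc \<rho> Z (fst p) (snd p)))\<^sup>2)"
    proof (rule Bochner_Integration.integrable_bound)
      show "integrable ?L (\<lambda>p. (1 / c) * cost_density u x i p)" using I by simp
      show "(\<lambda>p. (norm (disc \<rho> Z (fst p) (snd p)))\<^sup>2) \<in> borel_measurable ?L" using dm by measurable
      have "exp (- \<rho> * t) * (norm (Z t w))\<^sup>2 \<le> (1 / c) * cost_density u x i (t, w)" for t w
        using mult_left_mono[OF le[of t w], of "exp (- \<rho> * t)"] c by (simp add: cost_density_def field_simps)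
      thus "AE p in ?L. norm ((norm (disc \<rho> Z (fst p) (snd p)))\<^sup>2) \<le> norm ((1 / c) * cost_density u x i p)"
        unfolding disc_norm real_norm_def by (intro AE_I2 order_trans[OF _ abs_ge_self]) (metis abs_of_nonneg exp_ge_zero mult_nonneg_nonneg prod.collapse zero_le_power2)
    qed
    thus ?thesis using j dm by (simp add: L2disc_def sq_integrable_def)
  qed
  show "L2disc M \<rho> (\<lambda>t w. C *v tracking x i t w)"
    by (rule L[OF jmeas_matrix[OF jmeas_tracking[OF x i]] _ zero_less_one]) (use wnorm2_nonneg(2) in \<open>auto simp: wnorm2_Q\<close>)
  obtain r where r: "r > 0" "\<And>x. r * (norm x)\<^sup>2 \<le> x \<bullet> (R *v x)"
    using quadratic_form_lower_bound[of R] R unfolding posdef_def by metis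
  have "r * (norm (u i t w))\<^sup>2 \<le> wnorm2 Q (tracking x i t w) + wnorm2 R (u i t w)" for t w
    using r(2)[of "u i t w"] wnorm2_nonneg(1) by (simp add: wnorm2_def add_increasing)
  from L[OF u this r(1)] show "L2disc M \<rho> (u i)" .
qed

lemma L2disc_agent_cost:
  assumes x: "\<And>i. i \<in> {1..N} \<Longrightarrow> jmeas M (x i)" and i: "i \<in> {1..N}"
    and L: "L2disc M \<rho> (\<lambda>t w. C *v tracking x i t w)" "L2disc M \<rho> (u i)"
  shows "agent_cost \<rho> \<Gamma> Q R \<eta> N M u x i < \<infinity>"
proof -
  let ?L = "lebh \<Otimes>\<^sub>M M"
  note u = L2disc_jmeas[OF L(2)]
  have "integrable ?L (\<lambda>p. exp (- \<rho> * fst p) * ((C *v tracking x i (fst p) (snd p)) \<bullet> (C *v tracking x i (fst p) (snd p)))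
    + exp (- \<rho> * fst p) * (u i (fst p) (snd p) \<bullet> (R *v u i (fst p) (snd p))))"
    by (intro Bochner_Integration.integrable_add L2disc_inner L L2disc_matrix)
  hence I: "integrable ?L (cost_density u x i)"
    unfolding cost_density_def[abs_def] wnorm2_Q power2_norm_eq_inner distrib_left unfolding wnorm2_def .
  have "agent_cost \<rho> \<Gamma> Q R \<eta> N M u x i = ennreal (\<integral>p. cost_density u x i p \<partial>?L)"
    by (rule trans[OF agent_cost_nn_integral nn_integral_eq_integral[OF I]]) ((rule x, assumption) | rule u i | (rule AE_I2, rule cost_density_nonneg))+
  thus ?thesis by simp
qed

end

text \<open>\<open>xh\<close> is the given state under the feedback, and X a jointly measurable
  adapted process equal to it at all times almost surely. Computations use X; costs and equations
  transfer.\<close>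

locale closed_loop = social_game +
  fixes xh X :: "nat \<Rightarrow> real \<Rightarrow> 'a \<Rightarrow> real^'b"
  assumes st: "is_state A B G f \<sigma> N M F W x0 (decentralized_control B R P \<Pi>\<^sub>m xbar s xh) xh"
    and XJ: "\<And>i. i \<in> {1..N} \<Longrightarrow> jmeas M (X i)"
    and XF: "\<And>i t. i \<in> {1..N} \<Longrightarrow> 0 \<le> t \<Longrightarrow> X i t \<in> borel_measurable (F t)"
    and Xeq: "AE w in M. \<forall>i\<in>{1..N}. \<forall>t\<ge>0. X i t w = xh i t w"
    and Xc: "AE w in M. \<forall>i\<in>{1..N}. continuous_on {0..} (\<lambda>t. X i t w)"
begin

definition U where "U = decentralized_control B R P \<Pi>\<^sub>m xbar s X"

definition K where "K = matrix_inv R ** transpose B"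

definition noise where "noise i t w = X i t w - x0 i w - prim (\<lambda>r. drift A B G f N X U i r w) t"

definition e where "e t w = average N X t w - xbar t"

definition y where "y i t w = X i t w - average N X t w"

definition a0 where "a0 w = average N (\<lambda>i t. x0 i) 0 w"

lemma X_decomp: "X i t w = y i t w + e t w + xbar t"
  by (simp add: y_def e_def)

text \<open>The costate of agent i is P y_i plus the mean costate. The term P e is the error made by
  feeding back \<open>xbar\<close> in place of the actual mean.\<close>

lemma U_eq: "U i t w = - (K *v (P *v y i t w + P *v e t w + costate t))"
  unfolding U_def decentralized_control_def K_def costate_def X_decomp[of i t w]
  by (simp add: matrix_vector_right_distrib matrix_vector_mult_diff_rdistrib algebra_simps)

lemma average_y: "average N y t w = 0"
  using N unfolding y_def[abs_def] by (simp add: average_diff average_const)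

lemma average_U: "average N U t w = - (K *v (P *v e t w + costate t))"
proof -
  have "U = (\<lambda>i t w. ((- K) ** P) *v y i t w + (- K) *v (P *v e t w + costate t))"
    by (simp add: fun_eq_iff U_eq uminus_matrix_vector_mult matrix_vector_right_distrib matrix_vector_mul_assoc[symmetric])
  hence "average N U t w = ((- K) ** P) *v average N y t w + (- K) *v (P *v e t w + costate t)"
    by (simp only: average_add average_const[OF N] average_matrix)
  thus ?thesis unfolding average_y by (simp add: uminus_matrix_vector_mult)
qed

lemma UJ: "i \<in> {1..N} \<Longrightarrow> jmeas M (U i)"
proof -
  assume i: "i \<in> {1..N}"
  have U': "U i = (\<lambda>t w. (- K) *v (P *v X i t w + (\<Pi>\<^sub>m - P) *v xbar t + s t))"
    by (simp add: fun_eq_iff U_def decentralized_control_def K_def uminus_matrix_vector_mult)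
  show ?thesis unfolding U'
    by (intro jmeas_matrix jmeas_add XJ i L2disc_jmeas[OF L2disc_det_intros(3)] L2disc_jmeas[OF L2disc_det_intros(4)])
qed

lemma UF: "i \<in> {1..N} \<Longrightarrow> 0 \<le> t \<Longrightarrow> U i t \<in> borel_measurable (F t)"
proof -
  assume i: "i \<in> {1..N}" and t: "0 \<le> t"
  have U': "U i t = (\<lambda>w. (- K) *v (P *v X i t w + (\<Pi>\<^sub>m - P) *v xbar t + s t))"
    by (simp add: fun_eq_iff U_def decentralized_control_def K_def uminus_matrix_vector_mult)
  show ?thesis unfolding U' by (intro jmeas_adapted_matrix borel_measurable_add borel_measurable_const XF i t)
qed

lemma Ueq: "AE w in M. \<forall>i\<in>{1..N}. \<forall>t\<ge>0. U i t w = decentralized_control B R P \<Pi>\<^sub>m xbar s xh i t w"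
  using Xeq by eventually_elim (simp add: U_def decentralized_control_def)

lemma noise_facts:
  "AE w in M. \<forall>i\<in>{1..N}. \<forall>T\<ge>0. integrable (leb T) (\<lambda>r. drift A B G f N X U i r w)"
  "\<And>i. i \<in> {1..N} \<Longrightarrow> jmeas M (noise i)" "\<And>i t. i \<in> {1..N} \<Longrightarrow> 0 \<le> t \<Longrightarrow> is_ito_integral M (W i) \<sigma> t (noise i t)"
  unfolding noise_def[abs_def]
  by (rule state_noise[OF st UJ XJ Xeq Ueq C_half_continuous[OF Ch(1)] x0_measurable]; assumption)+

lemma noise_martingale: "i \<in> {1..N} \<Longrightarrow> martingale_noise (noise i)"
  by (rule martingale_noise_ito[OF W C_half_continuous[OF Ch(2)] noise_facts(2) noise_facts(3)])

lemma average_noise: "average N noise t w = (\<Sum>j\<in>{1..N}. (1 / real N) *\<^sub>R noise j t w)"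
  by (simp add: average_def scaleR_sum_right)

lemma deviation_noise:
  assumes "i \<in> {1..N}"
  shows "noise i t w - average N noise t w = (\<Sum>j\<in>{1..N}. ((if j = i then 1 else 0) - 1 / real N) *\<^sub>R noise j t w)"
  using assms by (simp add: average_noise scaleR_diff_left sum_subtractf if_distrib[of "\<lambda>c. c *\<^sub>R _"] cong: if_cong)

lemma combination_noise:
  "martingale_noise (\<lambda>t w. \<Sum>j\<in>{1..N}. c j *\<^sub>R noise j t w)"
  "noise_variance \<sigma> (\<Sum>j\<in>{1..N}. (c j)\<^sup>2) (\<lambda>t w. \<Sum>j\<in>{1..N}. c j *\<^sub>R noise j t w)"
  by (intro martingale_noise_sum martingale_noise_scaleR noise_martingale, assumption)
     (rule noise_variance_combination[OF W finite_atLeastAtMost Wind C_half_continuous[OF Ch(2)] noise_facts(3)]; assumption)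

lemma X_eq: "X i t w = x0 i w + prim (\<lambda>r. drift A B G f N X U i r w) t + noise i t w"
  by (simp add: noise_def)

lemma closed_loop_drift:
  "average N (drift A B G f N X U) t w = xbar' t + (Abar + G) *v e t w"
  "drift A B G f N X U i t w - average N (drift A B G f N X U) t w = Abar *v y i t w"
proof -
  have K: "B *v (K *v z) = (B ** matrix_inv R ** transpose B) *v z" for z
    by (simp add: K_def matrix_vector_mul_assoc matrix_mul_assoc)
  have Ab: "Abar *v z = A *v z - (B ** matrix_inv R ** transpose B) *v (P *v z)" for z
    by (simp add: Abar_def matrix_vector_mult_diff_rdistrib matrix_vector_mul_assoc)
  have m: "average N X t w = e t w + xbar t" by (simp add: e_def)
  have neg: "B *v (- z) = - (B *v z)" for z by (simp add: linear_neg[OF matrix_vector_mul_linear])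
  show "average N (drift A B G f N X U) t w = xbar' t + (Abar + G) *v e t w"
    unfolding average_drift[OF N] average_U m neg K xbar'_def
    by (simp add: matrix_vector_mult_add_rdistrib matrix_vector_right_distrib Ab costate_def)
  have "U i t w - average N U t w = - (K *v (P *v y i t w))"
    unfolding U_eq average_U by (simp add: matrix_vector_right_distrib)
  thus "drift A B G f N X U i t w - average N (drift A B G f N X U) t w = Abar *v y i t w"
    unfolding drift_deviation[OF N] Ab by (simp add: neg K y_def)
qed

lemma e_continuous: "AE w in M. continuous_on {0..} (\<lambda>t. e t w)"
  and y_continuous: "i \<in> {1..N} \<Longrightarrow> AE w in M. continuous_on {0..} (\<lambda>t. y i t w)"
proof -
  have avg: "AE w in M. continuous_on {0..} (\<lambda>t. average N X t w)"
    using Xc by eventually_elim (auto simp: average_def intro!: continuous_intros)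
  thus "AE w in M. continuous_on {0..} (\<lambda>t. e t w)"
    by eventually_elim (auto simp: e_def intro!: continuous_intros C_half_continuous[OF Ch(5)])
  show "i \<in> {1..N} \<Longrightarrow> AE w in M. continuous_on {0..} (\<lambda>t. y i t w)"
    using avg Xc by eventually_elim (auto simp: y_def intro!: continuous_intros)
qed

lemma e_equation: "AE w in M. \<forall>t\<ge>0. e t w = (a0 w - xbar0) + prim (\<lambda>r. (Abar + G) *v e r w) t + average N noise t w"
  and y_equation: "i \<in> {1..N} \<Longrightarrow> AE w in M. \<forall>t\<ge>0. y i t w = (x0 i w - a0 w) + prim (\<lambda>r. Abar *v y i r w) t + (noise i t w - average N noise t w)"
proof -
  have avg: "AE w in M. \<forall>t\<ge>0. average N X t w = a0 w + prim (\<lambda>r. average N (drift A B G f N X U) r w) t + average N noise t w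
     \<and> integrable (leb t) (\<lambda>r. average N (drift A B G f N X U) r w)"
    using noise_facts(1)
  proof eventually_elim
    case (elim w)
    show ?case
    proof (intro allI impI conjI)
      fix t :: real assume t: "0 \<le> t"
      have i: "integrable (leb t) (\<lambda>r. drift A B G f N X U i r w)" if "i \<in> {1..N}" for i using elim that t by blast
      show "integrable (leb t) (\<lambda>r. average N (drift A B G f N X U) r w)" by (rule average_prim(2)) (rule i)
      have "X = (\<lambda>i t w. x0 i w + prim (\<lambda>r. drift A B G f N X U i r w) t + noise i t w)" by (intro ext X_eq)
      from arg_cong[OF this, where f = "\<lambda>z. average N z t w"]
      have "average N X t w = average N (\<lambda>i t w. x0 i w + prim (\<lambda>r. drift A B G f N X U i r w) t + noise i t w) t w" .
      also have "\<dots> = a0 w + prim (\<lambda>r. average N (drift A B G f N X U) r w) t + average N noise t w"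
        unfolding average_add using average_prim(1)[where N = N and t = t and w = w and X = "drift A B G f N X U", OF i]
        by (simp only: a0_def average_def)
      finally show "average N X t w = a0 w + prim (\<lambda>r. average N (drift A B G f N X U) r w) t + average N noise t w" .
    qed
  qed
  have mc: "integrable (leb t) (\<lambda>t. Y *v h t)" if "continuous_on {0..} h" for Y :: "real^'b^'b" and h :: "real \<Rightarrow> real^'b" and t
    by (rule integrable_leb_continuous, rule continuous_on_compose2[OF matrix_vector_mult_linear_continuous_on[of UNIV Y] that]) auto
  show "AE w in M. \<forall>t\<ge>0. e t w = (a0 w - xbar0) + prim (\<lambda>r. (Abar + G) *v e r w) t + average N noise t w"
    using avg e_continuous
  proof eventually_elim
    case (elim w)
    show ?case
    proof (intro allI impI)
      fix t :: real assume t: "0 \<le> t"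
      have "prim (\<lambda>r. average N (drift A B G f N X U) r w) t = prim xbar' t + prim (\<lambda>r. (Abar + G) *v e r w) t"
        unfolding closed_loop_drift prim_def using mc[OF elim(2)] integrable_leb_continuous[OF xbar'_continuous] by simp
      thus "e t w = (a0 w - xbar0) + prim (\<lambda>r. (Abar + G) *v e r w) t + average N noise t w"
        using elim(1) t xbar_prim[OF t] by (simp add: e_def)
    qed
  qed
  assume i: "i \<in> {1..N}"
  show "AE w in M. \<forall>t\<ge>0. y i t w = (x0 i w - a0 w) + prim (\<lambda>r. Abar *v y i r w) t + (noise i t w - average N noise t w)"
    using avg noise_facts(1)
  proof eventually_elim
    case (elim w)
    show ?case
    proof (intro allI impI)
      fix t :: real assume t: "0 \<le> t"
      have "prim (\<lambda>r. Abar *v y i r w) t = prim (\<lambda>r. drift A B G f N X U i r w) t - prim (\<lambda>r. average N (drift A B G f N X U) r w) t"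
        unfolding closed_loop_drift(2)[symmetric] prim_def using elim t i by simp
      thus "y i t w = (x0 i w - a0 w) + prim (\<lambda>r. Abar *v y i r w) t + (noise i t w - average N noise t w)"
        using elim(1) t X_eq[of i t w] by (simp add: y_def)
    qed
  qed
qed

lemma a0_facts: "sq_integrable M a0" "a0 \<in> borel_measurable (F 0)"
proof -
  have a: "a0 = (\<lambda>w. (1 / real N) *\<^sub>R (\<Sum>j\<in>{1..N}. x0 j w))" by (simp add: fun_eq_iff a0_def average_def)
  show "sq_integrable M a0" unfolding a by (intro sq_integrable_scaleR sq_integrable_sum x0sq)
  show "a0 \<in> borel_measurable (F 0)" unfolding a by (intro borel_measurable_scaleR borel_measurable_const borel_measurable_sum x0F)
qed

lemma average_X_facts: "jmeas M (average N X)" "0 \<le> t \<Longrightarrow> average N X t \<in> borel_measurable (F t)"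
proof -
  show "jmeas M (average N X)" by (intro jmeas_average XJ)
  have "average N X t = (\<lambda>w. (1 / real N) *\<^sub>R (\<Sum>j\<in>{1..N}. X j t w))" by (simp add: average_def fun_eq_iff)
  thus "0 \<le> t \<Longrightarrow> average N X t \<in> borel_measurable (F t)"
    by (simp only:) (intro borel_measurable_scaleR borel_measurable_const borel_measurable_sum XF)
qed

lemma e_facts: "jmeas M e" "0 \<le> t \<Longrightarrow> e t \<in> borel_measurable (F t)"
  unfolding e_def[abs_def]
  by (intro jmeas_diff average_X_facts L2disc_jmeas[OF L2disc_det_intros(4)])
     (intro borel_measurable_diff average_X_facts borel_measurable_const)

lemma y_facts: "i \<in> {1..N} \<Longrightarrow> jmeas M (y i)" "i \<in> {1..N} \<Longrightarrow> 0 \<le> t \<Longrightarrow> y i t \<in> borel_measurable (F t)"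
  unfolding y_def[abs_def] by (intro jmeas_diff average_X_facts XJ, assumption) (intro borel_measurable_diff average_X_facts XF; assumption)

lemma L2proc_noise: "martingale_noise I \<Longrightarrow> L2proc M I"
  by (simp add: martingale_noise_def)

text \<open>Both sources of e are averages of uncorrelated centered terms: the initial states
  contribute the first summand, the noise the second.\<close>

lemma mean_error_bound:
  assumes Y: "psd Y" "\<And>x. 2 * ((Y *v x) \<bullet> ((Abar + G) *v x)) - \<rho> * (x \<bullet> (Y *v x)) \<le> - (norm x)\<^sup>2"
    and c: "0 \<le> c" "\<And>x. x \<bullet> (Y *v x) \<le> c * (norm x)\<^sup>2"
  shows "L2disc M \<rho> e"
    "(\<integral>p. exp (- \<rho> * fst p) * (norm (e (fst p) (snd p)))\<^sup>2 \<partial>(lebh \<Otimes>\<^sub>M M)) \<le> (c * (2 * C0 + 2 * (norm xbar0)\<^sup>2) + noise_energy Y) / real N"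
proof -
  have n: "martingale_noise (average N noise)" and v: "noise_variance \<sigma> (\<Sum>j\<in>{1..N}. (1 / real N)\<^sup>2) (average N noise)"
    using combination_noise[of "\<lambda>_. 1 / real N"] unfolding average_noise[abs_def] by auto
  have x: "sq_integrable M (\<lambda>w. a0 w - xbar0)" "(\<lambda>w. a0 w - xbar0) \<in> borel_measurable (F 0)"
    by (intro sq_integrable_diff a0_facts sq_integrable_const[OF finite_measure_axioms])
       (intro borel_measurable_diff a0_facts borel_measurable_const)
  have "AE w in M. \<forall>t\<ge>0. e t w = ((a0 w - xbar0) + average N noise t w) + prim (\<lambda>r. (Abar + G) *v e r w) t"
    using e_equation by eventually_elim (simp add: algebra_simps)
  \<comment> \<open>The energy bound presupposes square integrability on finite horizons; the
    exponential constant of this estimate does not enter the result.\<close>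
  note g = gronwall_process[OF e_facts(1) _ e_continuous this]
  have Le: "L2proc M e"
    by (rule g) (intro L2proc_add L2proc_const x L2proc_noise n)
  have eq: "AE w in M. e t w = (a0 w - xbar0) + prim (\<lambda>r. (Abar + G) *v e r w) t + average N noise t w" if "0 \<le> t" for t
    using e_equation by eventually_elim (use that in blast)
  note b = stable_energy_bound[OF Le e_facts(2) x n v eq Y \<rho>0 _ noise_energy(1)[OF Y(1)] noise_energy(2)[OF Y(1)]]
  show "L2disc M \<rho> e" by (rule b(1)) (auto intro: sum_nonneg)
  have "(\<integral>p. exp (- \<rho> * fst p) * (norm (e (fst p) (snd p)))\<^sup>2 \<partial>(lebh \<Otimes>\<^sub>M M))
    \<le> expectation (\<lambda>w. (a0 w - xbar0) \<bullet> (Y *v (a0 w - xbar0))) + (\<Sum>j\<in>{1..N}. (1 / real N)\<^sup>2) * noise_energy Y"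
    by (rule b(2)) (auto intro: sum_nonneg)
  also have "(\<Sum>j\<in>{1..N}. (1 / real N)\<^sup>2) = 1 / real N" using N by (simp add: power2_eq_square)
  also have "expectation (\<lambda>w. (a0 w - xbar0) \<bullet> (Y *v (a0 w - xbar0))) \<le> c * (2 * C0 + 2 * (norm xbar0)\<^sup>2) / real N"
    using initial_average_moment[OF c, of 0] by (simp add: a0_def)
  finally show "(\<integral>p. exp (- \<rho> * fst p) * (norm (e (fst p) (snd p)))\<^sup>2 \<partial>(lebh \<Otimes>\<^sub>M M)) \<le> (c * (2 * C0 + 2 * (norm xbar0)\<^sup>2) + noise_energy Y) / real N"
    by (simp add: add_divide_distrib)
qed

text \<open>The deviations are not small, but stability of \<open>Abar\<close> makes them square
  integrable with the discount, as the orthogonality relations require.\<close>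

lemma deviation_L2disc:
  assumes Y: "psd Y" "\<And>x. 2 * ((Y *v x) \<bullet> (Abar *v x)) - \<rho> * (x \<bullet> (Y *v x)) \<le> - (norm x)\<^sup>2" and i: "i \<in> {1..N}"
  shows "L2disc M \<rho> (y i)"
proof -
  let ?c = "\<lambda>j. (if j = i then 1 else 0) - 1 / real N"
  let ?n = "\<lambda>t w. noise i t w - average N noise t w"
  have n: "martingale_noise ?n" and v: "noise_variance \<sigma> (\<Sum>j\<in>{1..N}. (?c j)\<^sup>2) ?n"
    using combination_noise[of ?c] unfolding deviation_noise[OF i] by auto
  have x: "sq_integrable M (\<lambda>w. x0 i w - a0 w)" "(\<lambda>w. x0 i w - a0 w) \<in> borel_measurable (F 0)"
    by (intro sq_integrable_diff a0_facts x0sq i) (intro borel_measurable_diff a0_facts x0F i)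
  have "AE w in M. \<forall>t\<ge>0. y i t w = ((x0 i w - a0 w) + ?n t w) + prim (\<lambda>r. Abar *v y i r w) t"
    using y_equation[OF i] by eventually_elim (simp add: algebra_simps)
  note g = gronwall_process[OF y_facts(1)[OF i] _ y_continuous[OF i] this]
  have Ly: "L2proc M (y i)"
    by (rule g) (intro L2proc_add L2proc_const x L2proc_noise n)
  have eq: "AE w in M. y i t w = (x0 i w - a0 w) + prim (\<lambda>r. Abar *v y i r w) t + ?n t w" if "0 \<le> t" for t
    using y_equation[OF i] by eventually_elim (use that in blast)
  show ?thesis
    by (rule stable_energy_bound(1)[OF Ly y_facts(2)[OF i] x n v eq Y \<rho>0 _ noise_energy(1)[OF Y(1)] noise_energy(2)[OF Y(1)]])
       (auto intro: sum_nonneg)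
qed

end

section \<open>Optimality of the closed loop up to a bounded amount\<close>

text \<open>The bilinear parallel axis identity: deviations from the average sum to 0.\<close>

lemma sum_form_average:
  fixes S :: "real^'k^'k"
  assumes N: "N \<ge> 1"
  shows "(\<Sum>i\<in>{1..N}. a i t w \<bullet> (S *v b i t w))
    = (\<Sum>i\<in>{1..N}. (a i t w - average N a t w) \<bullet> (S *v (b i t w - average N b t w)))
      + real N * (average N a t w \<bullet> (S *v average N b t w))"
proof -
  let ?a = "average N a t w" and ?b = "average N b t w"
  have s: "(\<Sum>i\<in>{1..N}. c i t w) = real N *\<^sub>R average N c t w" for c :: "nat \<Rightarrow> real \<Rightarrow> _ \<Rightarrow> real^'k"
    using N by (simp add: average_def)
  have "(\<Sum>i\<in>{1..N}. (a i t w - ?a) \<bullet> (S *v (b i t w - ?b))) = (\<Sum>i\<in>{1..N}. a i t w \<bullet> (S *v b i t w))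
    - (\<Sum>i\<in>{1..N}. a i t w) \<bullet> (S *v ?b) - ?a \<bullet> (S *v (\<Sum>i\<in>{1..N}. b i t w)) + real N * (?a \<bullet> (S *v ?b))"
    by (simp add: matrix_vector_mult_diff_distrib inner_diff_left inner_diff_right sum_subtractf sum.distrib
       inner_sum_left inner_sum_right linear_sum[OF matrix_vector_mul_linear])
  thus ?thesis unfolding s by (simp add: matrix_vector_mult_scaleR)
qed

lemma sum_form_average_ge:
  fixes S :: "real^'k^'k"
  assumes N: "N \<ge> 1" and S: "\<And>z. 0 \<le> z \<bullet> (S *v z)"
  shows "real N * (average N a t w \<bullet> (S *v average N a t w)) \<le> (\<Sum>i\<in>{1..N}. a i t w \<bullet> (S *v a i t w))"
  unfolding sum_form_average[OF N] using S by (simp add: sum_nonneg)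

context filtered_prob begin

text \<open>Two stages: Gronwall's inequality for each finite horizon, then detectability for the
  discounted half-line.\<close>

lemma controlled_L2disc:
  fixes Z :: "real \<Rightarrow> 'w \<Rightarrow> real^'n" and v :: "real \<Rightarrow> 'w \<Rightarrow> real^'r" and A Y :: "real^'n^'n" and B :: "real^'r^'n" and C :: "real^'n^'m"
  assumes Z: "jmeas M Z" "\<And>t. 0 \<le> t \<Longrightarrow> Z t \<in> borel_measurable (F t)" "AE w in M. continuous_on {0..} (\<lambda>t. Z t w)"
    and v: "L2disc M \<rho> v" "\<And>t. 0 \<le> t \<Longrightarrow> v t \<in> borel_measurable (F t)"
    and eq: "AE w in M. \<forall>t\<ge>0. Z t w = prim (\<lambda>r. A *v Z r w + B *v v r w) t \<and> integrable (leb t) (\<lambda>r. A *v Z r w + B *v v r w)"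
    and CZ: "L2disc M \<rho> (\<lambda>t w. C *v Z t w)"
    and Y: "psd Y" "0 \<le> \<kappa>" "\<And>x. 2 * ((Y *v x) \<bullet> (A *v x)) - \<rho> * (x \<bullet> (Y *v x)) \<le> \<kappa> * (norm (C *v x))\<^sup>2 - (norm x)\<^sup>2"
    and \<rho>: "0 \<le> \<rho>"
  shows "L2disc M \<rho> Z"
proof -
  have "AE w in M. \<forall>t\<ge>0. Z t w = prim (\<lambda>r. B *v v r w) t + prim (\<lambda>r. A *v Z r w) t"
    using eq Z(3)
  proof eventually_elim
    case (elim w)
    show ?case
    proof (intro allI impI)
      fix t :: real assume t: "0 \<le> t"
      have a: "integrable (leb t) (\<lambda>r. A *v Z r w)"
        by (rule integrable_leb_continuous, rule continuous_on_compose2[OF matrix_vector_mult_linear_continuous_on[of UNIV A] elim(2)]) auto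
      have b: "integrable (leb t) (\<lambda>r. B *v v r w)"
        using Bochner_Integration.integrable_diff[OF conjunct2[OF elim(1)[rule_format, OF t]] a] by simp
      show "Z t w = prim (\<lambda>r. B *v v r w) t + prim (\<lambda>r. A *v Z r w) t"
        using elim(1) t a b by (simp add: prim_def)
    qed
  qed
  note g = gronwall_process[OF Z(1) _ Z(3) this]
  have LZ: "L2proc M Z" by (rule g) (rule L2proc_prim[OF L2disc_L2proc[OF L2disc_matrix[OF v(1)] \<rho>]])
  have "AE w in M. Z t w = prim (\<lambda>r. A *v Z r w + B *v v r w) t" if "0 \<le> t" for t
    using eq by eventually_elim (use that in blast)
  from detectable_L2disc[OF LZ Z(2) v(2) this v(1) CZ Y \<rho>] show ?thesis .
qed

end

context closed_loop begin

lemma tracking_X: "tracking X i t w = y i t w + (e t w - \<Gamma> *v e t w) + (xbar t - \<Gamma> *v xbar t - \<eta> t)"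
proof -
  have "average N X t w = e t w + xbar t" by (simp add: e_def)
  thus ?thesis unfolding tracking_def X_decomp[of i t w] by (simp add: matrix_vector_right_distrib)
qed

lemma closed_loop_L2disc:
  assumes Le: "L2disc M \<rho> e" and Ly: "L2disc M \<rho> (y i)"
  shows "L2disc M \<rho> (U i)" "L2disc M \<rho> (\<lambda>t w. C *v tracking X i t w)"
proof -
  have "U i = (\<lambda>t w. (- K) *v (P *v y i t w + P *v e t w + costate t))"
    by (simp add: fun_eq_iff U_eq uminus_matrix_vector_mult)
  thus "L2disc M \<rho> (U i)" by (simp only:) (intro L2disc_matrix L2disc_add Le Ly L2disc_det_intros)
  show "L2disc M \<rho> (\<lambda>t w. C *v tracking X i t w)"
    unfolding tracking_X by (intro L2disc_matrix L2disc_add L2disc_diff Le Ly L2disc_det_intros)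
qed

lemma noise_continuous: "i \<in> {1..N} \<Longrightarrow> AE w in M. continuous_on {0..} (\<lambda>t. noise i t w)"
  using Xc noise_facts(1)
proof eventually_elim
  case (elim w)
  have "continuous_on {0..} (prim (\<lambda>r. drift A B G f N X U i r w))" using elim by (intro continuous_on_prim) blast
  with elim show ?case unfolding noise_def by (intro continuous_intros) blast+
qed

end

text \<open>The closed loop together with a competing control u whose control and tracking output
  are square integrable. \<open>xu\<close> is the given state of u, and x its measurable
  modification.\<close>

locale comparison = closed_loop +
  fixes u :: "nat \<Rightarrow> real \<Rightarrow> 'a \<Rightarrow> real^'c" and x xu :: "nat \<Rightarrow> real \<Rightarrow> 'a \<Rightarrow> real^'b"
  assumes su: "is_state A B G f \<sigma> N M F W x0 u xu"
    and xJ: "\<And>i. i \<in> {1..N} \<Longrightarrow> jmeas M (x i)"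
    and xF: "\<And>i t. i \<in> {1..N} \<Longrightarrow> 0 \<le> t \<Longrightarrow> x i t \<in> borel_measurable (F t)"
    and xeq': "AE w in M. \<forall>i\<in>{1..N}. \<forall>t\<ge>0. x i t w = xu i t w"
    and xc: "AE w in M. \<forall>i\<in>{1..N}. continuous_on {0..} (\<lambda>t. x i t w)"
    and uJ: "\<And>i. i \<in> {1..N} \<Longrightarrow> jmeas M (u i)"
    and uF: "\<And>i t. i \<in> {1..N} \<Longrightarrow> 0 \<le> t \<Longrightarrow> u i t \<in> borel_measurable (F t)"
    and uL: "\<And>i. i \<in> {1..N} \<Longrightarrow> L2disc M \<rho> (u i)"
    and xL: "\<And>i. i \<in> {1..N} \<Longrightarrow> L2disc M \<rho> (\<lambda>t w. C *v tracking x i t w)"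
    and eL: "L2disc M \<rho> e" and yL: "\<And>i. i \<in> {1..N} \<Longrightarrow> L2disc M \<rho> (y i)"
begin

section \<open>Differences between the competitor and the feedback\<close>

definition du where "du i t w = u i t w - U i t w"
definition dx where "dx i t w = x i t w - X i t w"
definition dm where "dm = average N dx"
definition dw where "dw = average N du"
definition dy where "dy i t w = dx i t w - dm t w"
definition dv where "dv i t w = du i t w - dw t w"

text \<open>The noises of both states are Ito integrals of \<sigma> against the same Brownian
  motion: equal almost surely at each time by uniqueness, hence at all times by continuity. So the
  difference carries no noise and starts at 0.\<close>

lemma dx_equation: "AE w in M. \<forall>i\<in>{1..N}. \<forall>t\<ge>0. dx i t w = prim (\<lambda>r. drift A B G (\<lambda>_. 0) N dx du i r w) t
    \<and> integrable (leb t) (\<lambda>r. drift A B G (\<lambda>_. 0) N dx du i r w)"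
proof (rule AE_ball_finite_all)
  fix i assume i: "i \<in> {1..N}"
  define nu where "nu i t w = x i t w - x0 i w - prim (\<lambda>r. drift A B G f N x u i r w) t" for i t w
  have ueq: "AE w in M. \<forall>i\<in>{1..N}. \<forall>t\<ge>0. u i t w = u i t w" by simp
  have nf: "AE w in M. \<forall>i\<in>{1..N}. \<forall>T\<ge>0. integrable (leb T) (\<lambda>r. drift A B G f N x u i r w)"
    "0 \<le> t \<Longrightarrow> is_ito_integral M (W i) \<sigma> t (nu i t)" for t
    unfolding nu_def[abs_def]
    using state_noise[OF su uJ xJ xeq' ueq C_half_continuous[OF Ch(1)] x0_measurable] i by blast+
  have "AE w in M. continuous_on {0..} (\<lambda>t. nu i t w)"
    using xc nf(1)
  proof eventually_elim
    case (elim w)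
    have "continuous_on {0..} (prim (\<lambda>r. drift A B G f N x u i r w))" using elim i by (intro continuous_on_prim) blast
    with elim i show ?case unfolding nu_def by (intro continuous_intros) blast+
  qed
  moreover have "AE w in M. nu i t w = noise i t w" if t: "0 \<le> t" for t
    by (rule ito_unique[OF W[OF i] measurable_leb_lebh[OF continuous_on_measurable_lebh[OF C_half_continuous[OF Ch(2)]]] nf(2)[OF t] noise_facts(3)[OF i t]])
  ultimately have "AE w in M. \<forall>t\<ge>0. nu i t w = noise i t w" using AE_all_times noise_continuous[OF i] by blast
  thus "AE w in M. \<forall>t\<ge>0. dx i t w = prim (\<lambda>r. drift A B G (\<lambda>_. 0) N dx du i r w) t
    \<and> integrable (leb t) (\<lambda>r. drift A B G (\<lambda>_. 0) N dx du i r w)"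
    using nf(1) noise_facts(1)
  proof eventually_elim
    case (elim w)
    have d: "drift A B G (\<lambda>_. 0) N dx du i r w = drift A B G f N x u i r w - drift A B G f N X U i r w" for r
      unfolding drift_def dx_def[abs_def] du_def[abs_def] average_diff by (simp add: matrix_vector_mult_diff_distrib)
    show ?case
    proof (intro allI impI conjI)
      fix t :: real assume t: "0 \<le> t"
      have I: "integrable (leb t) (\<lambda>r. drift A B G f N x u i r w)" "integrable (leb t) (\<lambda>r. drift A B G f N X U i r w)"
        using elim i t by blast+
      thus "integrable (leb t) (\<lambda>r. drift A B G (\<lambda>_. 0) N dx du i r w)" unfolding d by (rule Bochner_Integration.integrable_diff)
      have "prim (\<lambda>r. drift A B G (\<lambda>_. 0) N dx du i r w) t = prim (\<lambda>r. drift A B G f N x u i r w) t - prim (\<lambda>r. drift A B G f N X U i r w) t"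
        unfolding d prim_def using I by (rule Bochner_Integration.integral_diff)
      moreover have "nu i t w = noise i t w" using elim(1) t by blast
      ultimately show "dx i t w = prim (\<lambda>r. drift A B G (\<lambda>_. 0) N dx du i r w) t"
        unfolding dx_def nu_def noise_def by (simp only:) (simp add: algebra_simps)
    qed
  qed
qed simp

lemma dm_equation: "AE w in M. \<forall>t\<ge>0. dm t w = prim (\<lambda>r. (A + G) *v dm r w + B *v dw r w) t
    \<and> integrable (leb t) (\<lambda>r. (A + G) *v dm r w + B *v dw r w)"
  and dy_equation: "i \<in> {1..N} \<Longrightarrow> AE w in M. \<forall>t\<ge>0. dy i t w = prim (\<lambda>r. A *v dy i r w + B *v dv i r w) t
    \<and> integrable (leb t) (\<lambda>r. A *v dy i r w + B *v dv i r w)"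
proof -
  let ?d = "drift A B G (\<lambda>_. 0) N dx du"
  have m: "average N ?d r w = (A + G) *v dm r w + B *v dw r w" for r w
    unfolding average_drift[OF N] dm_def dw_def by simp
  have dd: "?d i r w - average N ?d r w = A *v dy i r w + B *v dv i r w" for i r w
    unfolding drift_deviation[OF N] dy_def dv_def dm_def dw_def ..
  show me: "AE w in M. \<forall>t\<ge>0. dm t w = prim (\<lambda>r. (A + G) *v dm r w + B *v dw r w) t
    \<and> integrable (leb t) (\<lambda>r. (A + G) *v dm r w + B *v dw r w)"
    using dx_equation
  proof eventually_elim
    case (elim w)
    show ?case unfolding m[symmetric]
    proof (intro allI impI)
      fix t :: real assume t: "0 \<le> t"
      have I: "integrable (leb t) (\<lambda>r. ?d i r w)" if "i \<in> {1..N}" for i using elim that t by blast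
      have "dm t w = average N (\<lambda>i t w. prim (\<lambda>r. ?d i r w) t) t w"
        unfolding dm_def average_def using elim t by (intro arg_cong[where f = "(*\<^sub>R) _"] sum.cong refl) blast
      also have "\<dots> = prim (\<lambda>r. average N ?d r w) t" by (rule average_prim(1)) (rule I)
      finally show "dm t w = prim (\<lambda>r. average N ?d r w) t \<and> integrable (leb t) (\<lambda>r. average N ?d r w)"
        using average_prim(2)[where N = N and t = t and w = w and X = ?d, OF I] by blast
    qed
  qed
  assume i: "i \<in> {1..N}"
  show "AE w in M. \<forall>t\<ge>0. dy i t w = prim (\<lambda>r. A *v dy i r w + B *v dv i r w) t
    \<and> integrable (leb t) (\<lambda>r. A *v dy i r w + B *v dv i r w)"
    using dx_equation me
  proof eventually_elim
    case (elim w)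
    show ?case unfolding dd[symmetric]
    proof (intro allI impI conjI)
      fix t :: real assume t: "0 \<le> t"
      have I: "integrable (leb t) (\<lambda>r. ?d i r w)" and J: "integrable (leb t) (\<lambda>r. average N ?d r w)"
        using elim(1)[rule_format, OF i t] conjunct2[OF elim(2)[rule_format, OF t]] unfolding m by simp_all
      thus "integrable (leb t) (\<lambda>r. ?d i r w - average N ?d r w)" by (rule Bochner_Integration.integrable_diff)
      have "prim (\<lambda>r. ?d i r w - average N ?d r w) t = prim (\<lambda>r. ?d i r w) t - prim (\<lambda>r. average N ?d r w) t"
        unfolding prim_def using I J by (rule Bochner_Integration.integral_diff)
      also have "\<dots> = dx i t w - dm t w" using elim(1)[rule_format, OF i t] elim(2)[rule_format, OF t] unfolding m by simp
      finally show "dy i t w = prim (\<lambda>r. ?d i r w - average N ?d r w) t" unfolding dy_def by (rule sym)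
    qed
  qed
qed

lemma L2disc_average: "(\<And>i. i \<in> {1..N} \<Longrightarrow> L2disc M \<rho> (\<lambda>t w. a i t w)) \<Longrightarrow> L2disc M \<rho> (\<lambda>t w. average N a t w)"
  unfolding average_def by (intro L2disc_scaleR L2disc_sum)

lemma adapted_average:
  assumes "\<And>i. i \<in> {1..N} \<Longrightarrow> a i t \<in> borel_measurable (F t)"
  shows "average N a t \<in> borel_measurable (F t)"
proof -
  have "average N a t = (\<lambda>w. (1 / real N) *\<^sub>R (\<Sum>j\<in>{1..N}. a j t w))" by (simp add: average_def fun_eq_iff)
  thus ?thesis by (simp only:) (intro borel_measurable_scaleR borel_measurable_const borel_measurable_sum assms)
qed

lemma du_L2disc: "i \<in> {1..N} \<Longrightarrow> L2disc M \<rho> (du i)"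
  unfolding du_def[abs_def] by (intro L2disc_diff uL closed_loop_L2disc(1) eL yL)

lemma dw_L2disc: "L2disc M \<rho> dw"
  unfolding dw_def by (rule L2disc_average) (rule du_L2disc)

lemma dv_L2disc: "i \<in> {1..N} \<Longrightarrow> L2disc M \<rho> (dv i)"
  unfolding dv_def[abs_def] by (intro L2disc_diff du_L2disc dw_L2disc)

lemma d_adapted:
  assumes t: "0 \<le> t"
  shows "dm t \<in> borel_measurable (F t)" "dw t \<in> borel_measurable (F t)"
    "i \<in> {1..N} \<Longrightarrow> dy i t \<in> borel_measurable (F t)" "i \<in> {1..N} \<Longrightarrow> dv i t \<in> borel_measurable (F t)"
proof -
  have a: "dx i t \<in> borel_measurable (F t)" "du i t \<in> borel_measurable (F t)" if "i \<in> {1..N}" for i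
    unfolding dx_def[abs_def] du_def[abs_def] by (intro borel_measurable_diff xF XF that t, intro borel_measurable_diff uF UF that t)
  show m: "dm t \<in> borel_measurable (F t)" "dw t \<in> borel_measurable (F t)"
    unfolding dm_def dw_def by (intro adapted_average a; assumption)+
  show "i \<in> {1..N} \<Longrightarrow> dy i t \<in> borel_measurable (F t)" "i \<in> {1..N} \<Longrightarrow> dv i t \<in> borel_measurable (F t)"
    unfolding dy_def[abs_def] dv_def[abs_def] by (intro borel_measurable_diff m a; assumption)+
qed

lemma dx_jmeas: "i \<in> {1..N} \<Longrightarrow> jmeas M (dx i)" "jmeas M dm" "i \<in> {1..N} \<Longrightarrow> jmeas M (dy i)"
proof -
  show x: "jmeas M (dx i)" if "i \<in> {1..N}" for i
    unfolding dx_def[abs_def] using that by (intro jmeas_diff xJ XJ)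
  show m: "jmeas M dm" unfolding dm_def by (intro jmeas_average x)
  show "i \<in> {1..N} \<Longrightarrow> jmeas M (dy i)" unfolding dy_def[abs_def] by (intro jmeas_diff x m)
qed

lemma d_continuous: "AE w in M. continuous_on {0..} (\<lambda>t. dm t w)" "i \<in> {1..N} \<Longrightarrow> AE w in M. continuous_on {0..} (\<lambda>t. dy i t w)"
proof -
  have x: "AE w in M. \<forall>i\<in>{1..N}. continuous_on {0..} (\<lambda>t. dx i t w)"
    using xc Xc by eventually_elim (auto simp: dx_def intro!: continuous_intros)
  thus m: "AE w in M. continuous_on {0..} (\<lambda>t. dm t w)"
    by eventually_elim (auto simp: dm_def average_def intro!: continuous_intros)
  show "i \<in> {1..N} \<Longrightarrow> AE w in M. continuous_on {0..} (\<lambda>t. dy i t w)"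
    using x m by eventually_elim (auto simp: dy_def intro!: continuous_intros)
qed

lemma tracking_difference: "tracking x i t w - tracking X i t w = dy i t w + (dm t w - \<Gamma> *v dm t w)"
  unfolding tracking_def dy_def dm_def dx_def[abs_def] average_diff by (simp add: matrix_vector_mult_diff_distrib)

text \<open>The difference of outputs is known to be square integrable for each agent. Its average
  contains no deviation and so isolates the mean part; subtracting that isolates the
  deviation.\<close>

lemma output_L2disc: "L2disc M \<rho> (\<lambda>t w. (C ** (mat 1 - \<Gamma>)) *v dm t w)" "i \<in> {1..N} \<Longrightarrow> L2disc M \<rho> (\<lambda>t w. C *v dy i t w)"
proof -
  let ?z = "\<lambda>i t w. C *v dy i t w + C *v (dm t w - \<Gamma> *v dm t w)"
  have z: "L2disc M \<rho> (?z i)" if "i \<in> {1..N}" for i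
    using L2disc_diff[OF xL[OF that] closed_loop_L2disc(2)[OF eL yL[OF that]]]
    unfolding matrix_vector_mult_diff_distrib[symmetric] tracking_difference unfolding matrix_vector_right_distrib .
  have "average N ?z t w = C *v (dm t w - \<Gamma> *v dm t w)" for t w
  proof -
    have "average N dy t w = 0"
      using N unfolding dy_def[abs_def] by (simp add: average_diff average_const dm_def)
    thus ?thesis unfolding average_add average_const[OF N] average_matrix by simp
  qed
  with L2disc_average[of ?z, OF z] have m: "L2disc M \<rho> (\<lambda>t w. C *v (dm t w - \<Gamma> *v dm t w))" by (simp only:)
  thus "L2disc M \<rho> (\<lambda>t w. (C ** (mat 1 - \<Gamma>)) *v dm t w)"
    by (simp add: matrix_vector_mul_assoc[symmetric] matrix_vector_mult_diff_rdistrib)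
  show "i \<in> {1..N} \<Longrightarrow> L2disc M \<rho> (\<lambda>t w. C *v dy i t w)" using L2disc_diff[OF z m] by simp
qed

text \<open>First-order optimality of the deviations: the noisy factor is y_i, the noise-free one P
  applied to the deviation of the difference.\<close>

lemma deviation_orthogonality:
  assumes i: "i \<in> {1..N}" and D: "L2disc M \<rho> (dy i)"
  shows "(\<integral>p. exp (- \<rho> * fst p) * ((P *v y i (fst p) (snd p)) \<bullet> (B *v dv i (fst p) (snd p)) - y i (fst p) (snd p) \<bullet> (Q *v dy i (fst p) (snd p)))
    \<partial>(lebh \<Otimes>\<^sub>M M)) = 0"
proof -
  let ?h = "\<lambda>t w. Abar *v y i t w" and ?Z = "\<lambda>t w. P *v dy i t w"
  let ?k = "\<lambda>t w. P *v (A *v dy i t w + B *v dv i t w)" and ?n = "\<lambda>t w. noise i t w - average N noise t w"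
  have n: "martingale_noise ?n" unfolding deviation_noise[OF i] by (rule combination_noise(1))
  have k: "L2disc M \<rho> ?k" by (intro L2disc_matrix L2disc_add D dv_L2disc i)
  have kF: "?k t \<in> borel_measurable (F t)" if "0 \<le> t" for t
    by (intro jmeas_adapted_matrix borel_measurable_add d_adapted that i)
  have x: "sq_integrable M (\<lambda>w. x0 i w - a0 w)" by (intro sq_integrable_diff a0_facts x0sq i)
  have yeq: "AE w in M. y i t w = (x0 i w - a0 w) + prim (\<lambda>r. ?h r w) t + ?n t w" if "0 \<le> t" for t
    using y_equation[OF i] by eventually_elim (use that in blast)
  have zeq: "AE w in M. ?Z t w = prim (\<lambda>r. ?k r w) t" if "0 \<le> t" for t
    using dy_equation[OF i]
  proof eventually_elim
    case (elim w)
    have e: "dy i t w = prim (\<lambda>r. A *v dy i r w + B *v dv i r w) t" "integrable (leb t) (\<lambda>r. A *v dy i r w + B *v dv i r w)"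
      using elim that by blast+
    show ?case unfolding prim_matrix[OF e(2)] by (rule arg_cong[OF e(1)])
  qed
  from infinite_horizon_orthogonality[OF yL[OF i] L2disc_matrix[OF D] L2disc_matrix[OF yL[OF i]] k x n kF yeq zeq \<rho>0]
  show ?thesis unfolding deviation_adjoint .
qed

text \<open>First-order optimality of the mean at the limit \<open>xbar\<close>. Here the costate is
  deterministic, so the noise is 0.\<close>

lemma mean_orthogonality:
  assumes D: "L2disc M \<rho> dm"
  shows "(\<integral>p. exp (- \<rho> * fst p) * (costate (fst p) \<bullet> (B *v dw (fst p) (snd p)) -
    (xbar (fst p) - \<Gamma> *v xbar (fst p) - \<eta> (fst p)) \<bullet> (Q *v (dm (fst p) (snd p) - \<Gamma> *v dm (fst p) (snd p)))) \<partial>(lebh \<Otimes>\<^sub>M M)) = 0"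
proof -
  let ?k = "\<lambda>t w. (A + G) *v dm t w + B *v dw t w"
  have k: "L2disc M \<rho> ?k" by (intro L2disc_matrix L2disc_add D dw_L2disc)
  have kF: "?k t \<in> borel_measurable (F t)" if "0 \<le> t" for t
    by (intro jmeas_adapted_matrix borel_measurable_add d_adapted that)
  have x: "sq_integrable M (\<lambda>w. costate 0)" by (rule sq_integrable_const[OF finite_measure_axioms])
  have ceq: "AE w in M. costate t = costate 0 + prim (\<lambda>r. costate' r) t + 0" if "0 \<le> t" for t
    using costate_prim[OF that] by simp
  have zeq: "AE w in M. dm t w = prim (\<lambda>r. ?k r w) t" if "0 \<le> t" for t
    using dm_equation by eventually_elim (use that in blast)
  from infinite_horizon_orthogonality[OF L2disc_det_intros(5) D L2disc_det_intros(6) k x martingale_noise_zero kF ceq zeq \<rho>0]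
  show ?thesis unfolding mean_adjoint .
qed

text \<open>R cancels its inverse in the gain, which matches the control part of the cost expansion
  with the adjoint identities.\<close>

lemma K_form: "(K *v z) \<bullet> (R *v w) = z \<bullet> (B *v w)"
proof -
  have sR: "transpose R = R" using R by (simp add: posdef_def)
  have "(K *v z) \<bullet> (R *v w) = (R *v (K *v z)) \<bullet> w" by (rule inner_symmetric_matrix[OF sR, symmetric])
  also have "R *v (K *v z) = transpose B *v z"
    unfolding K_def matrix_vector_mul_assoc[symmetric] by (rule posdef_inv_vec(1)[OF R])
  also have "\<dots> \<bullet> w = z \<bullet> (B *v w)" by (rule inner_matrix_vector_transpose[symmetric])
  finally show ?thesis .
qed

lemma form_add:
  fixes S :: "real^'k^'k"
  assumes "transpose S = S"
  shows "(a + b) \<bullet> (S *v (a + b)) = a \<bullet> (S *v a) + 2 * (a \<bullet> (S *v b)) + b \<bullet> (S *v b)"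
  using inner_symmetric_matrix[OF assms, of b a]
  by (simp add: matrix_vector_right_distrib inner_add_left inner_add_right inner_commute)

text \<open>An inequality at each time and sample point. Expanding the cost around the feedback, the
  first-order terms are those of the two orthogonality relations, except for the ones that pair e
  with the mean of the difference; these are absorbed by the second-order terms at the price b N
  |e|^2.\<close>

lemma cost_gap:
  assumes b: "\<And>z. (z - \<Gamma> *v z) \<bullet> (Q *v (z - \<Gamma> *v z)) + (K *v (P *v z)) \<bullet> (R *v (K *v (P *v z))) \<le> b * (norm z)\<^sup>2"
  shows "(\<Sum>i\<in>{1..N}. wnorm2 Q (tracking X i t w) + wnorm2 R (U i t w)) - real N * b * (norm (e t w))\<^sup>2
      - 2 * (\<Sum>i\<in>{1..N}. (P *v y i t w) \<bullet> (B *v dv i t w) - y i t w \<bullet> (Q *v dy i t w))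
      - 2 * real N * (costate t \<bullet> (B *v dw t w) - (xbar t - \<Gamma> *v xbar t - \<eta> t) \<bullet> (Q *v (dm t w - \<Gamma> *v dm t w)))
    \<le> (\<Sum>i\<in>{1..N}. wnorm2 Q (tracking x i t w) + wnorm2 R (u i t w))"
proof -
  have sR: "transpose R = R" using R by (simp add: posdef_def)
  define g where "g = e t w - \<Gamma> *v e t w"
  define d where "d = dm t w - \<Gamma> *v dm t w"
  define xb where "xb = xbar t - \<Gamma> *v xbar t - \<eta> t"
  define D where "D i t w = dy i t w + (dm t w - \<Gamma> *v dm t w)" for i t w
  have T: "tracking X i t w = y i t w + (g + xb)" for i
    unfolding tracking_X g_def xb_def by (rule add.assoc)
  have avT: "average N (tracking X) t w = g + xb"
  proof -
    have "tracking X = (\<lambda>i t w. y i t w + ((e t w - \<Gamma> *v e t w) + (xbar t - \<Gamma> *v xbar t - \<eta> t)))"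
      by (intro ext) (simp only: tracking_X add.assoc)
    hence "average N (tracking X) t w = average N y t w + ((e t w - \<Gamma> *v e t w) + (xbar t - \<Gamma> *v xbar t - \<eta> t))"
      by (simp only: average_add average_const[OF N])
    thus ?thesis by (simp only: average_y g_def xb_def add_0_left)
  qed
  have avD: "average N D t w = d"
  proof -
    have "average N dy t w = 0"
      using N unfolding dy_def[abs_def] by (simp add: average_diff average_const dm_def)
    thus ?thesis unfolding D_def[abs_def] average_add average_const[OF N] d_def by simp
  qed
  have tx: "tracking x i t w = tracking X i t w + D i t w" for i
    using tracking_difference[of i t w] by (simp add: D_def algebra_simps)
  have ux: "u i t w = U i t w + du i t w" for i by (simp add: du_def)
  have Tdev: "tracking X i t w - (g + xb) = y i t w" and Ddev: "D i t w - d = dy i t w" for i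
    by (simp_all add: T D_def d_def)
  have Udev: "U i t w - average N U t w = - (K *v (P *v y i t w))" for i
    unfolding U_eq average_U by (simp add: matrix_vector_right_distrib)
  have dudev: "du i t w - average N du t w = dv i t w" for i by (simp add: dv_def dw_def)
  have Q1: "(\<Sum>i\<in>{1..N}. tracking X i t w \<bullet> (Q *v D i t w)) = (\<Sum>i\<in>{1..N}. y i t w \<bullet> (Q *v dy i t w)) + real N * ((g + xb) \<bullet> (Q *v d))"
    unfolding sum_form_average[OF N, of "tracking X"] avT avD Tdev Ddev ..
  \<comment> \<open>Only the mean part of the quadratic terms is kept: it has the same factor N as
    the cross terms with e.\<close>
  have Q2: "real N * (d \<bullet> (Q *v d)) \<le> (\<Sum>i\<in>{1..N}. D i t w \<bullet> (Q *v D i t w))"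
    using sum_form_average_ge[OF N, of Q D t w] wnorm2_nonneg(1) unfolding avD wnorm2_def by blast
  have R1: "(\<Sum>i\<in>{1..N}. U i t w \<bullet> (R *v du i t w))
    = - (\<Sum>i\<in>{1..N}. (P *v y i t w) \<bullet> (B *v dv i t w)) - real N * ((P *v e t w + costate t) \<bullet> (B *v dw t w))"
    unfolding sum_form_average[OF N, of U] Udev dudev unfolding average_U dw_def[symmetric] inner_minus_left K_form sum_negf by simp
  have R2: "real N * (dw t w \<bullet> (R *v dw t w)) \<le> (\<Sum>i\<in>{1..N}. du i t w \<bullet> (R *v du i t w))"
    using sum_form_average_ge[OF N, of R du t w] wnorm2_nonneg(2) unfolding dw_def wnorm2_def by blast
  \<comment> \<open>Nonnegativity of Q at g + d and of R at the combined controls bounds the two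
    cross terms from below by forms in e alone.\<close>
  have "0 \<le> (g + d) \<bullet> (Q *v (g + d))" using wnorm2_nonneg(1) by (simp only: wnorm2_def)
  hence c1: "0 \<le> g \<bullet> (Q *v g) + 2 * (g \<bullet> (Q *v d)) + d \<bullet> (Q *v d)" unfolding form_add[OF symQ] .
  have "0 \<le> (- (K *v (P *v e t w)) + dw t w) \<bullet> (R *v (- (K *v (P *v e t w)) + dw t w))" using wnorm2_nonneg(2) by (simp only: wnorm2_def)
  hence c2: "0 \<le> (K *v (P *v e t w)) \<bullet> (R *v (K *v (P *v e t w))) - 2 * ((P *v e t w) \<bullet> (B *v dw t w)) + dw t w \<bullet> (R *v dw t w)"
    unfolding form_add[OF sR] by (simp add: K_form linear_neg[OF matrix_vector_mul_linear])
  have "- (b * (norm (e t w))\<^sup>2) \<le> 2 * (g \<bullet> (Q *v d)) + d \<bullet> (Q *v d) - 2 * ((P *v e t w) \<bullet> (B *v dw t w)) + dw t w \<bullet> (R *v dw t w)"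
    using b[of "e t w"] c1 c2 unfolding g_def[symmetric] by linarith
  from mult_left_mono[OF this, of "real N"]
  have c: "- (real N * b * (norm (e t w))\<^sup>2) \<le> 2 * (real N * (g \<bullet> (Q *v d))) + real N * (d \<bullet> (Q *v d))
    - 2 * (real N * ((P *v e t w) \<bullet> (B *v dw t w))) + real N * (dw t w \<bullet> (R *v dw t w))"
    by (simp add: algebra_simps)
  have "(\<Sum>i\<in>{1..N}. wnorm2 Q (tracking x i t w) + wnorm2 R (u i t w)) = (\<Sum>i\<in>{1..N}. wnorm2 Q (tracking X i t w) + wnorm2 R (U i t w))
    + 2 * (\<Sum>i\<in>{1..N}. tracking X i t w \<bullet> (Q *v D i t w)) + (\<Sum>i\<in>{1..N}. D i t w \<bullet> (Q *v D i t w))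
    + 2 * (\<Sum>i\<in>{1..N}. U i t w \<bullet> (R *v du i t w)) + (\<Sum>i\<in>{1..N}. du i t w \<bullet> (R *v du i t w))"
    unfolding tx ux wnorm2_def form_add[OF symQ] form_add[OF sR] by (simp only: sum.distrib sum_distrib_left[symmetric])
  thus ?thesis using Q1 Q2 R1 R2 c unfolding d_def[symmetric] xb_def[symmetric]
    by (simp add: sum_subtractf inner_add_left algebra_simps)
qed

text \<open>\<open>cost_gap\<close> integrated. The multiplier N meets a mean error of order 1/N, so
  the total loss is a constant.\<close>

lemma cost_lower_bound:
  assumes dmL: "L2disc M \<rho> dm" and dyL: "\<And>i. i \<in> {1..N} \<Longrightarrow> L2disc M \<rho> (dy i)"
    and b: "\<And>z. (z - \<Gamma> *v z) \<bullet> (Q *v (z - \<Gamma> *v z)) + (K *v (P *v z)) \<bullet> (R *v (K *v (P *v z))) \<le> b * (norm z)\<^sup>2" "0 \<le> b"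
    and eb: "(\<integral>p. exp (- \<rho> * fst p) * (norm (e (fst p) (snd p)))\<^sup>2 \<partial>(lebh \<Otimes>\<^sub>M M)) \<le> \<beta> / real N"
  shows "social_cost \<rho> \<Gamma> Q R \<eta> N M U X \<le> social_cost \<rho> \<Gamma> Q R \<eta> N M u x + ennreal (b * \<beta>)"
proof -
  let ?L = "lebh \<Otimes>\<^sub>M M"
  let ?c = "\<lambda>i. cost_density U X i" and ?d = "\<lambda>i. cost_density u x i"
  note fU = finite_agent_cost[where x = X and u = U, OF XJ UJ _ L2disc_agent_cost[where x = X and u = U, OF XJ _ closed_loop_L2disc(2,1)[OF eL yL]]]
  note fu = finite_agent_cost[where x = x and u = u, OF xJ uJ _ L2disc_agent_cost[where x = x and u = u, OF xJ _ xL uL]]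
  have cU: "integrable ?L (?c i)" "agent_cost \<rho> \<Gamma> Q R \<eta> N M U X i = ennreal (integral\<^sup>L ?L (?c i))" if "i \<in> {1..N}" for i
    using fU(1,2)[where i = i] that by blast+
  have cu: "integrable ?L (?d i)" "agent_cost \<rho> \<Gamma> Q R \<eta> N M u x i = ennreal (integral\<^sup>L ?L (?d i))" if "i \<in> {1..N}" for i
    using fu(1,2)[where i = i] that by blast+
  let ?o = "\<lambda>i p. exp (- \<rho> * fst p) * ((P *v y i (fst p) (snd p)) \<bullet> (B *v dv i (fst p) (snd p)) - y i (fst p) (snd p) \<bullet> (Q *v dy i (fst p) (snd p)))"
  let ?m = "\<lambda>p. exp (- \<rho> * fst p) * (costate (fst p) \<bullet> (B *v dw (fst p) (snd p)) -
    (xbar (fst p) - \<Gamma> *v xbar (fst p) - \<eta> (fst p)) \<bullet> (Q *v (dm (fst p) (snd p) - \<Gamma> *v dm (fst p) (snd p))))"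
  let ?e = "\<lambda>p. exp (- \<rho> * fst p) * (norm (e (fst p) (snd p)))\<^sup>2"
  have o: "integrable ?L (?o i)" if "i \<in> {1..N}" for i
    unfolding right_diff_distrib
    by (intro Bochner_Integration.integrable_diff L2disc_inner L2disc_matrix yL dyL dv_L2disc that)
  have m: "integrable ?L ?m"
    unfolding right_diff_distrib
    by (intro Bochner_Integration.integrable_diff L2disc_inner[of M \<rho> "\<lambda>t w. costate t"]
       L2disc_inner[of M \<rho> "\<lambda>t w. xbar t - \<Gamma> *v xbar t - \<eta> t"] L2disc_matrix L2disc_diff L2disc_det_intros dw_L2disc dmL)
  have e: "integrable ?L ?e" using L2disc_inner[OF eL eL] by (simp only: power2_norm_eq_inner)
  let ?lhs = "\<lambda>p. (\<Sum>i\<in>{1..N}. ?c i p) - real N * b * ?e p - 2 * (\<Sum>i\<in>{1..N}. ?o i p) - 2 * real N * ?m p"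
  have I: "integrable ?L ?lhs"
    by (intro Bochner_Integration.integrable_diff Bochner_Integration.integrable_sum integrable_mult_right cU o m e)
  have le: "?lhs p \<le> (\<Sum>i\<in>{1..N}. ?d i p)" for p
    using mult_left_mono[OF cost_gap[OF b(1), of "fst p" "snd p"], of "exp (- \<rho> * fst p)"]
    unfolding cost_density_def sum_distrib_left[symmetric] by (simp add: algebra_simps)
  \<comment> \<open>By orthogonality the cross terms integrate to 0 and may be inserted
    freely.\<close>
  have "(\<Sum>i\<in>{1..N}. integral\<^sup>L ?L (?c i)) - real N * b * integral\<^sup>L ?L ?e
    = (\<Sum>i\<in>{1..N}. integral\<^sup>L ?L (?c i)) - real N * b * integral\<^sup>L ?L ?e - 2 * (\<Sum>i\<in>{1..N}. integral\<^sup>L ?L (?o i)) - 2 * real N * integral\<^sup>L ?L ?m"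
    using mean_orthogonality[OF dmL] deviation_orthogonality[OF _ dyL] by simp
  also have "\<dots> = integral\<^sup>L ?L ?lhs"
    using cU o m e by (simp only: Bochner_Integration.integral_diff Bochner_Integration.integral_sum Bochner_Integration.integral_mult_right
       Bochner_Integration.integrable_diff Bochner_Integration.integrable_sum integrable_mult_right)
  also have "\<dots> \<le> (\<integral>p. (\<Sum>i\<in>{1..N}. ?d i p) \<partial>?L)"
    by (rule integral_mono[OF I _ le]) (intro Bochner_Integration.integrable_sum cu)
  also have "\<dots> = (\<Sum>i\<in>{1..N}. integral\<^sup>L ?L (?d i))" by (rule Bochner_Integration.integral_sum) (rule cu)
  finally have "(\<Sum>i\<in>{1..N}. integral\<^sup>L ?L (?c i)) \<le> (\<Sum>i\<in>{1..N}. integral\<^sup>L ?L (?d i)) + real N * b * integral\<^sup>L ?L ?e" by simp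
  \<comment> \<open>Here N cancels.\<close>
  also have "real N * b * integral\<^sup>L ?L ?e \<le> real N * b * (\<beta> / real N)" using eb b(2) by (intro mult_left_mono) auto
  finally have S: "(\<Sum>i\<in>{1..N}. integral\<^sup>L ?L (?c i)) \<le> (\<Sum>i\<in>{1..N}. integral\<^sup>L ?L (?d i)) + b * \<beta>" using N by simp
  have nn: "0 \<le> integral\<^sup>L ?L (?c i)" "0 \<le> integral\<^sup>L ?L (?d i)" for i
    by (intro Bochner_Integration.integral_nonneg cost_density_nonneg)+
  have "0 \<le> integral\<^sup>L ?L ?e" by simp
  with eb N have "0 \<le> \<beta>" using order_trans[OF \<open>0 \<le> integral\<^sup>L ?L ?e\<close> eb] by (simp add: zero_le_divide_iff)
  have "social_cost \<rho> \<Gamma> Q R \<eta> N M U X = ennreal (\<Sum>i\<in>{1..N}. integral\<^sup>L ?L (?c i))"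
    unfolding social_cost_def using nn cU by (simp add: sum_ennreal)
  also have "\<dots> \<le> ennreal ((\<Sum>i\<in>{1..N}. integral\<^sup>L ?L (?d i)) + b * \<beta>)" by (rule ennreal_leI[OF S])
  also have "\<dots> = ennreal (\<Sum>i\<in>{1..N}. integral\<^sup>L ?L (?d i)) + ennreal (b * \<beta>)"
    using nn b(2) \<open>0 \<le> \<beta>\<close> by (intro ennreal_plus sum_nonneg) auto
  also have "ennreal (\<Sum>i\<in>{1..N}. integral\<^sup>L ?L (?d i)) = social_cost \<rho> \<Gamma> Q R \<eta> N M u x"
    unfolding social_cost_def using nn cu by (simp add: sum_ennreal)
  finally show ?thesis .
qed

end

section \<open>The centralized control problem\<close>

lemma space_central_filtration: "space (central_filtration N M x0 W t) = space M"
  by (simp add: central_filtration_def space_measure_of_conv)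

lemma sets_agent_filtration:
  "sets (agent_filtration M x0 W t) = sigma_sets (space M) ({x0 -` S \<inter> space M | S. S \<in> sets borel} \<union>
      {W r -` S \<inter> space M | r S. 0 \<le> r \<and> r \<le> t \<and> S \<in> sets borel})"
  unfolding agent_filtration_def by (rule sets_measure_of) auto

lemma sets_central_filtration:
  "sets (central_filtration N M x0 W t) = sigma_sets (space M) (\<Union>j\<in>{1..N}. sets (agent_filtration M (x0 j) (W j) t))"
  unfolding central_filtration_def
proof (rule sets_measure_of)
  have "sets (agent_filtration M (x0 j) (W j) t) \<subseteq> Pow (space M)" for j
    using sets.space_closed[of "agent_filtration M (x0 j) (W j) t"] by (simp add: agent_filtration_def space_measure_of_conv)
  thus "(\<Union>j\<in>{1..N}. sets (agent_filtration M (x0 j) (W j) t)) \<subseteq> Pow (space M)" by blast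
qed

lemma central_filtration_subset:
  assumes sp: "space S = space M" and x0: "\<And>j. j \<in> {1..N} \<Longrightarrow> x0 j \<in> borel_measurable S"
    and W: "\<And>j r. j \<in> {1..N} \<Longrightarrow> 0 \<le> r \<Longrightarrow> r \<le> t \<Longrightarrow> W j r \<in> borel_measurable S"
  shows "sets (central_filtration N M x0 W t) \<subseteq> sets S"
proof -
  have "sets (agent_filtration M (x0 j) (W j) t) \<subseteq> sets S" if j: "j \<in> {1..N}" for j
    unfolding sets_agent_filtration sp[symmetric]
    by (rule sets.sigma_sets_subset) (use measurable_sets[OF x0[OF j]] measurable_sets[OF W[OF j]] in auto)
  thus ?thesis unfolding sets_central_filtration sp[symmetric] by (intro sets.sigma_sets_subset) blast
qed

lemma central_filtration_measurable:
  assumes j: "j \<in> {1..N}"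
  shows "x0 j \<in> borel_measurable (central_filtration N M x0 W t)"
    "0 \<le> r \<Longrightarrow> r \<le> t \<Longrightarrow> W j r \<in> borel_measurable (central_filtration N M x0 W t)"
proof -
  have sub: "S \<in> sets (central_filtration N M x0 W t)" if "S \<in> {x0 j -` S \<inter> space M | S. S \<in> sets borel} \<union>
      {W j r -` S \<inter> space M | r S. 0 \<le> r \<and> r \<le> t \<and> S \<in> sets borel}" for S
    unfolding sets_central_filtration
    by (rule sigma_sets.Basic, rule UN_I[OF j], unfold sets_agent_filtration, rule sigma_sets.Basic, rule that)
  show "x0 j \<in> borel_measurable (central_filtration N M x0 W t)"
    by (rule measurableI) (simp, unfold space_central_filtration, rule sub, blast)
  show "0 \<le> r \<Longrightarrow> r \<le> t \<Longrightarrow> W j r \<in> borel_measurable (central_filtration N M x0 W t)"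
    by (rule measurableI) (simp, unfold space_central_filtration, rule sub, blast)
qed

lemma is_state_cong:
  assumes st: "is_state A B G f \<sigma> N M F W x0 u x"
    and eq: "AE w in M. \<forall>i\<in>{1..N}. \<forall>t\<ge>0. u' i t w = u i t w"
  shows "is_state A B G f \<sigma> N M F W x0 u' x"
  unfolding is_state_def
proof (intro ballI conjI allI impI)
  fix i assume i: "i \<in> {1..N}"
  show "x i t \<in> borel_measurable (F t)" if "0 \<le> t" for t using st i that by (simp add: is_state_def)
  show "AE w in M. continuous_on {0..} (\<lambda>t. x i t w)" using st i by (simp add: is_state_def)
  fix t :: real assume t: "0 \<le> t"
  obtain I where I: "is_ito_integral M (W i) \<sigma> t I" and ae: "AE w in M. set_integrable lborel {0..t} (\<lambda>r. drift A B G f N x u i r w) \<and>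
      x i t w = x0 i w + (LINT r:{0..t}|lborel. drift A B G f N x u i r w) + I w"
    using st i t unfolding is_state_def by blast
  have "AE w in M. set_integrable lborel {0..t} (\<lambda>r. drift A B G f N x u' i r w) \<and>
      x i t w = x0 i w + (LINT r:{0..t}|lborel. drift A B G f N x u' i r w) + I w"
    using ae eq
  proof eventually_elim
    case (elim w)
    have d: "indicator {0..t} r *\<^sub>R drift A B G f N x u' i r w = indicator {0..t} r *\<^sub>R drift A B G f N x u i r w" for r
      using elim(2) i by (cases "r \<in> {0..t}") (auto simp: drift_def)
    show ?case using elim(1) unfolding set_integrable_def set_lebesgue_integral_def d .
  qed
  with I show "\<exists>I. is_ito_integral M (W i) \<sigma> t I \<and> (AE w in M. set_integrable lborel {0..t} (\<lambda>r. drift A B G f N x u' i r w) \<and>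
      x i t w = x0 i w + (LINT r:{0..t}|lborel. drift A B G f N x u' i r w) + I w)" by blast
qed

lemma jmeas_iff: "jmeas M X \<longleftrightarrow> (\<lambda>(t, w). X t w) \<in> borel_measurable (restrict_space borel {0..} \<Otimes>\<^sub>M M)"
proof -
  have "sets (lebh \<Otimes>\<^sub>M M) = sets (restrict_space borel {0..} \<Otimes>\<^sub>M M)"
    by (intro sets_pair_measure_cong sets_restrict_space_cong) auto
  note eq = measurable_cong_sets[OF this refl]
  show ?thesis unfolding jmeas_def split_beta' eq ..
qed

context closed_loop begin

abbreviation H where "H \<equiv> central_filtration N M x0 W"

lemma W_measurable: "j \<in> {1..N} \<Longrightarrow> 0 \<le> r \<Longrightarrow> W j r \<in> borel_measurable (F r)"
  using W by (simp add: brownian_motion_def)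

lemma F_measurable_mono: "g \<in> borel_measurable (F r) \<Longrightarrow> 0 \<le> r \<Longrightarrow> r \<le> t \<Longrightarrow> g \<in> borel_measurable (F t)"
  using filtration_F by (auto simp: filtration_def measurable_def space_F)

lemma H_subset_F: "0 \<le> t \<Longrightarrow> sets (H t) \<subseteq> sets (F t)"
  by (rule central_filtration_subset[OF space_F F_measurable_mono[OF x0F] F_measurable_mono[OF W_measurable]]) auto

lemma H_measurable_F: "g \<in> borel_measurable (H t) \<Longrightarrow> 0 \<le> t \<Longrightarrow> g \<in> borel_measurable (F t)"
  using H_subset_F[of t] by (auto simp: measurable_def space_F space_central_filtration)

lemma F_measurable_M: "g \<in> borel_measurable (F t) \<Longrightarrow> g \<in> borel_measurable M"
  using sets_F_subset[of t] by (auto simp: measurable_def space_F)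

sublocale central: subfiltration M F H
proof unfold_locales
  show "space (H t) = space M" for t by (rule space_central_filtration)
  show "sets (H t) \<subseteq> sets M" for t
    by (rule central_filtration_subset[OF refl x0_measurable F_measurable_M[OF W_measurable]])
  show "sets (H s) \<subseteq> sets (H t)" if "s \<le> t" for s t
    by (rule central_filtration_subset[OF space_central_filtration central_filtration_measurable])
       (use that in auto)
qed

lemma noise_has_version:
  assumes i: "i \<in> {1..N}" and t: "0 \<le> t"
  shows "has_version M (H t) (noise i t)"
  by (rule central.ito_has_version[OF W[OF i] central_filtration_measurable(2)[OF i _ order_refl]
     measurable_leb_lebh[OF continuous_on_measurable_lebh[OF C_half_continuous[OF Ch(2)]]] noise_facts(3)[OF i t]])

lemma has_version_average: "(\<And>i. i \<in> {1..N} \<Longrightarrow> has_version M S (\<lambda>w. a i t w)) \<Longrightarrow> has_version M S (\<lambda>w. average N a t w)"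
  unfolding average_def by (intro has_version_scaleR has_version_sum)

lemma average_noise_continuous: "AE w in M. continuous_on {0..} (\<lambda>t. average N noise t w)"
proof -
  have "AE w in M. \<forall>i\<in>{1..N}. continuous_on {0..} (\<lambda>t. noise i t w)"
    by (rule AE_ball_finite_all) (auto intro: noise_continuous)
  thus ?thesis by eventually_elim (auto simp: average_def intro!: continuous_intros)
qed

lemma initial_has_version: "has_version M (H t) a0" "i \<in> {1..N} \<Longrightarrow> has_version M (H t) (x0 i)"
proof -
  show x: "i \<in> {1..N} \<Longrightarrow> has_version M (H t) (x0 i)" for i
    by (intro has_version_measurable central_filtration_measurable(1))
  have "a0 = (\<lambda>w. (1 / real N) *\<^sub>R (\<Sum>j\<in>{1..N}. x0 j w))" by (simp add: fun_eq_iff a0_def average_def)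
  thus "has_version M (H t) a0" by (simp only:) (intro has_version_scaleR has_version_sum x)
qed

lemma e_has_version:
  assumes t: "0 \<le> t"
  shows "has_version M (H t) (e t)"
proof -
  let ?n = "\<lambda>t w. (a0 w - xbar0) + average N noise t w"
  have v: "has_version M (H t) (?n t)" if "0 \<le> t" for t
    using that by (intro has_version_add has_version_diff has_version_const initial_has_version has_version_average noise_has_version)
  have c: "AE w in M. continuous_on {0..} (\<lambda>t. ?n t w)"
    using average_noise_continuous by eventually_elim (intro continuous_intros)
  have "AE w in M. \<forall>t\<ge>0. e t w = ?n t w + prim (\<lambda>r. (Abar + G) *v e r w) t"
    using e_equation by eventually_elim (simp add: algebra_simps)
  from central.linear_volterra_has_version[OF v c e_continuous this t] show ?thesis .
qed

lemma y_has_version: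
  assumes i: "i \<in> {1..N}" and t: "0 \<le> t"
  shows "has_version M (H t) (y i t)"
proof -
  let ?n = "\<lambda>t w. (x0 i w - a0 w) + (noise i t w - average N noise t w)"
  have v: "has_version M (H t) (?n t)" if "0 \<le> t" for t
    using that i by (intro has_version_add has_version_diff initial_has_version has_version_average noise_has_version)
  have c: "AE w in M. continuous_on {0..} (\<lambda>t. ?n t w)"
    using average_noise_continuous noise_continuous[OF i] by eventually_elim (intro continuous_intros)
  have "AE w in M. \<forall>t\<ge>0. y i t w = ?n t w + prim (\<lambda>r. Abar *v y i r w) t"
    using y_equation[OF i] by eventually_elim (simp add: algebra_simps)
  from central.linear_volterra_has_version[OF v c y_continuous[OF i] this t] show ?thesis .
qed

text \<open>The feedback is adapted to the augmented filtration only; since it is driven by the initial states and the Brownian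
  motions, it is indistinguishable from a control adapted to the unaugmented one.\<close>

lemma optimal_le_closed_loop:
  assumes Le: "L2disc M \<rho> e" and Ly: "\<And>i. i \<in> {1..N} \<Longrightarrow> L2disc M \<rho> (y i)"
  shows "optimal_social_cost \<rho> A B G \<Gamma> Q R f \<sigma> \<eta> N M F W x0 \<le> social_cost \<rho> \<Gamma> Q R \<eta> N M U X"
proof -
  have "\<exists>V. jmeas M V \<and> (\<forall>t\<ge>0. V t \<in> borel_measurable (H t)) \<and> (AE w in M. \<forall>t\<ge>0. V t w = U i t w)" if i: "i \<in> {1..N}" for i
  proof -
    have U': "U i = (\<lambda>t w. (- K) *v (P *v y i t w + P *v e t w + costate t))"
      by (simp add: fun_eq_iff U_eq uminus_matrix_vector_mult)
    have v: "has_version M (H t) (U i t)" if "0 \<le> t" for t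
      unfolding U' using that i
      by (intro has_version_matrix has_version_add has_version_const y_has_version e_has_version)
    have cc: "continuous_on {0..} costate"
      unfolding costate_def[abs_def]
      by (intro continuous_intros C_half_continuous[OF Ch(4)]
          continuous_on_compose2[OF matrix_vector_mult_linear_continuous_on[of UNIV] C_half_continuous[OF Ch(5)]]) auto
    have mc: "continuous_on {0..} (\<lambda>t. Z *v h t)" if "continuous_on {0..} h" for Z :: "real^'m^'k" and h :: "real \<Rightarrow> real^'m"
      by (rule continuous_on_compose2[OF matrix_vector_mult_linear_continuous_on[of UNIV Z] that]) auto
    have c: "AE w in M. continuous_on {0..} (\<lambda>t. U i t w)"
      using y_continuous[OF i] e_continuous unfolding U'
      by eventually_elim (intro continuous_on_add mc cc)
    obtain V where "jmeas M V" "\<forall>t\<ge>0. V t \<in> borel_measurable (H t)"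
      "\<forall>t\<ge>0. (\<lambda>p. V (fst p) (snd p)) \<in> borel_measurable (leb t \<Otimes>\<^sub>M H t)" "AE w in M. \<forall>t\<ge>0. V t w = U i t w"
      by (rule central.nice_version[OF v c])
    thus ?thesis by (intro exI[of _ V] conjI)
  qed
  hence "\<forall>i\<in>{1..N}. \<exists>V. jmeas M V \<and> (\<forall>t\<ge>0. V t \<in> borel_measurable (H t)) \<and> (AE w in M. \<forall>t\<ge>0. V t w = U i t w)" by blast
  from bchoice[OF this] obtain V where V: "\<And>i. i \<in> {1..N} \<Longrightarrow> jmeas M (V i)"
    "\<And>i t. i \<in> {1..N} \<Longrightarrow> 0 \<le> t \<Longrightarrow> V i t \<in> borel_measurable (H t)" "\<And>i. i \<in> {1..N} \<Longrightarrow> AE w in M. \<forall>t\<ge>0. V i t w = U i t w"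
    by blast
  have VU: "AE w in M. \<forall>i\<in>{1..N}. \<forall>t\<ge>0. V i t w = U i t w" by (rule AE_ball_finite_all) (auto intro: V(3))
  hence Vh: "AE w in M. \<forall>i\<in>{1..N}. \<forall>t\<ge>0. V i t w = decentralized_control B R P \<Pi>\<^sub>m xbar s xh i t w"
    using Ueq by eventually_elim simp
  have "(\<integral>\<^sup>+w. (\<integral>\<^sup>+t\<in>{0..}. ennreal (exp (- \<rho> * t) * (norm (V i t w))\<^sup>2) \<partial>lborel) \<partial>M) < \<infinity>" if i: "i \<in> {1..N}" for i
  proof -
    have "(\<integral>\<^sup>+w. (\<integral>\<^sup>+t\<in>{0..}. ennreal (exp (- \<rho> * t) * (norm (V i t w))\<^sup>2) \<partial>lborel) \<partial>M)
      = (\<integral>\<^sup>+w. (\<integral>\<^sup>+t. ennreal (exp (- \<rho> * t) * (norm (U i t w))\<^sup>2) \<partial>lebh) \<partial>M)"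
    proof (rule nn_integral_cong_AE)
      show "AE w in M. (\<integral>\<^sup>+t\<in>{0..}. ennreal (exp (- \<rho> * t) * (norm (V i t w))\<^sup>2) \<partial>lborel)
        = (\<integral>\<^sup>+t. ennreal (exp (- \<rho> * t) * (norm (U i t w))\<^sup>2) \<partial>lebh)"
        using V(3)[OF i]
      proof eventually_elim
        case (elim w)
        have "(\<integral>\<^sup>+t. ennreal (exp (- \<rho> * t) * (norm (U i t w))\<^sup>2) \<partial>lebh) = (\<integral>\<^sup>+t. ennreal (exp (- \<rho> * t) * (norm (V i t w))\<^sup>2) \<partial>lebh)"
          by (rule nn_integral_cong) (use elim in \<open>simp add: space_restrict_space\<close>)
        thus ?case by (simp add: nn_integral_restrict_space)
      qed
    qed
    thus ?thesis using closed_loop_L2disc(1)[OF Le Ly[OF i]] unfolding L2disc_iff_nn by simp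
  qed
  hence "V \<in> central_controls \<rho> N M x0 W"
    using V(1,2) unfolding central_controls_def jmeas_iff by blast
  moreover have "is_state A B G f \<sigma> N M F W x0 V xh" by (rule is_state_cong[OF st Vh])
  moreover have "social_cost \<rho> \<Gamma> Q R \<eta> N M U X = social_cost \<rho> \<Gamma> Q R \<eta> N M V xh"
  proof -
    have "AE w in M. \<forall>i\<in>{1..N}. \<forall>t\<ge>0. U i t w = V i t w" using VU by eventually_elim simp
    show ?thesis unfolding social_cost_def by (rule sum.cong[OF refl agent_cost_cong[OF Xeq \<open>AE w in M. \<forall>i\<in>{1..N}. \<forall>t\<ge>0. U i t w = V i t w\<close>]])
  qed
  ultimately show ?thesis unfolding optimal_social_cost_def by (intro Inf_lower) blast
qed

text \<open>The bound against each competitor, passed to the infimum. Y detects the deviations of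
  the state difference, Z its mean.\<close>

lemma closed_loop_le_optimal:
  assumes Le: "L2disc M \<rho> e" and Ly: "\<And>i. i \<in> {1..N} \<Longrightarrow> L2disc M \<rho> (y i)"
    and Y: "psd Y" "0 \<le> \<kappa>" "\<And>x. 2 * ((Y *v x) \<bullet> (A *v x)) - \<rho> * (x \<bullet> (Y *v x)) \<le> \<kappa> * (norm (C *v x))\<^sup>2 - (norm x)\<^sup>2"
    and Z: "psd Z" "0 \<le> \<kappa>'" "\<And>x. 2 * ((Z *v x) \<bullet> ((A + G) *v x)) - \<rho> * (x \<bullet> (Z *v x)) \<le> \<kappa>' * (norm ((C ** (mat 1 - \<Gamma>)) *v x))\<^sup>2 - (norm x)\<^sup>2"
    and b: "\<And>z. (z - \<Gamma> *v z) \<bullet> (Q *v (z - \<Gamma> *v z)) + (K *v (P *v z)) \<bullet> (R *v (K *v (P *v z))) \<le> b * (norm z)\<^sup>2" "0 \<le> b"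
    and eb: "(\<integral>p. exp (- \<rho> * fst p) * (norm (e (fst p) (snd p)))\<^sup>2 \<partial>(lebh \<Otimes>\<^sub>M M)) \<le> \<beta> / real N"
  shows "social_cost \<rho> \<Gamma> Q R \<eta> N M U X \<le> optimal_social_cost \<rho> A B G \<Gamma> Q R f \<sigma> \<eta> N M F W x0 + ennreal (b * \<beta>)"
proof -
  let ?c = "ennreal (b * \<beta>)"
  have "social_cost \<rho> \<Gamma> Q R \<eta> N M U X \<le> social_cost \<rho> \<Gamma> Q R \<eta> N M u x + ?c"
    if u: "u \<in> central_controls \<rho> N M x0 W" and x: "is_state A B G f \<sigma> N M F W x0 u x" for u x
  \<comment> \<open>A competitor of infinite cost satisfies the bound trivially; a finite cost
    supplies the integrability demanded by \<open>comparison\<close>.\<close>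
  proof (cases "social_cost \<rho> \<Gamma> Q R \<eta> N M u x < \<infinity>")
    case True
    obtain x' where x': "\<forall>i\<in>{1..N}. jmeas M (x' i)" "\<forall>i\<in>{1..N}. \<forall>t\<ge>0. x' i t \<in> borel_measurable (F t)"
      "AE w in M. \<forall>i\<in>{1..N}. \<forall>t\<ge>0. x' i t w = x i t w" "AE w in M. \<forall>i\<in>{1..N}. continuous_on {0..} (\<lambda>t. x' i t w)"
      by (rule nice_versions[OF x])
    have ac: "agent_cost \<rho> \<Gamma> Q R \<eta> N M u x' i = agent_cost \<rho> \<Gamma> Q R \<eta> N M u x i" if "i \<in> {1..N}" for i
      by (rule agent_cost_cong[OF x'(3) _ that]) simp
    hence sc: "social_cost \<rho> \<Gamma> Q R \<eta> N M u x' = social_cost \<rho> \<Gamma> Q R \<eta> N M u x"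
      unfolding social_cost_def by (rule sum.cong[OF refl])
    have fin: "agent_cost \<rho> \<Gamma> Q R \<eta> N M u x' i < \<infinity>" if "i \<in> {1..N}" for i
      using True that unfolding social_cost_def ac[OF that] by (simp add: less_top[symmetric])
    have uJ: "jmeas M (u i)" if "i \<in> {1..N}" for i using u that unfolding central_controls_def jmeas_iff by blast
    have uF: "u i t \<in> borel_measurable (F t)" if "i \<in> {1..N}" "0 \<le> t" for i t
      by (rule H_measurable_F) (use u that in \<open>auto simp: central_controls_def\<close>)
    have xJ: "jmeas M (x' i)" if "i \<in> {1..N}" for i using x'(1) that by blast
    note fc = finite_agent_cost[where x = x' and u = u, OF xJ uJ _ fin]
    interpret D: comparison M F N W x0 A G \<Gamma> Q P \<Pi>\<^sub>m C B R f \<sigma> \<eta> s xbar xbar0 \<rho> C0 xh X u x' x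
    proof unfold_locales
      show "i \<in> {1..N} \<Longrightarrow> L2disc M \<rho> (u i)" for i using fc(4)[where i = i] by blast
      show "i \<in> {1..N} \<Longrightarrow> L2disc M \<rho> (\<lambda>t w. C *v tracking x' i t w)" for i using fc(3)[where i = i] by blast
    qed (use x x' uJ uF Le Ly in blast)+
    have dm: "L2disc M \<rho> D.dm"
      by (rule controlled_L2disc[OF D.dx_jmeas(2) D.d_adapted(1) D.d_continuous(1) D.dw_L2disc D.d_adapted(2) D.dm_equation D.output_L2disc(1) Z \<rho>0])
    have dy: "L2disc M \<rho> (D.dy i)" if i: "i \<in> {1..N}" for i
      by (rule controlled_L2disc[OF D.dx_jmeas(3)[OF i] D.d_adapted(3)[OF _ i] D.d_continuous(2)[OF i] D.dv_L2disc[OF i] D.d_adapted(4)[OF _ i]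
        D.dy_equation[OF i] D.output_L2disc(2)[OF i] Y \<rho>0])
    show ?thesis using D.cost_lower_bound[OF dm dy b eb] unfolding sc .
  qed (simp add: less_top[symmetric])
  \<comment> \<open>Moving the constant to the left turns the bounds into one lower bound of the
    whole set, as the infimum requires.\<close>
  hence "social_cost \<rho> \<Gamma> Q R \<eta> N M U X - ?c \<le> optimal_social_cost \<rho> A B G \<Gamma> Q R f \<sigma> \<eta> N M F W x0"
    unfolding optimal_social_cost_def by (intro Inf_greatest) (auto simp: ennreal_minus_le_iff add.commute)
  thus ?thesis by (simp add: ennreal_minus_le_iff add.commute)
qed

lemma social_cost_U_X: "social_cost \<rho> \<Gamma> Q R \<eta> N M U X = social_cost \<rho> \<Gamma> Q R \<eta> N M (decentralized_control B R P \<Pi>\<^sub>m xbar s xh) xh"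
  unfolding social_cost_def by (rule sum.cong[OF refl agent_cost_cong[OF Xeq Ueq]])

lemma social_cost_finite:
  assumes Le: "L2disc M \<rho> e" and Ly: "\<And>i. i \<in> {1..N} \<Longrightarrow> L2disc M \<rho> (y i)"
  shows "social_cost \<rho> \<Gamma> Q R \<eta> N M U X < \<infinity>"
proof -
  have "agent_cost \<rho> \<Gamma> Q R \<eta> N M U X i < \<infinity>" if i: "i \<in> {1..N}" for i
    using L2disc_agent_cost[where x = X and u = U and i = i, OF XJ i closed_loop_L2disc(2,1)[OF Le Ly[OF i]]] .
  thus ?thesis unfolding social_cost_def by (simp add: less_top[symmetric])
qed

end

section \<open>Constants common to all N, and the final estimate\<close>

lemma psd_sqrt_form:
  assumes "psd_sqrt S Q"
  shows "z \<bullet> (Q *v z) = (norm (S *v z))\<^sup>2"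
proof -
  have S: "transpose S = S" "S ** S = Q" using assms by (auto simp: psd_sqrt_def psd_def)
  have "(S *v z) \<bullet> (S *v z) = z \<bullet> (S *v (S *v z))" by (rule inner_symmetric_matrix[OF S(1)])
  thus ?thesis by (simp add: power2_norm_eq_inner matrix_vector_mul_assoc S(2))
qed

text \<open>Both terms are combined into one quadratic form in z. The bound comes from the matrices
  of the problem only, so it serves every N.\<close>

lemma gap_constant:
  fixes \<Gamma> Q :: "real^'n^'n" and L :: "real^'n^'r" and R :: "real^'r^'r"
  obtains b where "0 \<le> b" "\<And>z. (z - \<Gamma> *v z) \<bullet> (Q *v (z - \<Gamma> *v z)) + (L *v z) \<bullet> (R *v (L *v z)) \<le> b * (norm z)\<^sup>2"
proof -
  let ?D = "mat 1 - \<Gamma>"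
  let ?S = "transpose ?D ** Q ** ?D + transpose L ** R ** L"
  obtain b where b: "b > 0" "\<And>x. x \<bullet> (?S *v x) \<le> b * (norm x)\<^sup>2" by (rule quadratic_form_upper_bound[of ?S]) blast
  have "z \<bullet> (?S *v z) = (z - \<Gamma> *v z) \<bullet> (Q *v (z - \<Gamma> *v z)) + (L *v z) \<bullet> (R *v (L *v z))" for z
  proof -
    have "z \<bullet> (?S *v z) = z \<bullet> (transpose ?D *v (Q *v (?D *v z))) + z \<bullet> (transpose L *v (R *v (L *v z)))"
      by (simp only: matrix_vector_mult_add_rdistrib inner_add_right matrix_vector_mul_assoc[symmetric])
    also have "\<dots> = (?D *v z) \<bullet> (Q *v (?D *v z)) + (L *v z) \<bullet> (R *v (L *v z))"
      by (simp only: inner_matrix_vector_left)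
    finally show ?thesis by (simp add: matrix_vector_mult_diff_rdistrib)
  qed
  with b that[of b] show thesis by simp
qed

theorem theorem4p5:
  fixes \<rho> C0 :: real
    and A G \<Gamma> Q P \<Pi>\<^sub>m sqrtQ :: "real^'n^'n" and B :: "real^'r^'n" and R :: "real^'r^'r"
    and f \<sigma> \<eta> s xbar :: "real \<Rightarrow> real^'n" and xbar0 :: "real^'n"
    and M :: "nat \<Rightarrow> 'w measure" and F :: "nat \<Rightarrow> real \<Rightarrow> 'w measure"
    and W :: "nat \<Rightarrow> nat \<Rightarrow> real \<Rightarrow> 'w \<Rightarrow> real"
    and x0 :: "nat \<Rightarrow> nat \<Rightarrow> 'w \<Rightarrow> real^'n"
    and xhat :: "nat \<Rightarrow> nat \<Rightarrow> real \<Rightarrow> 'w \<Rightarrow> real^'n"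
    and uhat :: "nat \<Rightarrow> nat \<Rightarrow> real \<Rightarrow> 'w \<Rightarrow> real^'r"
    and Jhat Jopt :: "nat \<Rightarrow> ennreal"
  assumes "\<rho> > 0" and "transpose Q = Q" and "posdef R"
    and "f \<in> C_half \<rho>" and "\<sigma> \<in> C_half \<rho>" and "\<eta> \<in> C_half \<rho>"
    and "maximal_riccati_solution \<rho> A B Q R P"
    and "maximal_riccati_solution \<rho> (A + G) B (Q - Xi \<Gamma> Q) R \<Pi>\<^sub>m"
    and "s \<in> C_half \<rho>" and "solves_s_equation \<rho> A B G \<Gamma> Q R f \<eta> \<Pi>\<^sub>m s"
    and "xbar \<in> C_half \<rho>" and "solves_xbar_equation A B G R f \<Pi>\<^sub>m s xbar0 xbar"
    and "\<And>N. N \<ge> 1 \<Longrightarrow> complete_filtered_prob_space (M N) (F N)"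
    and "\<And>N i. i \<in> {1..N} \<Longrightarrow> brownian_motion (M N) (F N) (W N i)"
    and "\<And>N. N \<ge> 1 \<Longrightarrow> prob_space.indep_vars (M N) (\<lambda>_. PiM {0..} (\<lambda>_. borel))
           (\<lambda>i \<omega>. \<lambda>t\<in>{0..}. W N i t \<omega>) {1..N}"
    and "\<And>N i. i \<in> {1..N} \<Longrightarrow> x0 N i \<in> borel_measurable (F N 0)"
    and A1: "\<And>N. N \<ge> 1 \<Longrightarrow> prob_space.indep_vars (M N) (\<lambda>_. borel) (x0 N) {1..N}"
      "\<And>N i. i \<in> {1..N} \<Longrightarrow> prob_space.expectation (M N) (x0 N i) = xbar0"
      "\<And>N i. i \<in> {1..N} \<Longrightarrow>
         (\<integral>\<^sup>+\<omega>. ennreal ((norm (x0 N i \<omega>))\<^sup>2) \<partial>M N) < ennreal C0"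
    and A2: "stabilizable (A - (\<rho>/2) *\<^sub>R mat 1) B"
      "stabilizable (A + G - (\<rho>/2) *\<^sub>R mat 1) B"
      "hurwitz ((A - B ** matrix_inv R ** transpose B ** P) + G - (\<rho>/2) *\<^sub>R mat 1)"
    and A3: "psd Q" "psd_sqrt sqrtQ Q"
      "observable (A - (\<rho>/2) *\<^sub>R mat 1) sqrtQ"
      "observable (A + G - (\<rho>/2) *\<^sub>R mat 1) (sqrtQ ** (mat 1 - \<Gamma>))"
    and "\<And>N. uhat N = decentralized_control B R P \<Pi>\<^sub>m xbar s (xhat N)"
    and "\<And>N. N \<ge> 1 \<Longrightarrow> is_state A B G f \<sigma> N (M N) (F N) (W N) (x0 N) (uhat N) (xhat N)"
    and "\<And>N. Jhat N = social_cost \<rho> \<Gamma> Q R \<eta> N (M N) (uhat N) (xhat N)"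
    and "\<And>N. Jopt N = optimal_social_cost \<rho> A B G \<Gamma> Q R f \<sigma> \<eta> N (M N) (F N) (W N) (x0 N)"
  shows "(\<forall>N\<ge>1. Jhat N < \<infinity> \<and> Jopt N < \<infinity>) \<and>
    (\<lambda>N. \<bar>enn2real (Jhat N) / real N - enn2real (Jopt N) / real N\<bar>)
      \<in> O(\<lambda>N. 1 / sqrt (real N))"
proof -
  note asm = assms
  have \<rho>: "\<rho> > 0" and symQ: "transpose Q = Q" and R: "posdef R" by (fact asm)+
  have Ch: "f \<in> C_half \<rho>" "\<sigma> \<in> C_half \<rho>" "\<eta> \<in> C_half \<rho>" "s \<in> C_half \<rho>" "xbar \<in> C_half \<rho>" by (fact asm)+
  have maxP: "maximal_riccati_solution \<rho> A B Q R P"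
    and max\<Pi>: "maximal_riccati_solution \<rho> (A + G) B (Q - Xi \<Gamma> Q) R \<Pi>\<^sub>m" by (fact asm)+
  have seq: "solves_s_equation \<rho> A B G \<Gamma> Q R f \<eta> \<Pi>\<^sub>m s" and xeq: "solves_xbar_equation A B G R f \<Pi>\<^sub>m s xbar0 xbar" by (fact asm)+
  have cfp: "complete_filtered_prob_space (M N) (F N)" if "N \<ge> 1" for N using that by (fact asm)
  have W: "brownian_motion (M N) (F N) (W N i)" if "i \<in> {1..N}" for N i using that by (fact asm)
  have Wind: "prob_space.indep_vars (M N) (\<lambda>_. PiM {0..} (\<lambda>_. borel)) (\<lambda>i \<omega>. \<lambda>t\<in>{0..}. W N i t \<omega>) {1..N}"
    if "N \<ge> 1" for N using that by (fact asm)
  have x0F: "x0 N i \<in> borel_measurable (F N 0)" if "i \<in> {1..N}" for N i using that by (fact asm)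
  have uhat: "uhat N = decentralized_control B R P \<Pi>\<^sub>m xbar s (xhat N)" for N by (fact asm)
  have st: "is_state A B G f \<sigma> N (M N) (F N) (W N) (x0 N) (uhat N) (xhat N)" if "N \<ge> 1" for N using that by (fact asm)
  have Jhat: "Jhat N = social_cost \<rho> \<Gamma> Q R \<eta> N (M N) (uhat N) (xhat N)" for N by (fact asm)
  have Jopt: "Jopt N = optimal_social_cost \<rho> A B G \<Gamma> Q R f \<sigma> \<eta> N (M N) (F N) (W N) (x0 N)" for N by (fact asm)
  have ricP: "riccati_solution \<rho> A B Q R P" and ric\<Pi>: "riccati_solution \<rho> (A + G) B (Q - Xi \<Gamma> Q) R \<Pi>\<^sub>m"
    using maxP max\<Pi> by (auto simp: maximal_riccati_solution_def)
  have QC: "x \<bullet> (Q *v x) = (norm (sqrtQ *v x))\<^sup>2" for x by (rule psd_sqrt_form[OF A3(2)])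
  have P: "psd P" by (rule maximal_riccati_solution_psd[OF R A3(1) A2(1) maxP])
  \<comment> \<open>All auxiliary matrices are chosen before N: Y1 controls the deviations of the
    closed loop, Y2 the mean error, Y and Z the deviations and the mean of a state
    difference.\<close>
  obtain Y1 where Y1: "psd Y1" "\<And>x. 2 * ((Y1 *v x) \<bullet> ((A - B ** matrix_inv R ** transpose B ** P) *v x)) - \<rho> * (x \<bullet> (Y1 *v x)) \<le> - (norm x)\<^sup>2"
    by (rule riccati_closed_loop_lyapunov[OF R P ricP QC A3(3)]) blast
  obtain Y2 where Y2: "psd Y2" "\<And>x. 2 * ((Y2 *v x) \<bullet> ((A - B ** matrix_inv R ** transpose B ** P + G) *v x)) - \<rho> * (x \<bullet> (Y2 *v x)) \<le> - (norm x)\<^sup>2"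
    by (rule hurwitz_shifted_lyapunov[OF A2(3)]) blast
  obtain c where c: "c > 0" "\<And>x. x \<bullet> (Y2 *v x) \<le> c * (norm x)\<^sup>2" by (rule quadratic_form_upper_bound[of Y2]) blast
  obtain Y \<kappa> where Y: "psd Y" "\<kappa> \<ge> 0" "\<And>x. 2 * ((Y *v x) \<bullet> (A *v x)) - \<rho> * (x \<bullet> (Y *v x)) \<le> \<kappa> * (norm (sqrtQ *v x))\<^sup>2 - (norm x)\<^sup>2"
    by (rule observable_shifted_detectability[OF A3(3)]) blast
  obtain Z \<kappa>' where Z: "psd Z" "\<kappa>' \<ge> 0"
    "\<And>x. 2 * ((Z *v x) \<bullet> ((A + G) *v x)) - \<rho> * (x \<bullet> (Z *v x)) \<le> \<kappa>' * (norm ((sqrtQ ** (mat 1 - \<Gamma>)) *v x))\<^sup>2 - (norm x)\<^sup>2"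
    by (rule observable_shifted_detectability[OF A3(4)]) blast
  obtain b where b: "0 \<le> b" "\<And>z. (z - \<Gamma> *v z) \<bullet> (Q *v (z - \<Gamma> *v z)) + ((matrix_inv R ** transpose B ** P) *v z) \<bullet> (R *v ((matrix_inv R ** transpose B ** P) *v z)) \<le> b * (norm z)\<^sup>2"
    by (rule gap_constant[of \<Gamma> Q "matrix_inv R ** transpose B ** P" R]) blast
  \<comment> \<open>N times the bound of \<open>mean_error_bound\<close>. The locale constant is
    used here outside any fixed game, which shows that \<beta> does not vary with N.\<close>
  define \<beta> where "\<beta> = c * (2 * C0 + 2 * (norm xbar0)\<^sup>2) + social_game.noise_energy \<sigma> \<rho> Y2"
  have main: "Jhat N < \<infinity> \<and> Jopt N \<le> Jhat N \<and> Jhat N \<le> Jopt N + ennreal (b * \<beta>)" if N: "N \<ge> 1" for N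
  proof -
    interpret prob_space "M N" using cfp[OF N] by (simp add: complete_filtered_prob_space_def)
    interpret filtered_prob "M N" "F N" by unfold_locales (rule cfp[OF N])
    have x0m: "sq_integrable (M N) (x0 N i)" "expectation (\<lambda>\<omega>. (norm (x0 N i \<omega>))\<^sup>2) \<le> C0" if i: "i \<in> {1..N}" for i
    proof -
      have m: "x0 N i \<in> borel_measurable (M N)"
        using x0F[OF i] sets_F_subset[of 0] by (auto simp: measurable_def space_F)
      have i2: "integrable (M N) (\<lambda>\<omega>. (norm (x0 N i \<omega>))\<^sup>2)"
        using A1(3)[OF i] m order.strict_trans[OF A1(3)[OF i] ennreal_less_top] by (intro integrableI_bounded) auto
      thus "sq_integrable (M N) (x0 N i)" using m by (simp add: sq_integrable_def)
      have "ennreal (expectation (\<lambda>\<omega>. (norm (x0 N i \<omega>))\<^sup>2)) < ennreal C0"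
        using A1(3)[OF i] nn_integral_eq_integral[OF i2] by simp
      thus "expectation (\<lambda>\<omega>. (norm (x0 N i \<omega>))\<^sup>2) \<le> C0" by (metis ennreal_leI leD linear)
    qed
    have s: "is_state A B G f \<sigma> N (M N) (F N) (W N) (x0 N) (decentralized_control B R P \<Pi>\<^sub>m xbar s (xhat N)) (xhat N)"
      using st[OF N] unfolding uhat .
    obtain X where X: "\<forall>i\<in>{1..N}. jmeas (M N) (X i)" "\<forall>i\<in>{1..N}. \<forall>t\<ge>0. X i t \<in> borel_measurable (F N t)"
      "AE \<omega> in M N. \<forall>i\<in>{1..N}. \<forall>t\<ge>0. X i t \<omega> = xhat N i t \<omega>" "AE \<omega> in M N. \<forall>i\<in>{1..N}. continuous_on {0..} (\<lambda>t. X i t \<omega>)"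
      by (rule nice_versions[OF s])
    interpret D: closed_loop "M N" "F N" N "W N" "x0 N" A G \<Gamma> Q P \<Pi>\<^sub>m sqrtQ B R f \<sigma> \<eta> s xbar xbar0 \<rho> C0 "xhat N" X
      by unfold_locales (use N \<rho> R symQ QC ricP ric\<Pi> Ch seq xeq W Wind[OF N] x0F A1(1)[OF N] A1(2) x0m s X in blast)+
    have KP: "(matrix_inv R ** transpose B ** P) *v z = D.K *v (P *v z)" for z
      by (simp only: D.K_def matrix_vector_mul_assoc)
    note mb = D.mean_error_bound[unfolded D.Abar_def, OF Y2 less_imp_le[OF c(1)] c(2)]
    note Ly = D.deviation_L2disc[unfolded D.Abar_def, OF Y1]
    have J: "Jhat N = social_cost \<rho> \<Gamma> Q R \<eta> N (M N) D.U X" unfolding Jhat uhat by (rule D.social_cost_U_X[symmetric])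
    show ?thesis unfolding J Jopt
      using D.social_cost_finite[OF mb(1) Ly] D.optimal_le_closed_loop[OF mb(1) Ly]
        D.closed_loop_le_optimal[OF mb(1) Ly Y Z b(2)[unfolded KP] b(1) mb(2)[folded \<beta>_def]]
      by blast
  qed
  have fin: "Jhat N < \<infinity> \<and> Jopt N < \<infinity>" if "N \<ge> 1" for N
    using main[OF that] by (auto intro: le_less_trans)
  have "norm \<bar>enn2real (Jhat N) / real N - enn2real (Jopt N) / real N\<bar> \<le> \<bar>b * \<beta>\<bar> * norm (1 / sqrt (real N))" if N: "N \<ge> 1" for N
  proof -
    have "enn2real (Jopt N) \<le> enn2real (Jhat N)" using main[OF N] by (intro enn2real_mono) auto
    moreover have "enn2real (Jhat N) \<le> enn2real (Jopt N + ennreal (b * \<beta>))"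
      using main[OF N] fin[OF N] by (intro enn2real_mono) auto
    \<comment> \<open>\<open>ennreal\<close> sends negative arguments to 0; the absolute value
      covers both signs.\<close>
    moreover have "enn2real (Jopt N + ennreal (b * \<beta>)) \<le> enn2real (Jopt N) + \<bar>b * \<beta>\<bar>"
      using fin[OF N] by (cases "0 \<le> b * \<beta>") (simp_all add: enn2real_plus ennreal_neg)
    ultimately have d: "\<bar>enn2real (Jhat N) - enn2real (Jopt N)\<bar> \<le> \<bar>b * \<beta>\<bar>" by linarith
    have "norm \<bar>enn2real (Jhat N) / real N - enn2real (Jopt N) / real N\<bar> = \<bar>enn2real (Jhat N) - enn2real (Jopt N)\<bar> / real N"
      by (simp add: diff_divide_distrib[symmetric])
    also have "\<dots> \<le> \<bar>b * \<beta>\<bar> / real N" using d by (rule divide_right_mono) simp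
    \<comment> \<open>The gap per agent is already of order 1/N; it is weakened to the stated rate
      by sqrt N \<le> N.\<close>
    also have "\<dots> \<le> \<bar>b * \<beta>\<bar> / sqrt (real N)"
    proof (rule divide_left_mono)
      have "real N \<le> (real N)\<^sup>2" using N by (simp add: power2_eq_square)
      thus "sqrt (real N) \<le> real N" by (intro real_le_lsqrt) auto
    qed (use N in auto)
    finally show ?thesis by simp
  qed
  hence "(\<lambda>N. \<bar>enn2real (Jhat N) / real N - enn2real (Jopt N) / real N\<bar>) \<in> O(\<lambda>N. 1 / sqrt (real N))"
    by (intro bigoI[of _ "\<bar>b * \<beta>\<bar>"] eventually_mono[OF eventually_ge_at_top[of 1]])
  with fin show ?thesis by blast
qed

end
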